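(* Let $\Theta:[0,\infty)\to[0,\infty)$ be a function which decreases to zero as $\lambda\to\infty$. Then there exist a nonzero compactly supported continuous function $f$ on the Heisenberg group $\mathbb{H}^n$ and a constant $C>0$ such that the group Fourier transform $\widehat f$ satisfies $$\widehat f(\lambda)^{*}\,\widehat f(\lambda)\le C\,e^{-2\,\Theta(\sqrt{H(\lambda)})\,\sqrt{H(\lambda)}}\qquad\text{for all }\lambda\in\mathbb{R}\setminus\{0\}$$ if and only if $\int_1^\infty \Theta(t)\,t^{-1}\,dt<\infty$.
   Context: The Heisenberg group is $\mathbb{H}^n=\mathbb{C}^n\times\mathbb{R}$ with group law $(z,t)(w,s)=\big(z+w,\;t+s+\tfrac12\Im(z\cdot\bar w)\big)$ and Haar measure the Lebesgue measure $dz\,dt$. For $\lambda\in\mathbb{R}\setminus\{0\}$ the Schr\"odinger representation $\pi_\lambda$ of $\mathbb{H}^n$ on $L^2(\mathbb{R}^n)$ is $$\pi_\lambda(z,t)\varphi(\xi)=e^{i\lambda t}e^{i\lambda(x\cdot\xi+\frac12 x\cdot y)}\varphi(\xi+y),\qquad z=x+iy .$$ For $f\in L^1(\mathbb{H}^n)$ the group Fourier transform is the operator-valued function $\widehat f(\lambda)=\int_{\mathbb{H}^n}f(z,t)\,\pi_\lambda(z,t)\,dz\,dt$, a bounded operator on $L^2(\mathbb{R}^n)$ for each $\lambda\ne0$. $H(\lambda)=-\Delta_{\mathbb{R}^n}+\lambda^2|x|^2$ is the scaled Hermite operator on $L^2(\mathbb{R}^n)$; it has an orthonormal eigenbasis (the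 scaled Hermite functions $\Phi_\alpha^\lambda$, $\alpha\in\mathbb{N}^n$, with $0\in\mathbb{N}$) with eigenvalues $(2|\alpha|+n)|\lambda|$, and functions of $H(\lambda)$ are defined by the spectral theorem. The inequality $A\le B$ between bounded self-adjoint operators means $\langle A\varphi,\varphi\rangle\le\langle B\varphi,\varphi\rangle$ for all $\varphi\in L^2(\mathbb{R}^n)$. *)

theory Defs
  imports "HOL-Analysis.Analysis"
begin

section \<open>The Heisenberg group\<close>

type_synonym 'n heis = "(complex ^ 'n) \<times> real"

definition heis_mult :: "'n::finite heis \<Rightarrow> 'n heis \<Rightarrow> 'n heis" where
  "heis_mult g h = (fst g + fst h,
     snd g + snd h + Im (\<Sum>i\<in>UNIV. fst g $ i * cnj (fst h $ i)) / 2)"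

definition re_vec :: "complex ^ 'n \<Rightarrow> real ^ 'n::finite" where
  "re_vec z = (\<chi> i. Re (z $ i))"

definition im_vec :: "complex ^ 'n \<Rightarrow> real ^ 'n::finite" where
  "im_vec z = (\<chi> i. Im (z $ i))"


section \<open>The Hilbert space of square integrable functions\<close>

text \<open>Elements of L2 are represented by Borel functions; two representatives denote the same
  element iff they agree almost everywhere. Every class of Lebesgue measurable functions has a
  Borel representative.\<close>

type_synonym 'n fn = "real ^ 'n \<Rightarrow> complex"

definition L2 :: "'n::finite fn set" where
  "L2 = {\<phi> \<in> borel_measurable borel. integrable lborel (\<lambda>x. (cmod (\<phi> x))\<^sup>2)}"

definition l2_inner :: "'n::finite fn \<Rightarrow> 'n fn \<Rightarrow> complex" where
  "l2_inner \<phi> \<psi> = (LINT x|lborel. \<phi> x * cnj (\<psi> x))"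

definition l2_norm :: "'n::finite fn \<Rightarrow> real" where
  "l2_norm \<phi> = sqrt (LINT x|lborel. (cmod (\<phi> x))\<^sup>2)"

text \<open>The values of the adjoint on L2 are determined up to equality almost everywhere.\<close>

definition l2_adjoint :: "('n::finite fn \<Rightarrow> 'n fn) \<Rightarrow> 'n fn \<Rightarrow> 'n fn" where
  "l2_adjoint T = (SOME S. \<forall>\<psi>\<in>L2. S \<psi> \<in> L2 \<and>
     (\<forall>\<phi>\<in>L2. l2_inner (T \<phi>) \<psi> = l2_inner \<phi> (S \<psi>)))"

text \<open>For self-adjoint operators both inner products are real.\<close>

definition l2_op_le :: "('n::finite fn \<Rightarrow> 'n fn) \<Rightarrow> ('n fn \<Rightarrow> 'n fn) \<Rightarrow> bool" where
  "l2_op_le A B \<longleftrightarrow> (\<forall>\<phi>\<in>L2. Re (l2_inner (A \<phi>) \<phi>) \<le> Re (l2_inner (B \<phi>) \<phi>))"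


section \<open>Schroedinger representation and group Fourier transform\<close>

definition schroedinger :: "real \<Rightarrow> 'n::finite heis \<Rightarrow> 'n fn \<Rightarrow> 'n fn" where
  "schroedinger lam g \<phi> \<xi> =
     (let x = re_vec (fst g); y = im_vec (fst g); t = snd g
      in cis (lam * t) * cis (lam * (x \<bullet> \<xi> + x \<bullet> y / 2)) * \<phi> (\<xi> + y))"

lemma schroedinger_mult:
  "schroedinger lam (heis_mult g h) \<phi> = schroedinger lam g (schroedinger lam h \<phi>)"
proof
  fix \<xi>
  let ?x = "re_vec (fst g)" and ?y = "im_vec (fst g)"
  let ?u = "re_vec (fst h)" and ?v = "im_vec (fst h)"
  have re: "re_vec (fst g + fst h) = ?x + ?u" and im: "im_vec (fst g + fst h) = ?y + ?v"
    by (simp_all add: re_vec_def im_vec_def vec_eq_iff)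
  have Im: "Im (\<Sum>i\<in>UNIV. fst g $ i * cnj (fst h $ i)) = ?y \<bullet> ?u - ?x \<bullet> ?v"
    by (simp add: re_vec_def im_vec_def inner_vec_def sum_subtractf)
  have snd: "snd (heis_mult g h) = snd g + snd h + (?y \<bullet> ?u - ?x \<bullet> ?v) / 2"
    by (simp only: heis_mult_def snd_conv Im)
  have "lam * snd (heis_mult g h) + lam * ((?x + ?u) \<bullet> \<xi> + (?x + ?u) \<bullet> (?y + ?v) / 2)
      = (lam * snd g + lam * (?x \<bullet> \<xi> + ?x \<bullet> ?y / 2))
        + (lam * snd h + lam * (?u \<bullet> (\<xi> + ?y) + ?u \<bullet> ?v / 2))"
    by (simp add: snd field_simps inner_add_left inner_add_right inner_commute)
  then have "cis (lam * snd (heis_mult g h)) *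
        cis (lam * ((?x + ?u) \<bullet> \<xi> + (?x + ?u) \<bullet> (?y + ?v) / 2))
      = cis (lam * snd g) * cis (lam * (?x \<bullet> \<xi> + ?x \<bullet> ?y / 2)) *
        (cis (lam * snd h) * cis (lam * (?u \<bullet> (\<xi> + ?y) + ?u \<bullet> ?v / 2)))"
    by (simp only: cis_mult)
  then show "schroedinger lam (heis_mult g h) \<phi> \<xi> = schroedinger lam g (schroedinger lam h \<phi>) \<xi>"
    by (simp add: schroedinger_def Let_def heis_mult_def re im add.assoc mult.assoc)
qed

text \<open>The L2-valued integral of \<open>f g\<close> times \<open>schroedinger lam g \<phi>\<close> over the group, evaluated
  pointwise. For integrable \<open>f\<close> and \<open>\<phi>\<close> in L2 the integrand is integrable for almost every \<open>\<xi>\<close>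
  (for every \<open>\<xi>\<close> if \<open>f\<close> is continuous with compact support).\<close>

definition group_fourier :: "('n::finite heis \<Rightarrow> complex) \<Rightarrow> real \<Rightarrow> 'n fn \<Rightarrow> 'n fn" where
  "group_fourier f lam \<phi> \<xi> = (LINT g|lborel. f g * schroedinger lam g \<phi> \<xi>)"


section \<open>The scaled Hermite operator and its functional calculus\<close>

definition partial :: "real ^ 'n \<Rightarrow> 'n fn \<Rightarrow> 'n::finite fn" where
  "partial b \<phi> x = frechet_derivative \<phi> (at x) b"

definition C2 :: "'n::finite fn \<Rightarrow> bool" where
  "C2 \<phi> \<longleftrightarrow> (\<forall>x. \<phi> differentiable at x) \<and>
     (\<forall>b\<in>Basis. (\<forall>x. partial b \<phi> differentiable at x) \<and>
        (\<forall>c\<in>Basis. continuous_on UNIV (partial c (partial b \<phi>))))"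

definition hermite_op :: "real \<Rightarrow> 'n::finite fn \<Rightarrow> 'n fn" where
  "hermite_op lam \<phi> x =
     - (\<Sum>b\<in>Basis. partial b (partial b \<phi>) x) + complex_of_real (lam\<^sup>2 * (norm x)\<^sup>2) * \<phi> x"

definition orthonormal_eigenbasis ::
    "('n::finite fn \<Rightarrow> 'n fn) \<Rightarrow> (nat \<Rightarrow> 'n fn) \<Rightarrow> (nat \<Rightarrow> real) \<Rightarrow> bool" where
  "orthonormal_eigenbasis H e \<mu> \<longleftrightarrow>
     (\<forall>k. e k \<in> L2 \<and> C2 (e k) \<and> (\<forall>x. H (e k) x = complex_of_real (\<mu> k) * e k x)) \<and>
     (\<forall>j k. l2_inner (e j) (e k) = (if j = k then 1 else 0)) \<and>
     (\<forall>\<phi>\<in>L2. (\<forall>k. l2_inner \<phi> (e k) = 0) \<longrightarrow> (AE x in lborel. \<phi> x = 0))"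

text \<open>The operator \<open>m(H)\<close> given by the spectral theorem for a differential operator \<open>H\<close> that is
  diagonalised by an orthonormal basis of eigenfunctions:
  \<open>m(H) \<phi>\<close> is the L2-sum of the series with terms \<open>m(\<mu> k) \<langle>\<phi>, e k\<rangle> e k\<close>. For
  \<open>H = hermite_op lam\<close> with nonzero \<open>lam\<close>, such a basis exists (the scaled Hermite functions in
  any enumeration). Eigenfunctions of this operator to different eigenvalues are orthogonal, so
  the sum does not depend, up to equality almost everywhere, on the chosen basis.\<close>

definition functional_calculus ::
    "('n::finite fn \<Rightarrow> 'n fn) \<Rightarrow> (real \<Rightarrow> real) \<Rightarrow> 'n fn \<Rightarrow> 'n fn" where
  "functional_calculus H m \<phi> = (SOME \<psi>. \<psi> \<in> L2 \<and> (\<exists>e \<mu>. orthonormal_eigenbasis H e \<mu> \<and>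
     (\<lambda>N. l2_norm (\<lambda>x. \<psi> x -
        (\<Sum>k<N. complex_of_real (m (\<mu> k)) * l2_inner \<phi> (e k) * e k x))) \<longlonglongrightarrow> 0))"

end

theory Submission
  imports Defs
begin

text \<open>
  Why the theorem is true. Throughout, \<open>\<nu> k\<close> are the eigenvalues of the scaled Hermite operator,
  \<open>s k = sqrt (\<nu> k)\<close>, and \<open>h k\<close> is the Hermite basis. The operator inequality says that
  the L2 norm of \<open>group_fourier f lam \<phi>\<close> is controlled by the coefficients of \<open>\<phi>\<close> damped by
  \<open>exp (- \<theta> (s k) * s k)\<close>.

  Sufficiency. The sublaplacian of the group becomes the Hermite operator under every Schroedinger
  representation, so that \<open>\<nu> k ^ m\<close> times the transform of \<open>f\<close> at \<open>h k\<close> is the transform of the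
  \<open>m\<close>-th power of the sublaplacian applied to \<open>f\<close>. If \<open>f\<close> is a product of bump functions whose
  \<open>k\<close>-th derivatives are bounded by \<open>\<Prod>i<k. 2 / a i\<close>, this gives decay \<open>E ^ m * W (2 * m) / \<nu> k ^ m\<close>
  for every \<open>m\<close>. A bump with these bounds, an infinite convolution of normalised indicator functions
  of intervals, exists as soon as the widths \<open>a i\<close> are summable. Taking \<open>a i\<close> proportional to
  \<open>\<theta> i / i\<close>, with \<open>\<theta>\<close> made positive by a small summand, whose summability is the integral condition, and \<open>2 * m\<close> just below \<open>\<theta> (s k) * s k\<close>
  produces the required exponential. Grouping the basis into blocks with the same \<open>m\<close> reduces
  the estimate for general \<open>\<phi>\<close> to a geometric series, with constants independent of \<open>lam\<close> (\<open>widths_exist\<close>, \<open>group_fourier_block\<close>,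
  \<open>ingham_sufficiency\<close>).

  Necessity. Fix \<open>lam\<close> and let \<open>\<zeta>\<close> be square integrable with bounded support. The adjoint of the
  transform, applied to \<open>\<zeta>\<close>, is a function \<open>g\<close> on the Euclidean space which again has bounded support,
  because \<open>f\<close> has, and by duality the operator inequality bounds its Hermite coefficients by a square
  summable sequence times \<open>exp (- \<theta> (s k) * s k)\<close>. Such a \<open>g\<close> vanishes if the integral diverges. Let \<open>\<phi>\<close>
  be a Gevrey bump supported off the support of \<open>g\<close>. The even function of \<open>t\<close> given by the series of
  \<open>\<langle>g, h k\<rangle> * cnj \<langle>\<phi>, h k\<rangle> * cos (t * s k)\<close> has all derivatives zero at the origin, since these are
  the pairings of \<open>g\<close> with powers of the Hermite operator applied to \<open>\<phi>\<close>. Divergence of the integral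
  puts the function into a quasi-analytic class, so that it vanishes identically by the theorem of
  Denjoy and Carleman. Uniqueness of the frequencies then shows that \<open>\<phi>\<close> is orthogonal to the
  projection of \<open>g\<close> to each single eigenspace. This projection is a polynomial times a Gaussian and now
  vanishes outside a ball, so that it is zero. Hence \<open>g = 0\<close> for all \<open>\<zeta>\<close> and all \<open>lam\<close>, and \<open>f = 0\<close>
  because the group Fourier transform is injective (\<open>eigenspace_pairing_vanishes\<close>,
  \<open>compact_support_spectral_decay_vanishes\<close>, \<open>group_fourier_injective\<close>, \<open>ingham_necessity\<close>).
\<close>

section \<open>Square integrable functions\<close>

lemma Cauchy_Schwarz_integral:
  fixes f g :: "'a \<Rightarrow> real"
  assumes [measurable]: "f \<in> borel_measurable M" "g \<in> borel_measurable M"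
    and f: "integrable M (\<lambda>x. (f x)\<^sup>2)" and g: "integrable M (\<lambda>x. (g x)\<^sup>2)"
  shows "integrable M (\<lambda>x. f x * g x)"
    and "(LINT x|M. \<bar>f x * g x\<bar>)\<^sup>2 \<le> (LINT x|M. (f x)\<^sup>2) * (LINT x|M. (g x)\<^sup>2)"
proof -
  have "\<bar>f x * g x\<bar> \<le> \<bar>(f x)\<^sup>2 + (g x)\<^sup>2\<bar>" for x
  proof -
    have "0 \<le> \<bar>f x * g x\<bar>" by simp
    moreover have "2 * \<bar>f x * g x\<bar> \<le> (f x)\<^sup>2 + (g x)\<^sup>2"
      using sum_squares_bound[of "\<bar>f x\<bar>" "\<bar>g x\<bar>"] by (simp add: abs_mult mult.assoc)
    ultimately show ?thesis by linarith
  qed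
  then show i: "integrable M (\<lambda>x. f x * g x)"
    by (intro Bochner_Integration.integrable_bound[OF Bochner_Integration.integrable_add[OF f g]]) auto
  define A where "A = sqrt (LINT x|M. (f x)\<^sup>2)"
  define B where "B = sqrt (LINT x|M. (g x)\<^sup>2)"
  define I where "I = (LINT x|M. \<bar>f x * g x\<bar>)"
  have A2: "A\<^sup>2 = (LINT x|M. (f x)\<^sup>2)" and B2: "B\<^sup>2 = (LINT x|M. (g x)\<^sup>2)"
    by (simp_all add: A_def B_def)
  have pos: "A \<ge> 0" "B \<ge> 0" "I \<ge> 0" by (simp_all add: A_def B_def I_def)
  have "0 \<le> (LINT x|M. (B * \<bar>f x\<bar> - A * \<bar>g x\<bar>)\<^sup>2)" by simp
  also have "\<dots> = (LINT x|M. B\<^sup>2 * (f x)\<^sup>2 - 2 * A * B * \<bar>f x * g x\<bar> + A\<^sup>2 * (g x)\<^sup>2)"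
    by (intro Bochner_Integration.integral_cong) (auto simp: power2_eq_square algebra_simps abs_mult)
  also have "\<dots> = B\<^sup>2 * A\<^sup>2 - 2 * A * B * I + A\<^sup>2 * B\<^sup>2"
    using i f g by (simp add: A2 B2 I_def)
  finally have le: "A * B * I \<le> (A * B)\<^sup>2" by (simp add: power_mult_distrib algebra_simps)
  have "I \<le> A * B"
  proof (cases "A * B = 0")
    case True
    have "AE x in M. f x * g x = 0"
    proof (cases "A = 0")
      case True
      then have "(LINT x|M. (f x)\<^sup>2) = 0" using A2 by simp
      then have "AE x in M. (f x)\<^sup>2 = 0" using f by (subst (asm) integral_nonneg_eq_0_iff_AE) auto
      then show ?thesis by auto
    next
      case False
      then have "(LINT x|M. (g x)\<^sup>2) = 0" using B2 \<open>A * B = 0\<close> by simp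
      then have "AE x in M. (g x)\<^sup>2 = 0" using g by (subst (asm) integral_nonneg_eq_0_iff_AE) auto
      then show ?thesis by auto
    qed
    then have "I = (LINT x|M. 0)" unfolding I_def by (intro integral_cong_AE) auto
    then show ?thesis using True pos by simp
  next
    case False
    then have "A * B > 0" using pos by (simp add: less_le)
    then show ?thesis using le by (metis mult_le_cancel_left_pos power2_eq_square)
  qed
  then have "I\<^sup>2 \<le> (A * B)\<^sup>2" using pos by (intro power_mono) auto
  then show "(LINT x|M. \<bar>f x * g x\<bar>)\<^sup>2 \<le> (LINT x|M. (f x)\<^sup>2) * (LINT x|M. (g x)\<^sup>2)"
    by (simp add: I_def power_mult_distrib A2 B2)
qed

lemma L2_measurable: "\<phi> \<in> L2 \<Longrightarrow> \<phi> \<in> borel_measurable borel"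
  by (simp add: L2_def)

lemma L2_integrable: "\<phi> \<in> L2 \<Longrightarrow> integrable lborel (\<lambda>x. (cmod (\<phi> x))\<^sup>2)"
  by (simp add: L2_def)

lemma L2_dominated:
  assumes "\<psi> \<in> L2" "\<phi> \<in> borel_measurable borel" "\<And>x. cmod (\<phi> x) \<le> cmod (\<psi> x)"
  shows "\<phi> \<in> L2"
proof -
  have [measurable]: "\<phi> \<in> borel_measurable borel" by fact
  have "integrable lborel (\<lambda>x. (cmod (\<phi> x))\<^sup>2)"
    by (rule Bochner_Integration.integrable_bound[OF L2_integrable[OF assms(1)]])
      (auto intro!: AE_I2 power_mono assms(3))
  then show ?thesis using assms by (simp add: L2_def)
qed

lemma L2_add [intro]: assumes "\<phi> \<in> L2" "\<psi> \<in> L2" shows "(\<lambda>x. \<phi> x + \<psi> x) \<in> L2"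
proof -
  have [measurable]: "\<phi> \<in> borel_measurable borel" "\<psi> \<in> borel_measurable borel"
    using assms by (auto simp: L2_def)
  have "(cmod (a + b))\<^sup>2 \<le> 2 * (cmod a)\<^sup>2 + 2 * (cmod b)\<^sup>2" for a b
  proof -
    have "(cmod (a + b))\<^sup>2 \<le> (cmod a + cmod b)\<^sup>2" by (intro power_mono norm_triangle_ineq) auto
    then show ?thesis using sum_squares_bound[of "cmod a" "cmod b"] by (simp add: power2_sum)
  qed
  then have "integrable lborel (\<lambda>x. (cmod (\<phi> x + \<psi> x))\<^sup>2)"
    by (intro Bochner_Integration.integrable_bound[OF Bochner_Integration.integrable_add[OF
       integrable_mult_right[OF L2_integrable[OF assms(1)], of 2]
       integrable_mult_right[OF L2_integrable[OF assms(2)], of 2]]]) auto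
  then show ?thesis by (simp add: L2_def)
qed

lemma L2_scale [intro]: assumes "\<phi> \<in> L2" shows "(\<lambda>x. c * \<phi> x) \<in> L2"
  using assms by (auto simp: L2_def norm_mult power_mult_distrib)

lemma L2_zero [intro, simp]: "(\<lambda>x. 0) \<in> L2"
  by (simp add: L2_def)

lemma L2_diff [intro]: assumes "\<phi> \<in> L2" "\<psi> \<in> L2" shows "(\<lambda>x. \<phi> x - \<psi> x) \<in> L2"
  using L2_add[OF assms(1) L2_scale[OF assms(2), of "-1"]] by simp

lemma L2_sum [intro]: "(\<And>k. k \<in> K \<Longrightarrow> e k \<in> L2) \<Longrightarrow> (\<lambda>x. \<Sum>k\<in>K. e k x) \<in> L2"
  by (induction K rule: infinite_finite_induct) auto

lemma L2_lincomb: "(\<And>k. k \<in> K \<Longrightarrow> e k \<in> L2) \<Longrightarrow> (\<lambda>x. \<Sum>k\<in>K. c k * e k x) \<in> L2"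
  by (rule L2_sum) (rule L2_scale)

lemma L2_cnj [intro]: assumes "\<phi> \<in> L2" shows "(\<lambda>x. cnj (\<phi> x)) \<in> L2"
  using assms measurable_compose[of \<phi> borel borel cnj borel] borel_measurable_continuous_onI[OF continuous_on_cnj[OF continuous_on_id]]
  by (auto simp: L2_def)

lemma l2_inner_integrable:
  assumes "\<phi> \<in> L2" "\<psi> \<in> L2" shows "integrable lborel (\<lambda>x. \<phi> x * cnj (\<psi> x))"
proof -
  have [measurable]: "\<phi> \<in> borel_measurable borel" "\<psi> \<in> borel_measurable borel"
    using assms by (auto simp: L2_def)
  have [measurable]: "(\<lambda>x. cnj (\<psi> x)) \<in> borel_measurable borel"
    using L2_cnj[OF assms(2)] by (simp add: L2_def)
  have "integrable lborel (\<lambda>x. cmod (\<phi> x) * cmod (\<psi> x))"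
    using assms by (intro Cauchy_Schwarz_integral(1)) (auto simp: L2_def)
  then show ?thesis
    by (rule Bochner_Integration.integrable_bound) (auto simp: norm_mult)
qed

lemma l2_inner_add_left:
  assumes "\<phi> \<in> L2" "\<psi> \<in> L2" "\<zeta> \<in> L2"
  shows "l2_inner (\<lambda>x. \<phi> x + \<psi> x) \<zeta> = l2_inner \<phi> \<zeta> + l2_inner \<psi> \<zeta>"
  using l2_inner_integrable[OF assms(1,3)] l2_inner_integrable[OF assms(2,3)]
  by (simp add: l2_inner_def distrib_right)

lemma l2_inner_diff_left:
  assumes "\<phi> \<in> L2" "\<psi> \<in> L2" "\<zeta> \<in> L2"
  shows "l2_inner (\<lambda>x. \<phi> x - \<psi> x) \<zeta> = l2_inner \<phi> \<zeta> - l2_inner \<psi> \<zeta>"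
  using l2_inner_integrable[OF assms(1,3)] l2_inner_integrable[OF assms(2,3)]
  by (simp add: l2_inner_def left_diff_distrib)

lemma l2_inner_scale_left: "l2_inner (\<lambda>x. c * \<phi> x) \<zeta> = c * l2_inner \<phi> \<zeta>"
  by (simp add: l2_inner_def mult.assoc)

lemma l2_inner_cnj: "cnj (l2_inner \<phi> \<psi>) = l2_inner \<psi> \<phi>"
proof -
  have "cnj (l2_inner \<phi> \<psi>) = (LINT x|lborel. cnj (\<phi> x * cnj (\<psi> x)))"
    unfolding l2_inner_def by (rule Bochner_Integration.integral_cnj[symmetric])
  also have "\<dots> = (LINT x|lborel. \<psi> x * cnj (\<phi> x))"
    by (rule Bochner_Integration.integral_cong) (simp_all add: mult.commute)
  finally show ?thesis by (simp only: l2_inner_def)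
qed

lemma l2_inner_zero_left [simp]: "l2_inner (\<lambda>x. 0) \<psi> = 0"
  by (simp add: l2_inner_def)

lemma l2_inner_sum_left:
  assumes "\<And>k. k \<in> K \<Longrightarrow> e k \<in> L2" "\<zeta> \<in> L2"
  shows "l2_inner (\<lambda>x. \<Sum>k\<in>K. c k * e k x) \<zeta> = (\<Sum>k\<in>K. c k * l2_inner (e k) \<zeta>)"
  using assms
proof (induction K rule: infinite_finite_induct)
  case (insert k K)
  then show ?case
    by (simp add: l2_inner_add_left[OF L2_scale L2_sum[OF L2_scale]] l2_inner_scale_left)
qed simp_all

lemma l2_norm_nonneg [simp]: "l2_norm \<phi> \<ge> 0"
  by (simp add: l2_norm_def)

lemma l2_norm_sq: "(l2_norm \<phi>)\<^sup>2 = (LINT x|lborel. (cmod (\<phi> x))\<^sup>2)"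
  by (simp add: l2_norm_def)

lemma l2_inner_self: "l2_inner \<phi> \<phi> = complex_of_real ((l2_norm \<phi>)\<^sup>2)"
  unfolding l2_norm_sq l2_inner_def complex_norm_square[symmetric] of_real_power[symmetric]
  by (rule integral_complex_of_real)

lemma l2_Cauchy_Schwarz:
  assumes "\<phi> \<in> L2" "\<psi> \<in> L2"
  shows "cmod (l2_inner \<phi> \<psi>) \<le> l2_norm \<phi> * l2_norm \<psi>"
proof -
  have [measurable]: "\<phi> \<in> borel_measurable borel" "\<psi> \<in> borel_measurable borel"
    using assms by (auto simp: L2_def)
  have "cmod (l2_inner \<phi> \<psi>) \<le> (LINT x|lborel. \<bar>cmod (\<phi> x) * cmod (\<psi> x)\<bar>)"
    unfolding l2_inner_def by (rule order_trans[OF integral_norm_bound]) (simp add: norm_mult)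
  moreover have "(LINT x|lborel. \<bar>cmod (\<phi> x) * cmod (\<psi> x)\<bar>)\<^sup>2 \<le> (l2_norm \<phi> * l2_norm \<psi>)\<^sup>2"
    unfolding power_mult_distrib l2_norm_sq
    using assms by (intro Cauchy_Schwarz_integral(2)) (auto simp: L2_def)
  then have "(LINT x|lborel. \<bar>cmod (\<phi> x) * cmod (\<psi> x)\<bar>) \<le> l2_norm \<phi> * l2_norm \<psi>"
    by (rule power2_le_imp_le) simp
  ultimately show ?thesis by simp
qed

lemma l2_norm_minus_commute: "l2_norm (\<lambda>x. \<phi> x - \<psi> x) = l2_norm (\<lambda>x. \<psi> x - \<phi> x)"
  by (simp add: l2_norm_def norm_minus_commute)

lemma l2_norm_add_le:
  assumes "\<phi> \<in> L2" "\<psi> \<in> L2"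
  shows "l2_norm (\<lambda>x. \<phi> x + \<psi> x) \<le> l2_norm \<phi> + l2_norm \<psi>"
proof (rule power2_le_imp_le)
  have s: "(\<lambda>x. \<phi> x + \<psi> x) \<in> L2" using assms by auto
  have "complex_of_real ((l2_norm (\<lambda>x. \<phi> x + \<psi> x))\<^sup>2)
     = l2_inner \<phi> (\<lambda>x. \<phi> x + \<psi> x) + l2_inner \<psi> (\<lambda>x. \<phi> x + \<psi> x)"
    unfolding l2_inner_self[symmetric] using assms s by (subst l2_inner_add_left) auto
  also have "\<dots> = cnj (l2_inner \<phi> \<phi> + l2_inner \<psi> \<phi>) + cnj (l2_inner \<phi> \<psi> + l2_inner \<psi> \<psi>)"
    using assms by (simp add: l2_inner_cnj[symmetric, of _ "\<lambda>x. \<phi> x + \<psi> x"] l2_inner_add_left)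
  finally have "(l2_norm (\<lambda>x. \<phi> x + \<psi> x))\<^sup>2
      = Re (cnj (l2_inner \<phi> \<phi> + l2_inner \<psi> \<phi>) + cnj (l2_inner \<phi> \<psi> + l2_inner \<psi> \<psi>))"
    by (metis Re_complex_of_real)
  also have "\<dots> = (l2_norm \<phi>)\<^sup>2 + (l2_norm \<psi>)\<^sup>2 + 2 * Re (l2_inner \<phi> \<psi>)"
    using l2_inner_cnj[of \<phi> \<psi>] by (simp add: l2_inner_self complex_eq_iff)
  also have "\<dots> \<le> (l2_norm \<phi>)\<^sup>2 + (l2_norm \<psi>)\<^sup>2 + 2 * (l2_norm \<phi> * l2_norm \<psi>)"
    using l2_Cauchy_Schwarz[OF assms] complex_Re_le_cmod[of "l2_inner \<phi> \<psi>"] by linarith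
  finally show "(l2_norm (\<lambda>x. \<phi> x + \<psi> x))\<^sup>2 \<le> (l2_norm \<phi> + l2_norm \<psi>)\<^sup>2"
    by (simp add: power2_sum)
qed simp

lemma l2_norm_eq_0_iff:
  assumes "\<phi> \<in> L2"
  shows "l2_norm \<phi> = 0 \<longleftrightarrow> (AE x in lborel. \<phi> x = 0)"
proof -
  have "l2_norm \<phi> = 0 \<longleftrightarrow> (LINT x|lborel. (cmod (\<phi> x))\<^sup>2) = 0" by (simp add: l2_norm_def)
  also have "\<dots> \<longleftrightarrow> (AE x in lborel. (cmod (\<phi> x))\<^sup>2 = 0)"
    using L2_integrable[OF assms] by (intro integral_nonneg_eq_0_iff_AE) auto
  finally show ?thesis by simp
qed

lemma l2_inner_cong_AE:
  assumes "\<phi> \<in> L2" "\<psi> \<in> L2" "\<zeta> \<in> L2" "AE x in lborel. \<phi> x = \<psi> x"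
  shows "l2_inner \<phi> \<zeta> = l2_inner \<psi> \<zeta>"
proof -
  have [measurable]: "(\<lambda>x. cnj (\<zeta> x)) \<in> borel_measurable borel"
    using L2_cnj[OF assms(3)] by (simp add: L2_def)
  have [measurable]: "\<phi> \<in> borel_measurable borel" "\<psi> \<in> borel_measurable borel"
    using assms by (auto simp: L2_def)
  show ?thesis unfolding l2_inner_def using assms(4) by (intro integral_cong_AE) auto
qed

lemma l2_inner_tendsto:
  assumes "\<psi> \<in> L2" "\<And>N. F N \<in> L2" "\<zeta> \<in> L2" "(\<lambda>N::nat. l2_norm (\<lambda>x. \<psi> x - F N x)) \<longlonglongrightarrow> 0"
  shows "(\<lambda>N. l2_inner (F N) \<zeta>) \<longlonglongrightarrow> l2_inner \<psi> \<zeta>"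
proof -
  have lim: "(\<lambda>N. l2_norm (\<lambda>x. \<psi> x - F N x) * l2_norm \<zeta>) \<longlonglongrightarrow> 0"
    using tendsto_mult_right[OF assms(4), of "l2_norm \<zeta>"] by simp
  have "cmod (l2_inner (F N) \<zeta> - l2_inner \<psi> \<zeta>) \<le> l2_norm (\<lambda>x. \<psi> x - F N x) * l2_norm \<zeta>" for N
  proof -
    have "cmod (l2_inner (F N) \<zeta> - l2_inner \<psi> \<zeta>) = cmod (l2_inner (\<lambda>x. F N x - \<psi> x) \<zeta>)"
      using assms by (simp add: l2_inner_diff_left)
    also have "\<dots> \<le> l2_norm (\<lambda>x. F N x - \<psi> x) * l2_norm \<zeta>"
      using assms by (intro l2_Cauchy_Schwarz) auto
    finally show ?thesis by (simp only: l2_norm_minus_commute)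
  qed
  from Lim_null_comparison[OF always_eventually[OF allI[OF this]] lim]
  show ?thesis by (simp only: LIM_zero_iff)
qed

text \<open>Completeness: a subsequence with geometrically decreasing steps converges almost everywhere, and its
  limit is also the limit in norm. Borel functions serve as representatives, so the limit has to be
  constructed as an honest Borel function.\<close>

lemma L2_complete:
  fixes F :: "nat \<Rightarrow> 'n::finite fn"
  assumes F: "\<And>N. F N \<in> L2"
    and Cauchy: "\<And>e. e > 0 \<Longrightarrow> \<exists>N. \<forall>m\<ge>N. \<forall>n\<ge>N. l2_norm (\<lambda>x. F m x - F n x) \<le> e"
  obtains \<psi> where "\<psi> \<in> L2" "(\<lambda>N. l2_norm (\<lambda>x. \<psi> x - F N x)) \<longlonglongrightarrow> 0"
proof -
  have [measurable]: "F N \<in> borel_measurable borel" for N using F[of N] by (simp add: L2_def)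
  have "\<exists>N. \<forall>m\<ge>N. \<forall>n\<ge>N. l2_norm (\<lambda>x. F m x - F n x) \<le> (1/2)^j" for j :: nat
    by (rule Cauchy) simp
  then obtain N0 where N0: "\<And>j m n. m \<ge> N0 j \<Longrightarrow> n \<ge> N0 j \<Longrightarrow> l2_norm (\<lambda>x. F m x - F n x) \<le> (1/2)^j"
    by metis
  define r where "r j = (\<Sum>i\<le>j. N0 i) + j" for j
  have r0: "r j \<ge> N0 j" and rj: "r j \<ge> j" and rS: "r (Suc j) \<ge> r j" for j
    by (auto simp: r_def intro: trans_le_add1 member_le_sum)
  have nn: "(\<integral>\<^sup>+x. ennreal ((cmod (F m x - F n x))\<^sup>2) \<partial>lborel) = ennreal ((l2_norm (\<lambda>x. F m x - F n x))\<^sup>2)" for m n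
    using L2_integrable[OF L2_diff[OF F F], of m n] by (subst nn_integral_eq_integral) (auto simp: l2_norm_sq)
  define D where "D j x = F (r (Suc j)) x - F (r j) x" for j x
  have [measurable]: "D j \<in> borel_measurable borel" for j unfolding D_def by measurable
  have "(\<integral>\<^sup>+x. (\<Sum>j. ennreal (2^j * (cmod (D j x))\<^sup>2)) \<partial>lborel)
      = (\<Sum>j. \<integral>\<^sup>+x. ennreal (2^j * (cmod (D j x))\<^sup>2) \<partial>lborel)"
    by (intro nn_integral_suminf) measurable
  also have "\<dots> \<le> (\<Sum>j. ennreal ((1/2)^j))"
  proof (intro suminf_le allI summableI)
    fix j
    have "(l2_norm (D j))\<^sup>2 \<le> ((1/2)^j)\<^sup>2"
      unfolding D_def using r0[of j] rS[of j] by (intro power_mono N0) auto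
    then have *: "2^j * (l2_norm (D j))\<^sup>2 \<le> 2^j * ((1/2)^j)\<^sup>2" by simp
    have "(\<integral>\<^sup>+x. ennreal (2^j * (cmod (D j x))\<^sup>2) \<partial>lborel) = ennreal (2^j) * ennreal ((l2_norm (D j))\<^sup>2)"
      unfolding ennreal_mult'[OF zero_le_power[of 2]] nn[symmetric] D_def
      by (subst nn_integral_cmult[symmetric]) (auto simp: ennreal_mult' D_def)
    also have "\<dots> = ennreal (2^j * (l2_norm (D j))\<^sup>2)" by (simp add: ennreal_mult')
    also have "\<dots> \<le> ennreal (2^j * ((1/2)^j)\<^sup>2)" using * by (rule ennreal_leI)
    also have "2^j * ((1/2)^j)\<^sup>2 = ((1/2)^j :: real)" by (simp add: power2_eq_square power_one_over)
    finally show "(\<integral>\<^sup>+x. ennreal (2^j * (cmod (D j x))\<^sup>2) \<partial>lborel) \<le> ennreal ((1/2)^j)" .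
  qed
  also have "\<dots> = ennreal (\<Sum>j. (1/2)^j)"
    by (intro suminf_ennreal2) (auto intro: summable_geometric)
  finally have "(\<integral>\<^sup>+x. (\<Sum>j. ennreal (2^j * (cmod (D j x))\<^sup>2)) \<partial>lborel) \<noteq> \<infinity>"
    by (auto simp: top_unique)
  then have AE: "AE x in lborel. (\<Sum>j. ennreal (2^j * (cmod (D j x))\<^sup>2)) \<noteq> \<infinity>"
    by (intro nn_integral_PInf_AE) measurable
  define \<psi> where "\<psi> x = lim (\<lambda>j. F (r j) x)" for x
  have [measurable]: "\<psi> \<in> borel_measurable borel"
    unfolding \<psi>_def by (intro borel_measurable_lim_metric) measurable
  have lim: "AE x in lborel. (\<lambda>j. F (r j) x) \<longlonglongrightarrow> \<psi> x"
    using AE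
  proof eventually_elim
    fix x assume "(\<Sum>j. ennreal (2^j * (cmod (D j x))\<^sup>2)) \<noteq> \<infinity>"
    then have s: "summable (\<lambda>j. 2^j * (cmod (D j x))\<^sup>2)"
      by (intro summable_suminf_not_top) auto
    have "norm (D j x) \<le> 2^j * (cmod (D j x))\<^sup>2 + (1/2)^j" for j
    proof (cases "cmod (D j x) * 2^j \<le> 1")
      case True
      then have "cmod (D j x) \<le> (1/2)^j" by (simp add: power_one_over field_simps)
      then show ?thesis by (simp add: add_increasing)
    next
      case False
      then have "cmod (D j x) * 1 \<le> cmod (D j x) * (cmod (D j x) * 2^j)"
        by (intro mult_left_mono) auto
      then have "cmod (D j x) \<le> 2^j * (cmod (D j x))\<^sup>2" by (simp add: power2_eq_square mult_ac)
      then show ?thesis by (simp add: add_increasing2)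
    qed
    then have "summable (\<lambda>j. D j x)"
      by (intro summable_comparison_test'[OF summable_add[OF s summable_geometric[of "1/2"]], of 0]) auto
    then have "(\<lambda>j. \<Sum>i<j. D i x) \<longlonglongrightarrow> (\<Sum>i. D i x)" by (rule summable_LIMSEQ)
    then have "(\<lambda>j. F (r 0) x + (\<Sum>i<j. D i x)) \<longlonglongrightarrow> F (r 0) x + (\<Sum>i. D i x)"
      by (intro tendsto_intros)
    moreover have "F (r 0) x + (\<Sum>i<j. D i x) = F (r j) x" for j
      by (simp add: D_def sum_lessThan_telescope[of "\<lambda>i. F (r i) x" j])
    ultimately have "convergent (\<lambda>j. F (r j) x)" by (auto simp: convergent_def)
    then show "(\<lambda>j. F (r j) x) \<longlonglongrightarrow> \<psi> x"
      unfolding \<psi>_def by (simp add: convergent_LIMSEQ_iff)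
  qed
  have fatou: "(\<lambda>x. \<psi> x - F N x) \<in> L2 \<and> l2_norm (\<lambda>x. \<psi> x - F N x) \<le> e"
    if e: "e > 0" "\<And>m n. m \<ge> N1 \<Longrightarrow> n \<ge> N1 \<Longrightarrow> l2_norm (\<lambda>x. F m x - F n x) \<le> e" "N \<ge> N1" for e N N1
  proof -
    have "(\<integral>\<^sup>+x. ennreal ((cmod (\<psi> x - F N x))\<^sup>2) \<partial>lborel)
        = (\<integral>\<^sup>+x. liminf (\<lambda>j. ennreal ((cmod (F (r j) x - F N x))\<^sup>2)) \<partial>lborel)"
    proof (rule nn_integral_cong_AE, use lim in eventually_elim)
      fix x assume "(\<lambda>j. F (r j) x) \<longlonglongrightarrow> \<psi> x"
      then have "(\<lambda>j. ennreal ((cmod (F (r j) x - F N x))\<^sup>2)) \<longlonglongrightarrow> ennreal ((cmod (\<psi> x - F N x))\<^sup>2)"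
        by (intro tendsto_intros)
      then show "ennreal ((cmod (\<psi> x - F N x))\<^sup>2) = liminf (\<lambda>j. ennreal ((cmod (F (r j) x - F N x))\<^sup>2))"
        by (rule lim_imp_Liminf[OF trivial_limit_sequentially, symmetric])
    qed
    also have "\<dots> \<le> liminf (\<lambda>j. \<integral>\<^sup>+x. ennreal ((cmod (F (r j) x - F N x))\<^sup>2) \<partial>lborel)"
      by (intro nn_integral_liminf) measurable
    also have "\<dots> \<le> liminf (\<lambda>j. ennreal (e\<^sup>2))"
    proof (rule Liminf_mono, rule eventually_sequentiallyI)
      fix j assume "j \<ge> N1"
      then show "(\<integral>\<^sup>+x. ennreal ((cmod (F (r j) x - F N x))\<^sup>2) \<partial>lborel) \<le> ennreal (e\<^sup>2)"
        unfolding nn using rj[of j] e by (intro ennreal_leI power_mono e(2)) auto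
    qed
    also have "\<dots> = ennreal (e\<^sup>2)" by (simp add: Liminf_const)
    finally have le: "(\<integral>\<^sup>+x. ennreal ((cmod (\<psi> x - F N x))\<^sup>2) \<partial>lborel) \<le> ennreal (e\<^sup>2)" .
    then have int: "integrable lborel (\<lambda>x. (cmod (\<psi> x - F N x))\<^sup>2)"
      by (intro integrableI_bounded) (auto simp: le_less_trans)
    then have "ennreal ((l2_norm (\<lambda>x. \<psi> x - F N x))\<^sup>2) \<le> ennreal (e\<^sup>2)"
      using le by (subst (asm) nn_integral_eq_integral) (auto simp: l2_norm_sq)
    then have "(l2_norm (\<lambda>x. \<psi> x - F N x))\<^sup>2 \<le> e\<^sup>2" by simp
    then have "l2_norm (\<lambda>x. \<psi> x - F N x) \<le> e" using e(1) by (rule power2_le_imp_le[OF _ less_imp_le])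
    with int show ?thesis by (simp add: L2_def)
  qed
  have cl: "\<exists>N1. \<forall>N\<ge>N1. (\<lambda>x. \<psi> x - F N x) \<in> L2 \<and> l2_norm (\<lambda>x. \<psi> x - F N x) \<le> e" if "e > 0" for e
    using Cauchy[OF that] fatou[OF that] by meson
  obtain N1 where "(\<lambda>x. \<psi> x - F N1 x) \<in> L2" using cl[of 1] by auto
  then have "\<psi> \<in> L2" using L2_add[OF _ F[of N1], of "\<lambda>x. \<psi> x - F N1 x"] by simp
  moreover have "(\<lambda>N. l2_norm (\<lambda>x. \<psi> x - F N x)) \<longlonglongrightarrow> 0"
  proof (rule LIMSEQ_I)
    fix e :: real assume "e > 0"
    then obtain N1 where "\<forall>N\<ge>N1. l2_norm (\<lambda>x. \<psi> x - F N x) \<le> e / 2" using cl[of "e/2"] by auto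
    then show "\<exists>no. \<forall>n\<ge>no. norm (l2_norm (\<lambda>x. \<psi> x - F n x) - 0) < e"
      using \<open>e > 0\<close> by (intro exI[of _ N1]) (auto intro: le_less_trans)
  qed
  ultimately show ?thesis using that by blast
qed

definition orthonormal :: "(nat \<Rightarrow> 'n::finite fn) \<Rightarrow> bool" where
  "orthonormal e \<longleftrightarrow> (\<forall>k. e k \<in> L2) \<and> (\<forall>j k. l2_inner (e j) (e k) = (if j = k then 1 else 0))"

definition l2_total :: "(nat \<Rightarrow> 'n::finite fn) \<Rightarrow> bool" where
  "l2_total e \<longleftrightarrow> (\<forall>\<phi>\<in>L2. (\<forall>k. l2_inner \<phi> (e k) = 0) \<longrightarrow> (AE x in lborel. \<phi> x = 0))"

lemma orthonormal_coeff:
  assumes "orthonormal e" "finite K"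
  shows "l2_inner (\<lambda>x. \<Sum>j\<in>K. a j * e j x) (e k) = (if k \<in> K then a k else 0)"
proof -
  have "l2_inner (\<lambda>x. \<Sum>j\<in>K. a j * e j x) (e k) = (\<Sum>j\<in>K. a j * l2_inner (e j) (e k))"
    using assms by (intro l2_inner_sum_left) (auto simp: orthonormal_def)
  also have "\<dots> = (\<Sum>j\<in>K. if k = j then a j else 0)"
    using assms(1) by (intro sum.cong) (auto simp: orthonormal_def)
  finally show ?thesis using assms(2) by (simp add: sum.delta)
qed

lemma orthonormal_norm_sum:
  assumes "orthonormal e" "finite K"
  shows "(l2_norm (\<lambda>x. \<Sum>j\<in>K. a j * e j x))\<^sup>2 = (\<Sum>j\<in>K. (cmod (a j))\<^sup>2)"
proof -
  let ?S = "\<lambda>x. \<Sum>j\<in>K. a j * e j x"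
  have e: "e k \<in> L2" for k using assms by (auto simp: orthonormal_def)
  have S: "?S \<in> L2" using e by (rule L2_lincomb)
  have "complex_of_real ((l2_norm ?S)\<^sup>2) = (\<Sum>j\<in>K. a j * l2_inner (e j) ?S)"
    unfolding l2_inner_self[symmetric] using e S by (intro l2_inner_sum_left) auto
  also have "\<dots> = (\<Sum>j\<in>K. a j * cnj (a j))"
    unfolding l2_inner_cnj[of ?S, symmetric] orthonormal_coeff[OF assms]
    by (intro sum.cong) auto
  also have "\<dots> = complex_of_real (\<Sum>j\<in>K. (cmod (a j))\<^sup>2)"
    by (simp add: complex_norm_square del: of_real_power)
  finally show ?thesis by (simp only: of_real_eq_iff)
qed

lemma Bessel:
  assumes "orthonormal e" "finite K" "\<phi> \<in> L2"
  shows "(\<Sum>k\<in>K. (cmod (l2_inner \<phi> (e k)))\<^sup>2) \<le> (l2_norm \<phi>)\<^sup>2"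
proof -
  let ?c = "\<lambda>k. l2_inner \<phi> (e k)" and ?S = "\<lambda>x. \<Sum>j\<in>K. l2_inner \<phi> (e j) * e j x"
  let ?s = "\<Sum>k\<in>K. (cmod (?c k))\<^sup>2"
  have e: "e k \<in> L2" for k using assms by (auto simp: orthonormal_def)
  have S: "?S \<in> L2" using e by (rule L2_lincomb)
  have "l2_inner ?S \<phi> = (\<Sum>k\<in>K. ?c k * cnj (?c k))"
    using assms e by (simp add: l2_inner_sum_left l2_inner_cnj)
  also have "\<dots> = complex_of_real ?s" by (simp add: complex_norm_square del: of_real_power)
  finally have "cmod (l2_inner ?S \<phi>) = ?s" by (simp add: sum_nonneg del: of_real_sum)
  then have "?s\<^sup>2 \<le> (l2_norm ?S * l2_norm \<phi>)\<^sup>2"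
    using l2_Cauchy_Schwarz[OF S assms(3)] by (intro power_mono) (auto intro: sum_nonneg)
  also have "\<dots> = ?s * (l2_norm \<phi>)\<^sup>2"
    by (simp add: power_mult_distrib orthonormal_norm_sum[OF assms(1,2)])
  finally have "?s * ?s \<le> ?s * (l2_norm \<phi>)\<^sup>2" by (simp add: power2_eq_square)
  moreover have "?s \<ge> 0" by (simp add: sum_nonneg)
  ultimately show ?thesis by (cases "?s = 0") (auto simp: mult_le_cancel_left)
qed

lemma Bessel_summable:
  assumes "orthonormal e" "\<phi> \<in> L2"
  shows "summable (\<lambda>k. (cmod (l2_inner \<phi> (e k)))\<^sup>2)"
  by (rule summableI_nonneg_bounded[OF _ Bessel[OF assms(1) _ assms(2)]]) auto

lemma coeff_product_summable:
  assumes "orthonormal e" "\<phi> \<in> L2" "\<psi> \<in> L2"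
  shows "summable (\<lambda>k. cmod (l2_inner \<phi> (e k)) * cmod (l2_inner \<psi> (e k)))"
proof (rule summable_comparison_test'[OF summable_add[OF Bessel_summable[OF assms(1,2)] Bessel_summable[OF assms(1,3)]], of 0])
  fix k
  let ?a = "cmod (l2_inner \<phi> (e k))" and ?b = "cmod (l2_inner \<psi> (e k))"
  have nn: "0 \<le> ?a * ?b" by simp
  have "2 * (?a * ?b) \<le> ?a\<^sup>2 + ?b\<^sup>2" using sum_squares_bound[of ?a ?b] by simp
  then have "?a * ?b \<le> ?a\<^sup>2 + ?b\<^sup>2" using nn by linarith
  then show "norm (?a * ?b) \<le> ?a\<^sup>2 + ?b\<^sup>2" using nn by (simp only: real_norm_def abs_of_nonneg)
qed

lemma Riesz_Fischer:
  assumes "orthonormal e" "summable (\<lambda>k. (cmod (c k))\<^sup>2)"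
  obtains \<psi> where "\<psi> \<in> L2" "(\<lambda>N. l2_norm (\<lambda>x. \<psi> x - (\<Sum>k<N. c k * e k x))) \<longlonglongrightarrow> 0"
proof -
  have e: "e k \<in> L2" for k using assms by (auto simp: orthonormal_def)
  let ?F = "\<lambda>N x. \<Sum>k<N. c k * e k x"
  have "\<exists>N. \<forall>m\<ge>N. \<forall>n\<ge>N. l2_norm (\<lambda>x. ?F m x - ?F n x) \<le> \<epsilon>" if "\<epsilon> > 0" for \<epsilon>
  proof -
    obtain N where N: "\<And>m n. m \<ge> N \<Longrightarrow> norm (\<Sum>k=m..<n. (cmod (c k))\<^sup>2) < \<epsilon>\<^sup>2"
      using assms(2)[unfolded summable_Cauchy] \<open>\<epsilon> > 0\<close> by (meson zero_less_power)
    have le: "l2_norm (\<lambda>x. ?F n x - ?F m x) \<le> \<epsilon>" if "m \<ge> N" "m \<le> n" for m n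
    proof -
      have "(\<lambda>x. ?F n x - ?F m x) = (\<lambda>x. \<Sum>k=m..<n. c k * e k x)"
        using that by (auto simp: lessThan_atLeast0 sum_diff_nat_ivl)
      then have "(l2_norm (\<lambda>x. ?F n x - ?F m x))\<^sup>2 = (\<Sum>k=m..<n. (cmod (c k))\<^sup>2)"
        using orthonormal_norm_sum[OF assms(1), of "{m..<n}" c] by simp
      also have "\<dots> \<le> \<epsilon>\<^sup>2" using N[OF that(1), of n] by simp
      finally show ?thesis using \<open>\<epsilon> > 0\<close> by (rule power2_le_imp_le[OF _ less_imp_le])
    qed
    show ?thesis
    proof (intro exI[of _ N] allI impI)
      fix m n assume "m \<ge> N" "n \<ge> N"
      then show "l2_norm (\<lambda>x. ?F m x - ?F n x) \<le> \<epsilon>"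
        using le[of m n] le[of n m] l2_norm_minus_commute[of "?F m" "?F n"] by (cases "m \<le> n") auto
    qed
  qed
  from L2_complete[of ?F, OF L2_lincomb[OF e] this] that show ?thesis by blast
qed

text \<open>The series converges to something by completeness; the difference to \<open>\<phi>\<close> is orthogonal to the whole
  system and therefore vanishes by totality.\<close>

lemma l2_expansion:
  assumes "orthonormal e" "l2_total e" "\<phi> \<in> L2"
  shows "(\<lambda>N. l2_norm (\<lambda>x. \<phi> x - (\<Sum>k<N. l2_inner \<phi> (e k) * e k x))) \<longlonglongrightarrow> 0"
proof -
  have e: "e k \<in> L2" for k using assms by (auto simp: orthonormal_def)
  let ?F = "\<lambda>N x. \<Sum>k<N. l2_inner \<phi> (e k) * e k x"
  have F: "?F N \<in> L2" for N using e by (rule L2_lincomb)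
  obtain \<psi> where \<psi>: "\<psi> \<in> L2" "(\<lambda>N. l2_norm (\<lambda>x. \<psi> x - ?F N x)) \<longlonglongrightarrow> 0"
    using Riesz_Fischer[OF assms(1) Bessel_summable[OF assms(1,3)]] by blast
  have "l2_inner (\<lambda>x. \<phi> x - \<psi> x) (e k) = 0" for k
  proof -
    have "(\<lambda>N. l2_inner (?F N) (e k)) \<longlonglongrightarrow> l2_inner \<psi> (e k)"
      by (rule l2_inner_tendsto[OF \<psi>(1) F e \<psi>(2)])
    moreover have "(\<lambda>N. l2_inner (?F N) (e k)) \<longlonglongrightarrow> l2_inner \<phi> (e k)"
      by (rule tendsto_eventually, rule eventually_sequentiallyI[of "Suc k"])
        (simp add: orthonormal_coeff[OF assms(1)])
    ultimately have "l2_inner \<psi> (e k) = l2_inner \<phi> (e k)" by (rule LIMSEQ_unique)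
    then show ?thesis using assms(3) \<psi>(1) e by (simp add: l2_inner_diff_left)
  qed
  then have AE: "AE x in lborel. \<phi> x - \<psi> x = 0"
    using assms(2) L2_diff[OF assms(3) \<psi>(1)] unfolding l2_total_def by blast
  have "l2_norm (\<lambda>x. \<phi> x - ?F N x) = l2_norm (\<lambda>x. \<psi> x - ?F N x)" for N
  proof -
    have [measurable]: "(\<lambda>x. \<phi> x - ?F N x) \<in> borel_measurable borel" "(\<lambda>x. \<psi> x - ?F N x) \<in> borel_measurable borel"
      using L2_diff[OF assms(3) F] L2_diff[OF \<psi>(1) F] by (auto simp: L2_def)
    show ?thesis unfolding l2_norm_def
      by (rule arg_cong[of _ _ sqrt], rule integral_cong_AE) (use AE in auto)
  qed
  with \<psi>(2) show ?thesis by simp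
qed

lemma Parseval:
  assumes "orthonormal e" "l2_total e" "\<phi> \<in> L2" "\<psi> \<in> L2"
  shows "(\<lambda>k. l2_inner \<phi> (e k) * cnj (l2_inner \<psi> (e k))) sums l2_inner \<phi> \<psi>"
proof -
  have e: "e k \<in> L2" for k using assms by (auto simp: orthonormal_def)
  have "(\<lambda>N. l2_inner (\<lambda>x. \<Sum>k<N. l2_inner \<phi> (e k) * e k x) \<psi>) \<longlonglongrightarrow> l2_inner \<phi> \<psi>"
    by (rule l2_inner_tendsto[OF assms(3) L2_lincomb[OF e] assms(4) l2_expansion[OF assms(1-3)]])
  then show ?thesis
    using e assms by (simp add: sums_def l2_inner_sum_left l2_inner_cnj)
qed

section \<open>Integration by parts on Euclidean spaces\<close>

text \<open>The directional derivative on an arbitrary Euclidean space. On \<open>real ^ 'n\<close> it is the partial derivative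
  used by the Hermite operator; on the group it carries the invariant vector fields.\<close>

definition dd :: "'a::euclidean_space \<Rightarrow> ('a \<Rightarrow> complex) \<Rightarrow> 'a \<Rightarrow> complex" where
  "dd b u x = frechet_derivative u (at x) b"

lemma partial_eq_dd: "partial b u = dd b u"
  by (simp add: fun_eq_iff partial_def dd_def)

lemma dd_eqI: "(u has_derivative u') (at x) \<Longrightarrow> dd b u x = u' b"
  unfolding dd_def using frechet_derivative_at by metis

lemma dd_has_derivative:
  "u differentiable (at x) \<Longrightarrow> (u has_derivative (\<lambda>h. dd h u x)) (at x)"
  unfolding dd_def using frechet_derivative_works[of u "at x"] by (simp add: eta_contract_eq)

lemma dd_add:
  "u differentiable (at x) \<Longrightarrow> v differentiable (at x) \<Longrightarrow> dd b (\<lambda>x. u x + v x) x = dd b u x + dd b v x"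
  by (rule dd_eqI) (intro derivative_intros dd_has_derivative)

lemma dd_diff:
  "u differentiable (at x) \<Longrightarrow> v differentiable (at x) \<Longrightarrow> dd b (\<lambda>x. u x - v x) x = dd b u x - dd b v x"
  by (rule dd_eqI) (intro derivative_intros dd_has_derivative)

lemma dd_mult:
  "u differentiable (at x) \<Longrightarrow> v differentiable (at x) \<Longrightarrow>
    dd b (\<lambda>x. u x * v x) x = dd b u x * v x + u x * dd b v x"
  by (subst dd_eqI[OF has_derivative_mult[OF dd_has_derivative dd_has_derivative]]) (auto simp: algebra_simps)

lemma dd_cmult: "u differentiable (at x) \<Longrightarrow> dd b (\<lambda>x. c * u x) x = c * dd b u x"
  by (rule dd_eqI) (intro derivative_intros dd_has_derivative)

lemma dd_zero_outside:
  assumes "closed K" "\<And>x. x \<notin> K \<Longrightarrow> u x = 0" "x \<notin> K"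
  shows "dd b u x = 0"
proof -
  have "((\<lambda>x. 0) has_derivative (\<lambda>h. 0)) (at x)" by simp
  then have "(u has_derivative (\<lambda>h. 0)) (at x)"
    by (rule has_derivative_transform_within_open[of _ _ _ _ "- K"]) (use assms in auto)
  then show ?thesis by (simp add: dd_eqI)
qed

lemma lborel_translate:
  fixes f :: "'a::euclidean_space \<Rightarrow> 'b::{banach, second_countable_topology}"
  assumes [measurable]: "f \<in> borel_measurable borel"
  shows lborel_integrable_translate: "integrable lborel (\<lambda>x. f (x + c)) \<longleftrightarrow> integrable lborel f"
    and lborel_integral_translate: "(LINT x|lborel. f (x + c)) = (LINT x|lborel. f x)"
proof -
  have "integrable (distr lborel borel ((+) c)) f \<longleftrightarrow> integrable lborel (\<lambda>x. f (c + x))"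
    by (intro integrable_distr_eq) auto
  then show "integrable lborel (\<lambda>x. f (x + c)) \<longleftrightarrow> integrable lborel f"
    by (simp add: lborel_distr_plus add.commute)
  have "integral\<^sup>L (distr lborel borel ((+) c)) f = (LINT x|lborel. f (c + x))"
    by (intro integral_distr) auto
  then show "(LINT x|lborel. f (x + c)) = (LINT x|lborel. f x)"
    by (simp add: lborel_distr_plus add.commute)
qed

text \<open>Integrating the fundamental theorem of calculus along the segment from \<open>x\<close> to \<open>x + b\<close> over all \<open>x\<close>
  gives the integral of \<open>F (x + b) - F x\<close>, which is zero by translation invariance. This covers
  integration by parts in any dimension, with integrability in place of compact support.\<close>

lemma integral_dd_eq_0:
  fixes F :: "'a::euclidean_space \<Rightarrow> complex"
  assumes diff: "\<And>x. F differentiable (at x)" and cont: "continuous_on UNIV (dd b F)"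
    and F: "integrable lborel F" and dF: "integrable lborel (dd b F)"
  shows "(LINT x|lborel. dd b F x) = 0"
proof -
  have contF: "continuous_on UNIV F"
    using diff by (simp add: continuous_at_imp_continuous_on differentiable_imp_continuous_within)
  have [measurable]: "F \<in> borel_measurable borel" "dd b F \<in> borel_measurable borel"
    using contF cont by (auto intro: borel_measurable_continuous_onI)
  define G where "G t x = indicator {0..1} t *\<^sub>R dd b F (x + t *\<^sub>R b)" for t :: real and x
  have [measurable]: "(\<lambda>p. G (fst p) (snd p)) \<in> borel_measurable (lborel \<Otimes>\<^sub>M lborel)"
    unfolding G_def by measurable
  have ftc: "(LINT t|lborel. G t x) = F (x + b) - F x" for x
  proof -
    have "(LINT t|lborel. indicator {0..1} t *\<^sub>R dd b F (x + t *\<^sub>R b)) = F (x + 1 *\<^sub>R b) - F (x + 0 *\<^sub>R b)"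
    proof (rule integral_FTC_Icc)
      fix t :: real
      have "((\<lambda>t. F (x + t *\<^sub>R b)) has_derivative (\<lambda>h. dd (h *\<^sub>R b) F (x + t *\<^sub>R b))) (at t within {0..1})"
        by (rule has_derivative_compose[of "\<lambda>t. x + t *\<^sub>R b" _ _ _ F])
          (auto intro!: derivative_eq_intros dd_has_derivative diff)
      moreover have "dd (h *\<^sub>R b) F y = h *\<^sub>R dd b F y" for h y
        using linear_scale[OF has_derivative_linear[OF dd_has_derivative[OF diff]]] .
      ultimately show "((\<lambda>t. F (x + t *\<^sub>R b)) has_vector_derivative dd b F (x + t *\<^sub>R b)) (at t within {0..1})"
        by (simp add: has_vector_derivative_def)
    qed (auto intro!: continuous_on_compose2[OF cont] continuous_intros)
    then show ?thesis by (simp add: G_def)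
  qed
  have "integrable (lborel \<Otimes>\<^sub>M lborel) (\<lambda>p. G (fst p) (snd p))"
  proof (rule lborel_pair.Fubini_integrable)
    have "(LINT x|lborel. norm (G t x)) = indicator {0..1} t * (LINT x|lborel. norm (dd b F x))" for t
      using lborel_integral_translate[of "\<lambda>x. norm (dd b F x)" "t *\<^sub>R b"]
      by (simp add: G_def)
    then show "integrable lborel (\<lambda>x. LINT y|lborel. norm (G (fst (x, y)) (snd (x, y))))"
      by (simp add: integrable_mult_left_iff)
    have "G t = (\<lambda>x. indicator {0..1} t *\<^sub>R dd b F (x + t *\<^sub>R b))" for t by (simp add: fun_eq_iff G_def)
    then have "integrable lborel (G t)" for t
      using lborel_integrable_translate[of "dd b F" "t *\<^sub>R b"] dF by simp
    then show "AE x in lborel. integrable lborel (\<lambda>y. G (fst (x, y)) (snd (x, y)))"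
      by simp
  qed measurable
  then have "(LINT x|lborel. LINT t|lborel. G t x) = (LINT t|lborel. LINT x|lborel. G t x)"
    by (intro lborel_pair.Fubini_integral) (simp add: case_prod_beta')
  also have "(LINT x|lborel. G t x) = indicator {0..1} t *\<^sub>R (LINT x|lborel. dd b F x)" for t
    using lborel_integral_translate[of "dd b F" "t *\<^sub>R b"] by (simp add: G_def)
  then have "(LINT t|lborel. LINT x|lborel. G t x)
      = (LINT t|lborel. indicator {0..1::real} t *\<^sub>R (LINT x|lborel. dd b F x))" by simp
  also have "\<dots> = (LINT x|lborel. dd b F x)" by simp
  also have "(LINT x|lborel. LINT t|lborel. G t x) = (LINT x|lborel. F (x + b)) - (LINT x|lborel. F x)"
    using F lborel_integrable_translate[of F b] by (simp add: ftc)
  finally show ?thesis using lborel_integral_translate[of F b] by simp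
qed

lemma integrable_compact_support:
  fixes u :: "'a::euclidean_space \<Rightarrow> 'b::euclidean_space"
  assumes "continuous_on UNIV u" "compact K" "\<And>x. x \<notin> K \<Longrightarrow> u x = 0"
  shows "integrable lborel u"
proof -
  have "integrable lborel (\<lambda>x. indicator K x *\<^sub>R u x)"
    using assms by (intro borel_integrable_compact) (auto intro: continuous_on_subset)
  moreover have "(\<lambda>x. indicator K x *\<^sub>R u x) = u" using assms(3) by (auto simp: indicator_def)
  ultimately show ?thesis by simp
qed

lemma C2D:
  assumes "C2 u" "b \<in> Basis"
  shows "u differentiable (at x)" "dd b u differentiable (at x)" "continuous_on UNIV u"
    "continuous_on UNIV (dd b u)" "c \<in> Basis \<Longrightarrow> continuous_on UNIV (dd c (dd b u))"
  using assms unfolding C2_def partial_eq_dd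
  by (auto simp: continuous_at_imp_continuous_on differentiable_imp_continuous_within)

text \<open>Only one of the two functions has compact support: the boundary terms are integrals of derivatives of
  functions that vanish outside that support.\<close>

lemma hermite_op_symmetric:
  fixes u w :: "'n::finite fn"
  assumes u: "C2 u" and w: "C2 w" and K: "compact K" "\<And>x. x \<notin> K \<Longrightarrow> w x = 0"
  shows "(LINT x|lborel. hermite_op lam u x * w x) = (LINT x|lborel. u x * hermite_op lam w x)"
proof -
  let ?dd = "\<lambda>b u. dd b (dd b u)"
  have clK: "closed K" using K(1) by (rule compact_imp_closed)
  have w1: "dd b w x = 0" if "x \<notin> K" for b x
    using dd_zero_outside[of K w, OF clK K(2)] that by blast
  have w2: "?dd b w x = 0" if "x \<notin> K" for b x
    using dd_zero_outside[of K "dd b w", OF clK w1] that by blast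
  note cu = C2D[OF u] and cw = C2D[OF w]
  have one: "integrable lborel (\<lambda>x. ?dd b u x * w x - u x * ?dd b w x)"
      "(LINT x|lborel. ?dd b u x * w x - u x * ?dd b w x) = 0" if b: "b \<in> Basis" for b
  proof -
    define F where "F x = dd b u x * w x - u x * dd b w x" for x
    have dF: "dd b F = (\<lambda>x. ?dd b u x * w x - u x * ?dd b w x)"
      unfolding F_def by (rule ext, subst dd_diff)
        (auto simp: dd_mult cu[OF b] cw[OF b] algebra_simps intro!: differentiable_mult)
    have "integrable lborel F" unfolding F_def
      using cu[OF b] cw[OF b] b K w1 w2 by (intro integrable_compact_support[OF _ K(1)] continuous_intros) auto
    moreover show i: "integrable lborel (\<lambda>x. ?dd b u x * w x - u x * ?dd b w x)"
      using cu[OF b] cw[OF b] b K w1 w2 by (intro integrable_compact_support[OF _ K(1)] continuous_intros) auto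
    moreover have "F differentiable (at x)" for x unfolding F_def
      using cu[OF b] cw[OF b] by (intro differentiable_diff differentiable_mult) auto
    moreover have "continuous_on UNIV (dd b F)" unfolding dF
      using cu[OF b] cw[OF b] b by (intro continuous_intros) auto
    ultimately show "(LINT x|lborel. ?dd b u x * w x - u x * ?dd b w x) = 0"
      using integral_dd_eq_0[of F b] by (simp add: dF)
  qed
  obtain b0 :: "real ^ 'n" where b0: "b0 \<in> Basis" using nonempty_Basis by blast
  have cH: "continuous_on UNIV (hermite_op lam v)" if "C2 v" for v :: "'n fn"
    unfolding hermite_op_def partial_eq_dd
    using C2D[OF that] b0 by (intro continuous_intros) (auto simp: continuous_on_of_real)
  have Hw: "hermite_op lam w x = 0" if "x \<notin> K" for x
    using that w2 K by (simp add: hermite_op_def partial_eq_dd)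
  have "(LINT x|lborel. hermite_op lam u x * w x) - (LINT x|lborel. u x * hermite_op lam w x)
      = (LINT x|lborel. hermite_op lam u x * w x - u x * hermite_op lam w x)"
    using cu[OF b0] cw[OF b0] Hw K cH[OF u] cH[OF w]
    by (intro Bochner_Integration.integral_diff[symmetric] integrable_compact_support[OF _ K(1)] continuous_intros) auto
  also have "\<dots> = (LINT x|lborel. - (\<Sum>b\<in>Basis. ?dd b u x * w x - u x * ?dd b w x))"
    by (intro Bochner_Integration.integral_cong)
      (auto simp: hermite_op_def partial_eq_dd sum_subtractf sum_distrib_left sum_distrib_right algebra_simps)
  also have "\<dots> = - (\<Sum>b\<in>Basis. LINT x|lborel. ?dd b u x * w x - u x * ?dd b w x)"
    using one by (simp del: Bochner_Integration.integral_diff)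
  also have "\<dots> = 0" using one by simp
  finally show ?thesis by simp
qed

section \<open>Products of functions of one variable\<close>

definition prodfun :: "('a::euclidean_space \<Rightarrow> real \<Rightarrow> complex) \<Rightarrow> 'a \<Rightarrow> complex" where
  "prodfun g x = (\<Prod>b\<in>Basis. g b (x \<bullet> b))"

lemma prodfun_cong: "(\<And>b. b \<in> Basis \<Longrightarrow> g b = h b) \<Longrightarrow> prodfun g = prodfun h"
  by (auto simp: prodfun_def fun_eq_iff intro!: prod.cong)

lemma prodfun_upd:
  assumes "c \<in> Basis" shows "prodfun (g(c := h)) x = h (x \<bullet> c) * (\<Prod>b\<in>Basis - {c}. g b (x \<bullet> b))"
  unfolding prodfun_def using assms by (subst prod.remove[of _ c]) (auto intro!: prod.cong)

lemma prodfun_remove: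
  assumes "c \<in> Basis" shows "prodfun g x = g c (x \<bullet> c) * (\<Prod>b\<in>Basis - {c}. g b (x \<bullet> b))"
  unfolding prodfun_def using assms by (subst prod.remove[of _ c]) auto

lemma prodfun_has_derivative:
  assumes "\<And>b. b \<in> Basis \<Longrightarrow> (g b has_vector_derivative g' b (x \<bullet> b)) (at (x \<bullet> b))"
  shows "(prodfun g has_derivative
     (\<lambda>h. \<Sum>b\<in>Basis. ((h \<bullet> b) *\<^sub>R g' b (x \<bullet> b)) * (\<Prod>c\<in>Basis - {b}. g c (x \<bullet> c)))) (at x)"
  unfolding prodfun_def[abs_def]
proof (rule has_derivative_prod)
  fix b :: 'a assume "b \<in> Basis"
  then have "(g b has_derivative (\<lambda>h. h *\<^sub>R g' b (x \<bullet> b))) (at (x \<bullet> b))"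
    using assms by (simp add: has_vector_derivative_def)
  moreover have "((\<lambda>x. x \<bullet> b) has_derivative (\<lambda>h. h \<bullet> b)) (at x)" by (auto intro!: derivative_eq_intros)
  ultimately show "((\<lambda>x. g b (x \<bullet> b)) has_derivative (\<lambda>h. (h \<bullet> b) *\<^sub>R g' b (x \<bullet> b))) (at x)"
    using has_derivative_compose[of "\<lambda>x. x \<bullet> b" "\<lambda>h. h \<bullet> b" x UNIV "g b"] by blast
qed

lemma prodfun_differentiable:
  assumes "\<And>b t. b \<in> Basis \<Longrightarrow> (g b has_vector_derivative g' b t) (at t)"
  shows "prodfun g differentiable (at x)"
  using prodfun_has_derivative[of g g' x] assms by (auto simp: differentiable_def)

lemma dd_prodfun:
  assumes "\<And>b t. b \<in> Basis \<Longrightarrow> (g b has_vector_derivative g' b t) (at t)" and c: "c \<in> Basis"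
  shows "dd c (prodfun g) = prodfun (g(c := g' c))"
proof
  fix x
  have "dd c (prodfun g) x
     = (\<Sum>b\<in>Basis. ((c \<bullet> b) *\<^sub>R g' b (x \<bullet> b)) * (\<Prod>c\<in>Basis - {b}. g c (x \<bullet> c)))"
    by (rule dd_eqI[OF prodfun_has_derivative]) (use assms in auto)
  also have "\<dots> = (\<Sum>b\<in>Basis. if b = c then g' c (x \<bullet> c) * (\<Prod>b\<in>Basis - {c}. g b (x \<bullet> b)) else 0)"
    using c by (intro sum.cong) (auto simp: inner_Basis)
  finally show "dd c (prodfun g) x = prodfun (g(c := g' c)) x"
    using c by (simp add: prodfun_upd sum.delta)
qed

lemma continuous_prodfun:
  assumes "\<And>b. b \<in> Basis \<Longrightarrow> continuous_on UNIV (g b)"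
  shows "continuous_on UNIV (prodfun g)"
  unfolding prodfun_def[abs_def]
  by (intro continuous_intros continuous_on_compose2[OF assms]) auto

lemma prodfun_C2:
  fixes g :: "real ^ 'n::finite \<Rightarrow> real \<Rightarrow> complex"
  assumes 1: "\<And>b t. b \<in> Basis \<Longrightarrow> (g b has_vector_derivative g1 b t) (at t)"
    and 2: "\<And>b t. b \<in> Basis \<Longrightarrow> (g1 b has_vector_derivative g2 b t) (at t)"
    and 3: "\<And>b. b \<in> Basis \<Longrightarrow> continuous_on UNIV (g2 b)"
  shows "C2 (prodfun g)"
    and "c \<in> Basis \<Longrightarrow> partial c (partial c (prodfun g)) = prodfun (g(c := g2 c))"
proof -
  have c0: "continuous_on UNIV (g b)" "continuous_on UNIV (g1 b)" if "b \<in> Basis" for b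
    using 1[OF that] 2[OF that]
    by (meson continuous_at_imp_continuous_on has_vector_derivative_continuous)+
  have d1: "((g(b := g1 b)) a has_vector_derivative (g1(b := g2 b)) a t) (at t)" if "a \<in> Basis" "b \<in> Basis" for a b t
    using 1 2 that by auto
  have dd2: "dd c (prodfun (g(b := g1 b))) = prodfun (g(b := g1 b, c := (g1(b := g2 b)) c))"
    if "b \<in> Basis" "c \<in> Basis" for b c
    using that d1 by (intro dd_prodfun) auto
  have dd1: "dd c (prodfun g) = prodfun (g(c := g1 c))" if "c \<in> Basis" for c
    using 1 that by (rule dd_prodfun)
  show "C2 (prodfun g)" unfolding C2_def partial_eq_dd
  proof (intro conjI ballI allI)
    show "prodfun g differentiable (at x)" for x using 1 by (rule prodfun_differentiable)
    fix b :: "real ^ 'n" assume b: "b \<in> Basis"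
    show "dd b (prodfun g) differentiable (at x)" for x
      unfolding dd1[OF b] using d1[OF _ b] by (rule prodfun_differentiable)
    fix c :: "real ^ 'n" assume c: "c \<in> Basis"
    show "continuous_on UNIV (dd c (dd b (prodfun g)))"
      unfolding dd1[OF b] dd2[OF b c] by (rule continuous_prodfun) (use c0 3 in auto)
  qed
  show "partial c (partial c (prodfun g)) = prodfun (g(c := g2 c))" if "c \<in> Basis"
    using dd2[OF that that] dd1[OF that] by (simp add: partial_eq_dd)
qed

lemma norm_sq_Basis: "(norm x)\<^sup>2 = (\<Sum>b\<in>Basis. (x \<bullet> b)\<^sup>2)" for x :: "'a::euclidean_space"
  unfolding dot_square_norm[symmetric] by (subst euclidean_inner) (simp add: power2_eq_square)

lemma hermite_op_prodfun:
  fixes g :: "real ^ 'n::finite \<Rightarrow> real \<Rightarrow> complex"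
  assumes 1: "\<And>b t. b \<in> Basis \<Longrightarrow> (g b has_vector_derivative g1 b t) (at t)"
    and 2: "\<And>b t. b \<in> Basis \<Longrightarrow> (g1 b has_vector_derivative g2 b t) (at t)"
    and 3: "\<And>b. b \<in> Basis \<Longrightarrow> continuous_on UNIV (g2 b)"
  shows "hermite_op lam (prodfun g) x =
    (\<Sum>c\<in>Basis. prodfun (g(c := (\<lambda>t. - g2 c t + complex_of_real (lam\<^sup>2 * t\<^sup>2) * g c t))) x)"
proof -
  have "hermite_op lam (prodfun g) x = - (\<Sum>b\<in>Basis. prodfun (g(b := g2 b)) x)
      + (\<Sum>b\<in>Basis. complex_of_real (lam\<^sup>2 * (x \<bullet> b)\<^sup>2) * prodfun g x)"
    unfolding hermite_op_def norm_sq_Basis sum_distrib_left of_real_sum sum_distrib_right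
    by (simp add: prodfun_C2(2)[OF 1 2 3])
  also have "\<dots> = (\<Sum>b\<in>Basis. - prodfun (g(b := g2 b)) x + complex_of_real (lam\<^sup>2 * (x \<bullet> b)\<^sup>2) * prodfun g x)"
    by (simp add: sum_subtractf)
  also have "\<dots> = (\<Sum>c\<in>Basis. prodfun (g(c := (\<lambda>t. - g2 c t + complex_of_real (lam\<^sup>2 * t\<^sup>2) * g c t))) x)"
    by (intro sum.cong refl) (simp add: prodfun_upd prodfun_remove[of _ g] algebra_simps)
  finally show ?thesis .
qed

lemma integral_prodfun:
  fixes g :: "'a::euclidean_space \<Rightarrow> real \<Rightarrow> complex"
  assumes "\<And>b. b \<in> Basis \<Longrightarrow> integrable lborel (g b)"
  shows "integrable lborel (prodfun g)"
    and "(LINT x|lborel. prodfun g x) = (\<Prod>b\<in>Basis. LINT t|lborel. g b t)"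
proof -
  interpret product_sigma_finite "\<lambda>_::'a. lborel::real measure" by standard
  let ?T = "\<lambda>f. \<Sum>b\<in>Basis. f b *\<^sub>R b :: 'a"
  have m: "?T \<in> measurable (\<Pi>\<^sub>M b\<in>Basis. lborel) borel" by measurable
  have eq: "lborel = distr (\<Pi>\<^sub>M b\<in>Basis. lborel) borel ?T" by (rule lborel_eq)
  have [measurable]: "g b \<in> borel_measurable borel" if "b \<in> Basis" for b
    using assms[OF that] by auto
  have mP: "prodfun g \<in> borel_measurable borel"
    unfolding prodfun_def by measurable
  have PT: "prodfun g (?T f) = (\<Prod>b\<in>Basis. g b (f b))" for f
    unfolding prodfun_def by (intro prod.cong) (auto simp: inner_sum_left_Basis)
  have "integrable (\<Pi>\<^sub>M b\<in>Basis. lborel) (\<lambda>f. prodfun g (?T f))"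
    unfolding PT by (intro product_integrable_prod assms) auto
  then show "integrable lborel (prodfun g)"
    by (subst eq) (simp add: integrable_distr_eq[OF m mP])
  have "(LINT x|lborel. prodfun g x) = (LINT f|(\<Pi>\<^sub>M b\<in>Basis. lborel). prodfun g (?T f))"
    by (subst eq) (rule integral_distr[OF m mP])
  also have "\<dots> = (\<Prod>b\<in>Basis. LINT t|lborel. g b t)"
    unfolding PT by (intro product_integral_prod assms) auto
  finally show "(LINT x|lborel. prodfun g x) = (\<Prod>b\<in>Basis. LINT t|lborel. g b t)" .
qed

section \<open>Bump functions with prescribed bounds on all derivatives\<close>

text \<open>Convolution with the normalised indicator function of an interval of length \<open>c\<close>.\<close>

definition avg :: "real \<Rightarrow> (real \<Rightarrow> real) \<Rightarrow> real \<Rightarrow> real" where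
  "avg c v t = integral {t - c..t} v / c"

lemma avg_bounds:
  assumes "c > 0" "continuous_on UNIV v" "\<And>s. s \<in> {t - c..t} \<Longrightarrow> l \<le> v s" "\<And>s. s \<in> {t - c..t} \<Longrightarrow> v s \<le> u"
  shows "l \<le> avg c v t" "avg c v t \<le> u"
proof -
  have i: "v integrable_on {t - c..t}"
    using assms(2) by (intro integrable_continuous_real) (auto intro: continuous_on_subset)
  have "integral {t - c..t} (\<lambda>_. l) \<le> integral {t - c..t} v"
    using assms i by (intro integral_le) auto
  moreover have "integral {t - c..t} v \<le> integral {t - c..t} (\<lambda>_. u)"
    using assms i by (intro integral_le) auto
  ultimately show "l \<le> avg c v t" "avg c v t \<le> u"
    using assms(1) by (auto simp: avg_def field_simps)
qed

lemma avg_diff: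
  assumes "continuous_on UNIV v" "continuous_on UNIV w"
  shows "avg c v t - avg c w t = avg c (\<lambda>s. v s - w s) t"
proof -
  have "v integrable_on {t - c..t}" "w integrable_on {t - c..t}"
    using assms by (auto intro!: integrable_continuous_real intro: continuous_on_subset)
  then show ?thesis by (simp add: avg_def Henstock_Kurzweil_Integration.integral_diff diff_divide_distrib)
qed

lemma avg_diff_bound:
  assumes "c > 0" "continuous_on UNIV v" "continuous_on UNIV w" and e: "\<And>s. \<bar>v s - w s\<bar> \<le> e"
  shows "\<bar>avg c v t - avg c w t\<bar> \<le> e"
proof -
  have le: "- e \<le> v s - w s" "v s - w s \<le> e" for s using e[of s] by linarith+
  from avg_bounds[of c "\<lambda>s. v s - w s" t "-e" e, OF assms(1) continuous_on_diff[OF assms(2,3)] le]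
  show ?thesis unfolding avg_diff[OF assms(2,3)] by linarith
qed

lemma avg_has_derivative:
  assumes "c > 0" "continuous_on UNIV v"
  shows "(avg c v has_real_derivative (v t - v (t - c)) / c) (at t)"
proof -
  obtain V where V: "\<And>x. (V has_vector_derivative v x) (at x)"
    using einterval_antiderivative[of "-\<infinity>" "\<infinity>" v] assms(2)
    by (auto simp: continuous_on_eq_continuous_at)
  have "avg c v = (\<lambda>t. (V t - V (t - c)) / c)"
  proof
    fix t
    have "(v has_integral (V t - V (t - c))) {t - c..t}"
      using assms(1) V by (intro fundamental_theorem_of_calculus) (auto intro: has_vector_derivative_at_within)
    then show "avg c v t = (V t - V (t - c)) / c" by (simp add: avg_def integral_unique)
  qed
  moreover have V': "(V has_real_derivative v x) (at x)" for x
    using V by (simp add: has_real_derivative_iff_has_vector_derivative)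
  have "((\<lambda>t. (V t - V (t - c)) / c) has_real_derivative (v t - v (t - c)) / c) (at t)"
    by (intro DERIV_cdivide DERIV_diff V' DERIV_shift[THEN iffD1, of _ _ _ "-c", simplified] )
  ultimately show ?thesis by simp
qed

text \<open>The hat function, convolved with indicator functions of widths \<open>a k, a (k + 1), \<dots>, a (k + m - 1)\<close>.\<close>

fun iterated_avg :: "(nat \<Rightarrow> real) \<Rightarrow> nat \<Rightarrow> nat \<Rightarrow> real \<Rightarrow> real" where
  "iterated_avg a k 0 = (\<lambda>t. max 0 (1 - \<bar>t\<bar>))"
| "iterated_avg a k (Suc m) = avg (a k) (iterated_avg a (Suc k) m)"

text \<open>The infinite convolution of a hat function with normalised indicator functions of widths \<open>a 0, a 1, \<dots>\<close>
  is smooth: each convolution factor \<open>a j\<close> turns one derivative into a difference quotient with step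
  \<open>a j\<close> and thus costs a factor \<open>2 / a j\<close>, while the support grows by \<open>a j\<close> only.\<close>

lemma bump_exists:
  fixes a :: "nat \<Rightarrow> real"
  assumes pos: "\<And>j. a j > 0" and sm: "summable a" and lt1: "suminf a < 1"
  obtains \<beta> :: "nat \<Rightarrow> real \<Rightarrow> real" where
    "\<And>k t. (\<beta> k has_real_derivative \<beta> (Suc k) t) (at t)"
    "\<And>k t. \<bar>\<beta> k t\<bar> \<le> (\<Prod>j<k. 2 / a j)"
    "\<And>k t. \<bar>t\<bar> > 2 \<Longrightarrow> \<beta> k t = 0"
    "\<And>t. \<beta> 0 t \<ge> 0" "\<beta> 0 0 > 0"
proof -
  let ?T = "iterated_avg a"
  \<comment> \<open>The tail sums control both the growth of the support and the speed of convergence.\<close>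
  define S where "S j = (\<Sum>i. a (i + j))" for j
  have smj: "summable (\<lambda>i. a (i + j))" for j by (rule summable_ignore_initial_segment[OF sm])
  have S: "S j = a j + S (Suc j)" for j
    using suminf_split_head[OF smj[of j]] by (simp add: S_def)
  have S0: "S j \<ge> 0" for j unfolding S_def by (intro suminf_nonneg smj) (simp add: less_imp_le pos)
  have Tcont: "continuous_on UNIV (?T k m)" for k m
  proof (induction m arbitrary: k)
    case 0 then show ?case by (auto intro!: continuous_intros)
  next
    case (Suc m)
    then show ?case using avg_has_derivative[OF pos Suc.IH]
      by (auto intro!: continuous_at_imp_continuous_on DERIV_isCont)
  qed
  have Tb: "0 \<le> ?T k m t \<and> ?T k m t \<le> 1" for k m t
  proof (induction m arbitrary: k t)
    case (Suc m)
    show ?case using avg_bounds[of "a k" "?T (Suc k) m" t 0 1, OF pos Tcont] Suc.IH by simp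
  qed auto
  have Ts: "t \<le> -1 \<or> t \<ge> 1 + S k \<Longrightarrow> ?T k m t = 0" for k m t
  proof (induction m arbitrary: k t)
    case (Suc m)
    have "?T (Suc k) m s = 0" if "s \<in> {t - a k..t}" for s
      using Suc.prems that S[of k] by (intro Suc.IH) auto
    then have "avg (a k) (?T (Suc k) m) t \<ge> 0" "avg (a k) (?T (Suc k) m) t \<le> 0"
      using avg_bounds[OF pos Tcont, where l = 0 and u = 0] by simp_all
    then show ?case by simp
  next
    case 0
    then show ?case using S0[of k] by auto
  qed
  have Td: "\<bar>?T k (Suc m) t - ?T k m t\<bar> \<le> a (m + k)" for k m t
  proof (induction m arbitrary: k t)
    case 0
    let ?v = "\<lambda>t::real. max 0 (1 - \<bar>t\<bar>)"
    have v: "continuous_on UNIV ?v" by (intro continuous_intros)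
    have "\<bar>?v s - ?v t\<bar> \<le> a k" if "s \<in> {t - a k..t}" for s
      using that by auto
    then have "?v t - a k \<le> ?v s" "?v s \<le> ?v t + a k" if "s \<in> {t - a k..t}" for s
      using that by (simp_all add: abs_le_iff algebra_simps)
    then have "?v t - a k \<le> avg (a k) ?v t" "avg (a k) ?v t \<le> ?v t + a k"
      using avg_bounds[of "a k" ?v t "?v t - a k" "?v t + a k", OF pos v] by blast+
    then show ?case by simp
  next
    case (Suc m)
    show ?case
      using avg_diff_bound[OF pos[of k] Tcont[of "Suc k" "Suc m"] Tcont[of "Suc k" m] Suc.IH] by simp
  qed
  define U where "U k t = lim (\<lambda>m. ?T k m t)" for k t
  have tele: "?T k m t = ?T k 0 t + (\<Sum>i<m. ?T k (Suc i) t - ?T k i t)" for k m t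
    using sum_lessThan_telescope[of "\<lambda>i. ?T k i t" m] by simp
  have dsm: "summable (\<lambda>i. ?T k (Suc i) t - ?T k i t)" for k t
    by (rule summable_comparison_test'[OF smj[of k], of 0]) (use Td in auto)
  have lim: "(\<lambda>m. ?T k m t) \<longlonglongrightarrow> U k t" for k t
  proof -
    have "(\<lambda>m. ?T k 0 t + (\<Sum>i<m. ?T k (Suc i) t - ?T k i t)) \<longlonglongrightarrow> ?T k 0 t + (\<Sum>i. ?T k (Suc i) t - ?T k i t)"
      by (intro tendsto_intros summable_LIMSEQ dsm)
    then show ?thesis unfolding U_def tele[symmetric] by (metis limI)
  qed
  have close: "\<bar>U k t - ?T k m t\<bar> \<le> S (m + k)" for k m t
  proof -
    have "\<bar>?T k (n + m) t - ?T k m t\<bar> \<le> S (m + k)" for n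
    proof -
      have "\<bar>?T k (n + m) t - ?T k m t\<bar> \<le> (\<Sum>i<n. a (i + (m + k)))"
      proof (induction n)
        case (Suc n)
        show ?case using Suc Td[of k "n + m" t] by (simp add: add.assoc)
      qed simp
      also have "\<dots> \<le> S (m + k)" unfolding S_def
        by (rule sum_le_suminf[OF smj]) (auto simp: less_imp_le pos)
      finally show ?thesis .
    qed
    moreover have "(\<lambda>n. \<bar>?T k (n + m) t - ?T k m t\<bar>) \<longlonglongrightarrow> \<bar>U k t - ?T k m t\<bar>"
      by (intro tendsto_intros LIMSEQ_ignore_initial_segment lim)
    ultimately show ?thesis by (intro LIMSEQ_le_const2) auto
  qed
  have Slim: "(\<lambda>m. S (m + k)) \<longlonglongrightarrow> 0" for k
    using LIMSEQ_ignore_initial_segment[OF suminf_exist_split2[OF sm], of k] by (simp add: S_def add.commute)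
  have unif: "uniform_limit UNIV (?T k) (U k) sequentially" for k
  proof (rule uniform_limitI)
    fix e :: real assume "e > 0"
    have "\<forall>\<^sub>F m in sequentially. S (m + k) < e" using Slim \<open>e > 0\<close> by (rule order_tendstoD)
    then show "\<forall>\<^sub>F m in sequentially. \<forall>t\<in>UNIV. dist (?T k m t) (U k t) < e"
      by eventually_elim (use close in \<open>fastforce simp: dist_real_def abs_minus_commute intro: le_less_trans\<close>)
  qed
  have Ucont: "continuous_on UNIV (U k)" for k
    by (rule uniform_limit_theorem[OF _ unif]) (auto simp: Tcont)
  have Ub: "0 \<le> U k t" "U k t \<le> 1" for k t
    using LIMSEQ_le_const[OF lim, of 0 k t] LIMSEQ_le_const2[OF lim, of k t 1] Tb by auto
  have Us: "t \<le> -1 \<or> t \<ge> 1 + S k \<Longrightarrow> U k t = 0" for k t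
    using LIMSEQ_unique[OF lim[of k t], of 0] by (simp add: Ts)
  have Uavg: "U k = avg (a k) (U (Suc k))" for k
  proof
    fix t
    have "(\<lambda>m. ?T k (Suc m) t - avg (a k) (U (Suc k)) t) \<longlonglongrightarrow> 0"
    proof (rule Lim_null_comparison[OF always_eventually Slim[of "Suc k"]], rule allI)
      fix m
      have b: "\<bar>?T (Suc k) m s - U (Suc k) s\<bar> \<le> S (m + Suc k)" for s
        using close[of "Suc k" s m] by (simp add: abs_minus_commute)
      show "norm (?T k (Suc m) t - avg (a k) (U (Suc k)) t) \<le> S (m + Suc k)"
        using avg_diff_bound[OF pos[of k] Tcont[of "Suc k" m] Ucont[of "Suc k"] b] by simp
    qed
    then have "(\<lambda>m. ?T k (Suc m) t) \<longlonglongrightarrow> avg (a k) (U (Suc k)) t" by (simp only: LIM_zero_iff)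
    then show "U k t = avg (a k) (U (Suc k)) t"
      using LIMSEQ_unique LIMSEQ_Suc[OF lim[of k t]] by blast
  qed
  \<comment> \<open>\<open>B k j\<close> is the \<open>k\<close>-th derivative of \<open>U j\<close>, the limit that starts with the width \<open>a j\<close>; by
    \<open>Uavg\<close> each derivative is a difference quotient of a derivative of the next limit.\<close>
  define B where "B = rec_nat U (\<lambda>k Bk j t. (Bk (Suc j) t - Bk (Suc j) (t - a j)) / a j)"
  have B0: "B 0 j t = U j t" and BS: "B (Suc k) j t = (B k (Suc j) t - B k (Suc j) (t - a j)) / a j" for k j t
    by (simp_all add: B_def)
  have Bder: "(B k j has_real_derivative B (Suc k) j t) (at t)" for k j t
  proof (induction k arbitrary: j t)
    case 0
    have "(avg (a j) (U (Suc j)) has_real_derivative (U (Suc j) t - U (Suc j) (t - a j)) / a j) (at t)"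
      by (rule avg_has_derivative[OF pos Ucont])
    moreover have "B 0 j = avg (a j) (U (Suc j))" by (simp add: fun_eq_iff B0 Uavg[symmetric])
    ultimately show ?case by (simp add: BS B0)
  next
    case (Suc k)
    have "((\<lambda>t. (B k (Suc j) t - B k (Suc j) (t - a j)) / a j) has_real_derivative
        (B (Suc k) (Suc j) t - B (Suc k) (Suc j) (t - a j)) / a j) (at t)"
      by (intro DERIV_cdivide DERIV_diff Suc.IH DERIV_shift[THEN iffD1, of _ _ _ "-a j", simplified])
    moreover have "B (Suc k) j = (\<lambda>t. (B k (Suc j) t - B k (Suc j) (t - a j)) / a j)"
      by (simp add: fun_eq_iff BS)
    ultimately show ?case by (simp only: BS)
  qed
  have Bb: "\<bar>B k j t\<bar> \<le> (\<Prod>i<k. 2 / a (i + j))" for k j t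
  proof (induction k arbitrary: j t)
    case 0 then show ?case using Ub by (simp add: B0)
  next
    case (Suc k)
    have "\<bar>B (Suc k) j t\<bar> \<le> (\<bar>B k (Suc j) t\<bar> + \<bar>B k (Suc j) (t - a j)\<bar>) / a j"
      using pos[of j] by (simp add: BS divide_right_mono abs_triangle_ineq4)
    also have "\<dots> \<le> ((\<Prod>i<k. 2 / a (i + Suc j)) + (\<Prod>i<k. 2 / a (i + Suc j))) / a j"
      using pos[of j] by (intro divide_right_mono add_mono Suc.IH) auto
    also have "\<dots> = (\<Prod>i<Suc k. 2 / a (i + j))"
      by (subst prod.lessThan_Suc_shift) simp
    finally show ?case .
  qed
  have Bs: "t < -1 \<or> t > 1 + S j \<Longrightarrow> B k j t = 0" for k j t
  proof (induction k arbitrary: j t)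
    case 0 then show ?case using Us by (auto simp: B0)
  next
    case (Suc k)
    have "B k (Suc j) t = 0" "B k (Suc j) (t - a j) = 0"
      using Suc.prems S[of j] pos[of j] S0[of j] by (intro Suc.IH; auto)+
    then show ?case by (simp add: BS)
  qed
  have S1: "S 0 < 1" using lt1 by (simp add: S_def)
  show ?thesis
  proof (rule that[of "\<lambda>k. B k 0"])
    show "(B k 0 has_real_derivative B (Suc k) 0 t) (at t)" for k t by (rule Bder)
    show "\<bar>B k 0 t\<bar> \<le> (\<Prod>j<k. 2 / a j)" for k t using Bb[of k 0 t] by simp
    show "\<bar>t\<bar> > 2 \<Longrightarrow> B k 0 t = 0" for k t using S1 by (intro Bs) auto
    show "B 0 0 t \<ge> 0" for t by (simp add: B0 Ub)
    show "B 0 0 0 > 0" using close[of 0 0 0] S1 by (simp add: B0)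
  qed
qed

section \<open>Uniqueness for Fourier transforms of integrable functions\<close>

text \<open>The image under \<open>P\<close> of the complex measure with density \<open>v\<close> has vanishing Fourier transform. The map
  \<open>P\<close> and the measure are kept general so that the notion covers functions on Euclidean space, on the
  group and, through the counting measure, sequences of frequencies.\<close>

definition fourier_null :: "'m measure \<Rightarrow> ('m \<Rightarrow> 'a::euclidean_space) \<Rightarrow> ('m \<Rightarrow> complex) \<Rightarrow> bool" where
  "fourier_null M P v \<longleftrightarrow> integrable M v \<and> (\<forall>\<omega>. (LINT x|M. v x * cis (\<omega> \<bullet> P x)) = 0)"

lemma integrable_mult_bounded:
  fixes v w :: "'m \<Rightarrow> complex"
  assumes "integrable M v" "w \<in> borel_measurable M" "\<And>x. cmod (w x) \<le> B"
  shows "integrable M (\<lambda>x. v x * w x)"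
proof -
  have [measurable]: "v \<in> borel_measurable M" "w \<in> borel_measurable M" using assms by auto
  have "AE x in M. norm (v x * w x) \<le> norm (B *\<^sub>R v x)"
  proof (rule AE_I2)
    fix x
    have "cmod (w x) \<le> \<bar>B\<bar>" using assms(3)[of x] by linarith
    then have "cmod (v x) * cmod (w x) \<le> cmod (v x) * \<bar>B\<bar>" by (intro mult_left_mono) auto
    then show "norm (v x * w x) \<le> norm (B *\<^sub>R v x)" by (simp add: norm_mult mult.commute)
  qed
  then show ?thesis using assms(1)
    by (intro Bochner_Integration.integrable_bound[of M "\<lambda>x. B *\<^sub>R v x" "\<lambda>x. v x * w x"]) auto
qed

lemma measurable_cis_inner [measurable (raw)]:
  "P \<in> borel_measurable M \<Longrightarrow> (\<lambda>x. cis (\<omega> \<bullet> P x)) \<in> borel_measurable M"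
  by (rule measurable_compose[where N = borel], assumption)
    (intro borel_measurable_continuous_onI continuous_intros)

lemma fourier_null_sin:
  assumes P[measurable]: "P \<in> borel_measurable M" and v: "fourier_null M P v"
  shows "fourier_null M P (\<lambda>x. v x * complex_of_real (sin (\<eta> \<bullet> P x)))"
proof -
  have vi: "integrable M v" and v0: "(LINT x|M. v x * cis (\<omega> \<bullet> P x)) = 0" for \<omega>
    using v by (auto simp: fourier_null_def)
  have i: "integrable M (\<lambda>x. v x * cis (\<omega> \<bullet> P x))" for \<omega>
    by (rule integrable_mult_bounded[OF vi, of _ 1]) auto
  have s: "complex_of_real (sin t) = (cis t - cis (- t)) / (2 * \<i>)" for t
    by (simp add: complex_eq_iff Re_divide Im_divide)
  have "(LINT x|M. v x * complex_of_real (sin (\<eta> \<bullet> P x)) * cis (\<omega> \<bullet> P x))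
      = (LINT x|M. (v x * cis ((\<omega> + \<eta>) \<bullet> P x) - v x * cis ((\<omega> - \<eta>) \<bullet> P x)) / (2 * \<i>))" for \<omega>
  proof (intro Bochner_Integration.integral_cong refl)
    fix x
    have c: "cis ((\<omega> + \<eta>) \<bullet> P x) = cis (\<omega> \<bullet> P x) * cis (\<eta> \<bullet> P x)"
      "cis ((\<omega> - \<eta>) \<bullet> P x) = cis (\<omega> \<bullet> P x) * cis (- (\<eta> \<bullet> P x))"
      unfolding cis_mult by (simp_all add: inner_add_left inner_diff_left)
    show "v x * complex_of_real (sin (\<eta> \<bullet> P x)) * cis (\<omega> \<bullet> P x)
      = (v x * cis ((\<omega> + \<eta>) \<bullet> P x) - v x * cis ((\<omega> - \<eta>) \<bullet> P x)) / (2 * \<i>)"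
      unfolding s c by (simp add: field_simps)
  qed
  also have "\<dots> \<omega> = 0" for \<omega>
    using i v0 by simp
  finally have "(LINT x|M. v x * complex_of_real (sin (\<eta> \<bullet> P x)) * cis (\<omega> \<bullet> P x)) = 0" for \<omega> .
  moreover have "integrable M (\<lambda>x. v x * complex_of_real (sin (\<eta> \<bullet> P x)))"
    by (rule integrable_mult_bounded[OF vi, of _ 1]) (auto simp: norm_of_real)
  ultimately show ?thesis by (simp add: fourier_null_def)
qed

lemma fourier_null_lincomb:
  assumes [measurable]: "P \<in> borel_measurable M" and "fourier_null M P v" "fourier_null M P w"
  shows "fourier_null M P (\<lambda>x. c * v x + d * w x)"
proof -
  have i: "integrable M (\<lambda>x. u x * cis (\<omega> \<bullet> P x))" if "fourier_null M P u" for u \<omega>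
    using that by (intro integrable_mult_bounded[of _ _ _ 1]) (auto simp: fourier_null_def)
  have "(LINT x|M. (c * v x + d * w x) * cis (\<omega> \<bullet> P x)) =
    (LINT x|M. c * (v x * cis (\<omega> \<bullet> P x)) + d * (w x * cis (\<omega> \<bullet> P x)))" for \<omega>
    by (simp add: algebra_simps)
  then show ?thesis
    using assms(2,3) i[OF assms(2)] i[OF assms(3)] by (simp add: fourier_null_def)
qed

lemma fourier_null_sum:
  assumes [measurable]: "P \<in> borel_measurable M" and "finite B" "\<And>b. b \<in> B \<Longrightarrow> fourier_null M P (v b)"
  shows "fourier_null M P (\<lambda>x. \<Sum>b\<in>B. v b x)"
  using assms(2,3)
proof (induction B rule: finite_induct)
  case empty then show ?case by (simp add: fourier_null_def)
next
  case (insert b B)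
  then show ?case using fourier_null_lincomb[OF assms(1), of "v b" "\<lambda>x. \<Sum>b\<in>B. v b x" 1 1] by simp
qed

definition sin_vec :: "real \<Rightarrow> 'a::euclidean_space \<Rightarrow> 'a" where
  "sin_vec L x = (\<Sum>b\<in>Basis. sin (x \<bullet> b / L) *\<^sub>R b)"

text \<open>Multiplication of \<open>v\<close> by a sine of a linear form is a combination of two modulations and keeps the
  Fourier transform zero; iterating gives all polynomials in the bounded functions \<open>sin (x \<bullet> b / L)\<close>.\<close>

lemma fourier_null_polynomial:
  assumes P[measurable]: "P \<in> borel_measurable M" and "real_polynomial_function p"
  shows "fourier_null M P v \<Longrightarrow> fourier_null M P (\<lambda>x. v x * complex_of_real (p (sin_vec L (P x))))"
  using assms(2)
proof (induction p arbitrary: v)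
  case (linear f)
  have "f (sin_vec L y) = (\<Sum>b\<in>Basis. f b * sin ((b /\<^sub>R L) \<bullet> y))" for y
    unfolding sin_vec_def using linear(1)
    by (simp add: linear_sum[OF bounded_linear.linear] linear_scale[OF bounded_linear.linear]
        inner_commute divide_inverse mult.commute)
  then have eq: "(\<lambda>x. v x * complex_of_real (f (sin_vec L (P x))))
      = (\<lambda>x. \<Sum>b\<in>Basis. of_real (f b) * (v x * of_real (sin ((b /\<^sub>R L) \<bullet> P x))))"
    by (simp add: sum_distrib_left algebra_simps del: inner_scaleR_left)
  have fn: "fourier_null M P (\<lambda>x. of_real (f b) * (v x * of_real (sin ((b /\<^sub>R L) \<bullet> P x))))" for b
    using fourier_null_lincomb[OF P fourier_null_sin[OF P linear(2), of "b /\<^sub>R L"]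
       fourier_null_sin[OF P linear(2), of "b /\<^sub>R L"], of "of_real (f b)" 0] by simp
  show ?case unfolding eq by (rule fourier_null_sum[OF P finite_Basis]) (rule fn)
next
  case (const c)
  then show ?case using fourier_null_lincomb[OF P const const, of c 0] by (simp add: mult.commute)
next
  case (add f g)
  show ?case
    using fourier_null_lincomb[OF P add.IH(1)[OF add.prems] add.IH(2)[OF add.prems], of 1 1]
    by (simp add: distrib_left)
next
  case (mult f g)
  show ?case using mult.IH(2)[OF mult.IH(1)[OF mult.prems]] by (simp add: mult.assoc)
qed

lemma n_sin_tendsto: "(\<lambda>n. real (Suc n) * sin (t / real (Suc n))) \<longlonglongrightarrow> t"
proof -
  have "((\<lambda>h. sin (t * h)) has_real_derivative t) (at 0)"
    by (auto intro!: derivative_eq_intros)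
  then have "((\<lambda>h. sin (t * h) / h) \<longlongrightarrow> t) (at 0)"
    by (simp add: DERIV_def)
  moreover have "filterlim (\<lambda>n. inverse (real (Suc n))) (at 0) sequentially"
    using LIMSEQ_inverse_real_of_nat by (auto simp: filterlim_at)
  ultimately have "(\<lambda>n. sin (t * inverse (real (Suc n))) / inverse (real (Suc n))) \<longlonglongrightarrow> t"
    by (rule filterlim_compose)
  then show ?thesis by (simp add: divide_inverse mult.commute)
qed

text \<open>A complex measure with vanishing Fourier transform annihilates every bounded continuous function:
  by the theorem of Stone and Weierstrass it annihilates continuous functions of the sines of
  \<open>x \<bullet> b / L\<close>, and \<open>L * sin (t / L)\<close> tends to \<open>t\<close> as \<open>L\<close> grows.\<close>

theorem fourier_null_bounded_continuous:
  fixes F :: "'a::euclidean_space \<Rightarrow> real"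
  assumes P[measurable]: "P \<in> borel_measurable M" and v: "fourier_null M P v"
    and F: "continuous_on UNIV F" and B: "\<And>y. \<bar>F y\<bar> \<le> B"
  shows "(LINT x|M. v x * complex_of_real (F (P x))) = 0"
proof -
  have vi: "integrable M v" using v by (simp add: fourier_null_def)
  have [measurable]: "v \<in> borel_measurable M" using vi by auto
  have [measurable]: "F \<in> borel_measurable borel" using F by (rule borel_measurable_continuous_onI)
  have contS: "continuous_on UNIV (sin_vec L :: 'a \<Rightarrow> 'a)" for L
    unfolding sin_vec_def divide_inverse by (intro continuous_intros)
  then have [measurable]: "sin_vec L \<in> borel_measurable (borel :: 'a measure)" for L
    by (rule borel_measurable_continuous_onI)
  have Sbox: "sin_vec L y \<in> cbox (- One) One" for L and y :: 'a
    by (auto simp: mem_box sin_vec_def inner_sum_left_Basis inner_diff_left)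
  have zero: "(LINT x|M. v x * complex_of_real (F (L *\<^sub>R sin_vec L (P x)))) = 0" for L
  proof -
    let ?I = "LINT x|M. v x * complex_of_real (F (L *\<^sub>R sin_vec L (P x)))"
    have "cmod ?I \<le> e * (LINT x|M. cmod (v x))" if e: "e > 0" for e
    proof -
      have "continuous_on (cbox (- One) One) (\<lambda>y. F (L *\<^sub>R y))"
        by (intro continuous_on_compose2[OF F] continuous_intros) auto
      then obtain p where p: "real_polynomial_function p" "\<And>y. y \<in> cbox (- One) One \<Longrightarrow> \<bar>F (L *\<^sub>R y) - p y\<bar> < e"
        using Stone_Weierstrass_real_polynomial_function[OF compact_cbox _ e] by metis
      have [measurable]: "p \<in> borel_measurable borel"
        using continuous_real_polymonial_function[OF p(1)]
        by (intro borel_measurable_continuous_onI) (auto simp: continuous_at_imp_continuous_on)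
      have np: "fourier_null M P (\<lambda>x. v x * complex_of_real (p (sin_vec L (P x))))"
        by (rule fourier_null_polynomial[OF P p(1) v])
      then have ip: "integrable M (\<lambda>x. v x * complex_of_real (p (sin_vec L (P x))))"
        and zp: "(LINT x|M. v x * complex_of_real (p (sin_vec L (P x)))) = 0"
        unfolding fourier_null_def by (auto dest: spec[of _ 0])
      have iF: "integrable M (\<lambda>x. v x * complex_of_real (F (L *\<^sub>R sin_vec L (P x))))"
        by (rule integrable_mult_bounded[OF vi, of _ B]) (auto simp: B)
      have "?I = (LINT x|M. v x * complex_of_real (F (L *\<^sub>R sin_vec L (P x)) - p (sin_vec L (P x))))"
        using ip iF zp by (simp add: right_diff_distrib)
      also have "cmod \<dots> \<le> (LINT x|M. cmod (v x * complex_of_real (F (L *\<^sub>R sin_vec L (P x)) - p (sin_vec L (P x)))))"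
        by (rule integral_norm_bound)
      also have "\<dots> \<le> (LINT x|M. e * cmod (v x))"
      proof (rule integral_mono)
        show "integrable M (\<lambda>x. cmod (v x * complex_of_real (F (L *\<^sub>R sin_vec L (P x)) - p (sin_vec L (P x)))))"
          using ip iF by (intro integrable_norm) (simp add: right_diff_distrib)
        fix x
        have "\<bar>F (L *\<^sub>R sin_vec L (P x)) - p (sin_vec L (P x))\<bar> \<le> e"
          using p(2)[OF Sbox] less_imp_le by blast
        then show "cmod (v x * complex_of_real (F (L *\<^sub>R sin_vec L (P x)) - p (sin_vec L (P x)))) \<le> e * cmod (v x)"
          unfolding norm_mult norm_of_real by (subst mult.commute) (intro mult_right_mono, auto)
      qed (use vi in auto)
      finally show ?thesis by simp
    qed
    note le = this
    show ?thesis
    proof (rule ccontr)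
      assume "?I \<noteq> 0"
      then have pos: "cmod ?I > 0" by simp
      define K where "K = (LINT x|M. cmod (v x))"
      have "K \<ge> 0" by (simp add: K_def)
      have "cmod ?I / (2 * (K + 1)) > 0" using pos \<open>K \<ge> 0\<close> by (intro divide_pos_pos) auto
      from le[OF this] have "cmod ?I \<le> cmod ?I / (2 * (K + 1)) * K" by (simp only: K_def)
      also have "\<dots> = cmod ?I * (K / (2 * (K + 1)))" by simp
      also have "\<dots> < cmod ?I * 1" using pos \<open>K \<ge> 0\<close> by (intro mult_strict_left_mono) (auto simp: field_simps)
      finally show False by simp
    qed
  qed
  have "(\<lambda>n. LINT x|M. v x * complex_of_real (F (real (Suc n) *\<^sub>R sin_vec (real (Suc n)) (P x))))
     \<longlonglongrightarrow> (LINT x|M. v x * complex_of_real (F (P x)))"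
  proof (rule integral_dominated_convergence[where w = "\<lambda>x. B * cmod (v x)"])
    show "AE x in M. (\<lambda>n. v x * complex_of_real (F (real (Suc n) *\<^sub>R sin_vec (real (Suc n)) (P x))))
       \<longlonglongrightarrow> v x * complex_of_real (F (P x))"
    proof (rule AE_I2)
      fix x
      have "(\<lambda>n. \<Sum>b\<in>Basis. (real (Suc n) * sin (P x \<bullet> b / real (Suc n))) *\<^sub>R b) \<longlonglongrightarrow> (\<Sum>b\<in>Basis. (P x \<bullet> b) *\<^sub>R b)"
        by (intro tendsto_intros n_sin_tendsto)
      then have "(\<lambda>n. real (Suc n) *\<^sub>R sin_vec (real (Suc n)) (P x)) \<longlonglongrightarrow> P x"
        by (simp add: sin_vec_def scaleR_sum_right euclidean_representation)
      moreover have "isCont F (P x)" using F by (simp add: continuous_on_eq_continuous_at)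
      ultimately show "(\<lambda>n. v x * complex_of_real (F (real (Suc n) *\<^sub>R sin_vec (real (Suc n)) (P x))))
        \<longlonglongrightarrow> v x * complex_of_real (F (P x))"
        by (intro tendsto_intros) (rule isCont_tendsto_compose)
    qed
    show "AE x in M. cmod (v x * complex_of_real (F (real (Suc n) *\<^sub>R sin_vec (real (Suc n)) (P x)))) \<le> B * cmod (v x)" for n
      unfolding norm_mult norm_of_real by (rule AE_I2, subst mult.commute) (intro mult_right_mono B norm_ge_zero)
  qed (use vi in auto)
  then show ?thesis unfolding zero by (simp add: LIMSEQ_const_iff)
qed

text \<open>The bounded continuous functions \<open>max 0 (1 - n * infdist x C)\<close> decrease to the indicator function of
  a closed set \<open>C\<close>, and the closed sets generate the Borel sets.\<close>

lemma AE_zero_if_integrals_zero: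
  fixes u :: "'a::euclidean_space \<Rightarrow> complex"
  assumes u: "integrable lborel u"
    and zero: "\<And>F B. continuous_on UNIV F \<Longrightarrow> (\<And>y. \<bar>F y\<bar> \<le> B) \<Longrightarrow> (LINT x|lborel. u x * complex_of_real (F x)) = 0"
  shows "AE x in lborel. u x = 0"
proof -
  have [measurable]: "u \<in> borel_measurable borel" using u by auto
  have iA: "integrable lborel (\<lambda>x. u x * indicator A x)" if "A \<in> sets borel" for A
    using that by (intro integrable_mult_bounded[OF u, of _ 1]) (auto simp: indicator_def)
  have z1: "(LINT x|lborel. u x) = 0"
    using zero[of "\<lambda>_. 1" 1] by simp
  have sets_eq: "sets (borel :: 'a measure) = sigma_sets UNIV {S. closed S}"
    by (simp add: borel_eq_closed)
  have Borel: "(LINT x|lborel. u x * indicator A x) = 0" if "A \<in> sigma_sets UNIV {S. closed S}" for A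
  proof (rule sigma_sets_induct_disjoint[OF _ _ that])
    show "Int_stable {S :: 'a set. closed S}" by (auto simp: Int_stable_def)
    show "{S :: 'a set. closed S} \<subseteq> Pow UNIV" by simp
    show "(LINT x|lborel. u x * indicator {} x) = 0" by simp
    show "(LINT x|lborel. u x * indicator (UNIV - A) x) = 0"
      if A: "A \<in> sigma_sets UNIV {S. closed S}" "(LINT x|lborel. u x * indicator A x) = 0" for A
    proof -
      have "(LINT x|lborel. u x * indicator (UNIV - A) x) = (LINT x|lborel. u x - u x * indicator A x)"
        by (intro Bochner_Integration.integral_cong) (auto simp: indicator_def)
      then show ?thesis using u iA[of A] A z1 by (simp add: sets_eq)
    qed
    show "(LINT x|lborel. u x * indicator C x) = 0" if C: "C \<in> {S. closed S}" for C :: "'a set"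
    proof (cases "C = {}")
      case False
      define F where "F n x = max 0 (1 - real n * infdist x C)" for n x
      have Fc: "continuous_on UNIV (F n)" for n unfolding F_def by (intro continuous_intros)
      have [measurable]: "F n \<in> borel_measurable borel" for n using Fc by (rule borel_measurable_continuous_onI)
      have Fb: "\<bar>F n y\<bar> \<le> 1" for n y by (auto simp: F_def infdist_nonneg)
      have "(\<lambda>n. LINT x|lborel. u x * complex_of_real (F n x)) \<longlonglongrightarrow> (LINT x|lborel. u x * indicator C x)"
      proof (rule integral_dominated_convergence[where w = "\<lambda>x. cmod (u x)"])
        show "AE x in lborel. (\<lambda>n. u x * complex_of_real (F n x)) \<longlonglongrightarrow> u x * indicator C x"
        proof (rule AE_I2)
          fix x
          have "(\<lambda>n. F n x) \<longlonglongrightarrow> indicator C x"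
          proof (cases "x \<in> C")
            case True
            then show ?thesis by (simp add: F_def)
          next
            case False
            then have "infdist x C > 0" using C \<open>C \<noteq> {}\<close> in_closed_iff_infdist_zero[of C x] infdist_nonneg[of x C]
              by (auto simp: less_le)
            then obtain N where N: "real N * infdist x C > 1" using reals_Archimedean3 by metis
            have "F n x = 0" if "n \<ge> N" for n
            proof -
              have "real N * infdist x C \<le> real n * infdist x C"
                using that \<open>infdist x C > 0\<close> by (intro mult_right_mono) auto
              then show ?thesis using N by (simp add: F_def)
            qed
            then have "eventually (\<lambda>n. F n x = 0) sequentially" by (auto simp: eventually_sequentially)
            then show ?thesis using False by (simp add: tendsto_eventually)
          qed
          then have "(\<lambda>n. u x * complex_of_real (F n x)) \<longlonglongrightarrow> u x * complex_of_real (indicator C x)"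
            by (intro tendsto_intros)
          then show "(\<lambda>n. u x * complex_of_real (F n x)) \<longlonglongrightarrow> u x * indicator C x"
            by (simp add: of_real_indicator)
        qed
        show "AE x in lborel. norm (u x * complex_of_real (F n x)) \<le> cmod (u x)" for n
          using Fb by (auto simp: norm_mult intro!: mult_left_le)
      qed (use u C in \<open>auto simp: borel_closed\<close>)
      then show ?thesis using zero[OF Fc Fb] by (simp add: LIMSEQ_const_iff)
    qed simp
    show "(LINT x|lborel. u x * indicator (\<Union>i. A i) x) = 0"
      if A: "disjoint_family A" "range A \<subseteq> sigma_sets UNIV {S. closed S}"
        "\<And>i. (LINT x|lborel. u x * indicator (A i) x) = 0" for A :: "nat \<Rightarrow> 'a set"
    proof -
      have mA [measurable]: "A i \<in> sets borel" for i using A(2) by (auto simp: sets_eq)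
      have "(\<lambda>n. LINT x|lborel. u x * (\<Sum>i<n. indicator (A i) x)) \<longlonglongrightarrow> (LINT x|lborel. u x * indicator (\<Union>i. A i) x)"
      proof (rule integral_dominated_convergence[where w = "\<lambda>x. cmod (u x)"])
        have s: "(\<Sum>i<n. indicator (A i) x) = (indicator (\<Union>i<n. A i) x :: complex)" for n x
          using A(1) by (intro indicator_UN_disjoint[symmetric])
            (auto simp: disjoint_family_on_def)
        show "AE x in lborel. (\<lambda>n. u x * (\<Sum>i<n. indicator (A i) x)) \<longlonglongrightarrow> u x * indicator (\<Union>i. A i) x"
          unfolding s by (intro AE_I2 tendsto_intros LIMSEQ_indicator_UN)
        show "AE x in lborel. norm (u x * (\<Sum>i<n. indicator (A i) x)) \<le> cmod (u x)" for n
          unfolding s by (auto simp: norm_mult indicator_def)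
      qed (use u in auto)
      moreover have "(LINT x|lborel. u x * (\<Sum>i<n. indicator (A i) x)) = 0" for n
        unfolding sum_distrib_left using iA[OF mA] A(3) by (subst Bochner_Integration.integral_sum) auto
      ultimately show ?thesis by (simp add: LIMSEQ_const_iff)
    qed
  qed
  have key: "AE x in lborel. \<not> T (u x) > 0" if T: "bounded_linear T" for T :: "complex \<Rightarrow> real"
  proof -
    have [measurable]: "T \<in> borel_measurable borel"
      using T by (intro borel_measurable_continuous_onI linear_continuous_on)
    let ?A = "{x. T (u x) > 0}"
    have A: "?A \<in> sets borel" by measurable
    have i: "integrable lborel (\<lambda>x. T (u x * indicator ?A x))"
      using integrable_bounded_linear[OF T iA[OF A]] .
    have "(LINT x|lborel. T (u x * indicator ?A x)) = T (LINT x|lborel. u x * indicator ?A x)"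
      by (rule integral_bounded_linear[OF T iA[OF A]])
    also have "\<dots> = 0" using Borel[of ?A] A T by (simp add: sets_eq linear_0[OF bounded_linear.linear])
    finally have "AE x in lborel. T (u x * indicator ?A x) = 0"
      using i T by (subst (asm) integral_nonneg_eq_0_iff_AE) (auto simp: indicator_def linear_0[OF bounded_linear.linear])
    then show ?thesis by (rule AE_mp) (auto simp: indicator_def)
  qed
  have "bounded_linear (\<lambda>z. - Re z)" "bounded_linear (\<lambda>z. - Im z)"
    by (intro bounded_linear_minus bounded_linear_Re bounded_linear_Im)+
  with key[OF bounded_linear_Re] key[OF bounded_linear_Im] key[of "\<lambda>z. - Re z"] key[of "\<lambda>z. - Im z"]
  show ?thesis by (auto simp: complex_eq_iff elim!: eventually_elim2 AE_mp)
qed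

section \<open>Polynomials times Gaussians in one variable\<close>

text \<open>The exponent is chosen so that the constant polynomial gives the ground state of the Hermite operator.\<close>

definition pg :: "real \<Rightarrow> real poly \<Rightarrow> real \<Rightarrow> real" where
  "pg a p t = poly p t * exp (- a * t\<^sup>2 / 2)"

lemma pg_add: "pg a (p + q) t = pg a p t + pg a q t"
  and pg_smult: "pg a (smult c p) t = c * pg a p t"
  and pg_X: "pg a ([:0, 1:] * p) t = t * pg a p t"
  by (simp_all add: pg_def algebra_simps)

lemma pg_mult: "pg a p t * pg b q t = pg (a + b) (p * q) t"
  by (simp add: pg_def exp_add[symmetric] algebra_simps add_divide_distrib diff_divide_distrib
      mult_exp_exp)

lemma pg_bounded: "a > 0 \<Longrightarrow> \<exists>C. \<forall>t. \<bar>pg a p t\<bar> \<le> C"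
proof (induction p arbitrary: a)
  case 0
  then show ?case by (auto simp: pg_def)
next
  case (pCons c p)
  obtain C where C: "\<And>t. \<bar>pg (a/2) p t\<bar> \<le> C" using pCons.IH[of "a/2"] pCons.prems by auto
  have C0: "C \<ge> 0" using C[of 0] by linarith
  have te: "\<bar>t\<bar> * exp (- (a/2) * t\<^sup>2 / 2) \<le> 1 + 4 / a" for t
  proof -
    have "\<bar>t\<bar> \<le> 1 + t\<^sup>2"
    proof (cases "\<bar>t\<bar> \<le> 1")
      case False
      then have "\<bar>t\<bar> * 1 \<le> \<bar>t\<bar> * \<bar>t\<bar>" by (intro mult_left_mono) auto
      then show ?thesis by (simp add: power2_eq_square)
    qed (simp add: add_increasing2)
    also have "\<dots> \<le> (1 + 4 / a) * (1 + a * t\<^sup>2 / 4)"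
      using pCons.prems by (simp add: field_simps)
    also have "\<dots> \<le> (1 + 4 / a) * exp (a * t\<^sup>2 / 4)"
      using pCons.prems by (intro mult_left_mono exp_ge_add_one_self) auto
    finally have "\<bar>t\<bar> * exp (- (a * t\<^sup>2 / 4)) \<le> (1 + 4 / a) * exp (a * t\<^sup>2 / 4) * exp (- (a * t\<^sup>2 / 4))"
      by (rule mult_right_mono) simp
    also have "\<dots> = 1 + 4 / a" by (simp add: mult.assoc exp_add[symmetric] mult_exp_exp)
    finally show ?thesis by simp
  qed
  have "\<bar>pg a (pCons c p) t\<bar> \<le> \<bar>c\<bar> + (1 + 4 / a) * C" for t
  proof -
    have e: "exp (- a * t\<^sup>2 / 2) = exp (- (a/2) * t\<^sup>2 / 2) * exp (- (a/2) * t\<^sup>2 / 2)"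
      by (simp add: mult_exp_exp)
    have "pg a (pCons c p) t = c * exp (- a * t\<^sup>2 / 2) + (t * exp (- (a/2) * t\<^sup>2 / 2)) * pg (a/2) p t"
      unfolding pg_def e by (simp add: algebra_simps)
    also have "\<bar>\<dots>\<bar> \<le> \<bar>c * exp (- a * t\<^sup>2 / 2)\<bar> + \<bar>(t * exp (- (a/2) * t\<^sup>2 / 2)) * pg (a/2) p t\<bar>"
      by (rule abs_triangle_ineq)
    also have "\<dots> \<le> \<bar>c\<bar> * 1 + (1 + 4 / a) * C"
      unfolding abs_mult using te[of t] C[of t] pCons.prems
      by (intro add_mono mult_left_mono mult_mono) auto
    finally show ?thesis by simp
  qed
  then show ?case by blast
qed

lemma integrable_inverse_square_plus_one: "integrable lborel (\<lambda>t::real. 1 / (1 + t\<^sup>2))"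
proof -
  let ?f = "\<lambda>t::real. 1 / (1 + t\<^sup>2)"
  have half: "(\<integral>\<^sup>+t. ennreal (?f t) * indicator {0..} t \<partial>lborel) = ennreal (pi / 2 - arctan 0)"
    by (rule nn_integral_FTC_atLeast)
      (auto intro!: derivative_eq_intros tendsto_arctan_at_top simp: add_nonneg_eq_0_iff field_simps)
  have "(\<integral>\<^sup>+t. ennreal (?f t) * indicator {..0} t \<partial>lborel)
      = (\<integral>\<^sup>+t. ennreal (?f t) * indicator {0..} t \<partial>lborel)"
    by (subst nn_integral_real_affine[where c = "-1" and t = 0]) (auto simp: indicator_def intro!: nn_integral_cong)
  moreover have "(\<integral>\<^sup>+t. ennreal (?f t) \<partial>lborel)
     \<le> (\<integral>\<^sup>+t. ennreal (?f t) * indicator {0..} t + ennreal (?f t) * indicator {..0} t \<partial>lborel)"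
    by (intro nn_integral_mono) (auto simp: indicator_def)
  then have "(\<integral>\<^sup>+t. ennreal (?f t) \<partial>lborel)
     \<le> (\<integral>\<^sup>+t. ennreal (?f t) * indicator {0..} t \<partial>lborel) + (\<integral>\<^sup>+t. ennreal (?f t) * indicator {..0} t \<partial>lborel)"
    by (subst (asm) nn_integral_add) auto
  ultimately have "(\<integral>\<^sup>+t. ennreal (?f t) \<partial>lborel) < \<infinity>" by (simp add: half le_less_trans flip: ennreal_plus)
  then show ?thesis by (intro integrableI_bounded) auto
qed

lemma continuous_pg: "continuous_on UNIV (pg a p)"
  unfolding pg_def[abs_def] by (intro continuous_intros) auto

lemma measurable_pg [measurable]: "pg a p \<in> borel_measurable borel"
  by (rule borel_measurable_continuous_onI[OF continuous_pg])

lemma integrable_pg: assumes "a > 0" shows "integrable lborel (pg a p)"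
proof -
  obtain C where C: "\<And>t. \<bar>pg a ([:1, 0, 1:] * p) t\<bar> \<le> C" using pg_bounded[OF assms] by blast
  have C0: "C \<ge> 0" using C[of 0] by linarith
  have "\<bar>pg a p t\<bar> \<le> \<bar>C * (1 / (1 + t\<^sup>2))\<bar>" for t
  proof -
    have p: "1 + t\<^sup>2 > 0" by (simp add: add_pos_nonneg)
    have "pg a ([:1, 0, 1:] * p) t = (1 + t\<^sup>2) * pg a p t" by (simp add: pg_def power2_eq_square algebra_simps)
    then have "(1 + t\<^sup>2) * \<bar>pg a p t\<bar> \<le> C" using C[of t] p by (simp add: abs_mult)
    then show ?thesis using p C0 by (simp add: field_simps)
  qed
  then show ?thesis
    by (intro Bochner_Integration.integrable_bound[OF integrable_mult_right[OF integrable_inverse_square_plus_one, of C]])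
      auto
qed

text \<open>The polynomial part of the derivative of \<open>pg a p\<close>.\<close>

definition pgD :: "real \<Rightarrow> real poly \<Rightarrow> real poly" where
  "pgD a p = pderiv p - [:0, a:] * p"

lemma pg_has_derivative: "(pg a p has_real_derivative pg a (pgD a p) t) (at t)"
  unfolding pg_def[abs_def] pgD_def
  by (rule derivative_eq_intros poly_DERIV refl | simp)+ (simp add: algebra_simps)

lemma pg_has_vector_derivative:
  "((\<lambda>t. complex_of_real (pg a p t)) has_vector_derivative complex_of_real (pg a (pgD a p) t)) (at t)"
  using pg_has_derivative by (intro has_vector_derivative_of_real) (simp add: has_real_derivative_iff_has_vector_derivative)

lemma integral_pgD: assumes "a > 0" shows "(LINT t|lborel. pg a (pgD a p) t) = 0"
proof -
  let ?F = "\<lambda>t. complex_of_real (pg a p t)"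
  have d: "(?F has_derivative (\<lambda>h. h *\<^sub>R complex_of_real (pg a (pgD a p) t))) (at t)" for t
    using pg_has_vector_derivative[of a p t] by (simp add: has_vector_derivative_def)
  have "dd 1 ?F t = complex_of_real (pg a (pgD a p) t)" for t
    using dd_eqI[OF d, of 1 t] by simp
  then have dF: "dd 1 ?F = (\<lambda>t. complex_of_real (pg a (pgD a p) t))" by blast
  have "(LINT t|lborel. dd 1 ?F t) = 0"
  proof (rule integral_dd_eq_0)
    show "?F differentiable (at x)" for x using d by (auto simp: differentiable_def)
    show "continuous_on UNIV (dd 1 ?F)" unfolding dF by (intro continuous_on_of_real continuous_pg)
    show "integrable lborel ?F" using integrable_pg[OF assms] by simp
    show "integrable lborel (dd 1 ?F)" unfolding dF using integrable_pg[OF assms] by simp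
  qed
  then show ?thesis by (simp add: dF)
qed

section \<open>Hermite functions\<close>

text \<open>The physicists' Hermite polynomials, rescaled to the weight \<open>exp (- a * t\<^sup>2)\<close>.\<close>

fun hq :: "real \<Rightarrow> nat \<Rightarrow> real poly" where
  "hq a 0 = 1"
| "hq a (Suc k) = [:0, 2 * a:] * hq a k - pderiv (hq a k)"

lemma pderiv_hq: "pderiv (hq a (Suc k)) = smult (2 * a * real (Suc k)) (hq a k)"
proof (induction k)
  case 0
  then show ?case by (simp add: pderiv_mult pderiv_pCons)
next
  case (Suc k)
  have "pderiv (hq a (Suc (Suc k))) = smult (2 * a) (hq a (Suc k)) + [:0, 2 * a:] * pderiv (hq a (Suc k))
      - pderiv (pderiv (hq a (Suc k)))"
    by (subst hq.simps(2)) (simp only: pderiv_diff pderiv_mult, simp add: pderiv_pCons)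
  also have "\<dots> = smult (2 * a) (hq a (Suc k)) + smult (2 * a * real (Suc k)) ([:0, 2 * a:] * hq a k - pderiv (hq a k))"
    unfolding Suc.IH by (simp add: pderiv_smult smult_diff_right del: hq.simps)
  also have "[:0, 2 * a:] * hq a k - pderiv (hq a k) = hq a (Suc k)" by simp
  finally show ?case by (simp add: smult_add_left[symmetric] algebra_simps del: hq.simps)
qed

lemma hq_nonzero: "a > 0 \<Longrightarrow> hq a k \<noteq> 0"
proof (induction k)
  case (Suc k)
  then have "pderiv (hq a (Suc k)) \<noteq> 0" unfolding pderiv_hq by simp
  then show ?case by fastforce
qed simp

lemma hq_ode: "pderiv (pderiv (hq a k)) = [:0, 2 * a:] * pderiv (hq a k) - smult (2 * a * real k) (hq a k)"
proof -
  have "pderiv (hq a (Suc k)) = smult (2 * a) (hq a k) + [:0, 2 * a:] * pderiv (hq a k) - pderiv (pderiv (hq a k))"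
    by (simp add: pderiv_diff pderiv_mult pderiv_pCons pderiv_smult)
  then show ?thesis unfolding pderiv_hq by (simp add: algebra_simps smult_add_left)
qed

lemma hq_recurrence: "a > 0 \<Longrightarrow> [:0, 1:] * hq a k = smult (1 / (2 * a)) (hq a (Suc k)) + smult (real k) (hq a (k - 1))"
proof -
  assume a: "a > 0"
  have "pderiv (hq a k) = smult (2 * a * real k) (hq a (k - 1))"
    using pderiv_hq[of a "k - 1"] by (cases k) (auto simp del: hq.simps(2))
  then have "hq a (Suc k) = smult (2 * a) ([:0, 1:] * hq a k) - smult (2 * a * real k) (hq a (k - 1))" by simp
  then show ?thesis using a by (simp add: smult_diff_right del: hq.simps)
qed

text \<open>By the differential equation, the product of two of the polynomials times the weight is, up to the
  factor given by the difference of the eigenvalues, the derivative of their Wronskian times the weight.\<close>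

lemma hq_orthogonal:
  assumes "a > 0" "j \<noteq> k" shows "(LINT t|lborel. pg (2 * a) (hq a j * hq a k) t) = 0"
proof -
  let ?r = "pderiv (hq a j) * hq a k - hq a j * pderiv (hq a k)"
  have "pgD (2 * a) ?r = smult (2 * a * (real k - real j)) (hq a j * hq a k)"
    unfolding pgD_def pderiv_diff pderiv_mult hq_ode
    by (simp add: algebra_simps smult_diff_left)
  then have "(LINT t|lborel. 2 * a * (real k - real j) * pg (2 * a) (hq a j * hq a k) t) = 0"
    using integral_pgD[of "2 * a" ?r] assms by (simp add: pg_smult)
  then show ?thesis using assms by simp
qed

lemma hq_norm_pos:
  assumes "a > 0" shows "(LINT t|lborel. pg (2 * a) (hq a k * hq a k) t) > 0"
proof -
  have nn: "pg (2 * a) (hq a k * hq a k) t \<ge> 0" for t by (simp add: pg_def)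
  have "(LINT t|lborel. pg (2 * a) (hq a k * hq a k) t) \<noteq> 0"
  proof
    assume "(LINT t|lborel. pg (2 * a) (hq a k * hq a k) t) = 0"
    then have "AE t in lborel. pg (2 * a) (hq a k * hq a k) t = 0"
      using integrable_pg[of "2 * a"] assms nn by (subst (asm) integral_nonneg_eq_0_iff_AE) auto
    moreover have "{t. poly (hq a k) t = 0} \<in> null_sets lborel"
      using poly_roots_finite[OF hq_nonzero[OF assms]] by (rule finite_imp_null_set_lborel)
    then have "AE t in lborel. t \<notin> {t. poly (hq a k) t = 0}" by (rule AE_not_in)
    ultimately have "AE t in (lborel :: real measure). False"
      by eventually_elim (auto simp: pg_def)
    then show False by (simp add: AE_iff_null null_sets_def)
  qed
  moreover have "(LINT t|lborel. pg (2 * a) (hq a k * hq a k) t) \<ge> 0" using nn by simp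
  ultimately show ?thesis by simp
qed

text \<open>The polynomials normalised so that \<open>pg a (hp a k)\<close> are orthonormal.\<close>

definition hp :: "real \<Rightarrow> nat \<Rightarrow> real poly" where
  "hp a k = smult (1 / sqrt (LINT t|lborel. pg (2 * a) (hq a k * hq a k) t)) (hq a k)"

lemma hp_orthonormal:
  assumes "a > 0" shows "(LINT t|lborel. pg a (hp a j) t * pg a (hp a k) t) = (if j = k then 1 else 0)"
proof -
  let ?c = "\<lambda>k. 1 / sqrt (LINT t|lborel. pg (2 * a) (hq a k * hq a k) t)"
  have "pg a (hp a j) t * pg a (hp a k) t = ?c j * ?c k * pg (2 * a) (hq a j * hq a k) t" for t
    unfolding pg_mult by (simp add: hp_def pg_smult)
  then have "(LINT t|lborel. pg a (hp a j) t * pg a (hp a k) t) = ?c j * ?c k * (LINT t|lborel. pg (2 * a) (hq a j * hq a k) t)"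
    by simp
  then show ?thesis using hq_orthogonal[OF assms, of j k] hq_norm_pos[OF assms, of k] by auto
qed

lemma hp_ode: "- pg a (pgD a (pgD a (hp a k))) t + a\<^sup>2 * t\<^sup>2 * pg a (hp a k) t = (2 * real k + 1) * a * pg a (hp a k) t"
proof -
  have two: "2 * p = smult 2 p" for p :: "real poly"
    by (metis mult_2 one_add_one smult_1_left smult_add_left)
  have "pgD a (pgD a (hq a k)) = [:0, 0, a\<^sup>2:] * hq a k - smult ((2 * real k + 1) * a) (hq a k)"
    unfolding pgD_def pderiv_diff pderiv_mult hq_ode
    by (simp add: pderiv_pCons algebra_simps smult_add_left power2_eq_square two)
  moreover have "pgD a (smult c p) = smult c (pgD a p)" for c p
    by (simp add: pgD_def pderiv_smult smult_diff_right)
  ultimately have D2: "pgD a (pgD a (hp a k)) = [:0, 0, a\<^sup>2:] * hp a k - smult ((2 * real k + 1) * a) (hp a k)"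
    by (simp add: hp_def smult_diff_right mult.commute)
  show ?thesis
    unfolding D2 by (simp add: pg_def power2_eq_square algebra_simps)
qed

lemma hp_recurrence:
  assumes "a > 0" shows "\<exists>c d. [:0, 1:] * hp a k = smult c (hp a (Suc k)) + smult d (hp a (k - 1))"
proof -
  let ?s = "\<lambda>k. sqrt (LINT t|lborel. pg (2 * a) (hq a k * hq a k) t)"
  have s: "?s k \<noteq> 0" for k using hq_norm_pos[OF assms, of k] by simp
  have h: "hq a k = smult (?s k) (hp a k)" for k using s[of k] by (simp add: hp_def)
  have "[:0, 1:] * hp a k = smult (1 / ?s k) ([:0, 1:] * hq a k)" by (simp add: hp_def)
  also have "\<dots> = smult (1 / ?s k * (1 / (2 * a)) * ?s (Suc k)) (hp a (Suc k)) + smult (1 / ?s k * real k * ?s (k - 1)) (hp a (k - 1))"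
    unfolding hq_recurrence[OF assms] by (subst (2) h, subst (3) h) (simp add: smult_add_right)
  finally show ?thesis by blast
qed

section \<open>The Hermite basis of the space of square integrable functions\<close>

lemma prodfun_mult: "prodfun g x * prodfun h x = prodfun (\<lambda>b t. g b t * h b t) x"
  by (simp add: prodfun_def prod.distrib)

lemma cmod_prodfun: "complex_of_real (cmod (prodfun g x)) = prodfun (\<lambda>b t. complex_of_real (cmod (g b t))) x"
  by (simp add: prodfun_def prod_norm[symmetric])

lemma prodfun_L2:
  fixes g :: "real ^ 'n::finite \<Rightarrow> real \<Rightarrow> complex"
  assumes "\<And>b. b \<in> Basis \<Longrightarrow> continuous_on UNIV (g b)"
    and "\<And>b. b \<in> Basis \<Longrightarrow> integrable lborel (\<lambda>t. (cmod (g b t))\<^sup>2)"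
  shows "prodfun g \<in> L2"
proof -
  have "(cmod (prodfun g x))\<^sup>2 = Re (prodfun (\<lambda>b t. complex_of_real ((cmod (g b t))\<^sup>2)) x)" for x
  proof -
    have "complex_of_real ((cmod (prodfun g x))\<^sup>2) = prodfun (\<lambda>b t. complex_of_real ((cmod (g b t))\<^sup>2)) x"
      by (simp add: power2_eq_square cmod_prodfun prodfun_mult)
    then show ?thesis by (metis Re_complex_of_real)
  qed
  moreover have "integrable lborel (prodfun (\<lambda>b t. complex_of_real ((cmod (g b t))\<^sup>2)))"
    by (rule integral_prodfun(1)) (use assms(2) in \<open>simp del: of_real_power\<close>)
  then have "integrable lborel (\<lambda>x. Re (prodfun (\<lambda>b t. complex_of_real ((cmod (g b t))\<^sup>2)) x))"
    by (rule integrable_Re)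
  moreover have "prodfun g \<in> borel_measurable borel"
    by (rule borel_measurable_continuous_onI[OF continuous_prodfun]) (rule assms(1))
  ultimately show ?thesis by (simp add: L2_def)
qed

lemma pg_square_integrable: "a > 0 \<Longrightarrow> integrable lborel (\<lambda>t. (pg a p t)\<^sup>2)"
  unfolding power2_eq_square pg_mult by (intro integrable_pg) simp

lemma pg_prod_L2:
  fixes p :: "real ^ 'n::finite \<Rightarrow> real poly"
  assumes "a > 0" shows "prodfun (\<lambda>b t. complex_of_real (pg a (p b) t)) \<in> L2"
  by (rule prodfun_L2)
    (auto intro!: continuous_on_of_real continuous_pg pg_square_integrable assms)

definition hfun :: "real \<Rightarrow> (real ^ 'n \<Rightarrow> nat) \<Rightarrow> 'n::finite fn" where
  "hfun a \<alpha> = prodfun (\<lambda>b t. complex_of_real (pg a (hp a (\<alpha> b)) t))"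

definition heig :: "real \<Rightarrow> (real ^ 'n \<Rightarrow> nat) \<Rightarrow> real" where
  "heig a \<alpha> = (\<Sum>b\<in>(Basis :: (real ^ 'n::finite) set). (2 * real (\<alpha> b) + 1) * a)"

lemma hfun_L2: "a > 0 \<Longrightarrow> hfun a \<alpha> \<in> L2"
  unfolding hfun_def by (rule pg_prod_L2)

lemma hfun_real: "cnj (hfun a \<alpha> x) = hfun a \<alpha> x"
  by (simp add: hfun_def prodfun_def)

lemma hfun_inner:
  assumes "a > 0"
  shows "l2_inner (hfun a \<alpha>) (hfun a \<beta>) = (if \<forall>b\<in>Basis. \<alpha> b = \<beta> b then 1 else 0)"
proof -
  have "l2_inner (hfun a \<alpha>) (hfun a \<beta>)
      = (LINT x|lborel. prodfun (\<lambda>b t. complex_of_real (pg a (hp a (\<alpha> b)) t * pg a (hp a (\<beta> b)) t)) x)"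
    by (simp add: l2_inner_def hfun_real) (simp add: hfun_def prodfun_mult)
  also have "\<dots> = (\<Prod>b\<in>Basis. LINT t|lborel. complex_of_real (pg a (hp a (\<alpha> b)) t * pg a (hp a (\<beta> b)) t))"
    by (rule integral_prodfun(2)) (use assms in \<open>simp add: pg_mult integrable_pg del: of_real_mult\<close>)
  also have "\<dots> = (\<Prod>b\<in>Basis. if \<alpha> b = \<beta> b then 1 else 0)"
    by (intro prod.cong refl) (simp add: hp_orthonormal[OF assms] del: of_real_mult)
  also have "\<dots> = (if \<forall>b\<in>Basis. \<alpha> b = \<beta> b then 1 else 0)" by (auto intro: prod.neutral)
  finally show ?thesis .
qed

lemma hfun_C2: "C2 (hfun a \<alpha>)"
  unfolding hfun_def
  by (rule prodfun_C2(1)) (rule pg_has_vector_derivative pg_has_vector_derivative continuous_on_of_real continuous_pg)+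

lemma hermite_op_hfun:
  assumes "lam \<noteq> 0"
  shows "hermite_op lam (hfun \<bar>lam\<bar> \<alpha>) x = complex_of_real (heig \<bar>lam\<bar> \<alpha>) * hfun \<bar>lam\<bar> \<alpha> x"
proof -
  let ?a = "\<bar>lam\<bar>"
  let ?g = "\<lambda>b t. complex_of_real (pg ?a (hp ?a (\<alpha> b)) t)"
  let ?g1 = "\<lambda>b t. complex_of_real (pg ?a (pgD ?a (hp ?a (\<alpha> b))) t)"
  let ?g2 = "\<lambda>b t. complex_of_real (pg ?a (pgD ?a (pgD ?a (hp ?a (\<alpha> b)))) t)"
  have ode: "- ?g2 c t + complex_of_real (lam\<^sup>2 * t\<^sup>2) * ?g c t = complex_of_real ((2 * real (\<alpha> c) + 1) * ?a) * ?g c t" for c t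
    using hp_ode[of ?a "\<alpha> c" t] by (simp only: of_real_mult[symmetric] of_real_minus[symmetric] of_real_add[symmetric] power2_abs)
  have "hermite_op lam (prodfun ?g) x
     = (\<Sum>c\<in>Basis. prodfun (?g(c := (\<lambda>t. - ?g2 c t + complex_of_real (lam\<^sup>2 * t\<^sup>2) * ?g c t))) x)"
    by (rule hermite_op_prodfun[of _ ?g1])
      (rule pg_has_vector_derivative pg_has_vector_derivative continuous_on_of_real continuous_pg)+
  also have "\<dots> = (\<Sum>c\<in>Basis. complex_of_real ((2 * real (\<alpha> c) + 1) * ?a) * prodfun ?g x)"
    unfolding ode by (intro sum.cong refl) (simp add: prodfun_upd prodfun_remove[of _ ?g] mult.assoc)
  finally show ?thesis by (simp add: hfun_def heig_def sum_distrib_right del: of_real_mult)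
qed

text \<open>The span of the Hermite functions, as an induction principle for linear combinations.\<close>

inductive hspan :: "real \<Rightarrow> 'n::finite fn \<Rightarrow> bool" for a where
  base: "hspan a (hfun a \<alpha>)"
| add: "hspan a u \<Longrightarrow> hspan a v \<Longrightarrow> hspan a (\<lambda>x. u x + v x)"
| scale: "hspan a u \<Longrightarrow> hspan a (\<lambda>x. c * u x)"

lemma hspan_L2: "hspan a u \<Longrightarrow> a > 0 \<Longrightarrow> u \<in> L2"
  by (induction rule: hspan.induct) (auto intro: hfun_L2 L2_add L2_scale)

lemma hspan_coordinate:
  assumes "a > 0" "b \<in> Basis"
  shows "hspan a u \<Longrightarrow> hspan a (\<lambda>x. complex_of_real (x \<bullet> b) * u x)"
proof (induction rule: hspan.induct)
  case (base \<alpha>)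
  obtain c d where cd: "[:0, 1:] * hp a (\<alpha> b) = smult c (hp a (Suc (\<alpha> b))) + smult d (hp a (\<alpha> b - 1))"
    using hp_recurrence[OF assms(1)] by blast
  have t: "t * pg a (hp a (\<alpha> b)) t = c * pg a (hp a (Suc (\<alpha> b))) t + d * pg a (hp a (\<alpha> b - 1)) t" for t
    using pg_X[of a "hp a (\<alpha> b)" t] unfolding cd by (simp add: pg_add pg_smult)
  have upd: "hfun a (\<alpha>(b := m)) x = complex_of_real (pg a (hp a m) (x \<bullet> b)) *
      (\<Prod>b'\<in>Basis - {b}. complex_of_real (pg a (hp a (\<alpha> b')) (x \<bullet> b')))" for m x
    unfolding hfun_def using assms(2)
    by (subst prodfun_remove[of b]) (auto intro!: prod.cong)
  have "complex_of_real (x \<bullet> b) * hfun a \<alpha> x = of_real c * hfun a (\<alpha>(b := Suc (\<alpha> b))) x + of_real d * hfun a (\<alpha>(b := \<alpha> b - 1)) x" for x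
  proof -
    have "complex_of_real (x \<bullet> b) * hfun a \<alpha> x = complex_of_real (x \<bullet> b) * hfun a (\<alpha>(b := \<alpha> b)) x" by simp
    also have "\<dots> = complex_of_real (x \<bullet> b * pg a (hp a (\<alpha> b)) (x \<bullet> b)) *
      (\<Prod>b'\<in>Basis - {b}. complex_of_real (pg a (hp a (\<alpha> b')) (x \<bullet> b')))"
      unfolding upd by simp
    finally show ?thesis unfolding t upd by (simp add: algebra_simps)
  qed
  then show ?case by (simp only:) (intro hspan.intros)
next
  case (add u v)
  show ?case unfolding distrib_left by (intro hspan.add add.IH)
next
  case (scale u c)
  have "(\<lambda>x. complex_of_real (x \<bullet> b) * (c * u x)) = (\<lambda>x. c * (complex_of_real (x \<bullet> b) * u x))"
    by (simp add: mult_ac)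
  then show ?case using hspan.scale[OF scale.IH] by simp
qed

lemma hspan_sum: "finite B \<Longrightarrow> B \<noteq> {} \<Longrightarrow> (\<And>b. b \<in> B \<Longrightarrow> hspan a (u b)) \<Longrightarrow> hspan a (\<lambda>x. \<Sum>b\<in>B. u b x)"
  by (induction B rule: finite_ne_induct) (auto intro: hspan.add)

lemma hspan_inner_power:
  assumes "a > 0" shows "hspan a (\<lambda>x. complex_of_real (\<omega> \<bullet> x) ^ k * hfun a (\<lambda>_. 0) x)"
proof (induction k)
  case 0 then show ?case by (simp add: hspan.base)
next
  case (Suc k)
  let ?v = "\<lambda>x. complex_of_real (\<omega> \<bullet> x) ^ k * hfun a (\<lambda>_. 0) x"
  have "(\<lambda>x. complex_of_real (\<omega> \<bullet> x) ^ Suc k * hfun a (\<lambda>_. 0) x)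
     = (\<lambda>x. \<Sum>b\<in>Basis. complex_of_real (\<omega> \<bullet> b) * (complex_of_real (x \<bullet> b) * ?v x))"
  proof
    fix x
    have "complex_of_real (\<omega> \<bullet> x) = (\<Sum>b\<in>Basis. complex_of_real (\<omega> \<bullet> b) * complex_of_real (x \<bullet> b))"
      by (subst euclidean_inner) simp
    then show "complex_of_real (\<omega> \<bullet> x) ^ Suc k * hfun a (\<lambda>_. 0) x
     = (\<Sum>b\<in>Basis. complex_of_real (\<omega> \<bullet> b) * (complex_of_real (x \<bullet> b) * ?v x))"
      by (simp add: sum_distrib_right mult.assoc)
  qed
  moreover have "hspan a (\<lambda>x. \<Sum>b\<in>Basis. complex_of_real (\<omega> \<bullet> b) * (complex_of_real (x \<bullet> b) * ?v x))"
    by (intro hspan_sum hspan.scale hspan_coordinate[OF assms] Suc.IH) auto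
  ultimately show ?case by simp
qed

text \<open>Exponential growth is absorbed by half of the Gaussian; this dominates the exponential series in the proof of totality.\<close>

lemma exp_times_gaussian_L2:
  fixes \<omega> :: "real ^ 'n::finite"
  assumes "a > 0" shows "(\<lambda>x. complex_of_real (exp \<bar>\<omega> \<bullet> x\<bar>) * hfun a (\<lambda>_. 0) x) \<in> L2"
proof -
  define g where "g b t = complex_of_real (exp (\<bar>\<omega> \<bullet> b\<bar> * \<bar>t\<bar>) * pg a (hp a 0) t)" for b :: "real ^ 'n" and t :: real
  have cont: "continuous_on UNIV (g b)" for b unfolding g_def
    by (intro continuous_on_of_real continuous_intros continuous_pg)
  have "integrable lborel (\<lambda>t. (cmod (g b t))\<^sup>2)" for b
  proof -
    let ?c = "\<bar>\<omega> \<bullet> b\<bar>"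
    have "(cmod (g b t))\<^sup>2 \<le> exp (2 * ?c\<^sup>2 / a) * pg a ((hp a 0)\<^sup>2) t" for t
    proof -
      have "0 \<le> (2 * ?c - a * \<bar>t\<bar>)\<^sup>2" by simp
      then have *: "4 * (?c * a * \<bar>t\<bar>) \<le> 4 * ?c\<^sup>2 + a\<^sup>2 * t\<^sup>2"
        by (simp add: power2_diff power_mult_distrib mult_ac)
      have "2 * (?c * \<bar>t\<bar>) = 4 * (?c * a * \<bar>t\<bar>) / (2 * a)" using assms by simp
      also have "\<dots> \<le> (4 * ?c\<^sup>2 + a\<^sup>2 * t\<^sup>2) / (2 * a)" using assms * by (intro divide_right_mono) auto
      also have "\<dots> = 2 * ?c\<^sup>2 / a + a * t\<^sup>2 / 2" using assms by (simp add: field_simps power2_eq_square)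
      finally have le: "2 * (?c * \<bar>t\<bar>) \<le> 2 * ?c\<^sup>2 / a + a * t\<^sup>2 / 2" .
      have "(cmod (g b t))\<^sup>2 = exp (2 * (?c * \<bar>t\<bar>)) * (poly (hp a 0) t)\<^sup>2 * exp (- a * t\<^sup>2)"
        unfolding g_def norm_of_real
        by (simp add: pg_def power_mult_distrib exp_double[symmetric] abs_mult)
      also have "\<dots> \<le> exp (2 * ?c\<^sup>2 / a + a * t\<^sup>2 / 2) * (poly (hp a 0) t)\<^sup>2 * exp (- a * t\<^sup>2)"
        using le by (intro mult_right_mono) auto
      also have "\<dots> = exp (2 * ?c\<^sup>2 / a) * (poly (hp a 0) t)\<^sup>2 * (exp (a * t\<^sup>2 / 2) * exp (- a * t\<^sup>2))"
        by (simp add: exp_add)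
      also have "exp (a * t\<^sup>2 / 2) * exp (- a * t\<^sup>2) = exp (- a * t\<^sup>2 / 2)"
        by (simp add: mult_exp_exp)
      finally show ?thesis by (simp add: pg_def mult.assoc)
    qed
    moreover have "g b \<in> borel_measurable borel" using cont by (rule borel_measurable_continuous_onI)
    ultimately show ?thesis
      by (intro Bochner_Integration.integrable_bound[OF integrable_mult_right[OF integrable_pg[OF assms]]])
        (auto intro!: AE_I2 order_trans[OF _ abs_ge_self])
  qed
  then have gL2: "prodfun g \<in> L2" using cont by (intro prodfun_L2) auto
  show ?thesis
  proof (rule L2_dominated[OF gL2])
    show "(\<lambda>x. complex_of_real (exp \<bar>\<omega> \<bullet> x\<bar>) * hfun a (\<lambda>_. 0) x) \<in> borel_measurable borel"
      using hfun_L2[OF assms] C2D(3)[OF hfun_C2] nonempty_Basis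
      by (intro borel_measurable_continuous_onI continuous_intros continuous_on_of_real) blast
    fix x :: "real ^ 'n"
    have "\<bar>\<omega> \<bullet> x\<bar> \<le> (\<Sum>b\<in>Basis. \<bar>\<omega> \<bullet> b\<bar> * \<bar>x \<bullet> b\<bar>)"
      by (subst euclidean_inner) (auto intro!: order_trans[OF sum_abs] simp: abs_mult)
    then have "exp \<bar>\<omega> \<bullet> x\<bar> \<le> (\<Prod>b\<in>Basis. exp (\<bar>\<omega> \<bullet> b\<bar> * \<bar>x \<bullet> b\<bar>))"
      by (simp add: exp_sum[symmetric])
    then have "exp \<bar>\<omega> \<bullet> x\<bar> * cmod (hfun a (\<lambda>_. 0) x) \<le> (\<Prod>b\<in>Basis. exp (\<bar>\<omega> \<bullet> b\<bar> * \<bar>x \<bullet> b\<bar>)) * cmod (hfun a (\<lambda>_. 0) x)"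
      by (rule mult_right_mono) simp
    also have "\<dots> = cmod (prodfun g x)"
      by (simp add: prodfun_def g_def hfun_def prod_norm[symmetric] norm_mult prod.distrib)
    finally show "cmod (complex_of_real (exp \<bar>\<omega> \<bullet> x\<bar>) * hfun a (\<lambda>_. 0) x) \<le> cmod (prodfun g x)"
      by (simp add: norm_mult)
  qed
qed

text \<open>The span of the Hermite functions contains all powers of linear forms times the Gaussian. Summing the
  exponential series, the function times the Gaussian has vanishing Fourier transform.\<close>

lemma hermite_total:
  fixes \<phi> :: "'n::finite fn"
  assumes a: "a > 0" and \<phi>: "\<phi> \<in> L2" and orth: "\<And>\<alpha>. l2_inner \<phi> (hfun a \<alpha>) = 0"
  shows "AE x in lborel. \<phi> x = 0"
proof -
  have [measurable]: "\<phi> \<in> borel_measurable borel" using \<phi> by (simp add: L2_def)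
  have i: "integrable lborel (\<lambda>x. \<phi> x * u x)" if "u \<in> L2" for u
    using l2_inner_integrable[OF \<phi> L2_cnj[OF that]] by simp
  have zero: "(LINT x|lborel. \<phi> x * u x) = 0" if "hspan a u" for u
    using that
  proof (induction rule: hspan.induct)
    case (base \<alpha>)
    then show ?case using orth[of \<alpha>] by (simp add: l2_inner_def hfun_real)
  next
    case (add u v)
    then show ?case using i[OF hspan_L2[OF add(1) a]] i[OF hspan_L2[OF add(2) a]] by (simp add: distrib_left)
  next
    case (scale u c)
    then show ?case by (simp add: mult.left_commute)
  qed
  let ?h = "hfun a (\<lambda>_. 0) :: 'n fn"
  have [measurable]: "?h \<in> borel_measurable borel" using hfun_L2[OF a, of "(\<lambda>_. 0) :: real ^ 'n \<Rightarrow> nat"] by (simp add: L2_def)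
  have "(LINT x|lborel. \<phi> x * ?h x * cis (\<omega> \<bullet> x)) = 0" for \<omega>
  proof -
    let ?s = "\<lambda>N x. \<Sum>k<N. (\<i> * complex_of_real (\<omega> \<bullet> x)) ^ k /\<^sub>R fact k"
    have "(\<lambda>N. LINT x|lborel. \<phi> x * ?h x * ?s N x) \<longlonglongrightarrow> (LINT x|lborel. \<phi> x * ?h x * cis (\<omega> \<bullet> x))"
    proof (rule integral_dominated_convergence[where w = "\<lambda>x. cmod (\<phi> x * (complex_of_real (exp \<bar>\<omega> \<bullet> x\<bar>) * ?h x))"])
      show "integrable lborel (\<lambda>x. cmod (\<phi> x * (complex_of_real (exp \<bar>\<omega> \<bullet> x\<bar>) * ?h x)))"
        by (intro integrable_norm i exp_times_gaussian_L2 a)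
      have "(\<lambda>N. ?s N x) \<longlonglongrightarrow> cis (\<omega> \<bullet> x)" for x
        using summable_LIMSEQ[OF summable_exp_generic[of "\<i> * complex_of_real (\<omega> \<bullet> x)"]]
        by (simp add: cis_conv_exp exp_def)
      then show "AE x in lborel. (\<lambda>N. \<phi> x * ?h x * ?s N x) \<longlonglongrightarrow> \<phi> x * ?h x * cis (\<omega> \<bullet> x)"
        by (intro AE_I2 tendsto_intros)
      show "AE x in lborel. cmod (\<phi> x * ?h x * ?s N x) \<le> cmod (\<phi> x * (complex_of_real (exp \<bar>\<omega> \<bullet> x\<bar>) * ?h x))" for N
      proof (rule AE_I2)
        fix x
        have "cmod (?s N x) \<le> (\<Sum>k<N. \<bar>\<omega> \<bullet> x\<bar> ^ k /\<^sub>R fact k)"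
          by (intro sum_norm_le) (simp add: norm_mult norm_power norm_divide divide_inverse mult.commute)
        also have "\<dots> \<le> exp \<bar>\<omega> \<bullet> x\<bar>"
          unfolding exp_def by (intro sum_le_suminf summable_exp_generic) auto
        finally have "cmod (\<phi> x) * cmod (?h x) * cmod (?s N x) \<le> cmod (\<phi> x) * cmod (?h x) * exp \<bar>\<omega> \<bullet> x\<bar>"
          by (rule mult_left_mono) simp
        then show "cmod (\<phi> x * ?h x * ?s N x) \<le> cmod (\<phi> x * (complex_of_real (exp \<bar>\<omega> \<bullet> x\<bar>) * ?h x))"
          unfolding norm_mult norm_of_real abs_exp_cancel by (simp only: mult_ac)
      qed
    qed measurable
    moreover have "(LINT x|lborel. \<phi> x * ?h x * ?s N x) = 0" for N
    proof (cases "N = 0")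
      case False
      have "?h x * ?s N x = (\<Sum>k<N. (\<i> ^ k / fact k) * (complex_of_real (\<omega> \<bullet> x) ^ k * ?h x))" for x
        by (simp add: sum_distrib_left power_mult_distrib scaleR_conv_of_real divide_inverse mult_ac)
      moreover have "hspan a (\<lambda>x. \<Sum>k<N. (\<i> ^ k / fact k) * (complex_of_real (\<omega> \<bullet> x) ^ k * ?h x))"
        using False by (intro hspan_sum hspan.scale hspan_inner_power a) auto
      ultimately show ?thesis using zero by (simp add: mult.assoc)
    qed simp
    ultimately show ?thesis by (simp add: LIMSEQ_const_iff)
  qed
  then have "fourier_null lborel (\<lambda>x. x) (\<lambda>x. \<phi> x * ?h x)"
    unfolding fourier_null_def using i[OF hfun_L2[OF a]] by simp
  then have "AE x in lborel. \<phi> x * ?h x = 0"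
    by (intro AE_zero_if_integrals_zero i hfun_L2 a fourier_null_bounded_continuous[where P = "\<lambda>x. x"]) auto
  moreover have "?h x \<noteq> 0" for x
    using hq_norm_pos[OF a, of 0] by (auto simp: hfun_def prodfun_def pg_def hp_def)
  ultimately show ?thesis by simp
qed

text \<open>Multi-indices are functions on the standard basis, extended by \<open>undefined\<close>, so that
  distinct ones give distinct Hermite functions.\<close>

definition multi_index :: "nat \<Rightarrow> (real ^ 'n::finite \<Rightarrow> nat)" where
  "multi_index = from_nat_into (Basis \<rightarrow>\<^sub>E UNIV)"

lemma multi_index_bij: "bij_betw (multi_index :: nat \<Rightarrow> (real ^ 'n::finite \<Rightarrow> nat)) UNIV (Basis \<rightarrow>\<^sub>E UNIV)"
  unfolding multi_index_def
proof (rule bij_betw_from_nat_into)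
  show "countable ((Basis :: (real ^ 'n) set) \<rightarrow>\<^sub>E (UNIV :: nat set))" by (intro countable_PiE) auto
  obtain b0 :: "real ^ 'n" where b0: "b0 \<in> Basis" using nonempty_Basis by blast
  have "inj (\<lambda>n::nat. restrict (\<lambda>_. n) (Basis :: (real ^ 'n) set))"
    by (rule injI) (metis b0 restrict_apply')
  moreover have "range (\<lambda>n::nat. restrict (\<lambda>_. n) (Basis :: (real ^ 'n) set)) \<subseteq> Basis \<rightarrow>\<^sub>E UNIV" by auto
  ultimately show "infinite ((Basis :: (real ^ 'n) set) \<rightarrow>\<^sub>E (UNIV :: nat set))"
    using infinite_super range_inj_infinite by blast
qed

definition hbasis :: "real \<Rightarrow> nat \<Rightarrow> 'n::finite fn" where
  "hbasis a k = hfun a (multi_index k)"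

definition hbasis_eig :: "'n::finite itself \<Rightarrow> real \<Rightarrow> nat \<Rightarrow> real" where
  "hbasis_eig _ a k = heig a (multi_index k :: real ^ 'n \<Rightarrow> nat)"

lemma hbasis_orthonormal: assumes "a > 0" shows "orthonormal (hbasis a :: nat \<Rightarrow> 'n::finite fn)"
proof -
  have "(\<forall>b\<in>(Basis :: (real ^ 'n) set). multi_index j b = multi_index k b) \<longleftrightarrow> j = k" for j k
  proof
    assume eq: "\<forall>b\<in>Basis. (multi_index j :: real ^ 'n \<Rightarrow> nat) b = multi_index k b"
    have "(multi_index i :: real ^ 'n \<Rightarrow> nat) \<in> Basis \<rightarrow>\<^sub>E UNIV" for i
      using multi_index_bij by (auto simp: bij_betw_def)
    from PiE_ext[OF this this] eq have "(multi_index j :: real ^ 'n \<Rightarrow> nat) = multi_index k" by blast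
    then show "j = k" using multi_index_bij by (metis UNIV_I bij_betw_inv_into_left)
  qed simp
  then show ?thesis
    using assms by (simp add: orthonormal_def hbasis_def hfun_L2 hfun_inner)
qed

lemma hbasis_total: assumes "a > 0" shows "l2_total (hbasis a :: nat \<Rightarrow> 'n::finite fn)"
  unfolding l2_total_def
proof (intro ballI impI)
  fix \<phi> :: "'n fn" assume \<phi>: "\<phi> \<in> L2" "\<forall>k. l2_inner \<phi> (hbasis a k) = 0"
  have "l2_inner \<phi> (hfun a \<alpha>) = 0" for \<alpha>
  proof -
    have "restrict \<alpha> Basis \<in> range (multi_index :: nat \<Rightarrow> (real ^ 'n \<Rightarrow> nat))"
      using multi_index_bij by (auto simp: bij_betw_def)
    then obtain k where "multi_index k = restrict \<alpha> Basis" by (elim rangeE) metis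
    then have "hbasis a k = hfun a \<alpha>"
      by (auto simp: hbasis_def hfun_def intro!: prodfun_cong)
    then show ?thesis using \<phi>(2) by metis
  qed
  then show "AE x in lborel. \<phi> x = 0" by (rule hermite_total[OF assms \<phi>(1)])
qed

lemma hbasis_eigenbasis:
  assumes "lam \<noteq> 0"
  shows "orthonormal_eigenbasis (hermite_op lam) (hbasis \<bar>lam\<bar> :: nat \<Rightarrow> 'n::finite fn) (hbasis_eig TYPE('n) \<bar>lam\<bar>)"
proof -
  have a: "\<bar>lam\<bar> > 0" using assms by simp
  show ?thesis unfolding orthonormal_eigenbasis_def
    using hbasis_orthonormal[OF a, where 'n = 'n] hbasis_total[OF a, where 'n = 'n]
    by (auto simp: orthonormal_def l2_total_def hbasis_def hbasis_eig_def hfun_C2 hermite_op_hfun[OF assms])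
qed

lemma hbasis_eig_pos: "a > 0 \<Longrightarrow> hbasis_eig TYPE('n::finite) a k > 0"
  unfolding hbasis_eig_def heig_def by (intro sum_pos) (auto intro!: mult_pos_pos add_nonneg_pos)

section \<open>Independence of the functional calculus from the eigenbasis\<close>

text \<open>The smooth bump for geometric widths, normalised to the value \<open>1\<close> at the origin.\<close>

lemma cutoff_exists:
  obtains \<kappa> :: "nat \<Rightarrow> real \<Rightarrow> real" and K where
    "\<And>k t. (\<kappa> k has_real_derivative \<kappa> (Suc k) t) (at t)" "\<kappa> 0 0 = 1" "K \<ge> 1"
    "\<And>k t. k \<le> 2 \<Longrightarrow> \<bar>\<kappa> k t\<bar> \<le> K" "\<And>k t. \<bar>t\<bar> > 2 \<Longrightarrow> \<kappa> k t = 0"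
proof -
  define a :: "nat \<Rightarrow> real" where "a j = 1/4 * (1/2)^j" for j
  have "a sums (1/4 * (1 / (1 - 1/2)))"
    unfolding a_def by (intro sums_mult geometric_sums) simp
  then have sm: "summable a" and lt: "suminf a < 1"
    by (auto simp: sums_iff)
  have apos: "a j > 0" for j by (simp add: a_def)
  obtain \<beta> where \<beta>: "\<And>k t. (\<beta> k has_real_derivative \<beta> (Suc k) t) (at t)"
    "\<And>k t. \<bar>\<beta> k t\<bar> \<le> (\<Prod>j<k. 2 / a j)" "\<And>k t. \<bar>t\<bar> > 2 \<Longrightarrow> \<beta> k t = 0"
    "\<And>t. \<beta> 0 t \<ge> 0" "\<beta> 0 0 > 0"
    by (rule bump_exists[OF apos sm lt]) blast
  define K where "K = 1 + (\<Sum>k\<le>2. (\<Prod>j<k. 2 / a j) / \<beta> 0 0)"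
  have nn: "(\<Prod>j<k. 2 / a j) / \<beta> 0 0 \<ge> 0" for k
    using \<beta>(5) apos by (intro divide_nonneg_pos prod_nonneg) (auto intro: less_imp_le)
  show ?thesis
  proof (rule that[of "\<lambda>k t. \<beta> k t / \<beta> 0 0" K])
    show "((\<lambda>t. \<beta> k t / \<beta> 0 0) has_real_derivative \<beta> (Suc k) t / \<beta> 0 0) (at t)" for k t
      by (intro DERIV_cdivide \<beta>)
    show "K \<ge> 1" using sum_nonneg[of "{..2}", OF nn] by (simp add: K_def)
    show "\<bar>\<beta> k t / \<beta> 0 0\<bar> \<le> K" if "k \<le> 2" for k t
    proof -
      have "\<bar>\<beta> k t / \<beta> 0 0\<bar> \<le> (\<Prod>j<k. 2 / a j) / \<beta> 0 0"
        using \<beta>(2)[of k t] \<beta>(5) by (simp add: divide_right_mono)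
      also have "\<dots> \<le> (\<Sum>k\<le>2. (\<Prod>j<k. 2 / a j) / \<beta> 0 0)"
        using that nn by (intro member_le_sum) auto
      finally show ?thesis by (simp add: K_def)
    qed
  qed (use \<beta> in auto)
qed

text \<open>The eigenfunction \<open>u\<close> is merely a twice differentiable square integrable function, and no decay
  of its derivatives is known. Integration by parts is therefore done against the Hermite function cut off at
  distance \<open>2 / R\<close>, and the derivatives of the cut-off contribute terms of order \<open>R\<close>.\<close>

lemma eigenfunction_orthogonal:
  fixes u :: "'n::finite fn"
  assumes lam: "lam \<noteq> 0" and u: "u \<in> L2" "C2 u" and eig: "\<And>x. hermite_op lam u x = complex_of_real \<mu> * u x"
    and ne: "\<mu> \<noteq> heig \<bar>lam\<bar> \<alpha>"
  shows "l2_inner u (hfun \<bar>lam\<bar> \<alpha>) = 0"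
proof -
  obtain \<kappa> :: "nat \<Rightarrow> real \<Rightarrow> real" and K where
    \<kappa>: "\<And>k t. (\<kappa> k has_real_derivative \<kappa> (Suc k) t) (at t)" "\<kappa> 0 0 = 1" "K \<ge> 1"
    "\<And>k t. k \<le> 2 \<Longrightarrow> \<bar>\<kappa> k t\<bar> \<le> K" "\<And>k t. \<bar>t\<bar> > 2 \<Longrightarrow> \<kappa> k t = 0"
    by (rule cutoff_exists) blast
  define a where "a = \<bar>lam\<bar>"
  have a: "a > 0" using lam by (simp add: a_def)
  define \<nu> where "\<nu> = heig a \<alpha>"
  define h where "h b = pg a (hp a (\<alpha> b))" for b
  define h1 where "h1 b = pg a (pgD a (hp a (\<alpha> b)))" for b
  define h2 where "h2 b = pg a (pgD a (pgD a (hp a (\<alpha> b))))" for b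
  have dh: "(h b has_real_derivative h1 b t) (at t)" and dh1: "(h1 b has_real_derivative h2 b t) (at t)" for b t
    unfolding h_def h1_def h2_def by (rule pg_has_derivative)+
  have ch: "continuous_on UNIV (h b)" "continuous_on UNIV (h1 b)" "continuous_on UNIV (h2 b)" for b
    unfolding h_def h1_def h2_def by (rule continuous_pg)+
  have ck: "continuous_on UNIV (\<kappa> k)" for k
    using \<kappa>(1) by (auto intro!: continuous_at_imp_continuous_on DERIV_isCont)
  \<comment> \<open>A majorant of the cut-off functions and, up to the factor \<open>R\<close>, of the error terms.\<close>
  define D where "D b t = complex_of_real (K * (\<bar>h b t\<bar> + 2 * \<bar>h1 b t\<bar>))" for b t
  have DL2: "prodfun D \<in> L2"
  proof (rule prodfun_L2)
    fix b :: "real ^ 'n"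
    show cD: "continuous_on UNIV (D b)" unfolding D_def
      by (intro continuous_on_of_real continuous_intros ch)
    have le: "(cmod (D b t))\<^sup>2 \<le> K\<^sup>2 * (2 * (h b t)\<^sup>2 + 8 * (h1 b t)\<^sup>2)" for t
    proof -
      have "(\<bar>h b t\<bar> + 2 * \<bar>h1 b t\<bar>)\<^sup>2 \<le> 2 * (h b t)\<^sup>2 + 8 * (h1 b t)\<^sup>2"
        using sum_squares_bound[of "\<bar>h b t\<bar>" "2 * \<bar>h1 b t\<bar>"] by (simp add: power2_sum power_mult_distrib)
      then have "K\<^sup>2 * (\<bar>h b t\<bar> + 2 * \<bar>h1 b t\<bar>)\<^sup>2 \<le> K\<^sup>2 * (2 * (h b t)\<^sup>2 + 8 * (h1 b t)\<^sup>2)"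
        by (rule mult_left_mono) simp
      then show ?thesis unfolding D_def norm_of_real power2_abs by (simp add: power_mult_distrib)
    qed
    have [measurable]: "D b \<in> borel_measurable borel" using cD by (rule borel_measurable_continuous_onI)
    have int: "integrable lborel (\<lambda>t. K\<^sup>2 * (2 * (h b t)\<^sup>2 + 8 * (h1 b t)\<^sup>2))"
      unfolding h_def h1_def
      by (intro integrable_mult_right Bochner_Integration.integrable_add pg_square_integrable a)
    show "integrable lborel (\<lambda>t. (cmod (D b t))\<^sup>2)"
    proof (rule Bochner_Integration.integrable_bound[OF int])
      show "AE t in lborel. norm ((cmod (D b t))\<^sup>2) \<le> norm (K\<^sup>2 * (2 * (h b t)\<^sup>2 + 8 * (h1 b t)\<^sup>2))"
        unfolding real_norm_def by (rule AE_I2, subst abs_of_nonneg[OF zero_le_power2], rule order_trans[OF le abs_ge_self])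
    qed measurable
  qed
  define g where "g R b t = complex_of_real (\<kappa> 0 (R * t) * h b t)" for R :: real and b t
  define g1 where "g1 R b t = complex_of_real (R * \<kappa> 1 (R * t) * h b t + \<kappa> 0 (R * t) * h1 b t)" for R :: real and b t
  define g2 where "g2 R b t = complex_of_real (R\<^sup>2 * \<kappa> 2 (R * t) * h b t + 2 * R * \<kappa> 1 (R * t) * h1 b t + \<kappa> 0 (R * t) * h2 b t)" for R :: real and b t
  \<comment> \<open>The part of the second derivative in which the cut-off is differentiated.\<close>
  define e where "e R b t = complex_of_real (R\<^sup>2 * \<kappa> 2 (R * t) * h b t + 2 * R * \<kappa> 1 (R * t) * h1 b t)" for R :: real and b t
  define w where "w R = prodfun (g R)" for R
  have [measurable]: "u \<in> borel_measurable borel" using u by (simp add: L2_def)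
  have dk: "((\<lambda>t. \<kappa> k (R * t)) has_real_derivative R * \<kappa> (Suc k) (R * t)) (at t)" for k R t
  proof -
    have d: "((\<lambda>t. R * t) has_real_derivative R * 1) (at t)" by (rule DERIV_cmult[OF DERIV_ident])
    show ?thesis using DERIV_chain'[OF d \<kappa>(1)[of k "R * t"]] by (simp add: mult.commute)
  qed
  have dg: "(g R b has_vector_derivative g1 R b t) (at t)" "(g1 R b has_vector_derivative g2 R b t) (at t)" for R b t
  proof -
    have "((\<lambda>t. \<kappa> 0 (R * t) * h b t) has_real_derivative R * \<kappa> 1 (R * t) * h b t + \<kappa> 0 (R * t) * h1 b t) (at t)"
      using DERIV_mult[OF dk[of 0 R t] dh[of b t]] by (simp add: algebra_simps)
    then show "(g R b has_vector_derivative g1 R b t) (at t)" unfolding g_def g1_def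
      by (intro has_vector_derivative_of_real) (simp add: has_real_derivative_iff_has_vector_derivative)
    have "((\<lambda>t. R * \<kappa> 1 (R * t) * h b t + \<kappa> 0 (R * t) * h1 b t) has_real_derivative
      R\<^sup>2 * \<kappa> 2 (R * t) * h b t + 2 * R * \<kappa> 1 (R * t) * h1 b t + \<kappa> 0 (R * t) * h2 b t) (at t)"
      using DERIV_add[OF DERIV_mult[OF DERIV_cmult[OF dk[of 1 R t], of R] dh[of b t]] DERIV_mult[OF dk[of 0 R t] dh1[of b t]]]
      by (simp add: algebra_simps power2_eq_square numeral_2_eq_2)
    then show "(g1 R b has_vector_derivative g2 R b t) (at t)" unfolding g1_def g2_def
      by (intro has_vector_derivative_of_real) (simp add: has_real_derivative_iff_has_vector_derivative)
  qed
  have ck': "continuous_on UNIV (\<lambda>t. \<kappa> k (R * t))" for k R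
    using dk by (auto intro!: continuous_at_imp_continuous_on DERIV_isCont)
  have cg2: "continuous_on UNIV (g2 R b)" for R b
    unfolding g2_def
    by (intro continuous_on_of_real continuous_intros ck' ch)
  have ce: "continuous_on UNIV (e R b)" and cg: "continuous_on UNIV (g R b)" for R b
    unfolding e_def g_def
    by (intro continuous_on_of_real continuous_intros ck' ch)+
  have ode: "- g2 R c t + complex_of_real (lam\<^sup>2 * t\<^sup>2) * g R c t
      = complex_of_real ((2 * real (\<alpha> c) + 1) * a) * g R c t - e R c t" for R c t
  proof -
    have "- h2 c t + lam\<^sup>2 * t\<^sup>2 * h c t = (2 * real (\<alpha> c) + 1) * a * h c t"
      using hp_ode[of a "\<alpha> c" t] by (simp add: h2_def h_def a_def)
    then have "\<kappa> 0 (R * t) * (- h2 c t + lam\<^sup>2 * t\<^sup>2 * h c t) = \<kappa> 0 (R * t) * ((2 * real (\<alpha> c) + 1) * a * h c t)"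
      by simp
    then show ?thesis
      unfolding g2_def g_def e_def of_real_mult[symmetric] of_real_minus[symmetric] of_real_add[symmetric] of_real_diff[symmetric] of_real_eq_iff
      by (simp add: algebra_simps)
  qed
  have Hw: "hermite_op lam (w R) x = complex_of_real \<nu> * w R x - (\<Sum>c\<in>Basis. prodfun ((g R)(c := e R c)) x)" for R x
  proof -
    have "hermite_op lam (w R) x
       = (\<Sum>c\<in>Basis. prodfun ((g R)(c := (\<lambda>t. - g2 R c t + complex_of_real (lam\<^sup>2 * t\<^sup>2) * g R c t))) x)"
      unfolding w_def by (rule hermite_op_prodfun[OF dg cg2])
    also have "\<dots> = (\<Sum>c\<in>Basis. complex_of_real ((2 * real (\<alpha> c) + 1) * a) * w R x - prodfun ((g R)(c := e R c)) x)"
      unfolding ode w_def by (intro sum.cong refl) (simp add: prodfun_upd prodfun_remove[of _ "g R"] algebra_simps)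
    finally show ?thesis by (simp add: \<nu>_def heig_def sum_subtractf sum_distrib_right del: of_real_mult)
  qed
  have gle: "cmod (g R b t) \<le> cmod (D b t)" for R b t
  proof -
    have "\<bar>\<kappa> 0 (R * t)\<bar> * \<bar>h b t\<bar> \<le> K * (\<bar>h b t\<bar> + 2 * \<bar>h1 b t\<bar>)"
      using \<kappa>(3) \<kappa>(4)[of 0 "R * t"] by (intro mult_mono) auto
    then show ?thesis using \<kappa>(3) unfolding g_def D_def norm_of_real abs_mult by simp
  qed
  have ele: "cmod (e R b t) \<le> R * cmod (D b t)" if R: "0 < R" "R \<le> 1" for R b t
  proof -
    have i: "R\<^sup>2 \<le> R" using R by (simp add: power2_eq_square mult_left_le_one_le)
    have "R\<^sup>2 * \<bar>\<kappa> 2 (R * t)\<bar> * \<bar>h b t\<bar> \<le> R * K * \<bar>h b t\<bar>"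
      using i R \<kappa>(3) \<kappa>(4)[of 2 "R * t"] by (intro mult_right_mono mult_mono) auto
    moreover have "2 * R * \<bar>\<kappa> 1 (R * t)\<bar> * \<bar>h1 b t\<bar> \<le> 2 * R * K * \<bar>h1 b t\<bar>"
      using R \<kappa>(4)[of 1 "R * t"] by (intro mult_right_mono mult_left_mono) auto
    moreover have "\<bar>R\<^sup>2 * \<kappa> 2 (R * t) * h b t + 2 * R * \<kappa> 1 (R * t) * h1 b t\<bar>
      \<le> R\<^sup>2 * \<bar>\<kappa> 2 (R * t)\<bar> * \<bar>h b t\<bar> + 2 * R * \<bar>\<kappa> 1 (R * t)\<bar> * \<bar>h1 b t\<bar>"
      using R by (intro order_trans[OF abs_triangle_ineq]) (simp add: abs_mult)
    ultimately have "\<bar>R\<^sup>2 * \<kappa> 2 (R * t) * h b t + 2 * R * \<kappa> 1 (R * t) * h1 b t\<bar> \<le> R * (K * (\<bar>h b t\<bar> + 2 * \<bar>h1 b t\<bar>))"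
      by (simp add: algebra_simps)
    also have "\<dots> = R * cmod (D b t)" using \<kappa>(3) unfolding D_def norm_of_real by simp
    finally show ?thesis unfolding e_def norm_of_real .
  qed
  have Ple: "cmod (prodfun ((g R)(c := e R c)) x) \<le> R * cmod (prodfun D x)" if "0 < R" "R \<le> 1" "c \<in> Basis" for R c x
  proof -
    have "cmod (prodfun ((g R)(c := e R c)) x) = cmod (e R c (x \<bullet> c)) * (\<Prod>b\<in>Basis - {c}. cmod (g R b (x \<bullet> b)))"
      by (simp add: prodfun_upd[OF that(3)] norm_mult prod_norm)
    also have "\<dots> \<le> (R * cmod (D c (x \<bullet> c))) * (\<Prod>b\<in>Basis - {c}. cmod (D b (x \<bullet> b)))"
      using that by (intro mult_mono ele prod_mono) (auto intro!: gle prod_nonneg)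
    also have "\<dots> = R * cmod (prodfun D x)"
      by (simp add: prodfun_remove[OF that(3), of D] norm_mult prod_norm)
    finally show ?thesis .
  qed
  have wle: "cmod (w R x) \<le> cmod (prodfun D x)" for R x
    unfolding w_def prodfun_def prod_norm[symmetric] by (intro prod_mono) (auto intro: gle)
  have wL2: "w R \<in> L2" for R
    by (rule L2_dominated[OF DL2 _ wle]) (unfold w_def, intro borel_measurable_continuous_onI continuous_prodfun cg)
  have iu: "integrable lborel (\<lambda>x. u x * v x)" if "v \<in> L2" for v
    using l2_inner_integrable[OF u(1) L2_cnj[OF that]] by simp
  define C where "C = (LINT x|lborel. cmod (u x * prodfun D x))"
  have iuP: "integrable lborel (\<lambda>x. u x * prodfun ((g R)(c := e R c)) x)"
    and uPle: "cmod (LINT x|lborel. u x * prodfun ((g R)(c := e R c)) x) \<le> R * C" if "0 < R" "R \<le> 1" "c \<in> Basis" for R c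
  proof -
    have L: "prodfun ((g R)(c := e R c)) \<in> L2"
    proof (rule L2_dominated[OF L2_scale[OF DL2, of "complex_of_real R"]])
      show "prodfun ((g R)(c := e R c)) \<in> borel_measurable borel"
        by (intro borel_measurable_continuous_onI continuous_prodfun) (auto simp: cg ce)
      show "cmod (prodfun ((g R)(c := e R c)) x) \<le> cmod (complex_of_real R * prodfun D x)" for x
        using Ple[OF that, of x] that by (simp add: norm_mult norm_divide)
    qed
    show i: "integrable lborel (\<lambda>x. u x * prodfun ((g R)(c := e R c)) x)" by (rule iu[OF L])
    have "cmod (LINT x|lborel. u x * prodfun ((g R)(c := e R c)) x) \<le> (LINT x|lborel. cmod (u x * prodfun ((g R)(c := e R c)) x))"
      by (rule integral_norm_bound)
    also have "\<dots> \<le> (LINT x|lborel. R * cmod (u x * prodfun D x))"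
    proof (rule integral_mono)
      show "cmod (u x * prodfun ((g R)(c := e R c)) x) \<le> R * cmod (u x * prodfun D x)" for x
        using mult_left_mono[OF Ple[OF that, of x] norm_ge_zero[of "u x"]] by (simp only: norm_mult mult.left_commute[of R])
      show "integrable lborel (\<lambda>x. R * cmod (u x * prodfun D x))"
        by (intro integrable_mult_right integrable_norm iu DL2)
    qed (use i in auto)
    finally show "cmod (LINT x|lborel. u x * prodfun ((g R)(c := e R c)) x) \<le> R * C" by (simp add: C_def)
  qed
  have main: "cmod (complex_of_real (\<nu> - \<mu>) * (LINT x|lborel. u x * w R x)) \<le> real DIM(real ^ 'n) * (R * C)" if R: "0 < R" "R \<le> 1" for R
  proof -
    have "(LINT x|lborel. hermite_op lam u x * w R x) = (LINT x|lborel. u x * hermite_op lam (w R) x)"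
    proof (rule hermite_op_symmetric[OF u(2)])
      show "C2 (w R)" unfolding w_def by (rule prodfun_C2(1)[OF dg cg2])
      show "compact (cbox (- ((2 / R) *\<^sub>R One)) ((2 / R) *\<^sub>R One :: real ^ 'n))" by (rule compact_cbox)
      fix x :: "real ^ 'n" assume "x \<notin> cbox (- ((2 / R) *\<^sub>R One)) ((2 / R) *\<^sub>R One)"
      then obtain b where b: "b \<in> Basis" "\<not> (- (2 / R) \<le> x \<bullet> b \<and> x \<bullet> b \<le> 2 / R)"
        by (auto simp: mem_box inner_diff_left)
      then have "\<bar>R * (x \<bullet> b)\<bar> > 2" using R by (auto simp: abs_mult field_simps abs_if)
      then have "g R b (x \<bullet> b) = 0" using \<kappa>(5) by (simp add: g_def)
      then show "w R x = 0" using b by (auto simp: w_def prodfun_remove[of b])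
    qed
    also have "(LINT x|lborel. hermite_op lam u x * w R x) = complex_of_real \<mu> * (LINT x|lborel. u x * w R x)"
      by (simp add: eig mult.assoc)
    also have "(LINT x|lborel. u x * hermite_op lam (w R) x)
       = (LINT x|lborel. complex_of_real \<nu> * (u x * w R x) - (\<Sum>c\<in>Basis. u x * prodfun ((g R)(c := e R c)) x))"
      by (intro Bochner_Integration.integral_cong refl) (simp add: Hw right_diff_distrib sum_distrib_left)
    also have "\<dots> = complex_of_real \<nu> * (LINT x|lborel. u x * w R x) - (\<Sum>c\<in>Basis. LINT x|lborel. u x * prodfun ((g R)(c := e R c)) x)"
      using iu[OF wL2[of R]] iuP[OF R] by (simp add: Bochner_Integration.integral_diff Bochner_Integration.integral_sum)
    finally have "complex_of_real (\<nu> - \<mu>) * (LINT x|lborel. u x * w R x) = (\<Sum>c\<in>Basis. LINT x|lborel. u x * prodfun ((g R)(c := e R c)) x)"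
      by (simp add: left_diff_distrib)
    also have "cmod \<dots> \<le> (\<Sum>c\<in>(Basis :: (real ^ 'n) set). R * C)" by (intro sum_norm_le uPle R)
    finally show ?thesis by simp
  qed
  have "(\<lambda>n. LINT x|lborel. u x * w (inverse (real (Suc n))) x) \<longlonglongrightarrow> (LINT x|lborel. u x * hfun a \<alpha> x)"
  proof (rule integral_dominated_convergence[where w = "\<lambda>x. cmod (u x * prodfun D x)"])
    have L: "hfun a \<alpha> \<in> L2" "w R \<in> L2" for R using hfun_L2[OF a] wL2 by blast+
    show "(\<lambda>x. u x * hfun a \<alpha> x) \<in> borel_measurable lborel"
      using iu[OF L(1)] by auto
    show "(\<lambda>x. u x * w (inverse (real (Suc n))) x) \<in> borel_measurable lborel" for n
      using iu[OF L(2)] by auto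
    show "integrable lborel (\<lambda>x. cmod (u x * prodfun D x))" by (intro integrable_norm iu DL2)
    show "AE x in lborel. cmod (u x * w (inverse (real (Suc n))) x) \<le> cmod (u x * prodfun D x)" for n
      by (rule AE_I2) (simp add: norm_mult mult_left_mono wle)
    show "AE x in lborel. (\<lambda>n. u x * w (inverse (real (Suc n))) x) \<longlonglongrightarrow> u x * hfun a \<alpha> x"
    proof (rule AE_I2)
      fix x :: "real ^ 'n"
      have "(\<lambda>n. g (inverse (real (Suc n))) b t) \<longlonglongrightarrow> complex_of_real (h b t)" for b t
      proof -
        have "(\<lambda>n. inverse (real (Suc n)) * t) \<longlonglongrightarrow> 0 * t"
          by (intro tendsto_intros LIMSEQ_inverse_real_of_nat)
        then have "(\<lambda>n. inverse (real (Suc n)) * t) \<longlonglongrightarrow> 0" by simp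
        moreover have "isCont (\<kappa> 0) 0" using \<kappa>(1) DERIV_isCont by blast
        ultimately have "(\<lambda>n. \<kappa> 0 (inverse (real (Suc n)) * t)) \<longlonglongrightarrow> \<kappa> 0 0" using isCont_tendsto_compose by blast
        then have "(\<lambda>n. complex_of_real (\<kappa> 0 (inverse (real (Suc n)) * t) * h b t)) \<longlonglongrightarrow> complex_of_real (\<kappa> 0 0 * h b t)"
          by (intro tendsto_intros)
        then show ?thesis by (simp add: g_def \<kappa>(2))
      qed
      then show "(\<lambda>n. u x * w (inverse (real (Suc n))) x) \<longlonglongrightarrow> u x * hfun a \<alpha> x"
        unfolding w_def hfun_def prodfun_def h_def by (intro tendsto_intros)
    qed
  qed
  then have L1: "(\<lambda>n. cmod (complex_of_real (\<nu> - \<mu>) * (LINT x|lborel. u x * w (inverse (real (Suc n))) x)))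
     \<longlonglongrightarrow> cmod (complex_of_real (\<nu> - \<mu>) * (LINT x|lborel. u x * hfun a \<alpha> x))"
    by (intro tendsto_intros)
  have L2: "(\<lambda>n. real DIM(real ^ 'n) * (inverse (real (Suc n)) * C)) \<longlonglongrightarrow> real DIM(real ^ 'n) * (0 * C)"
    by (intro tendsto_intros LIMSEQ_inverse_real_of_nat)
  have L3: "cmod (complex_of_real (\<nu> - \<mu>) * (LINT x|lborel. u x * w (inverse (real (Suc n))) x)) \<le> real DIM(real ^ 'n) * (inverse (real (Suc n)) * C)" for n
    by (rule main) (auto simp: inverse_le_1_iff)
  have "cmod (complex_of_real (\<nu> - \<mu>) * (LINT x|lborel. u x * hfun a \<alpha> x)) \<le> real DIM(real ^ 'n) * (0 * C)"
    by (rule LIMSEQ_le[OF L1 L2]) (use L3 in blast)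
  then have "(LINT x|lborel. u x * hfun a \<alpha> x) = 0"
    using ne by (simp add: \<nu>_def a_def)
  then show ?thesis by (simp add: l2_inner_def hfun_real a_def)
qed

text \<open>The choice operator in the functional calculus may select any orthonormal basis of eigenfunctions. Its
  members are orthogonal to all Hermite functions with another eigenvalue, so that the coefficients of
  the result with respect to the Hermite basis are the same for each choice.\<close>

lemma functional_calculus_coeffs:
  fixes \<phi> :: "'n::finite fn"
  assumes lam: "lam \<noteq> 0" and m: "\<And>s. s > 0 \<Longrightarrow> \<bar>m s\<bar> \<le> 1" and \<phi>: "\<phi> \<in> L2"
  defines "\<psi> \<equiv> functional_calculus (hermite_op lam) m \<phi>" and "h \<equiv> hbasis \<bar>lam\<bar>" and "\<nu> \<equiv> hbasis_eig TYPE('n) \<bar>lam\<bar>"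
  shows "\<psi> \<in> L2" and "l2_inner \<psi> (h l) = complex_of_real (m (\<nu> l)) * l2_inner \<phi> (h l)"
    and "(\<lambda>k. m (\<nu> k) * (cmod (l2_inner \<phi> (h k)))\<^sup>2) sums Re (l2_inner \<psi> \<phi>)"
proof -
  have a: "\<bar>lam\<bar> > 0" using lam by simp
  have h: "orthonormal h" "l2_total h" unfolding h_def using hbasis_orthonormal[OF a] hbasis_total[OF a] by auto
  have hL2: "h k \<in> L2" for k using h(1) by (simp add: orthonormal_def)
  let ?P = "\<lambda>\<psi>. \<psi> \<in> L2 \<and> (\<exists>e \<mu>. orthonormal_eigenbasis (hermite_op lam) e \<mu> \<and>
     (\<lambda>N. l2_norm (\<lambda>x. \<psi> x - (\<Sum>k<N. complex_of_real (m (\<mu> k)) * l2_inner \<phi> (e k) * e k x))) \<longlonglongrightarrow> 0)"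
  have "summable (\<lambda>k. (cmod (complex_of_real (m (\<nu> k)) * l2_inner \<phi> (h k)))\<^sup>2)"
  proof (rule summable_comparison_test'[OF Bessel_summable[OF h(1) \<phi>], of 0])
    fix k
    have "(m (\<nu> k))\<^sup>2 \<le> 1" using m[OF hbasis_eig_pos[OF a]] by (simp add: \<nu>_def abs_square_le_1)
    then show "norm ((cmod (complex_of_real (m (\<nu> k)) * l2_inner \<phi> (h k)))\<^sup>2) \<le> (cmod (l2_inner \<phi> (h k)))\<^sup>2"
      by (simp add: norm_mult power_mult_distrib mult_left_le_one_le)
  qed
  from Riesz_Fischer[OF h(1) this] obtain \<psi>0 where \<psi>0: "\<psi>0 \<in> L2"
    "(\<lambda>N. l2_norm (\<lambda>x. \<psi>0 x - (\<Sum>k<N. complex_of_real (m (\<nu> k)) * l2_inner \<phi> (h k) * h k x))) \<longlonglongrightarrow> 0"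
    by blast
  have "orthonormal_eigenbasis (hermite_op lam) h \<nu>"
    unfolding h_def \<nu>_def by (rule hbasis_eigenbasis[OF lam])
  with \<psi>0 have "?P \<psi>0" by (intro conjI exI[of _ h] exI[of _ \<nu>])
  then have "?P \<psi>" unfolding \<psi>_def functional_calculus_def by (rule someI[of ?P])
  then obtain e \<mu> where \<psi>: "\<psi> \<in> L2" and e: "orthonormal_eigenbasis (hermite_op lam) e \<mu>"
    and lim: "(\<lambda>N. l2_norm (\<lambda>x. \<psi> x - (\<Sum>k<N. complex_of_real (m (\<mu> k)) * l2_inner \<phi> (e k) * e k x))) \<longlonglongrightarrow> 0"
    by (elim conjE exE)
  have eo: "orthonormal e" "l2_total e" and ee: "e k \<in> L2" "C2 (e k)" "hermite_op lam (e k) x = complex_of_real (\<mu> k) * e k x" for k x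
    using e by (auto simp: orthonormal_eigenbasis_def orthonormal_def l2_total_def)
  show "\<psi> \<in> L2" by (rule \<psi>)
  show coeff: "l2_inner \<psi> (h l) = complex_of_real (m (\<nu> l)) * l2_inner \<phi> (h l)" for l
  proof -
    let ?F = "\<lambda>N x. \<Sum>k<N. (complex_of_real (m (\<mu> k)) * l2_inner \<phi> (e k)) * e k x"
    have "(\<lambda>N. l2_inner (?F N) (h l)) \<longlonglongrightarrow> l2_inner \<psi> (h l)"
      by (rule l2_inner_tendsto[OF \<psi> L2_lincomb[OF ee(1)] hL2 lim])
    moreover have "l2_inner (?F N) (h l) = complex_of_real (m (\<nu> l)) * (\<Sum>k<N. l2_inner \<phi> (e k) * cnj (l2_inner (h l) (e k)))" for N
    proof -
      have "l2_inner (?F N) (h l) = (\<Sum>k<N. (complex_of_real (m (\<mu> k)) * l2_inner \<phi> (e k)) * l2_inner (e k) (h l))"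
        by (rule l2_inner_sum_left[OF ee(1) hL2])
      also have "\<dots> = (\<Sum>k<N. complex_of_real (m (\<nu> l)) * (l2_inner \<phi> (e k) * cnj (l2_inner (h l) (e k))))"
      proof (intro sum.cong refl)
        fix k
        show "(complex_of_real (m (\<mu> k)) * l2_inner \<phi> (e k)) * l2_inner (e k) (h l)
          = complex_of_real (m (\<nu> l)) * (l2_inner \<phi> (e k) * cnj (l2_inner (h l) (e k)))"
        proof (cases "\<mu> k = \<nu> l")
          case True
          then show ?thesis by (simp add: l2_inner_cnj)
        next
          case False
          then have "l2_inner (e k) (h l) = 0"
            using eigenfunction_orthogonal[OF lam ee] by (simp add: h_def \<nu>_def hbasis_def hbasis_eig_def)
          then show ?thesis by (simp add: l2_inner_cnj)
        qed
      qed
      finally show ?thesis by (simp only: sum_distrib_left)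
    qed
    moreover have "(\<lambda>N. complex_of_real (m (\<nu> l)) * (\<Sum>k<N. l2_inner \<phi> (e k) * cnj (l2_inner (h l) (e k))))
       \<longlonglongrightarrow> complex_of_real (m (\<nu> l)) * l2_inner \<phi> (h l)"
      using Parseval[OF eo \<phi> hL2[of l]] by (intro tendsto_intros) (simp add: sums_def)
    ultimately show ?thesis using LIMSEQ_unique by auto
  qed
  have "(\<lambda>k. l2_inner \<psi> (h k) * cnj (l2_inner \<phi> (h k))) sums l2_inner \<psi> \<phi>"
    by (rule Parseval[OF h \<psi> \<phi>])
  moreover have "l2_inner \<psi> (h k) * cnj (l2_inner \<phi> (h k)) = complex_of_real (m (\<nu> k) * (cmod (l2_inner \<phi> (h k)))\<^sup>2)" for k
    by (simp add: coeff mult.assoc complex_norm_square[symmetric] del: of_real_power) 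
  ultimately have "(\<lambda>k. complex_of_real (m (\<nu> k) * (cmod (l2_inner \<phi> (h k)))\<^sup>2)) sums l2_inner \<psi> \<phi>" by simp
  from sums_Re[OF this] show "(\<lambda>k. m (\<nu> k) * (cmod (l2_inner \<phi> (h k)))\<^sup>2) sums Re (l2_inner \<psi> \<phi>)"
    by (simp only: Re_complex_of_real)
qed

section \<open>Smooth functions with controlled derivatives\<close>

definition ctrl0 :: "(nat \<Rightarrow> real) \<Rightarrow> real \<Rightarrow> real \<Rightarrow> nat \<Rightarrow> ('a::euclidean_space \<Rightarrow> complex) \<Rightarrow> bool" where
  "ctrl0 W R A j u \<longleftrightarrow> (\<forall>x. u differentiable (at x)) \<and>
     (\<forall>x. x \<notin> cbox (- (R *\<^sub>R One)) (R *\<^sub>R One) \<longrightarrow> u x = 0) \<and> (\<forall>x. cmod (u x) \<le> A * W j)"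

fun ctrl :: "(nat \<Rightarrow> real) \<Rightarrow> real \<Rightarrow> real \<Rightarrow> nat \<Rightarrow> nat \<Rightarrow> ('a::euclidean_space \<Rightarrow> complex) \<Rightarrow> bool" where
  "ctrl W R A 0 j u = ctrl0 W R A j u"
| "ctrl W R A (Suc n) j u = (ctrl0 W R A j u \<and> (\<forall>b\<in>Basis. ctrl W R A n (Suc j) (dd b u)))"

text \<open>All derivatives \<open>D\<close> of order \<open>k\<close> of \<open>u\<close> exist, vanish outside the cube of half side length \<open>R\<close> and satisfy
  \<open>\<bar>D u\<bar> \<le> A * W (j + k)\<close>. The offset \<open>j\<close> makes the class stable under differentiation with the same
  constant \<open>A\<close>. The depth \<open>n\<close> of \<open>ctrl\<close> turns this coinductive condition into inductions over numbers.\<close>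

definition Bd :: "(nat \<Rightarrow> real) \<Rightarrow> real \<Rightarrow> real \<Rightarrow> nat \<Rightarrow> ('a::euclidean_space \<Rightarrow> complex) \<Rightarrow> bool" where
  "Bd W R A j u \<longleftrightarrow> (\<forall>n. ctrl W R A n j u)"

lemma ctrl_ctrl0: "ctrl W R A n j u \<Longrightarrow> ctrl0 W R A j u"
  by (cases n) auto

lemma Bd_ctrl0: "Bd W R A j u \<Longrightarrow> ctrl0 W R A j u"
  unfolding Bd_def using ctrl_ctrl0 by blast

lemma Bd_dd: "Bd W R A j u \<Longrightarrow> b \<in> Basis \<Longrightarrow> Bd W R A (Suc j) (dd b u)"
  unfolding Bd_def using ctrl.simps(2) by blast

lemma BdI:
  assumes "ctrl0 W R A j u" "\<And>b. b \<in> Basis \<Longrightarrow> Bd W R A (Suc j) (dd b u)"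
  shows "Bd W R A j u"
  unfolding Bd_def
proof
  fix n show "ctrl W R A n j u" using assms by (cases n) (auto simp: Bd_def)
qed

lemma Bd_differentiable: "Bd W R A j u \<Longrightarrow> u differentiable (at x)"
  using Bd_ctrl0[of W R A j u] by (simp add: ctrl0_def)

lemma Bd_outside: "Bd W R A j u \<Longrightarrow> x \<notin> cbox (- (R *\<^sub>R One)) (R *\<^sub>R One) \<Longrightarrow> u x = 0"
  using Bd_ctrl0[of W R A j u] by (simp add: ctrl0_def)

lemma Bd_bound: "Bd W R A j u \<Longrightarrow> cmod (u x) \<le> A * W j"
  using Bd_ctrl0[of W R A j u] by (simp add: ctrl0_def)

lemma Bd_continuous: "Bd W R A j u \<Longrightarrow> continuous_on UNIV u"
  by (simp add: continuous_at_imp_continuous_on differentiable_imp_continuous_within Bd_differentiable)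

lemma ctrl_add: "ctrl W R A n j u \<Longrightarrow> ctrl W R B n j v \<Longrightarrow> ctrl W R (A + B) n j (\<lambda>x. u x + v x)"
proof (induction n arbitrary: j u v)
  case 0
  then show ?case
    by (auto simp: ctrl0_def distrib_right intro!: differentiable_add order_trans[OF norm_triangle_ineq] add_mono)
next
  case (Suc n)
  have "dd b (\<lambda>x. u x + v x) = (\<lambda>x. dd b u x + dd b v x)" for b
    using Suc.prems by (intro ext dd_add) (auto simp: ctrl0_def)
  moreover have "ctrl0 W R (A + B) j (\<lambda>x. u x + v x)"
    using Suc.prems
    by (auto simp: ctrl0_def distrib_right intro!: differentiable_add order_trans[OF norm_triangle_ineq] add_mono)
  ultimately show ?case using Suc by simp
qed

lemma Bd_add: "Bd W R A j u \<Longrightarrow> Bd W R B j v \<Longrightarrow> Bd W R (A + B) j (\<lambda>x. u x + v x)"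
  by (simp add: Bd_def ctrl_add)

lemma ctrl_cmult: "ctrl W R A n j u \<Longrightarrow> ctrl W R (cmod c * A) n j (\<lambda>x. c * u x)"
proof (induction n arbitrary: j u)
  case 0
  then show ?case
    by (auto simp: ctrl0_def norm_mult mult.assoc intro!: differentiable_mult mult_left_mono)
next
  case (Suc n)
  have "dd b (\<lambda>x. c * u x) = (\<lambda>x. c * dd b u x)" for b
    using Suc.prems by (intro ext dd_cmult) (auto simp: ctrl0_def)
  moreover have "ctrl0 W R (cmod c * A) j (\<lambda>x. c * u x)"
    using Suc.prems
    by (auto simp: ctrl0_def norm_mult mult.assoc intro!: differentiable_mult mult_left_mono)
  ultimately show ?case using Suc by simp
qed

lemma Bd_cmult: "Bd W R A j u \<Longrightarrow> Bd W R (cmod c * A) j (\<lambda>x. c * u x)"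
  by (simp add: Bd_def ctrl_cmult)

lemma Bd_minus: "Bd W R A j u \<Longrightarrow> Bd W R A j (\<lambda>x. - u x)"
  using Bd_cmult[of W R A j u "-1"] by simp

text \<open>Conditions on the bounds that make the class stable under products of functions of single coordinates
  (\<open>W_mult\<close>) and under multiplication by coordinates (\<open>W_step\<close>).\<close>

locale weights =
  fixes W :: "nat \<Rightarrow> real" and c :: real
  assumes W0: "W 0 = 1" and W_mono: "W k \<le> W (Suc k)" and W_step: "real (Suc k) * W k \<le> c * W (Suc k)"
    and W_mult: "W i * W j \<le> W (i + j)"
begin

lemma W_ge1: "1 \<le> W k"
  by (induction k) (use W0 W_mono order_trans in \<open>auto\<close>)

lemma c_nonneg: "c \<ge> 0"
proof -
  have "0 \<le> c * W 1" using W_step[of 0] W_ge1[of 0] by simp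
  then show ?thesis using W_ge1[of 1] by (simp add: zero_le_mult_iff)
qed

lemma Bd_nonneg: assumes "Bd W R A j u" shows "A \<ge> 0"
proof -
  have "0 \<le> A * W j" using Bd_bound[OF assms, of 0] norm_ge_zero order_trans by blast
  then show ?thesis using W_ge1[of j] by (simp add: zero_le_mult_iff)
qed

lemma Bd_weaken: assumes "Bd W R A j u" "A \<le> B" shows "Bd W R B j u"
proof -
  have "ctrl W R A n j u \<Longrightarrow> ctrl W R B n j u" for n j and u :: "'a \<Rightarrow> complex"
  proof (induction n arbitrary: j u)
    case 0
    then show ?case using assms(2) W_ge1[of j] by (auto simp: ctrl0_def intro: order_trans mult_right_mono)
  next
    case (Suc n)
    moreover have "ctrl0 W R B j u"
      using Suc.prems assms(2) W_ge1[of j] by (auto simp: ctrl0_def intro: order_trans mult_right_mono)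
    ultimately show ?case by simp
  qed
  then show ?thesis using assms(1) by (simp add: Bd_def)
qed

lemma Bd_raise: assumes "Bd W R A j u" shows "Bd W R A (Suc j) u"
proof -
  have A: "A \<ge> 0" by (rule Bd_nonneg[OF assms])
  have "ctrl W R A n j u \<Longrightarrow> ctrl W R A n (Suc j) u" for n j and u :: "'a \<Rightarrow> complex"
  proof (induction n arbitrary: j u)
    case 0
    then show ?case using A W_mono[of j] by (auto simp: ctrl0_def intro: order_trans mult_left_mono)
  next
    case (Suc n)
    moreover have "ctrl0 W R A (Suc j) u"
      using Suc.prems A W_mono[of j] by (auto simp: ctrl0_def intro: order_trans mult_left_mono)
    ultimately show ?case by simp
  qed
  then show ?thesis using assms(1) by (simp add: Bd_def)
qed

lemma coord_has_derivative:
  "((\<lambda>x. complex_of_real (x \<bullet> e)) has_derivative (\<lambda>h. complex_of_real (h \<bullet> e))) (at x)"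
  by (intro has_derivative_of_real derivative_eq_intros) auto

lemma coord_differentiable: "(\<lambda>x. complex_of_real (x \<bullet> e)) differentiable (at x)"
  using coord_has_derivative by (auto simp: differentiable_def)

lemma dd_coord_mult:
  assumes "u differentiable (at x)"
  shows "dd b (\<lambda>x. complex_of_real (x \<bullet> e) * u x) x
    = complex_of_real (b \<bullet> e) * u x + complex_of_real (x \<bullet> e) * dd b u x"
  using dd_mult[OF coord_differentiable assms, of b e] dd_eqI[OF coord_has_derivative, of b e x] by simp

lemma coord_mult_bound:
  assumes "Bd W R A j u" "e \<in> Basis" "R \<ge> 0" shows "cmod (complex_of_real (x \<bullet> e) * u x) \<le> R * A * W j"
proof (cases "x \<in> cbox (- (R *\<^sub>R One)) (R *\<^sub>R One)")
  case True
  then have "\<bar>x \<bullet> e\<bar> \<le> R" using assms(2) by (auto simp: mem_box inner_diff_left abs_le_iff minus_le_iff)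
  then have "\<bar>x \<bullet> e\<bar> * cmod (u x) \<le> R * (A * W j)"
    using Bd_bound[OF assms(1), of x] assms(3) by (intro mult_mono) auto
  then show ?thesis by (simp add: norm_mult mult.assoc)
next
  case False
  have "0 \<le> R * A * W j"
    using Bd_nonneg[OF assms(1)] W_ge1[of j] assms(3) by (intro mult_nonneg_nonneg) auto
  then show ?thesis using Bd_outside[OF assms(1) False] by simp
qed

text \<open>Differentiating \<open>k\<close> times a coordinate times \<open>u\<close> leaves at most \<open>k\<close> terms in which the coordinate was
  differentiated; \<open>W_step\<close> trades the factor \<open>k\<close> for one order of differentiation. The constant grows
  by \<open>R + c\<close> only, which keeps iterates of the operators below under geometric control.\<close>

lemma Bd_coord:
  assumes u: "Bd W R A j u" and R: "R \<ge> 0" and e: "e \<in> Basis"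
  shows "Bd W R ((R + c) * A) j (\<lambda>x. complex_of_real (x \<bullet> e) * u x)"
proof -
  have A: "A \<ge> 0" by (rule Bd_nonneg[OF u])
  have be: "cmod (complex_of_real (b \<bullet> e)) \<le> 1" if "b \<in> Basis" for b
    using that e by (auto simp: inner_Basis)
  \<comment> \<open>The remainder \<open>s\<close> collects the \<open>r\<close> terms in which the coordinate has been differentiated.\<close>
  have claim: "ctrl W R ((R + c) * A) n (Suc j) (\<lambda>x. complex_of_real (x \<bullet> e) * u x + s x)"
    if "Bd W R A (Suc j) u" "Bd W R (real r * A) j s" "r \<le> Suc j" for n j u s r
    using that
  proof (induction n arbitrary: j u s r)
    have c0: "ctrl0 W R ((R + c) * A) (Suc j) (\<lambda>x. complex_of_real (x \<bullet> e) * u x + s x)"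
      if p: "Bd W R A (Suc j) u" "Bd W R (real r * A) j s" "r \<le> Suc j" for j u s r
      unfolding ctrl0_def
    proof (intro conjI allI impI)
      show "(\<lambda>x. complex_of_real (x \<bullet> e) * u x + s x) differentiable (at x)" for x
        by (intro differentiable_add differentiable_mult coord_differentiable Bd_differentiable[OF p(1)] Bd_differentiable[OF p(2)])
      show "complex_of_real (x \<bullet> e) * u x + s x = 0" if "x \<notin> cbox (- (R *\<^sub>R One)) (R *\<^sub>R One)" for x
        using Bd_outside[OF p(1) that] Bd_outside[OF p(2) that] by simp
      fix x
      have "real r * W j \<le> real (Suc j) * W j" using p(3) W_ge1[of j] by (intro mult_right_mono) auto
      also have "\<dots> \<le> c * W (Suc j)" by (rule W_step)
      finally have "A * (real r * W j) \<le> A * (c * W (Suc j))" using A by (intro mult_left_mono)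
      then have "cmod (s x) \<le> c * A * W (Suc j)"
        using Bd_bound[OF p(2), of x] by (simp add: mult_ac)
      then show "cmod (complex_of_real (x \<bullet> e) * u x + s x) \<le> (R + c) * A * W (Suc j)"
        using coord_mult_bound[OF p(1) e R, of x] norm_triangle_ineq[of "complex_of_real (x \<bullet> e) * u x" "s x"]
        by (simp add: distrib_right)
    qed
    case 0
    then show ?case using c0 by simp
    case (Suc n)
    note p = Suc.prems
    have "ctrl W R ((R + c) * A) n (Suc (Suc j)) (dd b (\<lambda>x. complex_of_real (x \<bullet> e) * u x + s x))" if b: "b \<in> Basis" for b
    proof -
      have eq: "dd b (\<lambda>x. complex_of_real (x \<bullet> e) * u x + s x)
        = (\<lambda>x. complex_of_real (x \<bullet> e) * dd b u x + (complex_of_real (b \<bullet> e) * u x + dd b s x))"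
        by (rule ext, subst dd_add)
          (auto simp: dd_coord_mult[OF Bd_differentiable[OF p(1)]]
            intro!: differentiable_mult coord_differentiable Bd_differentiable[OF p(1)] Bd_differentiable[OF p(2)])
      have "Bd W R (cmod (complex_of_real (b \<bullet> e)) * A + real r * A) (Suc j) (\<lambda>x. complex_of_real (b \<bullet> e) * u x + dd b s x)"
        by (intro Bd_add Bd_cmult p(1) Bd_dd[OF p(2) b])
      then have "Bd W R (real (Suc r) * A) (Suc j) (\<lambda>x. complex_of_real (b \<bullet> e) * u x + dd b s x)"
        using mult_right_mono[OF be[OF b] A] by (elim Bd_weaken) (simp add: distrib_right)
      then show ?thesis unfolding eq using p(3) by (intro Suc.IH[of "Suc j" _ "Suc r"] Bd_dd[OF p(1) b]) auto
    qed
    then show ?case using c0[OF p] by simp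
  qed
  show ?thesis
  proof (rule BdI)
    have "R * A * W j \<le> (R + c) * A * W j"
      using A c_nonneg W_ge1[of j] by (intro mult_right_mono) auto
    then show "ctrl0 W R ((R + c) * A) j (\<lambda>x. complex_of_real (x \<bullet> e) * u x)"
      using Bd_outside[OF u] order_trans[OF coord_mult_bound[OF u e R]]
      by (auto simp: ctrl0_def intro!: differentiable_mult coord_differentiable Bd_differentiable[OF u])
    fix b :: 'a assume b: "b \<in> Basis"
    have eq: "dd b (\<lambda>x. complex_of_real (x \<bullet> e) * u x)
        = (\<lambda>x. complex_of_real (x \<bullet> e) * dd b u x + complex_of_real (b \<bullet> e) * u x)"
      by (rule ext) (simp add: dd_coord_mult[OF Bd_differentiable[OF u]])
    have "Bd W R (cmod (complex_of_real (b \<bullet> e)) * A) j (\<lambda>x. complex_of_real (b \<bullet> e) * u x)" by (rule Bd_cmult[OF u])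
    then have "Bd W R (real 1 * A) j (\<lambda>x. complex_of_real (b \<bullet> e) * u x)"
      using mult_right_mono[OF be[OF b] A] by (elim Bd_weaken) simp
    then show "Bd W R ((R + c) * A) (Suc j) (dd b (\<lambda>x. complex_of_real (x \<bullet> e) * u x))"
      unfolding eq Bd_def[of _ _ "(R + c) * A"] using claim[OF Bd_dd[OF u b], of 1] by auto
  qed
qed

lemma Bd_zero: "Bd W R 0 j (\<lambda>x. 0)"
proof -
  have "dd b (\<lambda>x::'a. 0) = (\<lambda>x. 0)" for b by (rule ext) (rule dd_eqI, simp)
  then have "ctrl W R 0 n j (\<lambda>x::'a. 0)" for n j by (induction n arbitrary: j) (auto simp: ctrl0_def)
  then show ?thesis by (simp add: Bd_def)
qed

lemma Bd_sum:
  "finite B \<Longrightarrow> (\<And>b. b \<in> B \<Longrightarrow> Bd W R A j (u b)) \<Longrightarrow> Bd W R (real (card B) * A) j (\<lambda>x. \<Sum>b\<in>B. u b x)"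
proof (induction B rule: finite_induct)
  case empty
  then show ?case using Bd_zero by simp
next
  case (insert b B)
  then have "Bd W R (A + real (card B) * A) j (\<lambda>x. u b x + (\<Sum>b\<in>B. u b x))" by (intro Bd_add) auto
  then show ?case using insert by (simp add: algebra_simps)
qed

lemma W_prod: "finite B \<Longrightarrow> (\<Prod>b\<in>B. W (n b)) \<le> W (\<Sum>b\<in>B. n b)"
proof (induction B rule: finite_induct)
  case (insert b B)
  have "W (n b) * (\<Prod>b\<in>B. W (n b)) \<le> W (n b) * W (\<Sum>b\<in>B. n b)"
    using insert W_ge1[of "n b"] by (intro mult_left_mono) auto
  also have "\<dots> \<le> W (n b + (\<Sum>b\<in>B. n b))" by (rule W_mult)
  finally show ?case using insert by simp
qed (simp add: W0)

lemma Bd_prodfun: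
  fixes G :: "'a::euclidean_space \<Rightarrow> nat \<Rightarrow> real \<Rightarrow> real"
  assumes G: "\<And>b k t. b \<in> Basis \<Longrightarrow> (G b k has_real_derivative G b (Suc k) t) (at t)"
    and le: "\<And>b k t. b \<in> Basis \<Longrightarrow> \<bar>G b k t\<bar> \<le> W k"
    and out: "\<And>b k t. b \<in> Basis \<Longrightarrow> \<bar>t\<bar> > R \<Longrightarrow> G b k t = 0"
  shows "Bd W R 1 (\<Sum>b\<in>Basis. \<alpha> b) (prodfun (\<lambda>b t. complex_of_real (G b (\<alpha> b) t)))"
proof -
  let ?P = "\<lambda>\<alpha>. prodfun (\<lambda>b t. complex_of_real (G b (\<alpha> b) t))"
  have d: "((\<lambda>t. complex_of_real (G b k t)) has_vector_derivative complex_of_real (G b (Suc k) t)) (at t)" if "b \<in> Basis" for b k t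
    using G[OF that] by (intro has_vector_derivative_of_real) (simp add: has_real_derivative_iff_has_vector_derivative)
  have ddP: "dd b (?P \<alpha>) = ?P (\<alpha>(b := Suc (\<alpha> b)))" if b: "b \<in> Basis" for b \<alpha>
  proof -
    have "dd b (?P \<alpha>) = prodfun ((\<lambda>b t. complex_of_real (G b (\<alpha> b) t))(b := (\<lambda>t. complex_of_real (G b (Suc (\<alpha> b)) t))))"
      using d b by (rule dd_prodfun[where g' = "\<lambda>b t. complex_of_real (G b (Suc (\<alpha> b)) t)"])
    also have "\<dots> = ?P (\<alpha>(b := Suc (\<alpha> b)))" by (rule prodfun_cong) auto
    finally show ?thesis .
  qed
  have c0: "ctrl0 W R 1 (\<Sum>b\<in>Basis. \<alpha> b) (?P \<alpha>)" for \<alpha>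
    unfolding ctrl0_def
  proof (intro conjI allI impI)
    show "?P \<alpha> differentiable (at x)" for x
      using d by (rule prodfun_differentiable[where g' = "\<lambda>b t. complex_of_real (G b (Suc (\<alpha> b)) t)"])
    show "?P \<alpha> x = 0" if x: "x \<notin> cbox (- (R *\<^sub>R One)) (R *\<^sub>R One)" for x
    proof -
      obtain b where b: "b \<in> Basis" "\<not> (- R \<le> x \<bullet> b \<and> x \<bullet> b \<le> R)"
        using x by (auto simp: mem_box inner_diff_left)
      then have "G b (\<alpha> b) (x \<bullet> b) = 0" by (intro out) (auto simp: abs_if)
      then show ?thesis using b(1) by (auto simp: prodfun_def)
    qed
    fix x :: 'a
    have "cmod (?P \<alpha> x) = (\<Prod>b\<in>Basis. \<bar>G b (\<alpha> b) (x \<bullet> b)\<bar>)"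
      by (simp add: prodfun_def prod_norm[symmetric])
    also have "\<dots> \<le> (\<Prod>b\<in>Basis. W (\<alpha> b))" by (intro prod_mono) (auto intro: le)
    also have "\<dots> \<le> W (\<Sum>b\<in>Basis. \<alpha> b)" by (rule W_prod) simp
    finally show "cmod (?P \<alpha> x) \<le> 1 * W (\<Sum>b\<in>Basis. \<alpha> b)" by simp
  qed
  have "ctrl W R 1 n (\<Sum>b\<in>Basis. \<alpha> b) (?P \<alpha>)" for n \<alpha>
  proof (induction n arbitrary: \<alpha>)
    case 0 then show ?case using c0 by simp
  next
    case (Suc n)
    have "ctrl W R 1 n (Suc (\<Sum>b\<in>Basis. \<alpha> b)) (dd b (?P \<alpha>))" if b: "b \<in> Basis" for b
    proof -
      have "(\<Sum>a\<in>Basis. (\<alpha>(b := Suc (\<alpha> b))) a) = Suc (\<Sum>b\<in>Basis. \<alpha> b)"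
        using b by (simp add: sum.remove[of Basis b])
      then show ?thesis unfolding ddP[OF b] using Suc.IH[of "\<alpha>(b := Suc (\<alpha> b))"] by simp
    qed
    then show ?case using c0 by simp
  qed
  then show ?thesis by (simp add: Bd_def)
qed

lemma Bd_hermite_op:
  fixes u :: "'n::finite fn"
  assumes u: "Bd W R A j u" and R: "R \<ge> 0"
  shows "Bd W R (real CARD('n) * (1 + lam\<^sup>2 * (R + c)\<^sup>2) * A) (j + 2) (hermite_op lam u)"
proof -
  let ?t = "\<lambda>b x. - dd b (dd b u) x + complex_of_real (lam\<^sup>2) * (complex_of_real (x \<bullet> b) * (complex_of_real (x \<bullet> b) * u x))"
  have 1: "Bd W R (A + cmod (complex_of_real (lam\<^sup>2)) * ((R + c) * ((R + c) * A))) (Suc (Suc j)) (?t b)" if b: "b \<in> Basis" for b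
    by (intro Bd_add Bd_minus Bd_dd u b Bd_cmult Bd_coord R Bd_raise)
  have "Bd W R ((1 + lam\<^sup>2 * (R + c)\<^sup>2) * A) (j + 2) (?t b)" if b: "b \<in> Basis" for b
  proof -
    have k: "A + cmod (complex_of_real (lam\<^sup>2)) * ((R + c) * ((R + c) * A)) = (1 + lam\<^sup>2 * (R + c)\<^sup>2) * A"
      unfolding norm_of_real by (simp add: power2_eq_square algebra_simps)
    show ?thesis using 1[OF that] unfolding k by simp
  qed
  then have "Bd W R (real (card (Basis :: (real ^ 'n) set)) * ((1 + lam\<^sup>2 * (R + c)\<^sup>2) * A)) (j + 2) (\<lambda>x. \<Sum>b\<in>Basis. ?t b x)"
    by (intro Bd_sum) auto
  moreover have "(\<lambda>x. \<Sum>b\<in>Basis. ?t b x) = hermite_op lam u"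
    unfolding hermite_op_def norm_sq_Basis partial_eq_dd
    by (auto simp: sum.distrib sum_negf sum_subtractf sum_distrib_left sum_distrib_right power2_eq_square mult_ac)
  ultimately show ?thesis by (simp add: mult.assoc)
qed

lemma Bd_hermite_op_power:
  fixes u :: "'n::finite fn"
  assumes u: "Bd W R A 0 u" and R: "R \<ge> 0"
  shows "Bd W R ((real CARD('n) * (1 + lam\<^sup>2 * (R + c)\<^sup>2)) ^ m * A) (2 * m) ((hermite_op lam ^^ m) u)"
proof (induction m)
  case (Suc m)
  from Bd_hermite_op[OF Suc.IH R, of lam] show ?case by (simp add: mult.assoc)
qed (use u in simp)

end

section \<open>The group Fourier transform on square integrable functions\<close>

lemma continuous_re_vec [continuous_intros]: "continuous_on S f \<Longrightarrow> continuous_on S (\<lambda>x. re_vec (f x))"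
  unfolding re_vec_def by (intro continuous_intros)

lemma continuous_im_vec [continuous_intros]: "continuous_on S f \<Longrightarrow> continuous_on S (\<lambda>x. im_vec (f x))"
  unfolding im_vec_def by (intro continuous_intros)

text \<open>The phase of the Schroedinger representation: \<open>schroedinger lam g\<close> is a translation followed by multiplication with \<open>cis\<close> of it.\<close>

definition hphase :: "real \<Rightarrow> 'n::finite heis \<Rightarrow> real ^ 'n \<Rightarrow> real" where
  "hphase lam g \<xi> = lam * (snd g + re_vec (fst g) \<bullet> \<xi> + re_vec (fst g) \<bullet> im_vec (fst g) / 2)"

lemma schroedinger_hphase: "schroedinger lam g \<phi> \<xi> = cis (hphase lam g \<xi>) * \<phi> (\<xi> + im_vec (fst g))"
  by (simp add: schroedinger_def Let_def cis_mult hphase_def algebra_simps)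

lemma continuous_hphase [continuous_intros]:
  "continuous_on S a \<Longrightarrow> continuous_on S b \<Longrightarrow> continuous_on S (\<lambda>x. hphase lam (a x) (b x))"
  unfolding hphase_def by (intro continuous_intros) auto

lemma lborel_pair_measurable:
  "measurable (lborel \<Otimes>\<^sub>M lborel) M = measurable (borel :: ('a::euclidean_space \<times> 'b::euclidean_space) measure) M"
  unfolding borel_prod[symmetric]
  by (intro measurable_cong_sets sets_pair_measure_cong) auto

lemma lborel_integral_uminus:
  fixes f :: "'a::euclidean_space \<Rightarrow> complex"
  assumes "f \<in> borel_measurable borel"
  shows "(LINT x|lborel. f (- x)) = (LINT x|lborel. f x)"
proof -
  have eq: "lborel = distr lborel borel (\<lambda>x::'a. - x)"
    using lborel_affine[of "-1" "0 :: 'a"] by (simp add: density_1)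
  have "(LINT x|distr lborel borel (\<lambda>x::'a. - x). f x) = (LINT x|lborel. f (- x))"
    using assms by (intro integral_distr) auto
  then show ?thesis using eq by metis
qed

lemma continuous_AE_zero:
  fixes u :: "'a::euclidean_space \<Rightarrow> complex"
  assumes c: "continuous_on UNIV u" and AE: "AE x in lborel. u x = 0"
  shows "u x = 0"
proof (rule ccontr)
  assume ne: "u x \<noteq> 0"
  let ?S = "{x. u x \<noteq> 0}"
  have op: "open ?S" using c by (rule open_Collect_neq[OF _ continuous_on_const])
  then have "?S \<in> null_sets lborel"
    using AE_iff_null_sets[of ?S lborel] AE by auto
  then have "?S \<in> null_sets lebesgue" by (rule null_sets_completionI)
  then have "negligible ?S" by (simp add: negligible_iff_null_sets)
  then show False using open_not_negligible[OF op] ne by blast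
qed

text \<open>The set \<open>K\<close> is a parameter, and not the closure of the support of \<open>f\<close>, so that explicit cubes can be
  used where a measure has to be estimated.\<close>

locale compact_supp =
  fixes f :: "'n::finite heis \<Rightarrow> complex" and K :: "'n heis set"
  assumes cont: "continuous_on UNIV f" and K: "compact K" and out: "\<And>g. g \<notin> K \<Longrightarrow> f g = 0"
begin

lemma integrable_f: "integrable lborel f"
  by (rule integrable_compact_support[OF cont K out])

definition mass :: real where "mass = (LINT g|lborel. cmod (f g))"

lemma mass_nonneg: "mass \<ge> 0" by (simp add: mass_def)

lemma measurable_f [measurable]: "f \<in> borel_measurable borel"
  by (rule borel_measurable_continuous_onI[OF cont])

lemma kernel_measurable:
  assumes [measurable]: "\<phi> \<in> borel_measurable borel"
  shows "(\<lambda>(g, \<xi>). f g * schroedinger lam g \<phi> \<xi>) \<in> borel_measurable (lborel \<Otimes>\<^sub>M lborel)"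
    and "(\<lambda>(g :: 'n heis, \<xi>). \<phi> (\<xi> + im_vec (fst g))) \<in> borel_measurable (lborel \<Otimes>\<^sub>M lborel)"
proof -
  have c: "continuous_on UNIV (\<lambda>p :: 'n heis \<times> (real ^ 'n). snd p + im_vec (fst (fst p)))"
    "continuous_on UNIV (\<lambda>p :: 'n heis \<times> (real ^ 'n). f (fst p) * cis (hphase lam (fst p) (snd p)))"
    by (intro continuous_intros continuous_on_compose2[OF cont]; simp)+
  note [measurable] = c[THEN borel_measurable_continuous_onI]
  have m: "(\<lambda>p :: 'n heis \<times> (real ^ 'n). \<phi> (snd p + im_vec (fst (fst p)))) \<in> borel_measurable borel"
    using measurable_compose[OF borel_measurable_continuous_onI[OF c(1)] assms] by (simp add: comp_def)
  then show "(\<lambda>(g :: 'n heis, \<xi>). \<phi> (\<xi> + im_vec (fst g))) \<in> borel_measurable (lborel \<Otimes>\<^sub>M lborel)"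
    by (simp add: lborel_pair_measurable case_prod_beta')
  have "(\<lambda>p. f (fst p) * cis (hphase lam (fst p) (snd p)) * \<phi> (snd p + im_vec (fst (fst p)))) \<in> borel_measurable borel"
    using m by measurable
  then show "(\<lambda>(g, \<xi>). f g * schroedinger lam g \<phi> \<xi>) \<in> borel_measurable (lborel \<Otimes>\<^sub>M lborel)"
    by (simp add: lborel_pair_measurable case_prod_beta' schroedinger_hphase mult.assoc)
qed

lemma dominating_integrable:
  assumes \<phi>: "\<phi> \<in> L2"
  shows "integrable (lborel \<Otimes>\<^sub>M lborel) (\<lambda>(g, \<xi>). cmod (f g) * (cmod (\<phi> (\<xi> + im_vec (fst g))))\<^sup>2)"
    and "(LINT p|(lborel \<Otimes>\<^sub>M lborel). (case p of (g, \<xi>) \<Rightarrow> cmod (f g) * (cmod (\<phi> (\<xi> + im_vec (fst g))))\<^sup>2)) = mass * (l2_norm \<phi>)\<^sup>2"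
proof -
  have m[measurable]: "\<phi> \<in> borel_measurable borel" using \<phi> by (simp add: L2_def)
  note [measurable] = kernel_measurable(2)[OF m]
  let ?H = "\<lambda>(g, \<xi>). cmod (f g) * (cmod (\<phi> (\<xi> + im_vec (fst g))))\<^sup>2"
  have t: "integrable lborel (\<lambda>\<xi>. (cmod (\<phi> (\<xi> + y)))\<^sup>2)" "(LINT \<xi>|lborel. (cmod (\<phi> (\<xi> + y)))\<^sup>2) = (l2_norm \<phi>)\<^sup>2" for y
    using lborel_integrable_translate[of "\<lambda>\<xi>. (cmod (\<phi> \<xi>))\<^sup>2" y] lborel_integral_translate[of "\<lambda>\<xi>. (cmod (\<phi> \<xi>))\<^sup>2" y] L2_integrable[OF \<phi>]
    by (auto simp: l2_norm_sq)
  have mf: "(\<lambda>(g, \<xi>). cmod (f g)) \<in> borel_measurable (lborel \<Otimes>\<^sub>M (lborel :: (real ^ 'n) measure))"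
    by measurable
  have "(\<lambda>p. (case p of (g, \<xi>) \<Rightarrow> cmod (f g)) * (cmod (case p of (g, \<xi>) \<Rightarrow> \<phi> (\<xi> + im_vec (fst g))))\<^sup>2)
     \<in> borel_measurable (lborel \<Otimes>\<^sub>M lborel)"
    using mf kernel_measurable(2)[OF m] by measurable
  then have mH: "?H \<in> borel_measurable (lborel \<Otimes>\<^sub>M lborel)" by (simp add: case_prod_beta')
  show i: "integrable (lborel \<Otimes>\<^sub>M lborel) ?H"
  proof (rule lborel_pair.Fubini_integrable[OF mH])
    show "integrable lborel (\<lambda>g. LINT \<xi>|lborel. norm (case (g, \<xi>) of (g, \<xi>) \<Rightarrow> cmod (f g) * (cmod (\<phi> (\<xi> + im_vec (fst g))))\<^sup>2))"
      using integrable_norm[OF integrable_f] by (simp add: t)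
    show "AE g in lborel. integrable lborel (\<lambda>\<xi>. case (g, \<xi>) of (g, \<xi>) \<Rightarrow> cmod (f g) * (cmod (\<phi> (\<xi> + im_vec (fst g))))\<^sup>2)"
      using t(1) by simp
  qed
  have "(LINT p|(lborel \<Otimes>\<^sub>M lborel). ?H p) = (LINT g|lborel. LINT \<xi>|lborel. cmod (f g) * (cmod (\<phi> (\<xi> + im_vec (fst g))))\<^sup>2)"
    using lborel_pair.integral_fst'[OF i] by simp
  then show "(LINT p|(lborel \<Otimes>\<^sub>M lborel). ?H p) = mass * (l2_norm \<phi>)\<^sup>2"
    by (simp add: t mass_def)
qed

lemma group_fourier_measurable:
  assumes "\<phi> \<in> borel_measurable borel" shows "group_fourier f lam \<phi> \<in> borel_measurable borel"
proof -
  have "(\<lambda>(\<xi>, g). f g * schroedinger lam g \<phi> \<xi>) \<in> borel_measurable (lborel \<Otimes>\<^sub>M lborel)"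
    using measurable_compose[OF measurable_pair_swap' kernel_measurable(1)[OF assms, of lam]]
    by (simp add: case_prod_beta')
  then have "(\<lambda>\<xi>. LINT g|lborel. f g * schroedinger lam g \<phi> \<xi>) \<in> borel_measurable lborel"
    by (rule lborel.borel_measurable_lebesgue_integral)
  then show ?thesis unfolding group_fourier_def by simp
qed

text \<open>The representation acts by unimodular factors and translations, hence by the inequality of Cauchy and
  Schwarz with weight \<open>\<bar>f\<bar>\<close> the transform is bounded by the L1 norm of \<open>f\<close>.\<close>

lemma group_fourier_L2:
  assumes \<phi>: "\<phi> \<in> L2"
  shows "group_fourier f lam \<phi> \<in> L2" and "l2_norm (group_fourier f lam \<phi>) \<le> mass * l2_norm \<phi>"
    and "AE \<xi> in lborel. integrable lborel (\<lambda>g. f g * schroedinger lam g \<phi> \<xi>)"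
proof -
  have m: "\<phi> \<in> borel_measurable borel" using \<phi> by (simp add: L2_def)
  let ?h = "\<lambda>g \<xi>. cmod (f g) * (cmod (\<phi> (\<xi> + im_vec (fst g))))\<^sup>2"
  let ?J = "\<lambda>\<xi>. LINT g|lborel. ?h g \<xi>"
  note H = dominating_integrable[OF \<phi>]
  have sec: "(\<lambda>g. f g * schroedinger lam g \<phi> \<xi>) \<in> borel_measurable lborel" for \<xi>
  proof -
    have "(\<lambda>g. case (g, \<xi>) of (g, \<xi>) \<Rightarrow> f g * schroedinger lam g \<phi> \<xi>) \<in> borel_measurable lborel"
      by (rule measurable_Pair1[OF kernel_measurable(1)[OF m]]) simp
    then show ?thesis by simp
  qed
  have AE: "AE \<xi> in lborel. integrable lborel (\<lambda>g. ?h g \<xi>)"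
    using lborel_pair.AE_integrable_snd[OF H(1)] .
  have pt: "integrable lborel (\<lambda>g. f g * schroedinger lam g \<phi> \<xi>) \<and> (cmod (group_fourier f lam \<phi> \<xi>))\<^sup>2 \<le> mass * ?J \<xi>"
    if i: "integrable lborel (\<lambda>g. ?h g \<xi>)" for \<xi>
  proof -
    let ?a = "\<lambda>g. sqrt (cmod (f g))" and ?b = "\<lambda>g. sqrt (cmod (f g)) * cmod (schroedinger lam g \<phi> \<xi>)"
    have c: "cmod (schroedinger lam g \<phi> \<xi>) = cmod (\<phi> (\<xi> + im_vec (fst g)))" for g
      by (simp add: schroedinger_hphase norm_mult)
    have "continuous_on UNIV (\<lambda>g :: 'n heis. \<xi> + im_vec (fst g))" by (intro continuous_intros)
    note [measurable] = borel_measurable_continuous_onI[OF this] m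
    have mb: "?b \<in> borel_measurable lborel" unfolding c by measurable
    have ma: "?a \<in> borel_measurable lborel" by measurable
    have sq: "(?a g)\<^sup>2 = cmod (f g)" "(?b g)\<^sup>2 = ?h g \<xi>" "?a g * ?b g = cmod (f g * schroedinger lam g \<phi> \<xi>)" for g
      by (simp_all add: power_mult_distrib c norm_mult mult.assoc[symmetric])
    note CS = Cauchy_Schwarz_integral[OF ma mb, unfolded sq, OF integrable_norm[OF integrable_f] i]
    have i2: "integrable lborel (\<lambda>g. f g * schroedinger lam g \<phi> \<xi>)"
      by (rule integrable_norm_cancel[OF CS(1) sec])
    have "cmod (group_fourier f lam \<phi> \<xi>) \<le> (LINT g|lborel. cmod (f g * schroedinger lam g \<phi> \<xi>))"
      unfolding group_fourier_def by (rule integral_norm_bound)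
    then have "(cmod (group_fourier f lam \<phi> \<xi>))\<^sup>2 \<le> (LINT g|lborel. cmod (f g * schroedinger lam g \<phi> \<xi>))\<^sup>2"
      by (rule power_mono) simp
    also have "\<dots> \<le> mass * ?J \<xi>" using CS(2) by (simp add: mass_def)
    finally show ?thesis using i2 by blast
  qed
  show "AE \<xi> in lborel. integrable lborel (\<lambda>g. f g * schroedinger lam g \<phi> \<xi>)"
    using AE by eventually_elim (use pt in blast)
  have iJ: "integrable lborel (\<lambda>\<xi>. mass * ?J \<xi>)"
    using lborel_pair.integrable_snd[OF H(1)] by (intro integrable_mult_right)
  have le: "AE \<xi> in lborel. (cmod (group_fourier f lam \<phi> \<xi>))\<^sup>2 \<le> mass * ?J \<xi>"
    using AE by eventually_elim (use pt in blast)
  have mg[measurable]: "group_fourier f lam \<phi> \<in> borel_measurable borel" by (rule group_fourier_measurable[OF m])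
  have i: "integrable lborel (\<lambda>\<xi>. (cmod (group_fourier f lam \<phi> \<xi>))\<^sup>2)"
    by (rule Bochner_Integration.integrable_bound[OF iJ]) (use le in \<open>auto elim!: eventually_mono\<close>)
  then show L: "group_fourier f lam \<phi> \<in> L2" using mg by (simp add: L2_def)
  have "(l2_norm (group_fourier f lam \<phi>))\<^sup>2 \<le> (LINT \<xi>|lborel. mass * ?J \<xi>)"
    unfolding l2_norm_sq by (rule integral_mono_AE[OF i iJ le])
  also have "\<dots> = mass * (mass * (l2_norm \<phi>)\<^sup>2)"
    using lborel_pair.integral_snd[OF H(1)] H(2) by simp
  finally have "(l2_norm (group_fourier f lam \<phi>))\<^sup>2 \<le> (mass * l2_norm \<phi>)\<^sup>2"
    by (simp add: power2_eq_square mult_ac)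
  then show "l2_norm (group_fourier f lam \<phi>) \<le> mass * l2_norm \<phi>"
    by (rule power2_le_imp_le) (simp add: mass_nonneg)
qed

lemma sesquilinear_integrable:
  assumes \<phi>: "\<phi> \<in> L2" and \<psi>: "\<psi> \<in> L2"
  shows "integrable (lborel \<Otimes>\<^sub>M lborel) (\<lambda>(g, \<xi>). f g * schroedinger lam g \<phi> \<xi> * cnj (\<psi> \<xi>))"
proof -
  have m: "\<phi> \<in> borel_measurable borel" "\<psi> \<in> borel_measurable borel" "(\<lambda>x. cnj (\<psi> x)) \<in> borel_measurable borel"
    using \<phi> \<psi> L2_cnj[OF \<psi>] by (auto simp: L2_def)
  have i\<psi>: "integrable (lborel \<Otimes>\<^sub>M lborel) (\<lambda>(g, \<xi>). cmod (f g) * (cmod (\<psi> \<xi>))\<^sup>2)"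
  proof (rule lborel_pair.Fubini_integrable)
    note [measurable] = m
    show "(\<lambda>(g, \<xi>). cmod (f g) * (cmod (\<psi> \<xi>))\<^sup>2) \<in> borel_measurable (lborel \<Otimes>\<^sub>M lborel)" by measurable
    show "integrable lborel (\<lambda>g. LINT \<xi>|lborel. norm (case (g, \<xi>) of (g, \<xi>) \<Rightarrow> cmod (f g) * (cmod (\<psi> \<xi>))\<^sup>2))"
      using integrable_norm[OF integrable_f] by simp
    show "AE g in lborel. integrable lborel (\<lambda>\<xi>. case (g, \<xi>) of (g, \<xi>) \<Rightarrow> cmod (f g) * (cmod (\<psi> \<xi>))\<^sup>2)"
      using L2_integrable[OF \<psi>] by simp
  qed
  have meas: "(\<lambda>(g, \<xi>). f g * schroedinger lam g \<phi> \<xi> * cnj (\<psi> \<xi>)) \<in> borel_measurable (lborel \<Otimes>\<^sub>M lborel)"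
  proof -
    have "(\<lambda>p. (case p of (g, \<xi>) \<Rightarrow> f g * schroedinger lam g \<phi> \<xi>) * cnj (\<psi> (snd p))) \<in> borel_measurable (lborel \<Otimes>\<^sub>M lborel)"
      by (intro borel_measurable_times kernel_measurable m(1) measurable_compose[OF measurable_snd])
        (use m(3) in simp)
    then show ?thesis by (simp add: case_prod_beta')
  qed
  show ?thesis
  proof (rule Bochner_Integration.integrable_bound[OF Bochner_Integration.integrable_add[OF dominating_integrable(1)[OF \<phi>] i\<psi>] meas], rule AE_I2)
    fix p :: "'n heis \<times> (real ^ 'n)"
    obtain g \<xi> where p: "p = (g, \<xi>)" by (cases p)
    let ?a = "cmod (\<phi> (\<xi> + im_vec (fst g)))" and ?b = "cmod (\<psi> \<xi>)"
    have "?a * ?b \<le> ?a\<^sup>2 + ?b\<^sup>2"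
    proof -
      have "0 \<le> ?a * ?b" by simp
      moreover have "2 * (?a * ?b) \<le> ?a\<^sup>2 + ?b\<^sup>2" using sum_squares_bound[of ?a ?b] by (simp only: mult.assoc)
      ultimately show ?thesis by linarith
    qed
    then have "cmod (f g) * (?a * ?b) \<le> cmod (f g) * (?a\<^sup>2 + ?b\<^sup>2)" by (rule mult_left_mono) simp
    moreover have "0 \<le> cmod (f g) * (?a\<^sup>2 + ?b\<^sup>2)" by simp
    ultimately show "norm (case p of (g, \<xi>) \<Rightarrow> f g * schroedinger lam g \<phi> \<xi> * cnj (\<psi> \<xi>))
      \<le> norm ((case p of (g, \<xi>) \<Rightarrow> cmod (f g) * (cmod (\<phi> (\<xi> + im_vec (fst g))))\<^sup>2) + (case p of (g, \<xi>) \<Rightarrow> cmod (f g) * (cmod (\<psi> \<xi>))\<^sup>2))"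
      by (simp add: p norm_mult schroedinger_hphase distrib_left mult.assoc)
  qed
qed

lemma group_fourier_inner:
  assumes \<phi>: "\<phi> \<in> L2" and \<psi>: "\<psi> \<in> L2"
  shows "l2_inner (group_fourier f lam \<phi>) \<psi> = (LINT g|lborel. LINT \<xi>|lborel. f g * schroedinger lam g \<phi> \<xi> * cnj (\<psi> \<xi>))"
proof -
  have "l2_inner (group_fourier f lam \<phi>) \<psi> = (LINT \<xi>|lborel. LINT g|lborel. f g * schroedinger lam g \<phi> \<xi> * cnj (\<psi> \<xi>))"
    unfolding l2_inner_def group_fourier_def by simp
  also have "\<dots> = (LINT g|lborel. LINT \<xi>|lborel. f g * schroedinger lam g \<phi> \<xi> * cnj (\<psi> \<xi>))"
    by (rule lborel_pair.Fubini_integral[OF sesquilinear_integrable[OF \<phi> \<psi>]])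
  finally show ?thesis .
qed

end

text \<open>The involution on functions on the group: inversion in the Heisenberg group is negation of the coordinates.\<close>

definition conj_refl :: "('n::finite heis \<Rightarrow> complex) \<Rightarrow> 'n heis \<Rightarrow> complex" where
  "conj_refl f g = cnj (f (- g))"

lemma compact_supp_conj_refl:
  assumes "compact_supp f K" shows "compact_supp (conj_refl f) (uminus ` K)"
proof -
  interpret compact_supp f K by fact
  show ?thesis
  proof
    show "continuous_on UNIV (conj_refl f)" unfolding conj_refl_def
      by (intro continuous_intros continuous_on_compose2[OF cont]) auto
    show "compact (uminus ` K)" by (intro compact_continuous_image continuous_intros K)
    show "conj_refl f g = 0" if "g \<notin> uminus ` K" for g
      using out[of "- g"] that by (force simp: conj_refl_def)
  qed
qed

lemma group_fourier_adjoint: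
  assumes f: "compact_supp f K" and \<phi>: "\<phi> \<in> L2" and \<psi>: "\<psi> \<in> L2"
  shows "l2_inner (group_fourier f lam \<phi>) \<psi> = l2_inner \<phi> (group_fourier (conj_refl f) lam \<psi>)"
proof -
  interpret f: compact_supp f K by fact
  interpret fs: compact_supp "conj_refl f" "uminus ` K" by (rule compact_supp_conj_refl[OF f])
  have m[measurable]: "\<phi> \<in> borel_measurable borel" "\<psi> \<in> borel_measurable borel"
    using \<phi> \<psi> by (auto simp: L2_def)
  have cm [measurable]: "cnj \<in> borel_measurable borel"
    by (intro borel_measurable_continuous_onI continuous_intros)
  have in_f: "(LINT \<xi>|lborel. f (-g) * schroedinger lam (-g) \<phi> \<xi> * cnj (\<psi> \<xi>))
      = cnj (LINT \<xi>|lborel. conj_refl f g * schroedinger lam g \<psi> \<xi> * cnj (\<phi> \<xi>))" for g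
  proof -
    let ?y = "im_vec (fst g)"
    have neg: "re_vec (- fst g) = - re_vec (fst g)" "im_vec (- fst g) = - ?y"
      by (simp_all add: re_vec_def im_vec_def vec_eq_iff)
    define H where "H \<xi> = f (-g) * schroedinger lam (-g) \<phi> \<xi> * cnj (\<psi> \<xi>)" for \<xi>
    have "(\<lambda>\<xi>. cis (hphase lam (-g) \<xi>)) \<in> borel_measurable borel"
      by (intro borel_measurable_continuous_onI continuous_intros)
    note [measurable] = this
    have mH: "H \<in> borel_measurable borel" unfolding H_def schroedinger_hphase by measurable
    have "(LINT \<xi>|lborel. H \<xi>) = (LINT \<xi>|lborel. H (\<xi> + ?y))"
      by (rule lborel_integral_translate[symmetric, OF mH])
    also have "\<dots> = (LINT \<xi>|lborel. cnj (conj_refl f g * schroedinger lam g \<psi> \<xi> * cnj (\<phi> \<xi>)))"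
    proof (intro Bochner_Integration.integral_cong refl)
      fix \<xi>
      have "hphase lam (-g) (\<xi> + ?y) = - hphase lam g \<xi>"
        by (simp add: hphase_def neg inner_add_right algebra_simps)
      then show "H (\<xi> + ?y) = cnj (conj_refl f g * schroedinger lam g \<psi> \<xi> * cnj (\<phi> \<xi>))"
        by (simp add: H_def schroedinger_hphase neg conj_refl_def cis_cnj mult_ac)
    qed
    also have "\<dots> = cnj (LINT \<xi>|lborel. conj_refl f g * schroedinger lam g \<psi> \<xi> * cnj (\<phi> \<xi>))"
      by (rule Bochner_Integration.integral_cnj)
    finally show ?thesis by (simp only: H_def)
  qed
  define I where "I g = (LINT \<xi>|lborel. f g * schroedinger lam g \<phi> \<xi> * cnj (\<psi> \<xi>))" for g
  have mI: "I \<in> borel_measurable borel"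
    using lborel.borel_measurable_lebesgue_integral[OF borel_measurable_integrable[OF f.sesquilinear_integrable[OF \<phi> \<psi>, of lam]]]
    by (simp add: I_def[abs_def])
  have "l2_inner (group_fourier f lam \<phi>) \<psi> = (LINT g|lborel. I g)"
    by (simp add: f.group_fourier_inner[OF \<phi> \<psi>] I_def)
  also have "\<dots> = (LINT g|lborel. I (- g))" by (rule lborel_integral_uminus[symmetric, OF mI])
  also have "\<dots> = (LINT g|lborel. cnj (LINT \<xi>|lborel. conj_refl f g * schroedinger lam g \<psi> \<xi> * cnj (\<phi> \<xi>)))"
    unfolding I_def in_f ..
  also have "\<dots> = cnj (LINT g|lborel. LINT \<xi>|lborel. conj_refl f g * schroedinger lam g \<psi> \<xi> * cnj (\<phi> \<xi>))"
    by (rule Bochner_Integration.integral_cnj)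
  also have "\<dots> = cnj (l2_inner (group_fourier (conj_refl f) lam \<psi>) \<phi>)"
    by (simp only: fs.group_fourier_inner[OF \<psi> \<phi>])
  finally show ?thesis by (simp only: l2_inner_cnj)
qed

text \<open>The adjoint is only determined up to null sets by the choice operator, but inner products do not see
  the difference.\<close>

lemma adjoint_composition_inner:
  assumes f: "compact_supp f K" and \<phi>: "\<phi> \<in> L2"
  shows "Re (l2_inner ((l2_adjoint (group_fourier f lam) \<circ> group_fourier f lam) \<phi>) \<phi>) = (l2_norm (group_fourier f lam \<phi>))\<^sup>2"
proof -
  interpret f: compact_supp f K by fact
  interpret fs: compact_supp "conj_refl f" "uminus ` K" by (rule compact_supp_conj_refl[OF f])
  let ?P = "\<lambda>S. \<forall>\<psi>\<in>L2. S \<psi> \<in> L2 \<and> (\<forall>\<phi>\<in>L2. l2_inner (group_fourier f lam \<phi>) \<psi> = l2_inner \<phi> (S \<psi>))"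
  have "?P (group_fourier (conj_refl f) lam)"
    using group_fourier_adjoint[OF f] fs.group_fourier_L2(1) by blast
  then have S: "?P (l2_adjoint (group_fourier f lam))" unfolding l2_adjoint_def by (rule someI[of ?P])
  let ?g = "group_fourier f lam \<phi>"
  have "l2_inner \<phi> (l2_adjoint (group_fourier f lam) ?g) = l2_inner ?g ?g"
    using S f.group_fourier_L2(1)[OF \<phi>] \<phi> by metis
  then have "l2_inner (l2_adjoint (group_fourier f lam) ?g) \<phi> = cnj (complex_of_real ((l2_norm ?g)\<^sup>2))"
    by (metis l2_inner_cnj l2_inner_self)
  then show ?thesis by simp
qed

section \<open>Vector fields on the Heisenberg group\<close>

text \<open>The coordinate directions \<open>x\<close>, \<open>y\<close> and \<open>t\<close> of the group as elements of its standard basis.\<close>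

definition ex :: "real ^ 'n \<Rightarrow> 'n::finite heis" where "ex b = ((\<chi> j. complex_of_real (b $ j)), 0)"
definition ey :: "real ^ 'n \<Rightarrow> 'n::finite heis" where "ey b = ((\<chi> j. \<i> * complex_of_real (b $ j)), 0)"
definition eT :: "'n::finite heis" where "eT = (0, 1)"

lemma heis_basis:
  assumes "b \<in> Basis" shows "ex b \<in> Basis" "ey b \<in> Basis"
proof -
  obtain i where b: "b = axis i 1" using assms by (auto simp: Basis_vec_def)
  have "(\<chi> j. complex_of_real (b $ j)) = axis i 1" "(\<chi> j. \<i> * complex_of_real (b $ j)) = axis i \<i>"
    by (auto simp: b vec_eq_iff axis_def)
  then show "ex b \<in> Basis" "ey b \<in> Basis"
    by (auto simp: ex_def ey_def Basis_prod_def Basis_vec_def Basis_complex_def)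
qed

lemma eT_basis: "eT \<in> Basis"
  by (auto simp: eT_def Basis_prod_def)

lemma heis_inner: "g \<bullet> ex b = re_vec (fst g) \<bullet> b" "g \<bullet> ey b = im_vec (fst g) \<bullet> b" "g \<bullet> eT = snd g"
  by (simp_all add: ex_def ey_def eT_def inner_prod_def inner_vec_def re_vec_def im_vec_def inner_complex_def)

lemma heis_coords:
  "re_vec (fst (ex b)) = b" "im_vec (fst (ex b)) = 0" "snd (ex b) = 0"
  "re_vec (fst (ey b)) = 0" "im_vec (fst (ey b)) = b" "snd (ey b) = 0"
  "re_vec (fst eT) = 0" "im_vec (fst eT) = 0" "snd eT = 1"
  by (simp_all add: ex_def ey_def eT_def re_vec_def im_vec_def vec_eq_iff)

lemma re_im_derivative:
  "((\<lambda>g :: 'n::finite heis. re_vec (fst g)) has_derivative (\<lambda>h. re_vec (fst h))) (at g)"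
  "((\<lambda>g :: 'n::finite heis. im_vec (fst g)) has_derivative (\<lambda>h. im_vec (fst h))) (at g)"
proof -
  have "linear (\<lambda>g :: 'n heis. re_vec (fst g))" "linear (\<lambda>g :: 'n heis. im_vec (fst g))"
    by (auto intro!: linearI simp: re_vec_def im_vec_def vec_eq_iff)
  then show "((\<lambda>g :: 'n heis. re_vec (fst g)) has_derivative (\<lambda>h. re_vec (fst h))) (at g)"
    "((\<lambda>g :: 'n heis. im_vec (fst g)) has_derivative (\<lambda>h. im_vec (fst h))) (at g)"
    by (auto simp: linear_conv_bounded_linear intro: bounded_linear.has_derivative[OF _ has_derivative_ident])
qed

definition C1 :: "('a::euclidean_space \<Rightarrow> complex) \<Rightarrow> bool" where
  "C1 u \<longleftrightarrow> (\<forall>x. u differentiable (at x)) \<and> (\<forall>b\<in>Basis. continuous_on UNIV (dd b u))"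

lemma C1_differentiable: "C1 u \<Longrightarrow> u differentiable (at x)"
  by (simp add: C1_def)

lemma C1_continuous: "C1 u \<Longrightarrow> continuous_on UNIV u"
  by (simp add: C1_def continuous_at_imp_continuous_on differentiable_imp_continuous_within)

lemma C2_C1:
  assumes "C2 u" shows "C1 u" and "b \<in> Basis \<Longrightarrow> C1 (dd b u)"
proof -
  obtain b0 :: "real ^ 'a" where "b0 \<in> Basis" using nonempty_Basis by blast
  then show "C1 u" "b \<in> Basis \<Longrightarrow> C1 (dd b u)" using C2D[OF assms] by (auto simp: C1_def)
qed

lemma schroedinger_dd:
  assumes \<phi>: "C1 \<phi>"
  shows "(\<lambda>g. schroedinger lam g \<phi> \<xi>) differentiable (at g)"
    and "dd v (\<lambda>g. schroedinger lam g \<phi> \<xi>) g =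
      \<i> * complex_of_real (lam * (snd v + re_vec (fst v) \<bullet> \<xi> + (re_vec (fst v) \<bullet> im_vec (fst g) + re_vec (fst g) \<bullet> im_vec (fst v)) / 2))
        * schroedinger lam g \<phi> \<xi>
      + cis (hphase lam g \<xi>) * dd (im_vec (fst v)) \<phi> (\<xi> + im_vec (fst g))"
proof -
  let ?p = "\<lambda>h. lam * (snd h + re_vec (fst h) \<bullet> \<xi> + (re_vec (fst h) \<bullet> im_vec (fst g) + re_vec (fst g) \<bullet> im_vec (fst h)) / 2)"
  have "((\<lambda>g. hphase lam g \<xi>) has_derivative ?p) (at g)"
    unfolding hphase_def
    by (rule derivative_eq_intros re_im_derivative refl | simp add: algebra_simps add_divide_distrib)+
  then have c: "((\<lambda>g. cis (hphase lam g \<xi>)) has_derivative (\<lambda>h. ?p h *\<^sub>R (\<i> * cis (hphase lam g \<xi>)))) (at g)"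
    by (rule has_derivative_cis)
  have "((\<lambda>g. \<xi> + im_vec (fst g)) has_derivative (\<lambda>h. im_vec (fst h))) (at g)"
    by (rule derivative_eq_intros re_im_derivative refl | simp)+
  from has_derivative_compose[OF this dd_has_derivative[OF C1_differentiable[OF \<phi>]]]
  have f: "((\<lambda>g. \<phi> (\<xi> + im_vec (fst g))) has_derivative (\<lambda>h. dd (im_vec (fst h)) \<phi> (\<xi> + im_vec (fst g)))) (at g)" .
  note D = has_derivative_mult[OF c f]
  show "(\<lambda>g. schroedinger lam g \<phi> \<xi>) differentiable (at g)"
    using D by (auto simp: schroedinger_hphase differentiable_def)
  show "dd v (\<lambda>g. schroedinger lam g \<phi> \<xi>) g =
      \<i> * complex_of_real (?p v) * schroedinger lam g \<phi> \<xi>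
      + cis (hphase lam g \<xi>) * dd (im_vec (fst v)) \<phi> (\<xi> + im_vec (fst g))"
    unfolding schroedinger_hphase by (subst dd_eqI[OF D]) (simp add: scaleR_conv_of_real algebra_simps)
qed

lemma dd_0: "u differentiable (at x) \<Longrightarrow> dd 0 u x = 0"
  using linear_0[OF has_derivative_linear[OF dd_has_derivative]] by blast

lemma schroedinger_dd_fields:
  assumes \<phi>: "C1 \<phi>"
  shows "dd (ex b) (\<lambda>g. schroedinger lam g \<phi> \<xi>) g = \<i> * complex_of_real (lam * (b \<bullet> \<xi> + (g \<bullet> ey b) / 2)) * schroedinger lam g \<phi> \<xi>"
    and "dd (ey b) (\<lambda>g. schroedinger lam g \<phi> \<xi>) g = \<i> * complex_of_real (lam * ((g \<bullet> ex b) / 2)) * schroedinger lam g \<phi> \<xi> + schroedinger lam g (dd b \<phi>) \<xi>"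
    and "dd eT (\<lambda>g. schroedinger lam g \<phi> \<xi>) g = \<i> * complex_of_real lam * schroedinger lam g \<phi> \<xi>"
  unfolding schroedinger_dd[OF \<phi>] heis_coords heis_inner
  by (simp_all add: dd_0[OF C1_differentiable[OF \<phi>]] inner_commute schroedinger_hphase)

lemma continuous_schroedinger:
  assumes "continuous_on UNIV \<phi>"
  shows "continuous_on UNIV (\<lambda>g. schroedinger lam g \<phi> \<xi>)"
  unfolding schroedinger_hphase by (intro continuous_intros continuous_on_compose2[OF assms]) auto

lemma group_fourier_integrable:
  assumes f: "Bd W R A j f" and \<phi>: "continuous_on UNIV \<phi>"
  shows "integrable lborel (\<lambda>g. f g * schroedinger lam g \<phi> \<xi>)"
  by (rule integrable_compact_support[OF _ compact_cbox[of "- (R *\<^sub>R One)" "R *\<^sub>R One"]])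
    (auto simp: Bd_outside[OF f] intro!: continuous_intros continuous_schroedinger[OF \<phi>] Bd_continuous[OF f])

lemma schroedinger_by_parts:
  assumes f: "Bd W R A j f" and \<phi>: "C1 \<phi>" and v: "v \<in> Basis"
    and d: "\<And>g. dd v (\<lambda>g. schroedinger lam g \<phi> \<xi>) g = D g" and D: "continuous_on UNIV D"
  shows "integrable lborel (\<lambda>g. dd v f g * schroedinger lam g \<phi> \<xi>)" "integrable lborel (\<lambda>g. f g * D g)"
    and "(LINT g|lborel. dd v f g * schroedinger lam g \<phi> \<xi>) + (LINT g|lborel. f g * D g) = 0"
proof -
  let ?S = "\<lambda>g. schroedinger lam g \<phi> \<xi>"
  note df = Bd_dd[OF f v]
  note S = continuous_schroedinger[OF C1_continuous[OF \<phi>], of lam \<xi>]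
  show i1: "integrable lborel (\<lambda>g. dd v f g * ?S g)"
    by (rule group_fourier_integrable[OF df C1_continuous[OF \<phi>]])
  show i2: "integrable lborel (\<lambda>g. f g * D g)"
    by (rule integrable_compact_support[OF _ compact_cbox[of "- (R *\<^sub>R One)" "R *\<^sub>R One"]])
      (auto simp: Bd_outside[OF f] intro!: continuous_intros D Bd_continuous[OF f])
  have eq: "dd v (\<lambda>g. f g * ?S g) = (\<lambda>g. dd v f g * ?S g + f g * D g)"
    by (rule ext) (simp add: dd_mult[OF Bd_differentiable[OF f] schroedinger_dd(1)[OF \<phi>]] d)
  have "(LINT g|lborel. dd v (\<lambda>g. f g * ?S g) g) = 0"
  proof (rule integral_dd_eq_0)
    show "(\<lambda>g. f g * ?S g) differentiable (at x)" for x
      by (intro differentiable_mult Bd_differentiable[OF f] schroedinger_dd(1)[OF \<phi>])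
    show "continuous_on UNIV (dd v (\<lambda>g. f g * ?S g))"
      unfolding eq by (intro continuous_intros Bd_continuous[OF f] Bd_continuous[OF df] S D)
    show "integrable lborel (\<lambda>g. f g * ?S g)" by (rule group_fourier_integrable[OF f C1_continuous[OF \<phi>]])
    show "integrable lborel (dd v (\<lambda>g. f g * ?S g))" unfolding eq using i1 i2 by simp
  qed
  then show "(LINT g|lborel. dd v f g * ?S g) + (LINT g|lborel. f g * D g) = 0"
    unfolding eq using i1 i2 by simp
qed

text \<open>The negatives of the left invariant vector fields. They are the formal adjoints of the fields, so that
  integration by parts moves them from \<open>f\<close> to the representation, where the fields act as
  differentiation and as multiplication by \<open>\<i> * lam\<close> times a coordinate.\<close>

definition Yf :: "real ^ 'n \<Rightarrow> ('n::finite heis \<Rightarrow> complex) \<Rightarrow> 'n heis \<Rightarrow> complex" where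
  "Yf b f = (\<lambda>g. - dd (ey b) f g + (1/2) * (complex_of_real (g \<bullet> ex b) * dd eT f g))"

definition Xf :: "real ^ 'n \<Rightarrow> ('n::finite heis \<Rightarrow> complex) \<Rightarrow> 'n heis \<Rightarrow> complex" where
  "Xf b f = (\<lambda>g. - dd (ex b) f g + (-1/2) * (complex_of_real (g \<bullet> ey b) * dd eT f g))"

definition sublaplacian :: "('n::finite heis \<Rightarrow> complex) \<Rightarrow> 'n heis \<Rightarrow> complex" where
  "sublaplacian f = (\<lambda>g. \<Sum>b\<in>Basis. - Yf b (Yf b f) g + - Xf b (Xf b f) g)"

context weights
begin

lemma Bd_fields:
  fixes f :: "'n::finite heis \<Rightarrow> complex"
  assumes f: "Bd W R A j f" and R: "R \<ge> 0" and b: "b \<in> Basis"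
  shows "Bd W R ((1 + (R + c) / 2) * A) (Suc j) (Yf b f)" "Bd W R ((1 + (R + c) / 2) * A) (Suc j) (Xf b f)"
proof -
  have "Bd W R (A + cmod (1/2) * ((R + c) * A)) (Suc j) (Yf b f)" unfolding Yf_def
    by (intro Bd_add Bd_minus Bd_dd f heis_basis b Bd_cmult Bd_coord R eT_basis)
  then show "Bd W R ((1 + (R + c) / 2) * A) (Suc j) (Yf b f)" by (simp add: algebra_simps add_divide_distrib)
  have "Bd W R (A + cmod (-1/2) * ((R + c) * A)) (Suc j) (Xf b f)" unfolding Xf_def
    by (intro Bd_add Bd_minus Bd_dd f heis_basis b Bd_cmult Bd_coord R eT_basis)
  then show "Bd W R ((1 + (R + c) / 2) * A) (Suc j) (Xf b f)" by (simp add: algebra_simps add_divide_distrib)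
qed

lemma Bd_sublaplacian:
  fixes f :: "'n::finite heis \<Rightarrow> complex"
  assumes f: "Bd W R A j f" and R: "R \<ge> 0"
  shows "Bd W R (2 * real CARD('n) * (1 + (R + c) / 2)\<^sup>2 * A) (j + 2) (sublaplacian f)"
proof -
  let ?q = "1 + (R + c) / 2"
  have "Bd W R (?q * (?q * A) + ?q * (?q * A)) (Suc (Suc j)) (\<lambda>g. - Yf b (Yf b f) g + - Xf b (Xf b f) g)" if "b \<in> Basis" for b
    by (intro Bd_add Bd_minus Bd_fields f R that)
  then have a: "Bd W R (real (card (Basis :: (real ^ 'n) set)) * (?q * (?q * A) + ?q * (?q * A))) (Suc (Suc j)) (sublaplacian f)"
    unfolding sublaplacian_def by (intro Bd_sum) auto
  have b: "real (card (Basis :: (real ^ 'n) set)) * (?q * (?q * A) + ?q * (?q * A)) = 2 * real CARD('n) * ?q\<^sup>2 * A"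
    by (simp add: power2_eq_square)
  show ?thesis using a by (simp only: b add_2_eq_Suc')
qed

lemma Bd_sublaplacian_power:
  fixes f :: "'n::finite heis \<Rightarrow> complex"
  assumes f: "Bd W R A 0 f" and R: "R \<ge> 0"
  shows "Bd W R ((2 * real CARD('n) * (1 + (R + c) / 2)\<^sup>2) ^ m * A) (2 * m) ((sublaplacian ^^ m) f)"
proof (induction m)
  case (Suc m)
  from Bd_sublaplacian[OF Suc.IH R] show ?case by (simp add: mult.assoc)
qed (use f in simp)

lemma group_fourier_Yf:
  fixes f :: "'n::finite heis \<Rightarrow> complex"
  assumes f: "Bd W R A j f" and R: "R \<ge> 0" and b: "b \<in> Basis" and \<phi>: "C1 \<phi>"
  shows "group_fourier f lam (dd b \<phi>) \<xi> = group_fourier (Yf b f) lam \<phi> \<xi>"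
proof -
  let ?S = "\<lambda>g. schroedinger lam g \<phi> \<xi>"
  let ?f2 = "\<lambda>g. complex_of_real (g \<bullet> ex b) * f g"
  have cb: "continuous_on UNIV (dd b \<phi>)" using \<phi> b by (simp add: C1_def)
  note S = continuous_schroedinger[OF C1_continuous[OF \<phi>], of lam \<xi>] continuous_schroedinger[OF cb, of lam \<xi>]
  have f2: "Bd W R ((R + c) * A) j ?f2" by (rule Bd_coord[OF f R heis_basis(1)[OF b]])
  have d2: "dd eT ?f2 g = complex_of_real (g \<bullet> ex b) * dd eT f g" for g
    by (subst dd_coord_mult[OF Bd_differentiable[OF f]]) (simp add: heis_inner heis_coords)
  note 1 = schroedinger_by_parts[OF f \<phi> heis_basis(2)[OF b] schroedinger_dd_fields(2)[OF \<phi>], of lam \<xi>]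
  note 2 = schroedinger_by_parts[OF f2 \<phi> eT_basis schroedinger_dd_fields(3)[OF \<phi>], of lam \<xi>]
  have c1: "continuous_on UNIV (\<lambda>g. \<i> * complex_of_real (lam * ((g \<bullet> ex b) / 2)) * ?S g + schroedinger lam g (dd b \<phi>) \<xi>)"
    by (intro continuous_intros S) auto
  have c2: "continuous_on UNIV (\<lambda>g. \<i> * complex_of_real lam * ?S g)" by (intro continuous_intros S)
  have i: "integrable lborel (\<lambda>g. f g * schroedinger lam g (dd b \<phi>) \<xi>)" by (rule group_fourier_integrable[OF f cb])
  have i2: "integrable lborel (\<lambda>g. complex_of_real (g \<bullet> ex b) * f g * ?S g)" by (rule group_fourier_integrable[OF f2 C1_continuous[OF \<phi>]])
  have i1: "integrable lborel (\<lambda>g. dd (ey b) f g * ?S g)" by (rule 1(1)[OF c1])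
  have i3: "integrable lborel (\<lambda>g. complex_of_real (g \<bullet> ex b) * dd eT f g * ?S g)" using 2(1)[OF c2] by (simp only: d2)
  have "(LINT g|lborel. f g * (\<i> * complex_of_real (lam * ((g \<bullet> ex b) / 2)) * ?S g + schroedinger lam g (dd b \<phi>) \<xi>))
      = (LINT g|lborel. \<i> * complex_of_real lam / 2 * (complex_of_real (g \<bullet> ex b) * f g * ?S g) + f g * schroedinger lam g (dd b \<phi>) \<xi>)"
    by (intro Bochner_Integration.integral_cong refl) (simp add: algebra_simps)
  also have "\<dots> = \<i> * complex_of_real lam / 2 * (LINT g|lborel. complex_of_real (g \<bullet> ex b) * f g * ?S g) + (LINT g|lborel. f g * schroedinger lam g (dd b \<phi>) \<xi>)"
    using i i2 by simp
  finally have e1: "(LINT g|lborel. dd (ey b) f g * ?S g) + (\<i> * complex_of_real lam / 2 * (LINT g|lborel. complex_of_real (g \<bullet> ex b) * f g * ?S g) + (LINT g|lborel. f g * schroedinger lam g (dd b \<phi>) \<xi>)) = 0"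
    using 1(3)[OF c1] by simp
  have "(LINT g|lborel. complex_of_real (g \<bullet> ex b) * f g * (\<i> * complex_of_real lam * ?S g))
      = \<i> * complex_of_real lam * (LINT g|lborel. complex_of_real (g \<bullet> ex b) * f g * ?S g)"
    by (subst integral_mult_right_zero[symmetric], intro Bochner_Integration.integral_cong refl) (simp add: mult_ac)
  then have e2: "(LINT g|lborel. complex_of_real (g \<bullet> ex b) * dd eT f g * ?S g) + \<i> * complex_of_real lam * (LINT g|lborel. complex_of_real (g \<bullet> ex b) * f g * ?S g) = 0"
    using 2(3)[OF c2] by (simp add: d2)
  have "group_fourier (Yf b f) lam \<phi> \<xi> = (LINT g|lborel. - (dd (ey b) f g * ?S g) + 1/2 * (complex_of_real (g \<bullet> ex b) * dd eT f g * ?S g))"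
    unfolding group_fourier_def Yf_def by (intro Bochner_Integration.integral_cong refl) (simp add: algebra_simps)
  also have "\<dots> = - (LINT g|lborel. dd (ey b) f g * ?S g) + 1/2 * (LINT g|lborel. complex_of_real (g \<bullet> ex b) * dd eT f g * ?S g)"
    using i1 i3 by simp
  also have "\<dots> = (LINT g|lborel. f g * schroedinger lam g (dd b \<phi>) \<xi>)"
    using e1 e2 by algebra
  finally show ?thesis by (simp add: group_fourier_def)
qed

lemma group_fourier_Xf:
  fixes f :: "'n::finite heis \<Rightarrow> complex"
  assumes f: "Bd W R A j f" and R: "R \<ge> 0" and b: "b \<in> Basis" and \<phi>: "C1 \<phi>"
  shows "group_fourier f lam (\<lambda>\<eta>. \<i> * complex_of_real lam * (complex_of_real (\<eta> \<bullet> b) * \<phi> \<eta>)) \<xi> = group_fourier (Xf b f) lam \<phi> \<xi>"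
proof -
  let ?S = "\<lambda>g. schroedinger lam g \<phi> \<xi>"
  let ?f2 = "\<lambda>g. complex_of_real (g \<bullet> ey b) * f g"
  note S = continuous_schroedinger[OF C1_continuous[OF \<phi>], of lam \<xi>]
  have f2: "Bd W R ((R + c) * A) j ?f2" by (rule Bd_coord[OF f R heis_basis(2)[OF b]])
  have d2: "dd eT ?f2 g = complex_of_real (g \<bullet> ey b) * dd eT f g" for g
    by (subst dd_coord_mult[OF Bd_differentiable[OF f]]) (simp add: heis_inner heis_coords)
  note 1 = schroedinger_by_parts[OF f \<phi> heis_basis(1)[OF b] schroedinger_dd_fields(1)[OF \<phi>], of lam \<xi>]
  note 2 = schroedinger_by_parts[OF f2 \<phi> eT_basis schroedinger_dd_fields(3)[OF \<phi>], of lam \<xi>]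
  have c1: "continuous_on UNIV (\<lambda>g. \<i> * complex_of_real (lam * (b \<bullet> \<xi> + (g \<bullet> ey b) / 2)) * ?S g)"
    by (intro continuous_intros S) auto
  have c2: "continuous_on UNIV (\<lambda>g. \<i> * complex_of_real lam * ?S g)" by (intro continuous_intros S)
  have i2: "integrable lborel (\<lambda>g. complex_of_real (g \<bullet> ey b) * f g * ?S g)" by (rule group_fourier_integrable[OF f2 C1_continuous[OF \<phi>]])
  have i1: "integrable lborel (\<lambda>g. dd (ex b) f g * ?S g)" by (rule 1(1)[OF c1])
  have i3: "integrable lborel (\<lambda>g. complex_of_real (g \<bullet> ey b) * dd eT f g * ?S g)" using 2(1)[OF c2] by (simp only: d2)
  have i4: "integrable lborel (\<lambda>g. f g * (\<i> * complex_of_real (lam * (b \<bullet> \<xi> + (g \<bullet> ey b) / 2)) * ?S g))" by (rule 1(2)[OF c1])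
  note e1 = 1(3)[OF c1]
  have "(LINT g|lborel. complex_of_real (g \<bullet> ey b) * f g * (\<i> * complex_of_real lam * ?S g))
      = \<i> * complex_of_real lam * (LINT g|lborel. complex_of_real (g \<bullet> ey b) * f g * ?S g)"
    by (subst integral_mult_right_zero[symmetric], intro Bochner_Integration.integral_cong refl) (simp add: mult_ac)
  then have e2: "(LINT g|lborel. complex_of_real (g \<bullet> ey b) * dd eT f g * ?S g) + \<i> * complex_of_real lam * (LINT g|lborel. complex_of_real (g \<bullet> ey b) * f g * ?S g) = 0"
    using 2(3)[OF c2] by (simp add: d2)
  have "group_fourier f lam (\<lambda>\<eta>. \<i> * complex_of_real lam * (complex_of_real (\<eta> \<bullet> b) * \<phi> \<eta>)) \<xi>
     = (LINT g|lborel. f g * (\<i> * complex_of_real (lam * (b \<bullet> \<xi> + (g \<bullet> ey b) / 2)) * ?S g) + \<i> * complex_of_real lam / 2 * (complex_of_real (g \<bullet> ey b) * f g * ?S g))"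
    unfolding group_fourier_def schroedinger_hphase
    by (intro Bochner_Integration.integral_cong refl) (simp add: heis_inner inner_add_left inner_commute algebra_simps)
  also have "\<dots> = (LINT g|lborel. f g * (\<i> * complex_of_real (lam * (b \<bullet> \<xi> + (g \<bullet> ey b) / 2)) * ?S g)) + \<i> * complex_of_real lam / 2 * (LINT g|lborel. complex_of_real (g \<bullet> ey b) * f g * ?S g)"
    using i4 i2 by (subst Bochner_Integration.integral_add) auto
  also have "\<dots> = - (LINT g|lborel. dd (ex b) f g * ?S g) + (-1/2) * (LINT g|lborel. complex_of_real (g \<bullet> ey b) * dd eT f g * ?S g)"
    using e1 e2 by algebra
  also have "\<dots> = (LINT g|lborel. - (dd (ex b) f g * ?S g) + (-1/2) * (complex_of_real (g \<bullet> ey b) * dd eT f g * ?S g))"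
    using i1 i3 by simp
  also have "\<dots> = group_fourier (Xf b f) lam \<phi> \<xi>"
    unfolding group_fourier_def Xf_def by (intro Bochner_Integration.integral_cong refl) (simp add: algebra_simps)
  finally show ?thesis .
qed

text \<open>The Hermite operator is minus the sum of the squares of differentiation and of multiplication by
  \<open>\<i> * lam\<close> times a coordinate, the images of the two families of vector fields.\<close>

lemma group_fourier_hermite_op:
  fixes f :: "'n::finite heis \<Rightarrow> complex"
  assumes f: "Bd W R A j f" and R: "R \<ge> 0" and \<phi>: "C2 \<phi>"
  shows "group_fourier f lam (hermite_op lam \<phi>) \<xi> = group_fourier (sublaplacian f) lam \<phi> \<xi>"
proof -
  let ?x = "\<lambda>b \<phi> \<eta>. \<i> * complex_of_real lam * (complex_of_real (\<eta> \<bullet> b) * \<phi> \<eta>)"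
  note c = C2_C1[OF \<phi>]
  have H: "hermite_op lam \<phi> = (\<lambda>\<eta>. \<Sum>b\<in>Basis. - dd b (dd b \<phi>) \<eta> + - ?x b (?x b \<phi>) \<eta>)"
    unfolding hermite_op_def norm_sq_Basis partial_eq_dd
    by (auto simp: sum_subtractf sum_negf sum.distrib sum_distrib_left sum_distrib_right power2_eq_square algebra_simps)
  have xC1: "C1 (?x b \<phi>)" if b: "b \<in> Basis" for b
  proof -
    have d: "(\<lambda>\<eta>. complex_of_real (\<eta> \<bullet> b) * \<phi> \<eta>) differentiable (at x)" for x
      by (intro differentiable_mult coord_differentiable C1_differentiable[OF c(1)])
    have "dd a (?x b \<phi>) = (\<lambda>x. \<i> * complex_of_real lam * (complex_of_real (a \<bullet> b) * \<phi> x + complex_of_real (x \<bullet> b) * dd a \<phi> x))" for a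
      by (rule ext) (simp add: dd_cmult[OF d] dd_coord_mult[OF C1_differentiable[OF c(1)]])
    then show ?thesis using d c(1) C1_continuous[OF c(1)]
      by (auto simp: C1_def intro!: differentiable_mult continuous_intros)
  qed
  have cont: "continuous_on UNIV (dd b (dd b \<phi>))" "continuous_on UNIV (?x b (?x b \<phi>))" if "b \<in> Basis" for b
    using that c(2)[OF that] C1_continuous[OF xC1[OF that]] by (auto simp: C1_def intro!: continuous_intros)
  have Sch: "schroedinger lam g (hermite_op lam \<phi>) \<xi>
     = (\<Sum>b\<in>Basis. - schroedinger lam g (dd b (dd b \<phi>)) \<xi> + - schroedinger lam g (?x b (?x b \<phi>)) \<xi>)" for g
    unfolding H schroedinger_hphase by (simp add: sum_distrib_left algebra_simps)
  have i: "integrable lborel (\<lambda>g. f g * schroedinger lam g (dd b (dd b \<phi>)) \<xi>)"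
    "integrable lborel (\<lambda>g. f g * schroedinger lam g (?x b (?x b \<phi>)) \<xi>)" if "b \<in> Basis" for b
    using cont[OF that] by (auto intro!: group_fourier_integrable[OF f])
  have "group_fourier f lam (hermite_op lam \<phi>) \<xi>
     = (LINT g|lborel. (\<Sum>b\<in>Basis. - (f g * schroedinger lam g (dd b (dd b \<phi>)) \<xi>) + - (f g * schroedinger lam g (?x b (?x b \<phi>)) \<xi>)))"
    unfolding group_fourier_def Sch by (simp add: sum_distrib_left algebra_simps)
  also have "\<dots> = (\<Sum>b\<in>Basis. - group_fourier f lam (dd b (dd b \<phi>)) \<xi> + - group_fourier f lam (?x b (?x b \<phi>)) \<xi>)"
    unfolding group_fourier_def using i by (subst Bochner_Integration.integral_sum) auto
  also have "\<dots> = (\<Sum>b\<in>Basis. - group_fourier (Yf b (Yf b f)) lam \<phi> \<xi> + - group_fourier (Xf b (Xf b f)) lam \<phi> \<xi>)"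
  proof (intro sum.cong refl)
    fix b :: "real ^ 'n" assume b: "b \<in> Basis"
    note Y = Bd_fields(1)[OF f R b] and X = Bd_fields(2)[OF f R b]
    show "- group_fourier f lam (dd b (dd b \<phi>)) \<xi> + - group_fourier f lam (?x b (?x b \<phi>)) \<xi>
      = - group_fourier (Yf b (Yf b f)) lam \<phi> \<xi> + - group_fourier (Xf b (Xf b f)) lam \<phi> \<xi>"
      using group_fourier_Yf[OF f R b c(2)[OF b]] group_fourier_Yf[OF Y R b c(1)]
        group_fourier_Xf[OF f R b xC1[OF b]] group_fourier_Xf[OF X R b c(1)] by simp
  qed
  also have "\<dots> = group_fourier (sublaplacian f) lam \<phi> \<xi>"
  proof -
    have j: "integrable lborel (\<lambda>g. Yf b (Yf b f) g * schroedinger lam g \<phi> \<xi>)"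
      "integrable lborel (\<lambda>g. Xf b (Xf b f) g * schroedinger lam g \<phi> \<xi>)" if b: "b \<in> Basis" for b
      using Bd_fields(1)[OF Bd_fields(1)[OF f R b] R b] Bd_fields(2)[OF Bd_fields(2)[OF f R b] R b]
      by (auto intro!: group_fourier_integrable C1_continuous[OF c(1)])
    have "group_fourier (sublaplacian f) lam \<phi> \<xi> = (LINT g|lborel. (\<Sum>b\<in>Basis. - (Yf b (Yf b f) g * schroedinger lam g \<phi> \<xi>) + - (Xf b (Xf b f) g * schroedinger lam g \<phi> \<xi>)))"
      unfolding group_fourier_def sublaplacian_def
      by (intro Bochner_Integration.integral_cong refl) (simp add: sum_distrib_right left_diff_distrib)
    also have "\<dots> = (\<Sum>b\<in>Basis. - group_fourier (Yf b (Yf b f)) lam \<phi> \<xi> + - group_fourier (Xf b (Xf b f)) lam \<phi> \<xi>)"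
      unfolding group_fourier_def using j by (subst Bochner_Integration.integral_sum) auto
    finally show ?thesis ..
  qed
  finally show ?thesis .
qed

lemma group_fourier_eigenfunction:
  fixes f :: "'n::finite heis \<Rightarrow> complex"
  assumes f: "Bd W R A j f" and R: "R \<ge> 0" and \<phi>: "C2 \<phi>" and eig: "\<And>x. hermite_op lam \<phi> x = complex_of_real \<mu> * \<phi> x"
  shows "complex_of_real (\<mu> ^ m) * group_fourier f lam \<phi> \<xi> = group_fourier ((sublaplacian ^^ m) f) lam \<phi> \<xi>"
  using f
proof (induction m arbitrary: f A j)
  case (Suc m)
  have "group_fourier f lam (hermite_op lam \<phi>) \<xi> = complex_of_real \<mu> * group_fourier f lam \<phi> \<xi>"
    unfolding group_fourier_def schroedinger_hphase
    by (subst integral_mult_right_zero[symmetric]) (intro Bochner_Integration.integral_cong refl, simp add: eig mult_ac)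
  then have "complex_of_real \<mu> * group_fourier f lam \<phi> \<xi> = group_fourier (sublaplacian f) lam \<phi> \<xi>"
    using group_fourier_hermite_op[OF Suc.prems R \<phi>] by simp
  then have "complex_of_real (\<mu> ^ Suc m) * group_fourier f lam \<phi> \<xi> = complex_of_real (\<mu> ^ m) * group_fourier (sublaplacian f) lam \<phi> \<xi>"
    by (simp add: mult_ac)
  also have "\<dots> = group_fourier ((sublaplacian ^^ Suc m) f) lam \<phi> \<xi>"
    using Suc.IH[OF Bd_sublaplacian[OF Suc.prems R]] by (simp add: funpow_swap1)
  finally show ?case .
qed simp

end

section \<open>Injectivity of the group Fourier transform\<close>

lemma (in compact_supp) group_fourier_continuous:
  assumes \<phi>: "continuous_on UNIV \<phi>" and C: "\<And>x. cmod (\<phi> x) \<le> C"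
  shows "continuous_on UNIV (group_fourier f lam \<phi>)"
proof (rule continuous_on_sequentiallyI)
  fix u :: "nat \<Rightarrow> real ^ 'n" and a assume u: "u \<longlonglongrightarrow> a"
  have m: "(\<lambda>g. f g * schroedinger lam g \<phi> \<xi>) \<in> borel_measurable lborel" for \<xi>
    using borel_measurable_continuous_onI[OF continuous_on_mult[OF cont continuous_schroedinger[OF \<phi>, of lam \<xi>]]] by simp
  show "(\<lambda>n. group_fourier f lam \<phi> (u n)) \<longlonglongrightarrow> group_fourier f lam \<phi> a"
    unfolding group_fourier_def
  proof (rule integral_dominated_convergence[where w = "\<lambda>g. C * cmod (f g)"])
    show "integrable lborel (\<lambda>g. C * cmod (f g))" using integrable_f by simp
    show "AE g in lborel. cmod (f g * schroedinger lam g \<phi> (u n)) \<le> C * cmod (f g)" for n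
      by (rule AE_I2) (simp add: norm_mult schroedinger_hphase mult.commute[of C] mult_left_mono[OF C])
    show "AE g in lborel. (\<lambda>n. f g * schroedinger lam g \<phi> (u n)) \<longlonglongrightarrow> f g * schroedinger lam g \<phi> a"
    proof (rule AE_I2)
      fix g :: "'n heis"
      have "continuous_on UNIV (\<lambda>\<xi>. schroedinger lam g \<phi> \<xi>)"
        unfolding schroedinger_hphase by (intro continuous_intros continuous_on_compose2[OF \<phi>]) auto
      then have "isCont (\<lambda>\<xi>. schroedinger lam g \<phi> \<xi>) a" by (simp add: continuous_on_eq_continuous_at)
      then have "(\<lambda>n. schroedinger lam g \<phi> (u n)) \<longlonglongrightarrow> schroedinger lam g \<phi> a" using u by (rule isCont_tendsto_compose)
      then show "(\<lambda>n. f g * schroedinger lam g \<phi> (u n)) \<longlonglongrightarrow> f g * schroedinger lam g \<phi> a" by (intro tendsto_intros)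
    qed
  qed (use m in auto)
qed

text \<open>Evaluating the transform at a point, on a function that equals an exponential where it matters, gives
  the Fourier transform of \<open>f\<close> in slightly changed coordinates, for all frequencies with a nonzero last
  component and by continuity for all frequencies.\<close>

theorem group_fourier_injective:
  fixes f :: "'n::finite heis \<Rightarrow> complex"
  assumes f: "compact_supp f K"
    and zero: "\<And>lam \<phi>. lam \<noteq> 0 \<Longrightarrow> \<phi> \<in> L2 \<Longrightarrow> AE \<xi> in lborel. group_fourier f lam \<phi> \<xi> = 0"
  shows "f g = 0"
proof -
  interpret compact_supp f K by fact
  \<comment> \<open>The shear removes the quadratic term of the phase.\<close>
  define P :: "'n heis \<Rightarrow> 'n heis" where "P g = (fst g, snd g + re_vec (fst g) \<bullet> im_vec (fst g) / 2)" for g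
  define Q :: "'n heis \<Rightarrow> 'n heis" where "Q g = (fst g, snd g - re_vec (fst g) \<bullet> im_vec (fst g) / 2)" for g
  have QP: "Q (P g) = g" for g by (simp add: P_def Q_def)
  have contP: "continuous_on UNIV P" unfolding P_def by (intro continuous_intros) auto
  have contQ: "continuous_on UNIV Q" unfolding Q_def by (intro continuous_intros) auto
  have [measurable]: "P \<in> borel_measurable borel" by (rule borel_measurable_continuous_onI[OF contP])
  have "bounded ((\<lambda>g. im_vec (fst g)) ` K)"
    by (intro compact_imp_bounded compact_continuous_image K continuous_intros)
  then obtain B where B: "\<And>g. g \<in> K \<Longrightarrow> norm (im_vec (fst g)) \<le> B"
    unfolding bounded_iff by auto
  have dot: "(w, \<tau>) \<bullet> P g = re_vec w \<bullet> re_vec (fst g) + im_vec w \<bullet> im_vec (fst g) + \<tau> * (snd g + re_vec (fst g) \<bullet> im_vec (fst g) / 2)" for w \<tau> g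
    by (simp add: P_def inner_prod_def inner_vec_def re_vec_def im_vec_def inner_complex_def sum.distrib)
  have nz: "(LINT g|lborel. f g * cis ((w, \<tau>) \<bullet> P g)) = 0" if \<tau>: "\<tau> \<noteq> 0" for w :: "complex ^ 'n" and \<tau>
  proof -
    define x0 where "x0 = re_vec w /\<^sub>R \<tau>"
    define N where "N = B + norm x0"
    \<comment> \<open>A cut-off which is \<open>1\<close> on all translates of \<open>x0\<close> that occur for points of \<open>K\<close>, so that \<open>\<phi>\<close> is square integrable.\<close>
    define k where "k \<eta> = max 0 (min 1 (N + 1 - norm \<eta>))" for \<eta> :: "real ^ 'n"
    define \<phi> where "\<phi> \<eta> = cis (im_vec w \<bullet> \<eta>) * complex_of_real (k \<eta>)" for \<eta> :: "real ^ 'n"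
    have ck: "continuous_on UNIV k" unfolding k_def by (intro continuous_intros)
    have c\<phi>: "continuous_on UNIV \<phi>" unfolding \<phi>_def
      by (intro continuous_intros continuous_on_of_real ck)
    have b\<phi>: "cmod (\<phi> \<eta>) \<le> 1" for \<eta> by (simp add: \<phi>_def norm_mult k_def)
    have "integrable lborel (\<lambda>\<eta>. (cmod (\<phi> \<eta>))\<^sup>2)"
    proof (rule integrable_compact_support[OF _ compact_cball[of 0 "\<bar>N\<bar> + 1"]])
      show "continuous_on UNIV (\<lambda>\<eta>. (cmod (\<phi> \<eta>))\<^sup>2)" by (intro continuous_intros c\<phi>)
      show "(cmod (\<phi> \<eta>))\<^sup>2 = 0" if "\<eta> \<notin> cball 0 (\<bar>N\<bar> + 1)" for \<eta>
        using that by (simp add: \<phi>_def k_def)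
    qed
    then have L: "\<phi> \<in> L2" using c\<phi> by (simp add: L2_def borel_measurable_continuous_onI)
    have "group_fourier f \<tau> \<phi> x0 = 0"
      by (rule continuous_AE_zero[OF group_fourier_continuous[OF c\<phi> b\<phi>] zero[OF \<tau> L]])
    also have "group_fourier f \<tau> \<phi> x0 = (LINT g|lborel. cis (im_vec w \<bullet> x0) * (f g * cis ((w, \<tau>) \<bullet> P g)))"
      unfolding group_fourier_def
    proof (intro Bochner_Integration.integral_cong refl)
      fix g :: "'n heis"
      show "f g * schroedinger \<tau> g \<phi> x0 = cis (im_vec w \<bullet> x0) * (f g * cis ((w, \<tau>) \<bullet> P g))"
      proof (cases "g \<in> K")
        case True
        have "norm (x0 + im_vec (fst g)) \<le> N"
          using norm_triangle_ineq[of x0 "im_vec (fst g)"] B[OF True] by (simp add: N_def)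
        then have k1: "k (x0 + im_vec (fst g)) = 1" by (simp add: k_def)
        have "hphase \<tau> g x0 + im_vec w \<bullet> (x0 + im_vec (fst g)) = im_vec w \<bullet> x0 + (w, \<tau>) \<bullet> P g"
        proof -
          have "\<tau> * (re_vec (fst g) \<bullet> x0) = re_vec w \<bullet> re_vec (fst g)"
            using \<tau> by (simp add: x0_def inner_commute)
          then show ?thesis unfolding hphase_def dot inner_add_right by (simp add: algebra_simps)
        qed
        then have "cis (hphase \<tau> g x0) * cis (im_vec w \<bullet> (x0 + im_vec (fst g))) = cis (im_vec w \<bullet> x0) * cis ((w, \<tau>) \<bullet> P g)"
          by (simp add: cis_mult)
        then show ?thesis by (simp add: schroedinger_hphase \<phi>_def k1)
      qed (simp add: out)
    qed
    also have "\<dots> = cis (im_vec w \<bullet> x0) * (LINT g|lborel. f g * cis ((w, \<tau>) \<bullet> P g))" by simp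
    finally show ?thesis by simp
  qed
  have all: "(LINT g|lborel. f g * cis (\<omega> \<bullet> P g)) = 0" for \<omega>
  proof (cases "snd \<omega> = 0")
    case False
    then show ?thesis using nz[of "snd \<omega>" "fst \<omega>"] by simp
  next
    case True
    have "(\<lambda>n. LINT g|lborel. f g * cis ((fst \<omega>, inverse (real (Suc n))) \<bullet> P g)) \<longlonglongrightarrow> (LINT g|lborel. f g * cis (\<omega> \<bullet> P g))"
    proof (rule integral_dominated_convergence[where w = "\<lambda>g. cmod (f g)"])
      show "AE g in lborel. (\<lambda>n. f g * cis ((fst \<omega>, inverse (real (Suc n))) \<bullet> P g)) \<longlonglongrightarrow> f g * cis (\<omega> \<bullet> P g)"
      proof (rule AE_I2)
        fix g
        have "(\<lambda>n. (fst \<omega>, inverse (real (Suc n))) \<bullet> P g) \<longlonglongrightarrow> (fst \<omega>, 0) \<bullet> P g"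
          by (intro tendsto_intros LIMSEQ_inverse_real_of_nat)
        then have "(\<lambda>n. (fst \<omega>, inverse (real (Suc n))) \<bullet> P g) \<longlonglongrightarrow> \<omega> \<bullet> P g" using True by (metis prod.collapse)
        then show "(\<lambda>n. f g * cis ((fst \<omega>, inverse (real (Suc n))) \<bullet> P g)) \<longlonglongrightarrow> f g * cis (\<omega> \<bullet> P g)"
          by (intro tendsto_mult tendsto_const tendsto_cis)
      qed
    qed (use integrable_f in \<open>auto simp: norm_mult\<close>)
    moreover have "(LINT g|lborel. f g * cis ((fst \<omega>, inverse (real (Suc n))) \<bullet> P g)) = 0" for n
      by (rule nz) simp
    ultimately show ?thesis by (simp add: LIMSEQ_const_iff)
  qed
  then have null: "fourier_null lborel P f" using integrable_f by (simp add: fourier_null_def)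
  have "bounded (f ` K)" by (intro compact_imp_bounded compact_continuous_image K continuous_on_subset[OF cont]) auto
  then obtain C where C: "\<And>g. g \<in> K \<Longrightarrow> cmod (f g) \<le> C"
    unfolding bounded_iff by auto
  have C': "cmod (f g) \<le> \<bar>C\<bar>" for g using C[of g] out[of g] by (cases "g \<in> K") force+
  have part: "(LINT g|lborel. f g * complex_of_real (T (f g))) = 0"
    if T: "continuous_on UNIV T" "\<And>z. \<bar>T z\<bar> \<le> cmod z" for T :: "complex \<Rightarrow> real"
  proof -
    have "(LINT g|lborel. f g * complex_of_real ((T \<circ> f \<circ> Q) (P g))) = 0"
    proof (rule fourier_null_bounded_continuous[OF _ null])
      show "continuous_on UNIV (T \<circ> f \<circ> Q)"
        by (intro continuous_on_compose contQ continuous_on_subset[OF cont] continuous_on_subset[OF T(1)]) auto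
      show "\<bar>(T \<circ> f \<circ> Q) y\<bar> \<le> \<bar>C\<bar>" for y using T(2)[of "f (Q y)"] C'[of "Q y"] by simp
    qed simp
    then show ?thesis by (simp add: QP)
  qed
  have R: "(LINT g|lborel. f g * complex_of_real (Re (f g))) = 0"
    by (rule part) (auto intro: continuous_intros abs_Re_le_cmod)
  have I: "(LINT g|lborel. f g * complex_of_real (Im (f g))) = 0"
    by (rule part) (auto intro: continuous_intros abs_Im_le_cmod)
  have ib: "integrable lborel (\<lambda>g. f g * complex_of_real (T (f g)))"
    if T: "continuous_on UNIV T" "\<And>z. \<bar>T z\<bar> \<le> cmod z" for T :: "complex \<Rightarrow> real"
  proof (rule integrable_mult_bounded[OF integrable_f, of _ "\<bar>C\<bar>"])
    have "continuous_on UNIV (\<lambda>g. T (f g))" by (rule continuous_on_compose2[OF T(1) cont]) simp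
    then show "(\<lambda>g. complex_of_real (T (f g))) \<in> borel_measurable lborel"
      using borel_measurable_continuous_onI[OF continuous_on_of_real] by simp
    show "cmod (complex_of_real (T (f g))) \<le> \<bar>C\<bar>" for g using T(2)[of "f g"] C'[of g] by simp
  qed
  have iR: "integrable lborel (\<lambda>g. f g * complex_of_real (Re (f g)))"
    by (rule ib) (auto intro: continuous_intros abs_Re_le_cmod)
  have iI: "integrable lborel (\<lambda>g. f g * complex_of_real (Im (f g)))"
    by (rule ib) (auto intro: continuous_intros abs_Im_le_cmod)
  have sq: "f g * complex_of_real (Re (f g)) - \<i> * (f g * complex_of_real (Im (f g))) = complex_of_real ((cmod (f g))\<^sup>2)" for g
    unfolding cmod_power2 by (simp add: complex_eq_iff power2_eq_square)
  have "(LINT g|lborel. complex_of_real ((cmod (f g))\<^sup>2)) = 0"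
    unfolding sq[symmetric] using R I iR iI by (simp add: Bochner_Integration.integral_diff)
  moreover have isq: "integrable lborel (\<lambda>g. complex_of_real ((cmod (f g))\<^sup>2))"
    unfolding sq[symmetric] by (intro Bochner_Integration.integrable_diff integrable_mult_right iR iI)
  ultimately have z: "(LINT g|lborel. (cmod (f g))\<^sup>2) = 0"
    by (simp only: integral_complex_of_real of_real_eq_0_iff)
  have "integrable lborel (\<lambda>g. (cmod (f g))\<^sup>2)" using isq by (simp only: complex_of_real_integrable_eq)
  then have "AE g in lborel. (cmod (f g))\<^sup>2 = 0" using z by (subst (asm) integral_nonneg_eq_0_iff_AE) auto
  then have "AE g in lborel. f g = 0" by simp
  then show ?thesis by (rule continuous_AE_zero[OF cont])
qed

section \<open>Quasi-analyticity\<close>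

lemma logconvex_ratio:
  fixes M :: "nat \<Rightarrow> real"
  assumes pos: "\<And>k. M k > 0" and lc: "\<And>k. (M (Suc k))\<^sup>2 \<le> M k * M (Suc (Suc k))"
  shows "l \<le> m \<Longrightarrow> M m / M (Suc m) \<le> M l / M (Suc l)"
proof (induction m rule: dec_induct)
  case (step m)
  have "M (Suc m) / M (Suc (Suc m)) \<le> M m / M (Suc m)"
    using lc[of m] pos[of m] pos[of "Suc m"] pos[of "Suc (Suc m)"] by (simp add: field_simps power2_eq_square)
  then show ?case using step by linarith
qed simp

lemma logconvex_growth:
  fixes M :: "nat \<Rightarrow> real"
  assumes pos: "\<And>k. M k > 0" and lc: "\<And>k. (M (Suc k))\<^sup>2 \<le> M k * M (Suc (Suc k))"
  shows "j + i \<le> Suc m \<Longrightarrow> M (j + i) \<le> M j * (M (Suc m) / M m) ^ i"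
proof (induction i)
  case (Suc i)
  have "M m / M (Suc m) \<le> M (j + i) / M (Suc (j + i))"
    using Suc.prems by (intro logconvex_ratio[where M = M, OF pos lc]) auto
  then have "M (Suc (j + i)) \<le> M (j + i) * (M (Suc m) / M m)"
    using pos[of m] pos[of "Suc m"] pos[of "j + i"] pos[of "Suc (j + i)"] by (simp add: field_simps)
  also have "\<dots> \<le> (M j * (M (Suc m) / M m) ^ i) * (M (Suc m) / M m)"
    using Suc pos by (intro mult_right_mono divide_nonneg_pos) (auto intro: less_imp_le)
  finally show ?case by (simp add: mult_ac)
qed simp

text \<open>Bang's argument. Smallness of all derivatives at a point, measured on a geometric scale and up to order
  \<open>m\<close>, persists on an interval of length comparable to \<open>M m / M (m + 1)\<close> at the price of one step on
  that scale, by Taylor expansion.\<close>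

lemma Bang_step:
  fixes h :: "nat \<Rightarrow> real \<Rightarrow> real" and M :: "nat \<Rightarrow> real"
  assumes der: "\<And>k t. (h k has_real_derivative h (Suc k) t) (at t)"
    and bound: "\<And>k t. \<bar>h k t\<bar> \<le> M k"
    and pos: "\<And>k. M k > 0" and lc: "\<And>k. (M (Suc k))\<^sup>2 \<le> M k * M (Suc (Suc k))"
    and N: "\<And>j. \<bar>h j x\<bar> \<le> exp (real j - real (Suc m)) * M j"
    and s: "0 \<le> s" "s \<le> (M m / M (Suc m)) / exp 1"
  shows "\<bar>h j (x + s)\<bar> \<le> exp (real j - real m) * M j"
proof (cases "m \<le> j")
  case True
  have "1 * M j \<le> exp (real j - real m) * M j" using True pos[of j] by (intro mult_right_mono) auto
  then show ?thesis using bound[of j "x + s"] by simp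
next
  case False
  show ?thesis
  proof (cases "s = 0")
    case True
    have "exp (real j - real (Suc m)) * M j \<le> exp (real j - real m) * M j"
      using pos[of j] by (intro mult_right_mono) auto
    then show ?thesis using N[of j] True by simp
  next
    case False
    with s have s0: "s > 0" by simp
    define n where "n = Suc m - j"
    have n: "j + n = Suc m" "n > 0" using \<open>\<not> m \<le> j\<close> by (auto simp: n_def)
    define \<rho> where "\<rho> = M (Suc m) / M m"
    define y where "y = exp 1 * (s * \<rho>)"
    have y: "0 \<le> y" "y \<le> 1"
      using s pos[of m] pos[of "Suc m"] by (auto simp: y_def \<rho>_def field_simps)
    have "\<forall>k t. k < n \<and> x \<le> t \<and> t \<le> x + s \<longrightarrow> DERIV (\<lambda>t. h (j + k) t) t :> h (j + Suc k) t"
      using der by simp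
    from Taylor_up[OF n(2), of "\<lambda>k. h (j + k)" "h j" x "x + s" x, OF _ this] s0
    obtain t where t: "h j (x + s) = (\<Sum>i<n. h (j + i) x / fact i * s ^ i) + h (j + n) t / fact n * s ^ n"
      by auto
    have tm: "exp (real (j + i) - real (Suc m)) * M (j + i) * s ^ i / fact i \<le> exp (real j - real (Suc m)) * M j * (y ^ i / fact i)"
      if "j + i \<le> Suc m" for i
    proof -
      have "exp (real (j + i) - real (Suc m)) = exp (real j - real (Suc m)) * exp 1 ^ i"
        by (simp add: exp_of_nat_mult[symmetric] mult_exp_exp algebra_simps)
      moreover have "M (j + i) * s ^ i \<le> M j * \<rho> ^ i * s ^ i"
        using logconvex_growth[where M = M, OF pos lc that] s(1) unfolding \<rho>_def by (intro mult_right_mono) auto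
      then have "exp (real j - real (Suc m)) * exp 1 ^ i / fact i * (M (j + i) * s ^ i)
         \<le> exp (real j - real (Suc m)) * exp 1 ^ i / fact i * (M j * \<rho> ^ i * s ^ i)"
        by (intro mult_left_mono) auto
      moreover have "y ^ i = exp 1 ^ i * (s ^ i * \<rho> ^ i)" by (simp only: y_def power_mult_distrib)
      ultimately show ?thesis by (simp add: mult_ac)
    qed
    have "\<bar>h j (x + s)\<bar> \<le> (\<Sum>i<n. \<bar>h (j + i) x / fact i * s ^ i\<bar>) + \<bar>h (j + n) t / fact n * s ^ n\<bar>"
      unfolding t by (intro order_trans[OF abs_triangle_ineq] add_mono sum_abs order_refl)
    also have "\<dots> \<le> (\<Sum>i<n. exp (real j - real (Suc m)) * M j * (y ^ i / fact i)) + exp (real j - real (Suc m)) * M j * (y ^ n / fact n)"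
    proof (intro add_mono sum_mono)
      fix i assume "i \<in> {..<n}"
      then have i: "j + i \<le> Suc m" using n by auto
      have "\<bar>h (j + i) x / fact i * s ^ i\<bar> = \<bar>h (j + i) x\<bar> * (s ^ i / fact i)"
        using s by (simp add: abs_mult)
      also have "\<dots> \<le> exp (real (j + i) - real (Suc m)) * M (j + i) * (s ^ i / fact i)"
        using s(1) by (intro mult_right_mono N) auto
      finally show "\<bar>h (j + i) x / fact i * s ^ i\<bar> \<le> exp (real j - real (Suc m)) * M j * (y ^ i / fact i)"
        using tm[OF i] by simp
    next
      have "\<bar>h (j + n) t / fact n * s ^ n\<bar> = \<bar>h (j + n) t\<bar> * (s ^ n / fact n)"
        using s by (simp add: abs_mult)
      also have "\<dots> \<le> M (j + n) * (s ^ n / fact n)"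
        using s(1) by (intro mult_right_mono bound) auto
      finally show "\<bar>h (j + n) t / fact n * s ^ n\<bar> \<le> exp (real j - real (Suc m)) * M j * (y ^ n / fact n)"
        using tm[of n] n by simp
    qed
    also have "\<dots> = exp (real j - real (Suc m)) * M j * (\<Sum>i<Suc n. y ^ i / fact i)"
      by (simp add: sum_distrib_left distrib_left)
    also have "\<dots> \<le> exp (real j - real (Suc m)) * M j * exp 1"
    proof (intro mult_left_mono)
      have "(\<Sum>i<Suc n. y ^ i / fact i) \<le> exp y"
        using sum_le_suminf[OF summable_exp_generic[of y], of "{..<Suc n}"] y(1)
        by (simp add: exp_def divide_inverse mult.commute)
      also have "\<dots> \<le> exp 1" using y by simp
      finally show "(\<Sum>i<Suc n. y ^ i / fact i) \<le> exp 1" .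
    qed (use pos[of j] in auto)
    also have "\<dots> = exp (real j - real m) * M j"
      by (simp add: mult_exp_exp mult.assoc mult.left_commute[of "M j"] mult.commute[of "M j"])
    finally show ?thesis .
  qed
qed

text \<open>Starting from infinite order of vanishing, a sum of step lengths is available before the estimate
  degrades to order \<open>k\<close>; since the sum diverges, every point is reached for every \<open>k\<close>.\<close>

theorem Bang:
  fixes h :: "nat \<Rightarrow> real \<Rightarrow> real" and M :: "nat \<Rightarrow> real"
  assumes der: "\<And>k t. (h k has_real_derivative h (Suc k) t) (at t)"
    and bound: "\<And>k t. \<bar>h k t\<bar> \<le> M k"
    and pos: "\<And>k. M k > 0" and lc: "\<And>k. (M (Suc k))\<^sup>2 \<le> M k * M (Suc (Suc k))"
    and h0: "\<And>k. h k 0 = 0"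
    and div: "\<not> summable (\<lambda>k. M k / M (Suc k))"
    and t: "t \<ge> 0"
  shows "h 0 t = 0"
proof -
  let ?r = "\<lambda>k. M k / M (Suc k)"
  have r: "?r k > 0" for k using pos by simp
  have claim: "\<bar>h j x\<bar> \<le> exp (real j - real k) * M j" if "0 \<le> x" "x \<le> (\<Sum>i=k..<k+d. ?r i) / exp 1" for d k x j
    using that
  proof (induction d arbitrary: k x j)
    case 0
    then show ?case using h0 pos[of j] by (simp add: less_imp_le)
  next
    case (Suc d)
    define x' where "x' = max 0 (x - ?r k / exp 1)"
    have split: "(\<Sum>i=k..<k+Suc d. ?r i) = ?r k + (\<Sum>i=Suc k..<Suc k+d. ?r i)"
      by (simp add: sum.atLeast_Suc_lessThan)
    have "0 \<le> (\<Sum>i=Suc k..<Suc k+d. ?r i) / exp 1" by (intro divide_nonneg_pos sum_nonneg r[THEN less_imp_le]) simp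
    then have x': "0 \<le> x'" "x' \<le> (\<Sum>i=Suc k..<Suc k+d. ?r i) / exp 1"
      using Suc.prems unfolding split by (auto simp: x'_def add_divide_distrib)
    have "\<bar>h j (x' + (x - x'))\<bar> \<le> exp (real j - real k) * M j"
    proof (rule Bang_step[where h = h and M = M, OF der bound pos lc])
      show "\<bar>h j x'\<bar> \<le> exp (real j - real (Suc k)) * M j" for j by (rule Suc.IH[OF x'])
      show "0 \<le> x - x'" "x - x' \<le> ?r k / exp 1"
        using Suc.prems(1) divide_nonneg_pos[OF less_imp_le[OF r[of k]] exp_gt_zero, of 1] by (auto simp: x'_def max_def)
    qed
    then show ?case by simp
  qed
  have le: "\<bar>h 0 t\<bar> \<le> exp (- real k) * M 0" for k
  proof -
    have "\<not> summable (\<lambda>i. ?r (i + k))" using div by (subst summable_iff_shift)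
    then have "\<not> (\<forall>d. (\<Sum>i<d. ?r (i + k)) \<le> t * exp 1)"
      using summableI_nonneg_bounded[of "\<lambda>i. ?r (i + k)" "t * exp 1"] r less_imp_le by blast
    then obtain d where "t * exp 1 < (\<Sum>i<d. ?r (i + k))" by (auto simp: not_le)
    also have "(\<Sum>i<d. ?r (i + k)) = (\<Sum>i=k..<k+d. ?r i)"
      using sum.shift_bounds_nat_ivl[of ?r 0 k d] by (simp add: lessThan_atLeast0 add.commute)
    finally have "t \<le> (\<Sum>i=k..<k+d. ?r i) / exp 1" by (simp add: field_simps)
    then show ?thesis using claim[OF t, of k d 0] by simp
  qed
  have "(\<lambda>k. exp (- real k) * M 0) \<longlonglongrightarrow> 0 * M 0"
  proof (intro tendsto_intros)
    have "(\<lambda>k. (exp (-1) :: real) ^ k) \<longlonglongrightarrow> 0" by (intro LIMSEQ_power_zero) simp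
    then show "(\<lambda>k. exp (- real k)) \<longlonglongrightarrow> 0" by (simp add: exp_of_nat_mult[symmetric])
  qed
  then have "\<bar>h 0 t\<bar> \<le> 0 * M 0" by (rule LIMSEQ_le_const) (use le in auto)
  then show ?thesis by simp
qed

lemma geometric_mean_le_arithmetic:
  fixes x :: "nat \<Rightarrow> real"
  assumes "\<And>i. x i > 0" "k > 0"
  shows "root k (\<Prod>i<k. x i) \<le> (\<Sum>i<k. x i) / real k"
proof -
  have "(\<Prod>i<k. x i) powr (1 / card {..<k}) \<le> (\<Sum>i<k. x i / card {..<k})"
    using assms by (intro arith_geom_mean) (auto intro: less_imp_le)
  moreover have "root k (\<Prod>i<k. x i) = (\<Prod>i<k. x i) powr (1 / real k)"
    using assms by (intro root_powr_inverse prod_nonneg) (auto intro: less_imp_le)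
  ultimately show ?thesis by (simp add: sum_divide_distrib)
qed

text \<open>Polya's proof: the weights \<open>c i\<close> have partial products \<open>(k + 1) ^ k\<close>, and the inequality between
  geometric and arithmetic means for \<open>r i * c i\<close> leaves a telescoping sum.\<close>

lemma Carleman_inequality:
  fixes r :: "nat \<Rightarrow> real"
  assumes pos: "\<And>i. r i > 0" and sm: "summable r"
  shows "summable (\<lambda>k. root (Suc k) (\<Prod>i<Suc k. r i))"
proof -
  define c where "c i = (real i + 2) ^ Suc i / (real i + 1) ^ i" for i
  have cpos: "c i > 0" for i by (simp add: c_def add_pos_pos)
  have cprod: "(\<Prod>i<k. c i) = (real k + 1) ^ k" for k
  proof (induction k)
    case (Suc k)
    have "(real k + 1) ^ k * c k = (real k + 2) ^ Suc k" by (simp add: c_def add_pos_pos)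
    then show ?case using Suc by (simp add: add.commute)
  qed simp
  have ce: "c i \<le> exp 1 * (real i + 1)" for i
  proof -
    have "(1 + 1 / (real i + 1)) ^ Suc i \<le> exp (1 / (real i + 1)) ^ Suc i"
      by (intro power_mono exp_ge_add_one_self) auto
    also have "\<dots> = exp (real (Suc i) * (1 / (real i + 1)))" by (rule exp_of_nat_mult[symmetric])
    also have "real (Suc i) * (1 / (real i + 1)) = 1" by (simp add: add.commute)
    finally have "(1 + 1 / (real i + 1)) ^ Suc i \<le> exp 1" .
    moreover have "c i = (1 + 1 / (real i + 1)) ^ Suc i * (real i + 1)"
    proof -
      have "1 + 1 / (real i + 1) = (real i + 2) / (real i + 1)" by (simp add: field_simps)
      then show ?thesis by (simp add: c_def power_divide)
    qed
    ultimately show ?thesis by (simp add: mult_right_mono)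
  qed
  have tm: "root (Suc k) (\<Prod>i<Suc k. r i) \<le> (\<Sum>i<Suc k. r i * c i) * (1 / (real k + 1) - 1 / (real k + 2))" for k
  proof -
    have "root (Suc k) (\<Prod>i<Suc k. r i * c i) \<le> (\<Sum>i<Suc k. r i * c i) / real (Suc k)"
      using pos cpos by (intro geometric_mean_le_arithmetic) auto
    moreover have "root (Suc k) (\<Prod>i<Suc k. r i * c i) = root (Suc k) (\<Prod>i<Suc k. r i) * (real k + 2)"
    proof -
      have "(\<Prod>i<Suc k. r i * c i) = (\<Prod>i<Suc k. r i) * (real k + 2) ^ Suc k"
        unfolding prod.distrib cprod by (simp add: add.commute)
      then show ?thesis by (simp add: real_root_mult real_root_power_cancel del: power_Suc prod.lessThan_Suc)
    qed
    ultimately have le: "root (Suc k) (\<Prod>i<Suc k. r i) * (real k + 2) \<le> (\<Sum>i<Suc k. r i * c i) / real (Suc k)" by simp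
    then have "root (Suc k) (\<Prod>i<Suc k. r i) \<le> (\<Sum>i<Suc k. r i * c i) / real (Suc k) / (real k + 2)"
      by (subst pos_le_divide_eq) auto
    also have "\<dots> = (\<Sum>i<Suc k. r i * c i) * (1 / (real k + 1) - 1 / (real k + 2))"
      by (simp add: field_simps del: sum.lessThan_Suc)
    finally show ?thesis .
  qed
  have tele: "(\<Sum>k=i..<n. 1 / (real k + 1) - 1 / (real k + 2)) \<le> 1 / (real i + 1)" if "i < n" for i n
  proof -
    have "(\<Sum>k=i..<n. 1 / (real k + 1) - 1 / (real k + 2)) = 1 / (real i + 1) - 1 / (real n + 1)"
      using that by (induction n) (auto simp: less_Suc_eq algebra_simps)
    then show ?thesis by simp
  qed
  have nested: "(\<Sum>k<n. \<Sum>i<Suc k. F k i) = (\<Sum>i<n. \<Sum>k=i..<n. F k i)" for n and F :: "nat \<Rightarrow> nat \<Rightarrow> real"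
  proof (induction n)
    case (Suc n)
    have "(\<Sum>i<Suc n. \<Sum>k=i..<Suc n. F k i) = (\<Sum>i<Suc n. (\<Sum>k=i..<n. F k i) + F n i)"
      by (intro sum.cong refl) simp
    also have "\<dots> = (\<Sum>i<n. \<Sum>k=i..<n. F k i) + (\<Sum>i<Suc n. F n i)"
      by (simp add: sum.distrib)
    finally show ?case using Suc by simp
  qed simp
  have bd: "(\<Sum>k<n. root (Suc k) (\<Prod>i<Suc k. r i)) \<le> exp 1 * suminf r" for n
  proof -
    have "(\<Sum>k<n. root (Suc k) (\<Prod>i<Suc k. r i)) \<le> (\<Sum>k<n. \<Sum>i<Suc k. r i * c i * (1 / (real k + 1) - 1 / (real k + 2)))"
      using tm by (intro sum_mono) (simp add: sum_distrib_right del: sum.lessThan_Suc)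
    also have "\<dots> = (\<Sum>i<n. \<Sum>k=i..<n. r i * c i * (1 / (real k + 1) - 1 / (real k + 2)))"
      by (rule nested)
    also have "\<dots> \<le> (\<Sum>i<n. exp 1 * r i)"
    proof (rule sum_mono)
      fix i assume i: "i \<in> {..<n}"
      have "(\<Sum>k=i..<n. r i * c i * (1 / (real k + 1) - 1 / (real k + 2))) = r i * c i * (\<Sum>k=i..<n. 1 / (real k + 1) - 1 / (real k + 2))"
        by (simp add: sum_distrib_left)
      also have "\<dots> \<le> r i * (exp 1 * (real i + 1)) * (1 / (real i + 1))"
        using pos[of i] cpos[of i] ce[of i] tele[of i n] i
        by (intro mult_mono mult_left_mono) (auto intro: less_imp_le intro!: sum_nonneg simp: field_simps)
      also have "\<dots> = exp 1 * r i" by (simp add: field_simps add_pos_pos)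
      finally show "(\<Sum>k=i..<n. r i * c i * (1 / (real k + 1) - 1 / (real k + 2))) \<le> exp 1 * r i" .
    qed
    also have "\<dots> = exp 1 * (\<Sum>i<n. r i)" by (simp add: sum_distrib_left)
    also have "\<dots> \<le> exp 1 * suminf r"
      using sum_le_suminf[OF sm, of "{..<n}"] pos by (intro mult_left_mono) (auto intro: less_imp_le)
    finally show ?thesis .
  qed
  show ?thesis
    by (rule summableI_nonneg_bounded[OF _ bd]) (intro real_root_ge_zero prod_nonneg less_imp_le divide_pos_pos pos)
qed

text \<open>Carleman's inequality converts the bound on the numbers \<open>M k\<close> into divergence of the sum of their
  quotients: the geometric mean of the first \<open>k\<close> quotients is the \<open>k\<close>-th root of \<open>M 0 / M k\<close>.\<close>

theorem Denjoy_Carleman: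
  fixes h :: "nat \<Rightarrow> real \<Rightarrow> real" and M q :: "nat \<Rightarrow> real"
  assumes der: "\<And>k t. (h k has_real_derivative h (Suc k) t) (at t)"
    and bound: "\<And>k t. \<bar>h k t\<bar> \<le> M k"
    and pos: "\<And>k. M k > 0" and lc: "\<And>k. (M (Suc k))\<^sup>2 \<le> M k * M (Suc (Suc k))"
    and h0: "\<And>k. h k 0 = 0"
    and q: "\<And>k. q k > 0" and B: "B > 0" and C: "C \<ge> 1"
    and le: "\<And>k. M (Suc k) \<le> C * (B * real (Suc k) / q (Suc k)) ^ Suc k"
    and div: "\<not> summable (\<lambda>k. q (Suc k) / real (Suc k))"
    and t: "t \<ge> 0"
  shows "h 0 t = 0"
proof (rule Bang[where h = h and M = M, OF der bound pos lc h0 _ t])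
  show "\<not> summable (\<lambda>k. M k / M (Suc k))"
  proof
    assume "summable (\<lambda>k. M k / M (Suc k))"
    then have s: "summable (\<lambda>k. root (Suc k) (\<Prod>i<Suc k. M i / M (Suc i)))"
      using pos by (intro Carleman_inequality) auto
    \<comment> \<open>Below \<open>1\<close>, so that a power of \<open>\<delta>\<close> is at most \<open>\<delta>\<close>; this absorbs the constants into the root.\<close>
    define \<delta> where "\<delta> = min 1 (M 0 / C)"
    have \<delta>: "0 < \<delta>" "\<delta> \<le> 1" "\<delta> \<le> M 0 / C" using pos[of 0] C by (auto simp: \<delta>_def)
    have "\<delta> / B * (q (Suc k) / real (Suc k)) \<le> root (Suc k) (\<Prod>i<Suc k. M i / M (Suc i))" for k
    proof -
      let ?y = "q (Suc k) / (B * real (Suc k))"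
      have y: "?y > 0" using q B by (intro divide_pos_pos mult_pos_pos) auto
      have "(\<Prod>i<n. M i / M (Suc i)) = M 0 / M n" for n
        using pos[THEN less_imp_neq] by (induction n) (auto simp: field_simps)
      note pr = this[of "Suc k"]
      have "(\<delta> * ?y) ^ Suc k \<le> \<delta> * ?y ^ Suc k"
      proof -
        have "\<delta> ^ Suc k \<le> \<delta> * 1" unfolding power_Suc using \<delta> by (intro mult_left_mono power_le_one) auto
        then have "\<delta> ^ Suc k * ?y ^ Suc k \<le> \<delta> * 1 * ?y ^ Suc k" by (rule mult_right_mono) (rule zero_le_power[OF less_imp_le[OF y]])
        then show ?thesis by (simp only: power_mult_distrib mult_1_right)
      qed
      also have "\<dots> \<le> M 0 / C * ?y ^ Suc k" using \<delta>(3) zero_le_power[OF less_imp_le[OF y]] by (rule mult_right_mono)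
      also have "\<dots> = M 0 / (C * (B * real (Suc k) / q (Suc k)) ^ Suc k)"
        by (simp add: power_divide del: power_Suc)
      also have "\<dots> \<le> M 0 / M (Suc k)"
        by (rule divide_left_mono[OF le less_imp_le[OF pos] mult_pos_pos[OF less_le_trans[OF pos le] pos]])
      finally have "(\<delta> * ?y) ^ Suc k \<le> (\<Prod>i<Suc k. M i / M (Suc i))" by (simp only: pr)
      then have "root (Suc k) ((\<delta> * ?y) ^ Suc k) \<le> root (Suc k) (\<Prod>i<Suc k. M i / M (Suc i))"
        by (rule real_root_le_mono[rotated]) simp
      moreover have "root (Suc k) ((\<delta> * ?y) ^ Suc k) = \<delta> * ?y"
        using \<delta> y by (intro real_root_power_cancel mult_nonneg_nonneg) (auto simp del: divide_le_0_iff)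
      moreover have "\<delta> * ?y = \<delta> / B * (q (Suc k) / real (Suc k))" by simp
      ultimately show ?thesis by (simp only:)
    qed
    then have "summable (\<lambda>k. \<delta> / B * (q (Suc k) / real (Suc k)))"
      using q \<delta> B by (intro summable_comparison_test'[OF s, of 0]) (auto simp: less_imp_le)
    then have "summable (\<lambda>k. q (Suc k) / real (Suc k))"
      using \<delta> B by (subst (asm) summable_cmult_iff) auto
    then show False using div by contradiction
  qed
qed

section \<open>Cosine series with rapidly decreasing coefficients\<close>

text \<open>The phase shift by \<open>j * pi / 2\<close> writes all derivatives of the cosine in one formula.\<close>

lemma cosine_series_derivative:
  fixes s p a :: "nat \<Rightarrow> real"
  assumes s: "\<And>k. s k \<ge> 0" and ap: "\<And>k. \<bar>a k\<bar> \<le> p k" and sm: "\<And>j. summable (\<lambda>k. s k ^ j * p k)"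
  defines "D \<equiv> \<lambda>j t. \<Sum>k. a k * s k ^ j * cos (t * s k + real j * (pi / 2))"
  shows "(D j has_real_derivative D (Suc j) t) (at t)"
    and "\<bar>D j t\<bar> \<le> (\<Sum>k. s k ^ j * p k)"
proof -
  have b: "norm (a k * s k ^ j * cos (t * s k + real j * (pi / 2))) \<le> s k ^ j * p k" for j k t
  proof -
    have "\<bar>a k\<bar> * s k ^ j * \<bar>cos (t * s k + real j * (pi / 2))\<bar> \<le> p k * s k ^ j * 1"
      using s[of k] ap[of k] by (intro mult_mono) auto
    then show ?thesis using s[of k] by (simp add: abs_mult mult.commute)
  qed
  have sD: "summable (\<lambda>k. a k * s k ^ j * cos (t * s k + real j * (pi / 2)))" for j t
    by (rule summable_comparison_test'[OF sm[of j], of 0]) (use b in auto)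
  have d: "((\<lambda>t. a k * s k ^ j * cos (t * s k + real j * (pi / 2))) has_real_derivative
      a k * s k ^ Suc j * cos (t * s k + real (Suc j) * (pi / 2))) (at t)" for k t
  proof -
    have "cos (t * s k + real (Suc j) * (pi / 2)) = - sin (t * s k + real j * (pi / 2))"
    proof -
      have e: "t * s k + real (Suc j) * (pi / 2) = (t * s k + real j * (pi / 2)) + pi / 2"
        by (simp add: algebra_simps add_divide_distrib)
      show ?thesis unfolding e cos_add[of "t * s k + real j * (pi / 2)" "pi / 2"] by simp
    qed
    then show ?thesis by (auto intro!: derivative_eq_intros simp: mult_ac)
  qed
  have u: "uniformly_convergent_on UNIV (\<lambda>n t. \<Sum>k<n. a k * s k ^ Suc j * cos (t * s k + real (Suc j) * (pi / 2)))"
    by (rule Weierstrass_m_test'[OF _ sm[of "Suc j"]]) (rule b)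
  show "(D j has_real_derivative D (Suc j) t) (at t)"
    unfolding D_def
  proof (rule has_field_derivative_series'(2)[where S = UNIV and ?x0.0 = t
        and f = "\<lambda>k t. a k * s k ^ j * cos (t * s k + real j * (pi / 2))"
        and f' = "\<lambda>k t. a k * s k ^ Suc j * cos (t * s k + real (Suc j) * (pi / 2))"])
    show "((\<lambda>t. a k * s k ^ j * cos (t * s k + real j * (pi / 2))) has_real_derivative
      a k * s k ^ Suc j * cos (t * s k + real (Suc j) * (pi / 2))) (at t within UNIV)" for k t
      by (rule d)
  qed (use u sD in \<open>simp_all del: power_Suc of_nat_Suc\<close>)
  have "\<bar>D j t\<bar> \<le> (\<Sum>k. norm (a k * s k ^ j * cos (t * s k + real j * (pi / 2))))"
    unfolding D_def real_norm_def[symmetric]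
    by (rule summable_norm, rule summable_comparison_test'[OF sm[of j], of 0]) (use b in auto)
  also have "\<dots> \<le> (\<Sum>k. s k ^ j * p k)"
    by (rule suminf_le[OF b _ sm], rule summable_comparison_test'[OF sm[of j], of 0]) (use b in auto)
  finally show "\<bar>D j t\<bar> \<le> (\<Sum>k. s k ^ j * p k)" .
qed

lemma moments_logconvex:
  fixes s p :: "nat \<Rightarrow> real"
  assumes s: "\<And>k. s k \<ge> 0" and p: "\<And>k. p k \<ge> 0" and sm: "\<And>j. summable (\<lambda>k. s k ^ j * p k)"
  shows "(\<Sum>k. s k ^ Suc j * p k)\<^sup>2 \<le> (\<Sum>k. s k ^ j * p k) * (\<Sum>k. s k ^ Suc (Suc j) * p k)"
proof (rule LIMSEQ_le)
  show "(\<lambda>n. (\<Sum>k<n. s k ^ Suc j * p k)\<^sup>2) \<longlonglongrightarrow> (\<Sum>k. s k ^ Suc j * p k)\<^sup>2"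
    by (intro tendsto_intros summable_LIMSEQ sm)
  show "(\<lambda>n. (\<Sum>k<n. s k ^ j * p k) * (\<Sum>k<n. s k ^ Suc (Suc j) * p k)) \<longlonglongrightarrow> (\<Sum>k. s k ^ j * p k) * (\<Sum>k. s k ^ Suc (Suc j) * p k)"
    by (intro tendsto_intros summable_LIMSEQ sm)
  have "(\<Sum>k<n. s k ^ Suc j * p k)\<^sup>2 \<le> (\<Sum>k<n. s k ^ j * p k) * (\<Sum>k<n. s k ^ Suc (Suc j) * p k)" for n
  proof -
    let ?a = "\<lambda>k. sqrt (s k ^ j * p k)" and ?b = "\<lambda>k. s k * sqrt (s k ^ j * p k)"
    have nn: "s k ^ j * p k \<ge> 0" for k using s p by simp
    have e: "?a k * ?b k = s k ^ Suc j * p k" "(?a k)\<^sup>2 = s k ^ j * p k" "(?b k)\<^sup>2 = s k ^ Suc (Suc j) * p k" for k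
      using nn[of k] by (simp_all add: power_mult_distrib power2_eq_square mult.left_commute[of "sqrt _"])
    have "(\<Sum>k<n. ?a k * ?b k)\<^sup>2 \<le> (\<Sum>k<n. (?a k)\<^sup>2) * (\<Sum>k<n. (?b k)\<^sup>2)"
      by (rule Cauchy_Schwarz_ineq_sum)
    then show ?thesis unfolding e .
  qed
  then show "\<exists>N. \<forall>n\<ge>N. (\<Sum>k<n. s k ^ Suc j * p k)\<^sup>2 \<le> (\<Sum>k<n. s k ^ j * p k) * (\<Sum>k<n. s k ^ Suc (Suc j) * p k)"
    by blast
qed

text \<open>At the origin the odd derivatives of the series vanish by parity and the even ones are the given
  moments. The bounds on the derivatives are moments of a positive sequence and therefore
  logarithmically convex, as the theorem of Denjoy and Carleman requires.\<close>

theorem cosine_series_vanishes: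
  fixes s p a q :: "nat \<Rightarrow> real"
  assumes s: "\<And>k. s k > 0" and ap: "\<And>k. \<bar>a k\<bar> \<le> p k" and sm: "\<And>j. summable (\<lambda>k. s k ^ j * p k)"
    and moments: "\<And>m. (\<Sum>k. a k * s k ^ (2 * m)) = 0"
    and q: "\<And>j. q j > 0" and B: "B > 0" and C: "C \<ge> 1"
    and growth: "\<And>j. (\<Sum>k. s k ^ Suc j * p k) \<le> C * (B * real (Suc j) / q (Suc j)) ^ Suc j"
    and div: "\<not> summable (\<lambda>j. q (Suc j) / real (Suc j))"
  shows "(\<Sum>k. a k * cos (t * s k)) = 0"
proof (cases "\<forall>k. p k = 0")
  case True
  then have "a k = 0" for k using ap[of k] by simp
  then show ?thesis by simp
next
  case False
  then obtain k0 where k0: "p k0 \<noteq> 0" by blast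
  have p: "p k \<ge> 0" for k using ap[of k] by linarith
  have s0: "s k \<ge> 0" for k using s less_imp_le by blast
  define M where "M j = (\<Sum>k. s k ^ j * p k)" for j
  define D where "D j t = (\<Sum>k. a k * s k ^ j * cos (t * s k + real j * (pi / 2)))" for j t
  note D = cosine_series_derivative[OF s0 ap sm, folded D_def M_def]
  have pk0: "p k0 > 0" using k0 p[of k0] by simp
  have "M j > 0" for j unfolding M_def
    using p s0 by (intro suminf_pos2[OF sm, of j k0] mult_nonneg_nonneg mult_pos_pos zero_less_power s pk0) auto
  moreover have "D j 0 = 0" for j
  proof (cases "even j")
    case True
    then obtain m where j: "j = 2 * m" by blast
    have "D j 0 = (\<Sum>k. (a k * s k ^ (2 * m)) * (-1) ^ m)"
      unfolding D_def j by (simp add: mult.assoc cos_npi)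
    also have "\<dots> = (\<Sum>k. a k * s k ^ (2 * m)) * (-1) ^ m"
    proof (rule suminf_mult2[symmetric])
      show "summable (\<lambda>k. a k * s k ^ (2 * m))"
        by (rule summable_comparison_test'[OF sm[of "2 * m"], of 0])
          (use s0 ap in \<open>auto simp: abs_mult mult.commute intro!: mult_right_mono\<close>)
    qed
    finally show ?thesis using moments by simp
  next
    case False
    then obtain m where j: "j = 2 * m + 1" using oddE by blast
    have "cos (real j * (pi / 2)) = 0"
      unfolding j cos_zero_iff by (intro disjI1 exI[of _ "2 * m + 1"]) simp
    then show ?thesis by (simp add: D_def)
  qed
  moreover have "(M (Suc k))\<^sup>2 \<le> M k * M (Suc (Suc k))" for k
    unfolding M_def by (rule moments_logconvex[OF s0 p sm])
  ultimately have "D 0 u = 0" if "u \<ge> 0" for u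
    by (intro Denjoy_Carleman[where h = D and M = M and q = q and B = B and C = C])
      (use D q B C growth div that in \<open>auto simp: M_def\<close>)
  from this[of "\<bar>t\<bar>"] have "(\<Sum>k. a k * cos (\<bar>t\<bar> * s k)) = 0" by (simp add: D_def)
  moreover have "cos (\<bar>t\<bar> * s k) = cos (t * s k)" for k
    by (cases "t \<ge> 0") auto
  ultimately show ?thesis by simp
qed

text \<open>The series is the Fourier transform of a discrete measure with mass at the frequencies \<open>s k\<close> and
  \<open>- s k\<close>, which annihilates all bounded continuous functions if it vanishes.\<close>

lemma cosine_series_unique:
  fixes s :: "nat \<Rightarrow> real" and a :: "nat \<Rightarrow> complex" and F :: "real \<Rightarrow> real"
  assumes sm: "summable (\<lambda>k. cmod (a k))" and zero: "\<And>t. (\<Sum>k. a k * complex_of_real (cos (t * s k))) = 0"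
    and F: "continuous_on UNIV F" "\<And>y. \<bar>F y\<bar> \<le> B" "\<And>y. F (- y) = F y"
  shows "(\<Sum>k. a k * complex_of_real (F (s k))) = 0"
proof -
  define v where "v n = a (n div 2)" for n
  \<comment> \<open>Even and odd indices enumerate the frequencies \<open>s k\<close> and \<open>- s k\<close>.\<close>
  define P where "P n = (if even n then s (n div 2) else - s (n div 2))" for n
  let ?M = "count_space (UNIV :: nat set)"
  have "(\<Sum>n<2*N. cmod (v n)) = 2 * (\<Sum>k<N. cmod (a k))" for N
    by (induction N) (auto simp: v_def)
  then have "(\<Sum>n<N. cmod (v n)) \<le> 2 * suminf (\<lambda>k. cmod (a k))" for N
    using sum_mono2[of "{..<2*N}" "{..<N}" "\<lambda>n. cmod (v n)"] sum_le_suminf[OF sm, of "{..<N}"] by fastforce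
  then have smv: "summable (\<lambda>n. cmod (v n))" by (intro summableI_nonneg_bounded) auto
  then have iv: "integrable ?M v" by (simp add: integrable_count_space_nat_iff)
  have group: "(LINT n|?M. v n * G (P n)) = (\<Sum>k. a k * (G (s k) + G (- s k)))" if G: "\<And>y. cmod (G y) \<le> C" for G C
  proof -
    have i: "integrable ?M (\<lambda>n. v n * G (P n))"
      by (rule integrable_mult_bounded[OF iv, of _ C]) (auto simp: G)
    then have "summable (\<lambda>n. v n * G (P n))"
      using summable_norm_cancel by (auto simp: integrable_count_space_nat_iff)
    then have "(\<lambda>n. v n * G (P n)) sums (LINT n|?M. v n * G (P n))"
      using i by (simp add: integral_count_space_nat summable_sums)
    from sums_group[OF this, of 2] have "(\<lambda>k. \<Sum>n=k*2..<k*2+2. v n * G (P n)) sums (LINT n|?M. v n * G (P n))" by simp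
    moreover have "(\<Sum>n=k*2..<k*2+2. v n * G (P n)) = a k * (G (s k) + G (- s k))" for k
    proof -
      have "{k * 2..<k * 2 + 2} = {2 * k, 2 * k + 1}" by auto
      then show ?thesis by (simp add: v_def P_def distrib_left)
    qed
    ultimately show ?thesis by (simp add: sums_iff)
  qed
  have "fourier_null ?M P v"
    unfolding fourier_null_def
  proof (intro conjI allI iv)
    fix \<omega> :: real
    have "(LINT n|?M. v n * cis (\<omega> \<bullet> P n)) = (\<Sum>k. a k * (cis (\<omega> * s k) + cis (\<omega> * - s k)))"
      using group[of "\<lambda>y. cis (\<omega> * y)" 1] by simp
    also have "\<dots> = (\<Sum>k. 2 * (a k * complex_of_real (cos (\<omega> * s k))))"
      by (intro suminf_cong) (simp add: complex_eq_iff)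
    also have "\<dots> = 2 * (\<Sum>k. a k * complex_of_real (cos (\<omega> * s k)))"
    proof (rule suminf_mult)
      show "summable (\<lambda>k. a k * complex_of_real (cos (\<omega> * s k)))"
        by (rule summable_comparison_test'[OF sm, of 0]) (simp add: norm_mult mult_left_le)
    qed
    finally show "(LINT n|?M. v n * cis (\<omega> \<bullet> P n)) = 0" using zero by simp
  qed
  then have "(LINT n|?M. v n * complex_of_real (F (P n))) = 0"
    by (rule fourier_null_bounded_continuous[rotated]) (use F in auto)
  then have "(\<Sum>k. a k * (complex_of_real (F (s k)) + complex_of_real (F (- s k)))) = 0"
    using group[of "\<lambda>y. complex_of_real (F y)" B] F(2) by simp
  then have "(\<Sum>k. 2 * (a k * complex_of_real (F (s k)))) = 0"
    by (simp add: F(3) mult_ac)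
  moreover have "summable (\<lambda>k. a k * complex_of_real (F (s k)))"
  proof (rule summable_comparison_test'[OF summable_mult[OF sm, of B], of 0])
    show "norm (a k * complex_of_real (F (s k))) \<le> B * cmod (a k)" for k
      using mult_right_mono[OF F(2)[of "s k"], of "cmod (a k)"] by (simp add: norm_mult mult.commute)
  qed
  ultimately show ?thesis by (simp add: suminf_mult)
qed

section \<open>Comparison of the integral condition with sums\<close>

lemma antimono_onD: "antimono_on {0..} \<theta> \<Longrightarrow> 0 \<le> t \<Longrightarrow> t \<le> u \<Longrightarrow> \<theta> u \<le> \<theta> t" for \<theta> :: "real \<Rightarrow> real"
  by (auto simp: monotone_on_def)

lemma nn_integral_le_block_sum:
  fixes \<theta> x :: "_ \<Rightarrow> real"
  assumes nn: "\<And>t. t \<ge> 0 \<Longrightarrow> \<theta> t \<ge> 0" and mono: "antimono_on {0..} \<theta>"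
    and x: "x 0 > 0" "\<And>j. x j \<le> x (Suc j)" "filterlim x at_top sequentially"
  shows "(\<integral>\<^sup>+ t. ennreal (\<theta> t / t) * indicator {x 0..} t \<partial>lborel) \<le> (\<Sum>j. ennreal (\<theta> (x j) / x j * (x (Suc j) - x j)))"
proof -
  have xpos: "x j > 0" for j by (induction j) (use x less_le_trans in \<open>blast+\<close>)
  have "ennreal (\<theta> t / t) * indicator {x 0..} t \<le> (\<Sum>j. ennreal (\<theta> (x j) / x j) * indicator {x j..<x (Suc j)} t)" for t
  proof (cases "t \<ge> x 0")
    case True
    obtain J where "t < x J" using x(3) by (auto simp: filterlim_at_top_dense eventually_sequentially)
    define m where "m = (LEAST j. t < x j)"
    have m: "t < x m" unfolding m_def using \<open>t < x J\<close> by (rule LeastI)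
    then obtain j where j: "m = Suc j" using True by (cases m) auto
    have "\<not> t < x j" using not_less_Least[of j "\<lambda>j. t < x j"] j by (simp add: m_def)
    then have t: "x j \<le> t" by simp
    have "\<theta> t \<le> \<theta> (x j)" using mono t xpos[of j] by (intro antimono_onD[OF mono]) auto
    then have "\<theta> t / t \<le> \<theta> (x j) / x j" using t xpos[of j] nn[of t] nn[of "x j"] by (intro frac_le) auto
    then have "ennreal (\<theta> t / t) * indicator {x 0..} t \<le> ennreal (\<theta> (x j) / x j) * indicator {x j..<x (Suc j)} t"
      using True t m j by (simp add: ennreal_leI)
    also have "\<dots> \<le> (\<Sum>j. ennreal (\<theta> (x j) / x j) * indicator {x j..<x (Suc j)} t)"
    proof -
      define f where "f j = ennreal (\<theta> (x j) / x j) * indicator {x j..<x (Suc j)} t" for j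
      have "f j \<le> suminf f" using sum_le_suminf[of f "{j}"] by simp
      then show ?thesis by (simp only: f_def[abs_def])
    qed
    finally show ?thesis .
  qed simp
  then have "(\<integral>\<^sup>+ t. ennreal (\<theta> t / t) * indicator {x 0..} t \<partial>lborel)
     \<le> (\<integral>\<^sup>+ t. (\<Sum>j. ennreal (\<theta> (x j) / x j) * indicator {x j..<x (Suc j)} t) \<partial>lborel)"
    by (intro nn_integral_mono)
  also have "\<dots> = (\<Sum>j. \<integral>\<^sup>+ t. ennreal (\<theta> (x j) / x j) * indicator {x j..<x (Suc j)} t \<partial>lborel)"
    by (intro nn_integral_suminf) auto
  also have "\<dots> = (\<Sum>j. ennreal (\<theta> (x j) / x j * (x (Suc j) - x j)))"
  proof (intro suminf_cong)
    fix j
    have "0 \<le> \<theta> (x j) / x j" "0 \<le> x (Suc j) - x j"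
      using x(2)[of j] xpos[of j] nn[of "x j"] by (auto intro: divide_nonneg_pos)
    note e = ennreal_mult[OF this]
    show "(\<integral>\<^sup>+ t. ennreal (\<theta> (x j) / x j) * indicator {x j..<x (Suc j)} t \<partial>lborel) = ennreal (\<theta> (x j) / x j * (x (Suc j) - x j))"
      unfolding e using x(2)[of j] by (simp add: nn_integral_cmult)
  qed
  finally show ?thesis .
qed

text \<open>The measure \<open>dt / t\<close> gives the interval between \<open>L * j ^ 4\<close> and \<open>L * (j + 1) ^ 4\<close> a mass of order
  \<open>1 / j\<close>, so that the sum and the integral are comparable. The fourth power is the growth that a Gevrey
  bump costs in the necessity part.\<close>

lemma divergent_integral_imp_divergent_sum:
  fixes \<theta> :: "real \<Rightarrow> real"
  assumes nn: "\<And>t. t \<ge> 0 \<Longrightarrow> \<theta> t \<ge> 0" and mono: "antimono_on {0..} \<theta>" and L: "L \<ge> 1"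
    and inf: "\<not> (\<integral>\<^sup>+ t \<in> {1..}. ennreal (\<theta> t / t) \<partial>lborel) < \<infinity>"
  shows "\<not> summable (\<lambda>j. \<theta> (L * real (Suc j) ^ 4) / real (Suc j))"
proof
  assume sm: "summable (\<lambda>j. \<theta> (L * real (Suc j) ^ 4) / real (Suc j))"
  define x where "x j = L * real (Suc j) ^ 4" for j
  have xpos: "x j \<ge> 1" for j
  proof -
    have "1 * 1 \<le> L * real (Suc j) ^ 4" using L by (intro mult_mono one_le_power) auto
    then show ?thesis by (simp add: x_def)
  qed
  have xmono: "x j \<le> x (Suc j)" for j unfolding x_def using L by (intro mult_left_mono power_mono) auto
  have "real j \<le> x j" for j
  proof -
    have "1 * (real (Suc j)) ^ 1 \<le> L * real (Suc j) ^ 4"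
      using L by (intro mult_mono power_increasing) auto
    then show ?thesis by (simp add: x_def)
  qed
  then have xlim: "filterlim x at_top sequentially"
    by (intro filterlim_at_top_mono[OF filterlim_real_sequentially]) auto
  have b: "\<theta> (x j) / x j * (x (Suc j) - x j) \<le> 15 * (\<theta> (x j) / real (Suc j))" for j
  proof -
    let ?y = "real (Suc j)"
    have y: "?y \<ge> 1" by simp
    have "(?y + 1) ^ 4 - ?y ^ 4 = 4 * ?y ^ 3 + 6 * ?y ^ 2 + 4 * ?y + 1"
      by (simp add: power4_eq_xxxx power3_eq_cube power2_eq_square algebra_simps)
    also have "\<dots> \<le> 4 * ?y ^ 3 + 6 * ?y ^ 3 + 4 * ?y ^ 3 + ?y ^ 3"
      using power_increasing[OF _ y, of 2 3] power_increasing[OF _ y, of 1 3] power_increasing[OF _ y, of 0 3]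
      by (intro add_mono mult_left_mono) auto
    also have "\<dots> = 15 * ?y ^ 3" by simp
    finally have "(?y + 1) ^ 4 - ?y ^ 4 \<le> 15 * ?y ^ 3" .
    then have "((?y + 1) ^ 4 - ?y ^ 4) / ?y ^ 4 \<le> 15 * ?y ^ 3 / ?y ^ 4"
      by (rule divide_right_mono) simp
    also have "\<dots> = 15 / ?y" by (simp add: power4_eq_xxxx power3_eq_cube)
    also have "((?y + 1) ^ 4 - ?y ^ 4) / ?y ^ 4 = (x (Suc j) - x j) / x j"
    proof -
      have "x (Suc j) - x j = L * ((?y + 1) ^ 4 - ?y ^ 4)" by (simp add: x_def right_diff_distrib add.commute)
      then show ?thesis using L by (simp add: x_def)
    qed
    finally have "\<theta> (x j) * ((x (Suc j) - x j) / x j) \<le> \<theta> (x j) * (15 / ?y)"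
      using nn[of "x j"] xpos[of j] by (intro mult_left_mono) auto
    then show "\<theta> (x j) / x j * (x (Suc j) - x j) \<le> 15 * (\<theta> (x j) / ?y)" by (simp add: mult_ac)
  qed
  have b0: "0 \<le> \<theta> (x j) / x j * (x (Suc j) - x j)" for j
    using nn[of "x j"] xpos[of j] xmono[of j] by (intro mult_nonneg_nonneg divide_nonneg_nonneg) auto
  have smb: "summable (\<lambda>j. \<theta> (x j) / x j * (x (Suc j) - x j))"
  proof (rule summable_comparison_test'[of _ 0])
    show "summable (\<lambda>j. 15 * (\<theta> (x j) / real (Suc j)))" unfolding x_def by (rule summable_mult[OF sm])
    show "norm (\<theta> (x j) / x j * (x (Suc j) - x j)) \<le> 15 * (\<theta> (x j) / real (Suc j))" for j
      unfolding real_norm_def abs_of_nonneg[OF b0] by (rule b)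
  qed
  \<comment> \<open>The first block fills the gap between \<open>1\<close> and \<open>L\<close>.\<close>
  define y where "y j = (case j of 0 \<Rightarrow> 1 | Suc j \<Rightarrow> x j)" for j
  have ymono: "y j \<le> y (Suc j)" for j
    using xpos[of 0] xmono by (cases j) (auto simp: y_def)
  have "filterlim (\<lambda>j. y (Suc j)) at_top sequentially" using xlim by (simp add: y_def)
  then have ylim: "filterlim y at_top sequentially" by (simp only: filterlim_sequentially_Suc)
  have y1: "y j \<ge> 1" for j using xpos by (cases j) (auto simp: y_def)
  have smy: "summable (\<lambda>j. \<theta> (y j) / y j * (y (Suc j) - y j))"
    by (subst summable_Suc_iff[symmetric]) (use smb in \<open>simp add: y_def\<close>)
  have y0: "0 \<le> \<theta> (y j) / y j * (y (Suc j) - y j)" for j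
    using nn[of "y j"] y1[of j] ymono[of j] by (intro mult_nonneg_nonneg divide_nonneg_nonneg) auto
  have "(\<integral>\<^sup>+ t. ennreal (\<theta> t / t) * indicator {y 0..} t \<partial>lborel) \<le> (\<Sum>j. ennreal (\<theta> (y j) / y j * (y (Suc j) - y j)))"
    by (rule nn_integral_le_block_sum[OF nn mono _ ymono ylim]) (auto simp: y_def)
  also have "\<dots> = ennreal (\<Sum>j. \<theta> (y j) / y j * (y (Suc j) - y j))"
    by (rule suminf_ennreal2[OF y0 smy])
  also have "\<dots> < \<infinity>" by simp
  finally have "(\<integral>\<^sup>+ t \<in> {1..}. ennreal (\<theta> t / t) \<partial>lborel) < \<infinity>" by (simp add: y_def)
  then show False using inf by contradiction
qed

lemma finite_integral_imp_summable:
  fixes \<theta> :: "real \<Rightarrow> real"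
  assumes nn: "\<And>t. t \<ge> 0 \<Longrightarrow> \<theta> t \<ge> 0" and mono: "antimono_on {0..} \<theta>"
    and fin: "(\<integral>\<^sup>+ t \<in> {1..}. ennreal (\<theta> t / t) \<partial>lborel) < \<infinity>"
  shows "summable (\<lambda>j. \<theta> (real j) / real j)"
proof -
  let ?c = "\<lambda>j. \<theta> (real (j + 2)) / real (j + 2)"
  have "(\<Sum>j. ennreal (?c j)) = (\<Sum>j. \<integral>\<^sup>+ t. ennreal (?c j) * indicator {real (j+1)..<real (j+2)} t \<partial>lborel)"
    by (intro suminf_cong) (simp add: nn_integral_cmult)
  also have "\<dots> = (\<integral>\<^sup>+ t. (\<Sum>j. ennreal (?c j) * indicator {real (j+1)..<real (j+2)} t) \<partial>lborel)"
    by (intro nn_integral_suminf[symmetric]) auto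
  also have "\<dots> \<le> (\<integral>\<^sup>+ t \<in> {1..}. ennreal (\<theta> t / t) \<partial>lborel)"
  proof (rule nn_integral_mono)
    fix t :: real
    show "(\<Sum>j. ennreal (?c j) * indicator {real (j+1)..<real (j+2)} t) \<le> ennreal (\<theta> t / t) * indicator {1..} t"
    proof (cases "t \<ge> 1")
      case True
      define k where "k = nat \<lfloor>t\<rfloor> - 1"
      have k: "real (k + 1) \<le> t" "t < real (k + 2)" using True by (auto simp: k_def) linarith+
      have "(\<Sum>j. ennreal (?c j) * indicator {real (j+1)..<real (j+2)} t) = (\<Sum>j. if j = k then ennreal (?c j) else 0)"
        using k by (intro suminf_cong) (auto simp: indicator_def)
      also have "\<dots> = ennreal (?c k)" using sums_single[of k "\<lambda>j. ennreal (?c j)"] by (simp add: sums_iff)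
      also have "\<dots> \<le> ennreal (\<theta> t / t)"
        using k True by (intro ennreal_leI frac_le nn antimono_onD[OF mono]) auto
      finally show ?thesis using True by simp
    next
      case False
      then have "indicator {real (j+1)..<real (j+2)} t = (0 :: ennreal)" for j by (auto simp: indicator_def)
      then show ?thesis by simp
    qed
  qed
  finally have "(\<Sum>j. ennreal (?c j)) \<noteq> \<infinity>" using fin by auto
  then have "summable ?c" by (intro summable_suminf_not_top divide_nonneg_nonneg nn) auto
  then show ?thesis by (subst (asm) summable_iff_shift)
qed

section \<open>Sufficiency of the integral condition\<close>

lemma prod_prefix_le:
  fixes \<kappa> :: real
  assumes "\<kappa> \<ge> 1" shows "(\<Prod>i<n. if i + 1 < J then \<kappa> else 1) \<le> \<kappa> ^ J"
proof -
  have "(\<Prod>i<n. if i + 1 < J then \<kappa> else 1) \<le> \<kappa> ^ min n J"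
  proof (induction n)
    case (Suc n)
    show ?case
    proof (cases "n + 1 < J")
      case True
      then show ?thesis using Suc assms by (simp add: min_def mult.commute mult_left_mono)
    next
      case False
      have "\<kappa> ^ min n J \<le> \<kappa> ^ min (Suc n) J" using assms by (intro power_increasing) auto
      then show ?thesis using Suc False by simp
    qed
  qed simp
  also have "\<dots> \<le> \<kappa> ^ J" using assms by (intro power_increasing) auto
  finally show ?thesis .
qed

text \<open>The widths are \<open>B * \<Theta> j / j\<close>, made constant for small \<open>j\<close> so that their sum stays below \<open>1\<close>. Each factor
  \<open>sqrt E * (2 / a i)\<close> with \<open>i < 2 * m \<le> \<Theta> s * s\<close> is then at most \<open>exp (- 2) * s\<close>, because
  \<open>\<Theta> s \<le> \<Theta> (i + 1)\<close>; the finitely many exceptional factors go into the constant \<open>C\<close>.\<close>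

lemma widths_exist:
  fixes \<Theta> :: "real \<Rightarrow> real"
  assumes all_pos: "\<forall>t\<ge>0. \<Theta> t > 0" and mono: "antimono_on {0..} \<Theta>" and lim: "(\<Theta> \<longlongrightarrow> 0) at_top"
    and sm: "summable (\<lambda>j. \<Theta> (real j) / real j)" and E: "E > 0"
  shows "\<exists>(a :: nat \<Rightarrow> real) s0 C. (\<forall>i. a i > 0) \<and> summable a \<and> suminf a < 1 \<and> (\<forall>i. a (Suc i) \<le> a i) \<and>
    (\<forall>i. real (Suc i) * a i \<le> 2) \<and> s0 \<ge> 1 \<and> C \<ge> 1 \<and>
    (\<forall>s m. s \<ge> s0 \<longrightarrow> real (2 * m) \<le> \<Theta> s * s \<longrightarrow> E ^ m * (\<Prod>i<2*m. 2 / a i) \<le> C * exp (- 4 * real m) * s ^ (2 * m))"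
proof -
  have pos: "\<Theta> t > 0" if "t \<ge> 0" for t using all_pos that by blast
  \<comment> \<open>Makes \<open>sqrt E * (2 / a i)\<close> equal to \<open>exp (- 2) * (i + 1) / \<Theta> (i + 1)\<close> for large \<open>i\<close>.\<close>
  define B where "B = 2 * sqrt E * exp 2"
  have B: "B > 0" using E by (simp add: B_def)
  let ?g = "\<lambda>j. \<Theta> (real j) / real j"
  have "filterlim (\<lambda>j. \<Theta> (real j)) (nhds 0) sequentially"
    by (rule filterlim_compose[OF lim filterlim_real_sequentially])
  then have e1: "eventually (\<lambda>J. \<Theta> (real J) < min 1 (1 / (4 * B))) sequentially"
    using B by (intro order_tendstoD) auto
  have "(\<lambda>J. \<Sum>i. ?g (i + J)) \<longlonglongrightarrow> 0" using suminf_exist_split2[OF sm] by simp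
  then have "(\<lambda>J. \<Sum>i. ?g (i + Suc J)) \<longlonglongrightarrow> 0" by (rule LIMSEQ_Suc)
  then have e2: "eventually (\<lambda>J. (\<Sum>i. ?g (i + Suc J)) < 1 / (4 * B)) sequentially"
    using B by (intro order_tendstoD) auto
  obtain J where J: "J \<ge> 1" "\<Theta> (real J) < min 1 (1 / (4 * B))" "(\<Sum>i. ?g (i + Suc J)) < 1 / (4 * B)"
    using eventually_happens[OF eventually_conj[OF eventually_ge_at_top[of 1] eventually_conj[OF e1 e2]]] by auto
  define a where "a i = B * (\<Theta> (real (max (i + 1) J)) / real (max (i + 1) J))" for i
  have apos: "a i > 0" for i unfolding a_def using B pos J(1) by (intro mult_pos_pos divide_pos_pos) auto
  have tail: "a (i + J) = B * ?g (i + Suc J)" for i by (simp add: a_def)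
  have sma: "summable a"
  proof (subst summable_iff_shift[symmetric, of _ J])
    show "summable (\<lambda>i. a (i + J))" unfolding tail
      by (intro summable_mult summable_ignore_initial_segment[OF sm])
  qed
  have "suminf a = (\<Sum>i. a (i + J)) + (\<Sum>i<J. a i)" by (rule suminf_split_initial_segment[OF sma])
  also have "(\<Sum>i. a (i + J)) = B * (\<Sum>i. ?g (i + Suc J))"
    unfolding tail by (intro suminf_mult summable_ignore_initial_segment[OF sm])
  also have "(\<Sum>i<J. a i) = (\<Sum>i<J. B * (\<Theta> (real J) / real J))"
    by (intro sum.cong) (auto simp: a_def max_def)
  also have "\<dots> = B * \<Theta> (real J)" using J(1) by simp
  also have "B * (\<Sum>i. ?g (i + Suc J)) + B * \<Theta> (real J) < B * (1 / (4 * B)) + B * (1 / (4 * B))"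
    using B J by (intro add_strict_mono mult_strict_left_mono) auto
  also have "\<dots> < 1" using B by simp
  finally have lt1: "suminf a < 1" .
  have adec: "a (Suc i) \<le> a i" for i unfolding a_def
    using B J(1) pos by (intro mult_left_mono frac_le antimono_onD[OF mono]) (auto intro: less_imp_le)
  have astep: "real (Suc i) * a i \<le> 2" for i
  proof -
    let ?m = "real (max (i + 1) J)"
    have m: "?m > 0" by simp
    have "real (Suc i) * a i = B * \<Theta> ?m * (real (Suc i) / ?m)" by (simp add: a_def)
    also have "\<dots> \<le> B * \<Theta> (real J) * 1"
      using B J(1) pos[of ?m] pos[of "real J"] m by (intro mult_mono mult_left_mono antimono_onD[OF mono]) (auto simp: divide_le_eq)
    also have "\<dots> \<le> B * (1 / (4 * B)) * 1"
    proof (intro mult_right_mono mult_left_mono)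
      show "\<Theta> (real J) \<le> 1 / (4 * B)" using J(2) by simp
    qed (use B in auto)
    finally show ?thesis using B by simp
  qed
  have "eventually (\<lambda>s. \<Theta> s < 1) at_top" using lim by (intro order_tendstoD) auto
  then obtain s1 where s1: "\<And>s. s \<ge> s1 \<Longrightarrow> \<Theta> s < 1" by (auto simp: eventually_at_top_linorder)
  define s0 where "s0 = max 1 s1"
  define \<kappa> where "\<kappa> = real J / \<Theta> (real J)"
  have \<kappa>: "\<kappa> \<ge> 1" using J pos[of "real J"] by (simp add: \<kappa>_def)
  have factor: "sqrt E * (2 / a i) \<le> exp (-2) * s * (if i + 1 < J then \<kappa> else 1)"
    if s: "s \<ge> s0" and i: "i < 2 * m" "real (2 * m) \<le> \<Theta> s * s" for s m i
  proof -
    have s1': "s \<ge> 1" "\<Theta> s \<le> 1" using s s1[of s] by (auto simp: s0_def)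
    have eq: "sqrt E * (2 / (B * (\<Theta> x / x))) = exp (-2) * (x / \<Theta> x)" if "x > 0" for x
      using that pos[of x] E by (simp add: B_def field_simps exp_minus)
    show ?thesis
    proof (cases "i + 1 < J")
      case True
      then have "sqrt E * (2 / a i) = exp (-2) * \<kappa>"
        using eq[of "real J"] J(1) by (simp add: a_def \<kappa>_def max_def)
      also have "\<dots> \<le> exp (-2) * (s * \<kappa>)" using s1' \<kappa> by (intro mult_left_mono) (auto simp: mult_le_cancel_right1)
      finally show ?thesis using True by (simp add: mult.assoc)
    next
      case False
      let ?x = "real (i + 1)"
      have le: "?x \<le> \<Theta> s * s" using i by linarith
      also have "\<dots> \<le> 1 * s" using s1' by (intro mult_right_mono) auto
      finally have "?x \<le> s" by simp
      then have "\<Theta> s \<le> \<Theta> ?x" by (intro antimono_onD[OF mono]) auto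
      then have "\<Theta> s * s \<le> \<Theta> ?x * s" using s1' by (intro mult_right_mono) auto
      with le have "?x / \<Theta> ?x \<le> s" using pos[of ?x] by (simp add: field_simps)
      then have "exp (-2) * (?x / \<Theta> ?x) \<le> exp (-2) * s" by (intro mult_left_mono) auto
      moreover have "sqrt E * (2 / a i) = exp (-2) * (?x / \<Theta> ?x)"
        using eq[of ?x] False by (simp add: a_def max_def)
      ultimately show ?thesis using False by simp
    qed
  qed
  show ?thesis
  proof (rule exI[of _ a], rule exI[of _ s0], rule exI[of _ "\<kappa> ^ J"], intro conjI allI impI apos sma lt1 adec astep)
    show "s0 \<ge> 1" by (simp add: s0_def)
    show "\<kappa> ^ J \<ge> 1" using \<kappa> by (rule one_le_power)
    show "E ^ m * (\<Prod>i<2*m. 2 / a i) \<le> \<kappa> ^ J * exp (- 4 * real m) * s ^ (2 * m)"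
      if s: "s \<ge> s0" "real (2 * m) \<le> \<Theta> s * s" for s m
    proof -
      have "E ^ m = sqrt E ^ (2 * m)" using E by (simp add: power_mult)
      then have "E ^ m * (\<Prod>i<2*m. 2 / a i) = (\<Prod>i<2*m. sqrt E * (2 / a i))"
        by (simp only: prod.distrib prod_constant card_lessThan)
      also have "\<dots> \<le> (\<Prod>i<2*m. exp (-2) * s * (if i + 1 < J then \<kappa> else 1))"
        using factor[OF s(1) _ s(2)] apos E by (intro prod_mono) (auto intro!: mult_nonneg_nonneg divide_nonneg_pos)
      also have "\<dots> = (exp (-2) * s) ^ (2 * m) * (\<Prod>i<2*m. if i + 1 < J then \<kappa> else 1)"
        by (simp only: prod.distrib prod_constant card_lessThan power_mult_distrib)
      also have "\<dots> \<le> (exp (-2) * s) ^ (2 * m) * \<kappa> ^ J"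
        by (intro mult_left_mono prod_prefix_le \<kappa>) (simp add: power_mult)
      also have "(exp (-2) * s) ^ (2 * m) = exp (- 4 * real m) * s ^ (2 * m)"
        by (simp add: power_mult_distrib exp_of_nat_mult[symmetric] mult.commute)
      finally show ?thesis by (simp add: mult_ac)
    qed
  qed
qed

lemma weights_of_widths:
  assumes pos: "\<And>i. a i > (0::real)" and dec: "\<And>i. a (Suc i) \<le> a i" and step: "\<And>i. real (Suc i) * a i \<le> 2"
  shows "weights (\<lambda>k. \<Prod>i<k. 2 / a i) 1"
proof
  let ?W = "\<lambda>k. \<Prod>i<k. 2 / a i"
  have Wpos: "?W k > 0" for k using pos by (intro prod_pos) auto
  show "?W 0 = 1" by simp
  show "?W k \<le> ?W (Suc k)" for k
  proof -
    have "1 * a k \<le> real (Suc k) * a k" using pos[of k] by (intro mult_right_mono) auto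
    then have "a k \<le> 2" using step[of k] by linarith
    then have "1 \<le> 2 / a k" using pos[of k] by simp
    then have "?W k * 1 \<le> ?W k * (2 / a k)" using Wpos[of k] by (intro mult_left_mono) auto
    then show ?thesis by simp
  qed
  show "real (Suc k) * ?W k \<le> 1 * ?W (Suc k)" for k
  proof -
    have "real (Suc k) \<le> 2 / a k" using step[of k] pos[of k] by (simp add: field_simps)
    then have "real (Suc k) * ?W k \<le> 2 / a k * ?W k" using Wpos[of k] by (intro mult_right_mono) auto
    then show ?thesis by (simp add: mult.commute)
  qed
  have anti: "a (i + j) \<le> a i" for i j by (induction j) (use dec order_trans in \<open>auto\<close>)
  show "?W i * ?W j \<le> ?W (i + j)" for i j
  proof (induction j)
    case (Suc j)
    have "?W i * ?W (Suc j) = ?W i * ?W j * (2 / a j)" by simp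
    also have "\<dots> \<le> ?W (i + j) * (2 / a j)" using Suc pos[of j] by (intro mult_right_mono) auto
    also have "\<dots> \<le> ?W (i + j) * (2 / a (i + j))"
      using anti[of j i] pos Wpos[of "i + j"] by (intro mult_left_mono divide_left_mono mult_pos_pos) (auto simp: add.commute)
    finally show ?case by simp
  qed simp
qed

lemma Bd_compact_supp:
  assumes "Bd W R A j f" shows "compact_supp f (cbox (- (R *\<^sub>R One)) (R *\<^sub>R One))"
  by standard (use Bd_continuous[OF assms] Bd_outside[OF assms] in auto)

lemma Bd_mass:
  fixes f :: "'n::finite heis \<Rightarrow> complex"
  assumes f: "Bd W R A j f"
  shows "compact_supp.mass f \<le> A * W j * measure lborel (cbox (- (R *\<^sub>R One)) (R *\<^sub>R One) :: 'n heis set)"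
proof -
  interpret compact_supp f "cbox (- (R *\<^sub>R One)) (R *\<^sub>R One)" by (rule Bd_compact_supp[OF f])
  let ?K = "cbox (- (R *\<^sub>R One)) (R *\<^sub>R One) :: 'n heis set"
  have iK: "integrable lborel (\<lambda>g. A * W j * indicator ?K g)"
    by (intro integrable_mult_right integrable_real_indicator emeasure_lborel_cbox_finite) simp
  have "mass \<le> (LINT g|lborel. A * W j * indicator ?K g)"
    unfolding mass_def
  proof (rule integral_mono[OF integrable_norm[OF integrable_f] iK])
    fix g show "cmod (f g) \<le> A * W j * indicator ?K g"
      using Bd_bound[OF f, of g] Bd_outside[OF f, of g] by (cases "g \<in> ?K") auto
  qed
  then show ?thesis by simp
qed

context compact_supp
begin

lemma group_fourier_add_norm:
  assumes "\<phi> \<in> L2" "\<psi> \<in> L2"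
  shows "l2_norm (group_fourier f lam (\<lambda>x. \<phi> x + \<psi> x)) \<le> l2_norm (group_fourier f lam \<phi>) + l2_norm (group_fourier f lam \<psi>)"
proof -
  have s: "(\<lambda>x. \<phi> x + \<psi> x) \<in> L2" using assms by (rule L2_add)
  note G = group_fourier_L2(1)[OF assms(1), of lam] group_fourier_L2(1)[OF assms(2), of lam] group_fourier_L2(1)[OF s, of lam]
  have "AE \<xi> in lborel. group_fourier f lam (\<lambda>x. \<phi> x + \<psi> x) \<xi> = group_fourier f lam \<phi> \<xi> + group_fourier f lam \<psi> \<xi>"
    using group_fourier_L2(3)[OF assms(1), of lam] group_fourier_L2(3)[OF assms(2), of lam]
  proof eventually_elim
    case (elim \<xi>)
    have "f g * schroedinger lam g (\<lambda>x. \<phi> x + \<psi> x) \<xi> = f g * schroedinger lam g \<phi> \<xi> + f g * schroedinger lam g \<psi> \<xi>" for g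
      by (simp add: schroedinger_hphase distrib_left)
    then show ?case unfolding group_fourier_def using elim by simp
  qed
  moreover have "(\<lambda>\<xi>. group_fourier f lam \<phi> \<xi> + group_fourier f lam \<psi> \<xi>) \<in> L2" using G by auto
  ultimately have "l2_norm (group_fourier f lam (\<lambda>x. \<phi> x + \<psi> x)) = l2_norm (\<lambda>\<xi>. group_fourier f lam \<phi> \<xi> + group_fourier f lam \<psi> \<xi>)"
    unfolding l2_norm_def using G
    by (intro arg_cong[of _ _ sqrt] integral_cong_AE) (auto simp: L2_def elim!: eventually_mono)
  also have "\<dots> \<le> l2_norm (group_fourier f lam \<phi>) + l2_norm (group_fourier f lam \<psi>)"
    by (rule l2_norm_add_le[OF G(1,2)])
  finally show ?thesis .
qed

lemma group_fourier_sum_norm: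
  assumes "finite B" "\<And>b. b \<in> B \<Longrightarrow> u b \<in> L2"
  shows "l2_norm (group_fourier f lam (\<lambda>x. \<Sum>b\<in>B. u b x)) \<le> (\<Sum>b\<in>B. l2_norm (group_fourier f lam (u b)))"
  using assms
proof (induction B rule: finite_induct)
  case empty
  then show ?case by (simp add: group_fourier_def schroedinger_hphase l2_norm_def)
next
  case (insert b B)
  have "l2_norm (group_fourier f lam (\<lambda>x. u b x + (\<Sum>b\<in>B. u b x)))
     \<le> l2_norm (group_fourier f lam (u b)) + l2_norm (group_fourier f lam (\<lambda>x. \<Sum>b\<in>B. u b x))"
    using insert by (intro group_fourier_add_norm L2_sum) auto
  then show ?case using insert by fastforce
qed

end

context weights
begin

lemma group_fourier_sum:
  fixes f :: "'n::finite heis \<Rightarrow> complex"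
  assumes f: "Bd W R A j f" and h: "\<And>k. continuous_on UNIV (h k)" and B: "finite B"
  shows "group_fourier f lam (\<lambda>x. \<Sum>k\<in>B. z k * h k x) \<xi> = (\<Sum>k\<in>B. z k * group_fourier f lam (h k) \<xi>)"
proof -
  have i: "integrable lborel (\<lambda>g. z k * (f g * schroedinger lam g (h k) \<xi>))" for k
    by (intro integrable_mult_right group_fourier_integrable[OF f h])
  have "group_fourier f lam (\<lambda>x. \<Sum>k\<in>B. z k * h k x) \<xi> = (LINT g|lborel. (\<Sum>k\<in>B. z k * (f g * schroedinger lam g (h k) \<xi>)))"
    unfolding group_fourier_def schroedinger_hphase
    by (intro Bochner_Integration.integral_cong refl) (simp add: sum_distrib_left mult_ac)
  also have "\<dots> = (\<Sum>k\<in>B. LINT g|lborel. z k * (f g * schroedinger lam g (h k) \<xi>))"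
    using i by (intro Bochner_Integration.integral_sum) auto
  finally show ?thesis by (simp add: group_fourier_def)
qed

text \<open>On a finite combination of Hermite functions, dividing the coefficients by \<open>\<nu> k ^ m\<close> is paid for by
  applying the sublaplacian \<open>m\<close> times to \<open>f\<close>. The bound involves \<open>lam\<close> only through the eigenvalues.\<close>

lemma group_fourier_block:
  fixes f :: "'n::finite heis \<Rightarrow> complex"
  assumes f: "Bd W R A 0 f" and R: "R \<ge> 0" and lam: "lam \<noteq> 0" and B: "finite B"
  defines "h \<equiv> hbasis \<bar>lam\<bar>" and "\<nu> \<equiv> hbasis_eig TYPE('n) \<bar>lam\<bar>"
    and "V \<equiv> measure lborel (cbox (- (R *\<^sub>R One)) (R *\<^sub>R One) :: 'n heis set)"
    and "E \<equiv> 2 * real CARD('n) * (1 + (R + c) / 2)\<^sup>2"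
  shows "l2_norm (group_fourier f lam (\<lambda>x. \<Sum>k\<in>B. z k * h k x))
     \<le> V * A * (E ^ m * W (2 * m)) * sqrt (\<Sum>k\<in>B. (cmod (z k) / \<nu> k ^ m)\<^sup>2)"
proof -
  have a: "\<bar>lam\<bar> > 0" using lam by simp
  have \<nu>: "\<nu> k > 0" for k unfolding \<nu>_def by (rule hbasis_eig_pos[OF a])
  have h: "orthonormal h" unfolding h_def by (rule hbasis_orthonormal[OF a])
  have hC2: "C2 (h k)" for k unfolding h_def hbasis_def by (rule hfun_C2)
  have hcont: "continuous_on UNIV (h k)" for k by (rule C1_continuous[OF C2_C1(1)[OF hC2]])
  have heig: "hermite_op lam (h k) x = complex_of_real (\<nu> k) * h k x" for k x
    unfolding h_def \<nu>_def hbasis_def hbasis_eig_def by (rule hermite_op_hfun[OF lam])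
  let ?g = "(sublaplacian ^^ m) f"
  have g: "Bd W R (E ^ m * A) (2 * m) ?g" unfolding E_def by (rule Bd_sublaplacian_power[OF f R])
  interpret g: compact_supp ?g "cbox (- (R *\<^sub>R One)) (R *\<^sub>R One)" by (rule Bd_compact_supp[OF g])
  let ?z = "\<lambda>k. z k / complex_of_real (\<nu> k ^ m)"
  have "group_fourier f lam (\<lambda>x. \<Sum>k\<in>B. z k * h k x) = group_fourier ?g lam (\<lambda>x. \<Sum>k\<in>B. ?z k * h k x)"
  proof
    fix \<xi>
    have "z k * group_fourier f lam (h k) \<xi> = ?z k * group_fourier ?g lam (h k) \<xi>" for k
      using group_fourier_eigenfunction[OF f R hC2 heig, of k m \<xi>, symmetric] \<nu>[of k] by simp
    then show "group_fourier f lam (\<lambda>x. \<Sum>k\<in>B. z k * h k x) \<xi> = group_fourier ?g lam (\<lambda>x. \<Sum>k\<in>B. ?z k * h k x) \<xi>"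
      unfolding group_fourier_sum[OF f hcont B] group_fourier_sum[OF g hcont B] by (intro sum.cong refl)
  qed
  then have "l2_norm (group_fourier f lam (\<lambda>x. \<Sum>k\<in>B. z k * h k x)) \<le> g.mass * l2_norm (\<lambda>x. \<Sum>k\<in>B. ?z k * h k x)"
    using g.group_fourier_L2(2)[OF L2_lincomb[of B h ?z]] h by (simp add: orthonormal_def)
  also have "l2_norm (\<lambda>x. \<Sum>k\<in>B. ?z k * h k x) = sqrt (\<Sum>k\<in>B. (cmod (?z k))\<^sup>2)"
    by (subst orthonormal_norm_sum[OF h B, symmetric]) simp
  also have "(\<Sum>k\<in>B. (cmod (?z k))\<^sup>2) = (\<Sum>k\<in>B. (cmod (z k) / \<nu> k ^ m)\<^sup>2)"
    using \<nu> by (intro sum.cong refl) (simp add: norm_divide norm_power less_imp_le)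
  also have "g.mass * sqrt (\<Sum>k\<in>B. (cmod (z k) / \<nu> k ^ m)\<^sup>2) \<le> (E ^ m * A * W (2 * m) * V) * sqrt (\<Sum>k\<in>B. (cmod (z k) / \<nu> k ^ m)\<^sup>2)"
    unfolding V_def by (intro mult_right_mono Bd_mass[OF g]) (simp add: sum_nonneg)
  finally show ?thesis by (simp add: mult_ac)
qed

end

text \<open>For each basis element the order \<open>m\<close> is chosen so that \<open>2 * m\<close> is just below \<open>\<Theta> (s k) * s k\<close>. The blocks
  of equal \<open>m\<close> contribute terms with an additional factor \<open>exp (- 2 * m)\<close>, which can be summed.\<close>

theorem ingham_sufficiency:
  fixes \<theta> :: "real \<Rightarrow> real"
  assumes nn: "\<And>t. t \<ge> 0 \<Longrightarrow> 0 \<le> \<theta> t" and mono: "antimono_on {0..} \<theta>" and lim: "(\<theta> \<longlongrightarrow> 0) at_top"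
    and fin: "(\<integral>\<^sup>+ t \<in> {1..}. ennreal (\<theta> t / t) \<partial>lborel) < \<infinity>"
  obtains f :: "'n::finite heis \<Rightarrow> complex" and C :: real where
    "continuous_on UNIV f" "compact (closure {g. f g \<noteq> 0})" "\<exists>g. f g \<noteq> 0" "C > 0"
    "\<And>lam. lam \<noteq> 0 \<Longrightarrow> l2_op_le (l2_adjoint (group_fourier f lam) \<circ> group_fourier f lam)
       (\<lambda>\<phi> \<xi>. complex_of_real C * functional_calculus (hermite_op lam) (\<lambda>s. exp (- 2 * \<theta> (sqrt s) * sqrt s)) \<phi> \<xi>)"
proof -
  \<comment> \<open>The widths have to be positive, which \<open>\<theta>\<close> need not be; the added term has a convergent integral.\<close>
  define \<Theta> where "\<Theta> t = \<theta> t + 1 / (1 + t)" for t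
  have pos: "\<Theta> t > 0" if "t \<ge> 0" for t using nn[OF that] that by (simp add: \<Theta>_def add_nonneg_pos)
  have le\<Theta>: "\<theta> t \<le> \<Theta> t" if "t \<ge> 0" for t using that by (simp add: \<Theta>_def)
  have mono\<Theta>: "antimono_on {0..} \<Theta>"
    unfolding \<Theta>_def using antimono_onD[OF mono] by (auto simp: monotone_on_def intro!: add_mono divide_left_mono)
  have "((\<lambda>t::real. 1 / (1 + t)) \<longlongrightarrow> 0) at_top"
    by (intro tendsto_divide_0[OF tendsto_const] filterlim_at_top_imp_at_infinity
        filterlim_tendsto_add_at_top[OF tendsto_const] filterlim_ident)
  then have lim\<Theta>: "(\<Theta> \<longlongrightarrow> 0) at_top" unfolding \<Theta>_def using tendsto_add[OF lim, of _ 0] by simp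
  have "summable (\<lambda>j. 1 / (1 + real j) / real j)"
  proof (rule summable_comparison_test'[of _ 1])
    show "summable (\<lambda>j. inverse (real j ^ 2))" by (rule inverse_power_summable) simp
    show "norm (1 / (1 + real j) / real j) \<le> inverse (real j ^ 2)" if "j \<ge> 1" for j
    proof -
      have "1 / ((1 + real j) * real j) \<le> 1 / (real j * real j)"
        using that by (intro divide_left_mono mult_right_mono mult_pos_pos) auto
      then show ?thesis by (simp add: power2_eq_square inverse_eq_divide)
    qed
  qed
  then have sm: "summable (\<lambda>j. \<Theta> (real j) / real j)"
    using summable_add[OF finite_integral_imp_summable[OF nn mono fin]] by (simp add: \<Theta>_def add_divide_distrib)
  \<comment> \<open>The constant of \<open>Bd_sublaplacian_power\<close> for half side length \<open>R = 2\<close> and \<open>c = 1\<close>.\<close>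
  define E where "E = 2 * real CARD('n) * (1 + (2 + 1) / 2)\<^sup>2"
  have E: "E > 0" by (simp add: E_def)
  have all_pos: "\<forall>t\<ge>0. \<Theta> t > 0" using pos by blast
  obtain a s0 C0 where a: "\<forall>i. a i > 0" "summable a" "suminf a < 1" "\<forall>i. a (Suc i) \<le> a i" "\<forall>i. real (Suc i) * a i \<le> 2"
    and s0: "s0 \<ge> 1" and C0: "C0 \<ge> 1"
    and est': "\<forall>s m. s \<ge> s0 \<longrightarrow> real (2 * m) \<le> \<Theta> s * s \<longrightarrow> E ^ m * (\<Prod>i<2*m. 2 / a i) \<le> C0 * exp (- 4 * real m) * s ^ (2 * m)"
    using widths_exist[OF all_pos mono\<Theta> lim\<Theta> sm E] by (elim exE conjE)
  note est = est'[rule_format]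
  define W where "W k = (\<Prod>i<k. 2 / a i)" for k
  interpret weights W 1 unfolding W_def by (rule weights_of_widths[OF a(1,4,5)[rule_format]])
  obtain \<beta> where \<beta>: "\<And>k t. (\<beta> k has_real_derivative \<beta> (Suc k) t) (at t)"
    "\<And>k t. \<bar>\<beta> k t\<bar> \<le> (\<Prod>j<k. 2 / a j)" "\<And>k t. \<bar>t\<bar> > 2 \<Longrightarrow> \<beta> k t = 0" "\<And>t. \<beta> 0 t \<ge> 0" "\<beta> 0 0 > 0"
    by (rule bump_exists[OF a(1)[rule_format] a(2,3)]) blast
  define f :: "'n heis \<Rightarrow> complex" where "f = prodfun (\<lambda>b t. complex_of_real (\<beta> 0 t))"
  have f: "Bd W 2 1 0 f"
    using Bd_prodfun[of "\<lambda>b. \<beta>" 2 "\<lambda>_. 0"] \<beta> by (simp add: f_def W_def)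
  let ?K = "cbox (- (2 *\<^sub>R One)) (2 *\<^sub>R One) :: 'n heis set"
  interpret compact_supp f ?K by (rule Bd_compact_supp[OF f])
  define V where "V = measure lborel ?K"
  define C1 where "C1 = max (exp 2 * C0) (exp (\<Theta> 0 * s0))"
  have C1: "C1 > 0" by (simp add: C1_def less_max_iff_disj)
  define C where "C = (2 * V * C1)\<^sup>2 + 1"
  define M where "M = (\<lambda>s. exp (- 2 * \<theta> (sqrt s) * sqrt s))"
  have blocks: "(l2_norm (group_fourier f lam \<phi>))\<^sup>2 \<le> C * Re (l2_inner (functional_calculus (hermite_op lam) M \<phi>) \<phi>)"
    if lam: "lam \<noteq> 0" and \<phi>: "\<phi> \<in> L2" for lam \<phi>
  proof -
    have al: "\<bar>lam\<bar> > 0" using lam by simp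
    define h :: "nat \<Rightarrow> 'n fn" where "h = hbasis \<bar>lam\<bar>"
    define \<nu> where "\<nu> = hbasis_eig TYPE('n) \<bar>lam\<bar>"
    have \<nu>: "\<nu> k > 0" for k unfolding \<nu>_def by (rule hbasis_eig_pos[OF al])
    have h: "orthonormal h" "l2_total h" unfolding h_def by (rule hbasis_orthonormal[OF al], rule hbasis_total[OF al])
    have hL: "h k \<in> L2" for k using h(1) by (simp add: orthonormal_def)
    define s where "s k = sqrt (\<nu> k)" for k
    have spos: "s k > 0" for k using \<nu>[of k] by (simp add: s_def)
    \<comment> \<open>By \<open>widths_exist\<close> the block \<open>m\<close> gains \<open>exp (- 4 * m)\<close>: one half of it becomes the required
      exponential, the other half makes the sum over the blocks converge.\<close>
    define mm where "mm k = (if s k \<ge> s0 then nat \<lfloor>\<Theta> (s k) * s k / 2\<rfloor> else 0)" for k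
    define z where "z k = l2_inner \<phi> (h k)" for k
    let ?w = "\<lambda>k. exp (- \<theta> (s k) * s k)"
    have key: "E ^ mm k * W (2 * mm k) / \<nu> k ^ mm k \<le> C1 * exp (- 2 * real (mm k)) * ?w k" for k
    proof (cases "s k \<ge> s0")
      case True
      let ?x = "\<Theta> (s k) * s k"
      have x0: "?x \<ge> 0" using pos[of "s k"] spos[of k] by simp
      have m: "real (2 * mm k) \<le> ?x" "?x \<le> real (2 * mm k) + 2"
        using True x0 by (auto simp: mm_def) linarith+
      have "s k ^ (2 * mm k) = \<nu> k ^ mm k" using \<nu>[of k] by (simp add: power_mult s_def)
      then have "E ^ mm k * W (2 * mm k) \<le> C0 * exp (- 4 * real (mm k)) * \<nu> k ^ mm k"
        using est[OF True m(1)] by (simp add: W_def)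
      then have "E ^ mm k * W (2 * mm k) / \<nu> k ^ mm k \<le> C0 * exp (- 4 * real (mm k))"
        using \<nu>[of k] by (simp add: divide_le_eq)
      also have "\<dots> \<le> C0 * (exp 2 * exp (- 2 * real (mm k)) * ?w k)"
      proof (intro mult_left_mono)
        have "\<theta> (s k) * s k \<le> ?x" using le\<Theta>[of "s k"] spos[of k] by (intro mult_right_mono) auto
        then have "- 4 * real (mm k) \<le> 2 + - 2 * real (mm k) + - \<theta> (s k) * s k" using m by simp
        then show "exp (- 4 * real (mm k)) \<le> exp 2 * exp (- 2 * real (mm k)) * ?w k"
          unfolding mult_exp_exp by simp
      qed (use C0 in simp)
      also have "\<dots> = (exp 2 * C0) * (exp (- 2 * real (mm k)) * ?w k)" by (simp add: mult_ac)
      also have "\<dots> \<le> C1 * (exp (- 2 * real (mm k)) * ?w k)" by (intro mult_right_mono) (auto simp: C1_def)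
      finally show ?thesis by (simp add: mult.assoc)
    next
      case False
      then have m0: "mm k = 0" by (simp add: mm_def)
      have "\<theta> (s k) * s k \<le> \<Theta> 0 * s0"
        using False spos[of k] le\<Theta>[of "s k"] antimono_onD[OF mono\<Theta>, of 0 "s k"] nn[of "s k"] by (intro mult_mono) auto
      then have "1 \<le> exp (\<Theta> 0 * s0) * ?w k" unfolding mult_exp_exp by simp
      also have "\<dots> \<le> C1 * ?w k" by (intro mult_right_mono) (auto simp: C1_def)
      finally show ?thesis using m0 W0 by simp
    qed
    define S where "S = Re (l2_inner (functional_calculus (hermite_op lam) M \<phi>) \<phi>)"
    have M1: "\<bar>M s\<bar> \<le> 1" if "s > 0" for s using nn[of "sqrt s"] that by (simp add: M_def)
    have "(\<lambda>k. M (\<nu> k) * (cmod (z k))\<^sup>2) sums S"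
      unfolding S_def z_def h_def \<nu>_def by (rule functional_calculus_coeffs(3)[OF lam M1 \<phi>])
    moreover have zw: "M (\<nu> k) * (cmod (z k))\<^sup>2 = (cmod (z k) * ?w k)\<^sup>2" for k
      by (simp add: M_def s_def power_mult_distrib exp_double[symmetric])
    ultimately have sumsS: "(\<lambda>k. (cmod (z k) * ?w k)\<^sup>2) sums S" by simp
    have partial_le: "(\<Sum>k<N. (cmod (z k) * ?w k)\<^sup>2) \<le> S" for N
      using sum_le_suminf[OF sums_summable[OF sumsS], of "{..<N}"] sums_unique[OF sumsS] by simp
    have S0: "S \<ge> 0" using partial_le[of 0] by simp
    have V0: "V \<ge> 0" unfolding V_def by (rule measure_nonneg)
    have geo: "(\<Sum>m\<in>I. exp (- 2 * real m)) \<le> 2" if "finite I" for I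
    proof -
      have e2: "exp (-2 :: real) \<le> 1 / 2"
        using exp_ge_add_one_self[of "2::real"] by (simp add: exp_minus inverse_eq_divide field_simps)
      have "(\<Sum>m\<in>I. exp (- 2 * real m)) = (\<Sum>m\<in>I. exp (-2) ^ m)"
        by (intro sum.cong refl) (simp add: exp_of_nat_mult[symmetric] mult.commute)
      also have "\<dots> \<le> (\<Sum>m. exp (-2) ^ m)"
        using e2 that by (intro sum_le_suminf summable_geometric) auto
      also have "\<dots> = 1 / (1 - exp (-2))" using e2 by (intro suminf_geometric) simp
      also have "\<dots> \<le> 2" using e2 by (simp add: field_simps)
      finally show ?thesis .
    qed
    have partial_norm: "l2_norm (group_fourier f lam (\<lambda>x. \<Sum>k<N. z k * h k x)) \<le> 2 * V * C1 * sqrt S" for N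
    proof -
      define I where "I = mm ` {..<N}"
      define B where "B m = {k \<in> {..<N}. mm k = m}" for m
      have finI: "finite I" by (simp add: I_def)
      have eq: "(\<lambda>x. \<Sum>k<N. z k * h k x) = (\<lambda>x. \<Sum>m\<in>I. \<Sum>k\<in>B m. z k * h k x)"
        unfolding I_def B_def by (rule ext, rule sum.image_gen) simp
      have "l2_norm (group_fourier f lam (\<lambda>x. \<Sum>k<N. z k * h k x))
         \<le> (\<Sum>m\<in>I. l2_norm (group_fourier f lam (\<lambda>x. \<Sum>k\<in>B m. z k * h k x)))"
        unfolding eq by (intro group_fourier_sum_norm finI L2_lincomb hL)
      also have "\<dots> \<le> (\<Sum>m\<in>I. V * C1 * sqrt S * exp (- 2 * real m))"
      proof (rule sum_mono)
        fix m assume "m \<in> I"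
        have finB: "finite (B m)" by (simp add: B_def)
        let ?q = "E ^ m * W (2 * m)"
        have q0: "?q \<ge> 0" using E W_ge1[of "2 * m"] by simp
        have "l2_norm (group_fourier f lam (\<lambda>x. \<Sum>k\<in>B m. z k * h k x))
          \<le> V * 1 * ?q * sqrt (\<Sum>k\<in>B m. (cmod (z k) / \<nu> k ^ m)\<^sup>2)"
          unfolding V_def E_def h_def \<nu>_def by (rule group_fourier_block[OF f _ lam finB]) simp
        also have "\<dots> = V * sqrt (?q\<^sup>2 * (\<Sum>k\<in>B m. (cmod (z k) / \<nu> k ^ m)\<^sup>2))"
          using q0 by (simp add: real_sqrt_mult)
        also have "?q\<^sup>2 * (\<Sum>k\<in>B m. (cmod (z k) / \<nu> k ^ m)\<^sup>2) = (\<Sum>k\<in>B m. (cmod (z k) * (?q / \<nu> k ^ m))\<^sup>2)"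
          unfolding sum_distrib_left by (intro sum.cong refl) (simp add: power_mult_distrib power_divide)
        also have "V * sqrt \<dots> \<le> V * sqrt (\<Sum>k\<in>B m. (C1 * exp (- 2 * real m) * (cmod (z k) * ?w k))\<^sup>2)"
        proof (intro mult_left_mono real_sqrt_le_mono sum_mono power_mono V0)
          fix k assume "k \<in> B m"
          then have "mm k = m" by (simp add: B_def)
          then have "cmod (z k) * (?q / \<nu> k ^ m) \<le> cmod (z k) * (C1 * exp (- 2 * real m) * ?w k)"
            using key[of k] by (intro mult_left_mono) auto
          then show "cmod (z k) * (?q / \<nu> k ^ m) \<le> C1 * exp (- 2 * real m) * (cmod (z k) * ?w k)"
            by (simp only: mult_ac)
          show "0 \<le> cmod (z k) * (?q / \<nu> k ^ m)" using q0 \<nu>[of k] by (simp add: less_imp_le)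
        qed
        also have "(\<Sum>k\<in>B m. (C1 * exp (- 2 * real m) * (cmod (z k) * ?w k))\<^sup>2)
           = (C1 * exp (- 2 * real m))\<^sup>2 * (\<Sum>k\<in>B m. (cmod (z k) * ?w k)\<^sup>2)"
          by (simp only: sum_distrib_left power_mult_distrib)
        also have "V * sqrt \<dots> \<le> V * sqrt ((C1 * exp (- 2 * real m))\<^sup>2 * S)"
        proof (intro mult_left_mono real_sqrt_le_mono V0)
          have "(\<Sum>k\<in>B m. (cmod (z k) * ?w k)\<^sup>2) \<le> (\<Sum>k<N. (cmod (z k) * ?w k)\<^sup>2)"
            by (rule sum_mono2) (auto simp: B_def)
          then show "(\<Sum>k\<in>B m. (cmod (z k) * ?w k)\<^sup>2) \<le> S" using partial_le[of N] by linarith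
        qed simp
        also have "\<dots> = V * C1 * sqrt S * exp (- 2 * real m)"
          using C1 by (simp add: real_sqrt_mult)
        finally show "l2_norm (group_fourier f lam (\<lambda>x. \<Sum>k\<in>B m. z k * h k x)) \<le> V * C1 * sqrt S * exp (- 2 * real m)" .
      qed
      also have "\<dots> = V * C1 * sqrt S * (\<Sum>m\<in>I. exp (- 2 * real m))" by (simp only: sum_distrib_left)
      also have "\<dots> \<le> V * C1 * sqrt S * 2"
        using geo[OF finI] V0 C1 S0 by (intro mult_left_mono mult_nonneg_nonneg) auto
      finally show ?thesis by simp
    qed
    have "l2_norm (group_fourier f lam \<phi>) \<le> mass * l2_norm (\<lambda>x. \<phi> x - (\<Sum>k<N. z k * h k x)) + 2 * V * C1 * sqrt S" for N
    proof -
      have L: "(\<lambda>x. \<Sum>k<N. z k * h k x) \<in> L2" by (intro L2_lincomb hL)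
      have "l2_norm (group_fourier f lam (\<lambda>x. (\<phi> x - (\<Sum>k<N. z k * h k x)) + (\<Sum>k<N. z k * h k x)))
         \<le> l2_norm (group_fourier f lam (\<lambda>x. \<phi> x - (\<Sum>k<N. z k * h k x))) + l2_norm (group_fourier f lam (\<lambda>x. \<Sum>k<N. z k * h k x))"
        by (rule group_fourier_add_norm[OF L2_diff[OF \<phi> L] L])
      then show ?thesis
        using group_fourier_L2(2)[OF L2_diff[OF \<phi> L], of lam] partial_norm[of N] by simp
    qed
    moreover have "(\<lambda>N. mass * l2_norm (\<lambda>x. \<phi> x - (\<Sum>k<N. z k * h k x)) + 2 * V * C1 * sqrt S) \<longlonglongrightarrow> mass * 0 + 2 * V * C1 * sqrt S"
      unfolding z_def by (intro tendsto_intros l2_expansion[OF h \<phi>])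
    ultimately have "l2_norm (group_fourier f lam \<phi>) \<le> mass * 0 + 2 * V * C1 * sqrt S"
      by (intro LIMSEQ_le_const[where a = "l2_norm (group_fourier f lam \<phi>)"]) auto
    then have "(l2_norm (group_fourier f lam \<phi>))\<^sup>2 \<le> (2 * V * C1 * sqrt S)\<^sup>2" by (intro power_mono) auto
    also have "\<dots> = (2 * V * C1)\<^sup>2 * S" using S0 by (simp add: power_mult_distrib)
    also have "\<dots> \<le> C * S" using S0 by (simp add: C_def mult_right_mono)
    finally show ?thesis by (simp only: S_def)
  qed
  show ?thesis
  proof (rule that[of f C])
    show "continuous_on UNIV f" by (rule cont)
    have sub: "{g. f g \<noteq> 0} \<subseteq> ?K" using out by blast
    show "compact (closure {g. f g \<noteq> 0})"
      using bounded_subset[OF bounded_cbox sub] by (simp only: compact_closure)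
    have "f 0 \<noteq> 0" using \<beta>(5) by (simp add: f_def prodfun_def)
    then show "\<exists>g. f g \<noteq> 0" by blast
    show "C > 0" by (simp add: C_def add_nonneg_pos)
    fix lam :: real assume lam: "lam \<noteq> 0"
    show "l2_op_le (l2_adjoint (group_fourier f lam) \<circ> group_fourier f lam)
       (\<lambda>\<phi> \<xi>. complex_of_real C * functional_calculus (hermite_op lam) (\<lambda>s. exp (- 2 * \<theta> (sqrt s) * sqrt s)) \<phi> \<xi>)"
      unfolding l2_op_le_def
    proof
      fix \<phi> :: "'n fn" assume \<phi>: "\<phi> \<in> L2"
      show "Re (l2_inner ((l2_adjoint (group_fourier f lam) \<circ> group_fourier f lam) \<phi>) \<phi>)
        \<le> Re (l2_inner (\<lambda>\<xi>. complex_of_real C * functional_calculus (hermite_op lam) (\<lambda>s. exp (- 2 * \<theta> (sqrt s) * sqrt s)) \<phi> \<xi>) \<phi>)"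
        unfolding adjoint_composition_inner[OF compact_supp_axioms \<phi>] l2_inner_scale_left M_def[symmetric]
        using blocks[OF lam \<phi>] by simp
    qed
  qed
qed

section \<open>Necessity of the integral condition\<close>

text \<open>On each line through the origin the combination is a polynomial times a Gaussian, and a polynomial with
  infinitely many zeros vanishes.\<close>

lemma hermite_combination_vanishes:
  fixes P :: "'n::finite fn"
  assumes P: "P = (\<lambda>x. \<Sum>k\<in>B. z k * hbasis a k x)" and out: "\<And>x. norm x > r \<Longrightarrow> P x = 0"
  shows "P x = 0"
proof -
  \<comment> \<open>The functional \<open>T\<close> stands for the real or the imaginary part, which turns coefficients into real ones.\<close>
  have zero_line: "T (P (t *\<^sub>R x)) = 0" if T: "\<And>u v. T (u + v) = T u + T v" "T 0 = 0" "\<And>z y. T (z * complex_of_real y) = T z * y"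
    and x: "x \<noteq> 0" for T :: "complex \<Rightarrow> real" and x :: "real ^ 'n" and t
  proof -
    define q where "q = (\<Sum>k\<in>B. smult (T (z k)) (\<Prod>b\<in>(Basis :: (real ^ 'n) set). pcompose (hp a (multi_index k b)) [:0, x \<bullet> b:]))"
    have TP: "T (P (t *\<^sub>R x)) = poly q t * exp (- a * (norm (t *\<^sub>R x))\<^sup>2 / 2)" for t
    proof -
      have h: "hbasis a k (t *\<^sub>R x) = complex_of_real ((\<Prod>b\<in>(Basis :: (real ^ 'n) set). poly (hp a (multi_index k b)) (t * (x \<bullet> b))) * exp (- a * (norm (t *\<^sub>R x))\<^sup>2 / 2))" for k
      proof -
        have "(\<Prod>b\<in>(Basis :: (real ^ 'n) set). exp (- a * (t * (x \<bullet> b))\<^sup>2 / 2)) = exp (\<Sum>b\<in>(Basis :: (real ^ 'n) set). - a * (t * (x \<bullet> b))\<^sup>2 / 2)"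
          by (simp add: exp_sum)
        also have "(\<Sum>b\<in>(Basis :: (real ^ 'n) set). - a * (t * (x \<bullet> b))\<^sup>2 / 2) = - a * (norm (t *\<^sub>R x))\<^sup>2 / 2"
          unfolding norm_sq_Basis by (simp add: sum_distrib_left sum_divide_distrib sum_negf)
        finally show ?thesis
          by (simp only: hbasis_def hfun_def prodfun_def pg_def prod.distrib of_real_prod[symmetric] of_real_mult[symmetric] inner_scaleR_left real_scaleR_def)
      qed
      have Tsum: "T (\<Sum>k\<in>B. w k) = (\<Sum>k\<in>B. T (w k))" for w
        by (induction B rule: infinite_finite_induct) (auto simp: T)
      show ?thesis unfolding P h Tsum T(3) q_def poly_sum sum_distrib_right
        by (intro sum.cong refl) (simp add: poly_prod poly_pcompose mult.commute mult.assoc)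
    qed
    have "poly q t = 0" if "t > \<bar>r\<bar> / norm x" for t
    proof -
      have "r \<le> \<bar>r\<bar>" "\<bar>r\<bar> < t * norm x" using that x by (auto simp: pos_divide_less_eq)
      moreover have "t * norm x \<le> \<bar>t\<bar> * norm x" by (intro mult_right_mono) auto
      ultimately have "norm (t *\<^sub>R x) > r" by simp
      then show ?thesis using TP[of t] out T(2) by simp
    qed
    then have "{\<bar>r\<bar> / norm x<..} \<subseteq> {t. poly q t = 0}" by auto
    then have "infinite {t. poly q t = 0}" using infinite_super infinite_Ioi by blast
    then have "q = 0" using poly_roots_finite by blast
    then show ?thesis using TP by simp
  qed
  obtain b0 :: "real ^ 'n" where b0: "b0 \<in> Basis" using nonempty_Basis by blast
  obtain y :: "real ^ 'n" and t where y: "y \<noteq> 0" "x = t *\<^sub>R y"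
  proof (cases "x = 0")
    case True
    then show ?thesis using that[of b0 0] b0 nonzero_Basis by auto
  next
    case False
    then show ?thesis using that[of x 1] by simp
  qed
  have "Re (P x) = 0" "Im (P x) = 0" unfolding y(2) by (rule zero_line[where T = Re] zero_line[where T = Im]; simp add: y(1))+
  then show ?thesis by (simp add: complex_eq_iff)
qed

lemma gevrey_widths: "(\<lambda>i. 1 / (2 * (real (i + 1) * real (i + 2)))) sums (1 / 2)"
proof -
  have "(\<lambda>n. 1 / real (Suc n)) \<longlonglongrightarrow> 0" using LIMSEQ_inverse_real_of_nat by (simp add: inverse_eq_divide)
  then have "(\<lambda>n. 1 / real (Suc n) - 1 / real (Suc (Suc n))) sums (1 / real (Suc 0) - 0)" by (rule telescope_sums')
  from sums_mult[OF this, of "1/2"] have "(\<lambda>n. 1/2 * (1 / real (Suc n) - 1 / real (Suc (Suc n)))) sums (1/2 * (1 / real (Suc 0) - 0))" .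
  moreover have "1/2 * (1 / real (Suc n) - 1 / real (Suc (Suc n))) = 1 / (2 * (real (n + 1) * real (n + 2)))" for n
  proof -
    have "1 / a - 1 / (a + 1) = 1 / (a * (a + 1))" if "a > 0" for a :: real using that by (simp add: field_simps)
    from this[of "real (n + 1)"] show ?thesis by (simp add: add.commute)
  qed
  moreover have "1/2 * (1 / real (Suc 0) - 0) = (1/2 :: real)" by simp
  ultimately show ?thesis by (simp only:)
qed

text \<open>The bump for the widths \<open>1 / (2 * (i + 1) * (i + 2))\<close>, whose sum is \<open>1 / 2\<close>, scaled by \<open>\<delta>\<close> and moved to
  \<open>x0\<close> in each coordinate. Quadratically decreasing widths give derivatives of order \<open>2 * j\<close> bounded by
  \<open>(D * j ^ 4) ^ j\<close>.\<close>

lemma gevrey_bump_exists: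
  fixes x0 :: "real ^ 'n::finite"
  assumes \<rho>: "\<rho> > 0"
  shows "\<exists>W R D \<phi>. weights W 1 \<and> R \<ge> 0 \<and> D > 0 \<and> Bd W R 1 0 \<phi> \<and> (\<forall>x. norm (x - x0) \<ge> \<rho> \<longrightarrow> \<phi> x = 0)
    \<and> (\<forall>x. \<phi> x = complex_of_real (Re (\<phi> x)) \<and> Re (\<phi> x) \<ge> 0) \<and> Re (\<phi> x0) > 0
    \<and> (\<forall>j. W (2 * Suc j) \<le> (D * real (Suc j) ^ 4) ^ Suc j)"
proof -
  define a :: "nat \<Rightarrow> real" where "a i = 1 / (2 * (real (i + 1) * real (i + 2)))" for i
  have apos: "a i > 0" for i by (simp add: a_def)
  have as: "summable a" "suminf a < 1" using gevrey_widths by (auto simp: sums_iff a_def[abs_def])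
  obtain \<beta> where \<beta>: "\<And>k t. (\<beta> k has_real_derivative \<beta> (Suc k) t) (at t)"
    "\<And>k t. \<bar>\<beta> k t\<bar> \<le> (\<Prod>j<k. 2 / a j)" "\<And>k t. \<bar>t\<bar> > 2 \<Longrightarrow> \<beta> k t = 0" "\<And>t. \<beta> 0 t \<ge> 0" "\<beta> 0 0 > 0"
    by (rule bump_exists[OF apos as]) blast
  define N where "N = real CARD('n)"
  have N: "N > 0" by (simp add: N_def)
  \<comment> \<open>The support is a cube of half side length \<open>2 * \<delta>\<close>, contained in the ball of radius \<open>\<rho>\<close>.\<close>
  define \<delta> where "\<delta> = min 1 (\<rho> / (3 * N))"
  have \<delta>: "0 < \<delta>" "\<delta> \<le> 1" "\<delta> \<le> \<rho> / (3 * N)" using \<rho> N by (auto simp: \<delta>_def)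
  define W where "W k = (\<Prod>i<k. 2 / (\<delta> * a i))" for k
  have ad: "a (Suc i) \<le> a i" for i unfolding a_def by (intro divide_left_mono mult_left_mono mult_mono mult_pos_pos) auto
  have ai: "real (Suc i) * a i \<le> 1" for i
    
  proof -
    have "real (Suc i) * 1 \<le> (real (i + 1)) * (2 * real (i + 2))" by (intro mult_mono) auto
    then show ?thesis unfolding a_def by (simp add: divide_le_eq)
  qed
  have w: "weights W 1" unfolding W_def
  proof (rule weights_of_widths)
    show "0 < \<delta> * a i" for i using \<delta> apos by simp
    show "\<delta> * a (Suc i) \<le> \<delta> * a i" for i using \<delta> ad by (intro mult_left_mono) auto
    have "\<delta> * (real (Suc i) * a i) \<le> 1 * 1" for i
      using \<delta> ai apos[of i] by (intro mult_mono) (auto intro: less_imp_le)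
    then have "real (Suc i) * (\<delta> * a i) \<le> 1 * 1" for i by (simp only: mult.left_commute[of "real (Suc i)" \<delta>])
    from order_trans[OF this] show "real (Suc i) * (\<delta> * a i) \<le> 2" for i by simp
  qed
  define G where "G b k t = \<beta> k ((t - x0 \<bullet> b) / \<delta>) / \<delta> ^ k" for b :: "real ^ 'n" and k t
  define \<phi> where "\<phi> = prodfun (\<lambda>b t. complex_of_real (G b 0 t))"
  define R where "R = norm x0 + 2 * \<delta>"
  have Bd: "Bd W R 1 0 \<phi>"
  proof -
    have der: "(G b k has_real_derivative G b (Suc k) t) (at t)" for b k t
    proof -
      have "((\<lambda>t. (t - x0 \<bullet> b) / \<delta>) has_real_derivative 1 / \<delta>) (at t)"
        using \<delta> by (auto intro!: derivative_eq_intros)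
      from DERIV_cdivide[OF DERIV_chain'[OF this \<beta>(1)[of k]], of "\<delta> ^ k"]
      show ?thesis by (simp add: G_def[abs_def] mult.commute)
    qed
    have le: "\<bar>G b k t\<bar> \<le> W k" for b k t
    proof -
      have "W k = (\<Prod>i<k. 2 / a i) / \<delta> ^ k"
        unfolding W_def by (simp add: prod_dividef prod.distrib mult.commute)
      then show ?thesis using \<beta>(2)[of k "(t - x0 \<bullet> b) / \<delta>"] \<delta> by (simp add: G_def abs_divide divide_right_mono)
    qed
    have out: "G b k t = 0" if "b \<in> Basis" "\<bar>t\<bar> > R" for b k t
    proof -
      have "\<bar>x0 \<bullet> b\<bar> \<le> norm x0" using that(1) by (rule Basis_le_norm)
      then have "\<bar>t - x0 \<bullet> b\<bar> > 2 * \<delta>" using that(2) by (simp add: R_def)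
      then have "\<bar>(t - x0 \<bullet> b) / \<delta>\<bar> > 2" using \<delta> by (simp add: abs_divide field_simps)
      then show ?thesis using \<beta>(3) by (simp add: G_def)
    qed
    from weights.Bd_prodfun[where G = G and R = R and \<alpha> = "\<lambda>_. 0", OF w der le out] show ?thesis by (simp add: \<phi>_def)
  qed
  have \<phi>real: "\<phi> x = complex_of_real (\<Prod>b\<in>Basis. \<beta> 0 ((x \<bullet> b - x0 \<bullet> b) / \<delta>))" for x
    by (simp add: \<phi>_def prodfun_def G_def)
  have Re\<phi>: "Re (\<phi> x) = (\<Prod>b\<in>Basis. \<beta> 0 ((x \<bullet> b - x0 \<bullet> b) / \<delta>))" for x
    unfolding \<phi>real by (rule Re_complex_of_real)
  have supp: "\<phi> x = 0" if "norm (x - x0) \<ge> \<rho>" for x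
  proof (rule ccontr)
    assume ne: "\<phi> x \<noteq> 0"
    have "\<bar>(x - x0) \<bullet> b\<bar> \<le> 2 * \<delta>" if "b \<in> Basis" for b
    proof (rule ccontr)
      assume "\<not> \<bar>(x - x0) \<bullet> b\<bar> \<le> 2 * \<delta>"
      then have "\<bar>(x \<bullet> b - x0 \<bullet> b) / \<delta>\<bar> > 2" using \<delta> by (simp add: abs_divide field_simps inner_diff_left)
      then have "\<beta> 0 ((x \<bullet> b - x0 \<bullet> b) / \<delta>) = 0" by (rule \<beta>(3))
      then have "(\<Prod>b\<in>Basis. \<beta> 0 ((x \<bullet> b - x0 \<bullet> b) / \<delta>)) = 0" using that by (auto intro!: prod_zero)
      then show False using ne by (simp add: \<phi>real)
    qed
    then have "norm (x - x0) \<le> (\<Sum>b\<in>(Basis :: (real ^ 'n) set). 2 * \<delta>)"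
      by (intro order_trans[OF norm_le_l1] sum_mono)
    also have "\<dots> = N * (2 * \<delta>)" by (simp add: N_def)
    also have "\<dots> \<le> N * (2 * (\<rho> / (3 * N)))" using \<delta> N by (intro mult_left_mono) auto
    also have "\<dots> < \<rho>" using N \<rho> by simp
    finally show False using that by simp
  qed
  define D where "D = 16 * 81 / \<delta>\<^sup>2"
  have Wle: "W (2 * Suc j) \<le> (D * real (Suc j) ^ 4) ^ Suc j" for j
  proof -
    let ?J = "real (Suc j)"
    have "2 / (\<delta> * a i) \<le> 4 / \<delta> * (3 * ?J)\<^sup>2" if "i < 2 * Suc j" for i
    proof -
      have "real (i + 1) * real (i + 2) \<le> (3 * ?J) * (3 * ?J)" using that by (intro mult_mono) auto
      then have "4 / \<delta> * (real (i + 1) * real (i + 2)) \<le> 4 / \<delta> * (3 * ?J)\<^sup>2"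
        using \<delta> unfolding power2_eq_square by (intro mult_left_mono) auto
      moreover have "2 / (\<delta> * a i) = 4 / \<delta> * (real (i + 1) * real (i + 2))" using \<delta> by (simp add: a_def)
      ultimately show ?thesis by simp
    qed
    then have "W (2 * Suc j) \<le> (\<Prod>i<2 * Suc j. 4 / \<delta> * (3 * ?J)\<^sup>2)"
      unfolding W_def using \<delta> apos by (intro prod_mono) (auto intro: less_imp_le)
    also have "\<dots> = ((4 / \<delta> * (3 * ?J)\<^sup>2)\<^sup>2) ^ Suc j" by (simp only: prod_constant card_lessThan power_mult)
    also have "(4 / \<delta> * (3 * ?J)\<^sup>2)\<^sup>2 = D * ?J ^ 4"
    proof -
      have "(4 / \<delta> * (3 * x)\<^sup>2)\<^sup>2 = D * x ^ 4" for x
        by (simp add: D_def power_mult_distrib power_divide flip: power_mult)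
      then show ?thesis .
    qed
    finally show ?thesis .
  qed
  have "Re (\<phi> x0) > 0" unfolding Re\<phi> using \<beta>(5) by (simp add: prod_pos)
  moreover have "\<forall>x. \<phi> x = complex_of_real (Re (\<phi> x)) \<and> Re (\<phi> x) \<ge> 0"
    using Re\<phi> \<phi>real by (auto intro!: prod_nonneg \<beta>(4))
  moreover have "R \<ge> 0" "D > 0" using \<delta> by (auto simp: R_def D_def)
  ultimately show ?thesis using w Bd supp Wle
    by (intro exI[of _ W] exI[of _ R] exI[of _ D] exI[of _ \<phi>]) blast
qed

lemma Bd_C2: "Bd W R A j u \<Longrightarrow> C2 u" for u :: "'n::finite fn"
  unfolding C2_def partial_eq_dd by (auto intro: Bd_differentiable Bd_continuous Bd_dd)

context weights
begin

lemma Bd_L2: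
  fixes u :: "'n::finite fn"
  assumes u: "Bd W R A j u"
  shows "u \<in> L2" "l2_norm u \<le> A * W j * sqrt (measure lborel (cbox (- (R *\<^sub>R One)) (R *\<^sub>R One) :: (real ^ 'n) set))"
proof -
  let ?K = "cbox (- (R *\<^sub>R One)) (R *\<^sub>R One) :: (real ^ 'n) set"
  have i: "integrable lborel (\<lambda>x. (cmod (u x))\<^sup>2)"
    by (rule integrable_compact_support[OF _ compact_cbox[of "- (R *\<^sub>R One)" "R *\<^sub>R One"]])
      (auto simp: Bd_outside[OF u] intro!: continuous_intros Bd_continuous[OF u])
  then show L: "u \<in> L2" using Bd_continuous[OF u] by (simp add: L2_def borel_measurable_continuous_onI)
  have AW: "A * W j \<ge> 0" using Bd_nonneg[OF u] W_ge1[of j] by simp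
  have "(l2_norm u)\<^sup>2 \<le> (LINT x|lborel. (A * W j)\<^sup>2 * indicator ?K x)"
    unfolding l2_norm_sq
  proof (rule integral_mono[OF i])
    show "integrable lborel (\<lambda>x. (A * W j)\<^sup>2 * indicator ?K x)"
      by (intro integrable_mult_right integrable_real_indicator emeasure_lborel_cbox_finite) simp
    show "(cmod (u x))\<^sup>2 \<le> (A * W j)\<^sup>2 * indicator ?K x" for x
      using Bd_bound[OF u, of x] Bd_outside[OF u, of x] by (cases "x \<in> ?K") (auto intro: power_mono)
  qed
  also have "\<dots> = (A * W j)\<^sup>2 * measure lborel ?K" by simp
  also have "\<dots> = (A * W j * sqrt (measure lborel ?K))\<^sup>2" by (simp only: power_mult_distrib real_sqrt_pow2 measure_nonneg)
  finally show "l2_norm u \<le> A * W j * sqrt (measure lborel ?K)"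
    using AW by (intro power2_le_imp_le[of "l2_norm u"]) auto
qed

lemma hermite_power_coeff:
  fixes u :: "'n::finite fn"
  assumes u: "Bd W R A 0 u" and R: "R \<ge> 0" and lam: "lam \<noteq> 0"
  shows "l2_inner ((hermite_op lam ^^ m) u) (hbasis \<bar>lam\<bar> k) = complex_of_real (hbasis_eig TYPE('n) \<bar>lam\<bar> k ^ m) * l2_inner u (hbasis \<bar>lam\<bar> k)"
proof (induction m)
  case (Suc m)
  let ?v = "(hermite_op lam ^^ m) u" and ?h = "hbasis \<bar>lam\<bar> k :: 'n fn"
  note v = Bd_hermite_op_power[OF u R, of lam m]
  have hr: "cnj (?h x) = ?h x" for x by (simp add: hbasis_def hfun_real)
  have hC2: "C2 ?h" unfolding hbasis_def by (rule hfun_C2)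
  have heig: "hermite_op lam ?h x = complex_of_real (hbasis_eig TYPE('n) \<bar>lam\<bar> k) * ?h x" for x
    unfolding hbasis_def hbasis_eig_def by (rule hermite_op_hfun[OF lam])
  have "l2_inner (hermite_op lam ?v) ?h = (LINT x|lborel. ?h x * hermite_op lam ?v x)"
    by (simp add: l2_inner_def hr mult.commute)
  also have "\<dots> = (LINT x|lborel. hermite_op lam ?h x * ?v x)"
    by (rule hermite_op_symmetric[symmetric, OF hC2 Bd_C2[OF v] compact_cbox]) (rule Bd_outside[OF v])
  also have "\<dots> = complex_of_real (hbasis_eig TYPE('n) \<bar>lam\<bar> k) * l2_inner ?v ?h"
    unfolding heig l2_inner_def hr by (simp only: integral_mult_right_zero[symmetric]) (rule Bochner_Integration.integral_cong[OF refl], simp only: mult_ac)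
  finally show ?case using Suc by (simp add: mult.assoc)
qed simp

end

lemma hermite_power_outside:
  fixes u :: "'n::finite fn"
  assumes K: "closed K" and u: "\<And>x. x \<notin> K \<Longrightarrow> u x = 0" and x: "x \<notin> K"
  shows "(hermite_op lam ^^ m) u x = 0"
  using x
proof (induction m arbitrary: x)
  case 0
  then show ?case using u by simp
next
  case (Suc m)
  have "dd b (dd b ((hermite_op lam ^^ m) u)) x = 0" for b
    by (intro dd_zero_outside[OF K] Suc.IH Suc.prems)
  then show ?case
    unfolding funpow.simps comp_apply hermite_op_def[of lam "(hermite_op lam ^^ m) u" x] partial_eq_dd
    using Suc.IH[OF Suc.prems] by simp
qed

lemma hbasis_eig_multi_index:
  "hbasis_eig TYPE('n::finite) a k = (2 * real (\<Sum>b\<in>(Basis :: (real ^ 'n) set). multi_index k b) + real CARD('n)) * a"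
proof -
  have "(\<Sum>b\<in>(Basis :: (real ^ 'n) set). (2 * real (multi_index k b) + 1) * a)
    = (\<Sum>b\<in>(Basis :: (real ^ 'n) set). 2 * real (multi_index k b) + 1) * a" by (simp only: sum_distrib_right)
  also have "(\<Sum>b\<in>(Basis :: (real ^ 'n) set). 2 * real (multi_index k b) + 1)
    = 2 * real (\<Sum>b\<in>(Basis :: (real ^ 'n) set). multi_index k b) + real CARD('n)"
    by (simp add: sum.distrib sum_distrib_left)
  finally show ?thesis by (simp add: hbasis_eig_def heig_def)
qed

text \<open>The spectrum lies in an arithmetic progression with step \<open>2 * a\<close>; this makes a single eigenvalue visible to continuous functions.\<close>

lemma hbasis_eig_separated:
  assumes a: "a > 0" and ne: "hbasis_eig TYPE('n::finite) a k \<noteq> hbasis_eig TYPE('n) a l"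
  shows "2 * a \<le> \<bar>hbasis_eig TYPE('n) a k - hbasis_eig TYPE('n) a l\<bar>"
proof -
  let ?S = "\<lambda>k. \<Sum>b\<in>(Basis :: (real ^ 'n) set). multi_index k b"
  have "?S k \<noteq> ?S l" using ne unfolding hbasis_eig_multi_index by metis
  then have "1 \<le> \<bar>real (?S k) - real (?S l)\<bar>" by linarith
  then have "2 * a * 1 \<le> 2 * a * \<bar>real (?S k) - real (?S l)\<bar>" using a by (intro mult_left_mono) auto
  also have "\<dots> = \<bar>2 * a * (real (?S k) - real (?S l))\<bar>" using a by (simp add: abs_mult)
  also have "2 * a * (real (?S k) - real (?S l)) = hbasis_eig TYPE('n) a k - hbasis_eig TYPE('n) a l"
    by (simp only: hbasis_eig_multi_index) (simp only: algebra_simps)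
  finally show ?thesis by simp
qed

lemma finite_eigenvalue_multiplicity:
  assumes a: "a > 0"
  shows "finite {k. hbasis_eig TYPE('n::finite) a k = \<mu>}"
proof -
  let ?I = "multi_index :: nat \<Rightarrow> real ^ 'n \<Rightarrow> nat"
  have inj: "inj ?I" using multi_index_bij by (auto simp: bij_betw_def)
  have "?I k \<in> PiE Basis (\<lambda>_. {..nat \<lceil>\<mu> / a\<rceil>})" if k: "hbasis_eig TYPE('n) a k = \<mu>" for k
  proof -
    have mem: "?I k \<in> Basis \<rightarrow>\<^sub>E UNIV" using bij_betwE[OF multi_index_bij] by blast
    have "?I k b \<le> nat \<lceil>\<mu> / a\<rceil>" if b: "b \<in> Basis" for b
    proof -
      have "?I k b \<le> (\<Sum>b\<in>(Basis :: (real ^ 'n) set). ?I k b)" using b by (intro member_le_sum) auto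
      then have "real (?I k b) \<le> 2 * real (\<Sum>b\<in>(Basis :: (real ^ 'n) set). ?I k b) + real CARD('n)" by linarith
      also have "\<dots> = \<mu> / a" using k a by (simp add: hbasis_eig_multi_index field_simps)
      finally show ?thesis by linarith
    qed
    then show ?thesis using mem by (auto simp: PiE_iff)
  qed
  then have "?I ` {k. hbasis_eig TYPE('n) a k = \<mu>} \<subseteq> PiE Basis (\<lambda>_. {..nat \<lceil>\<mu> / a\<rceil>})" by blast
  then have "finite (?I ` {k. hbasis_eig TYPE('n) a k = \<mu>})"
    by (rule finite_subset) (intro finite_PiE finite_Basis finite_atMost)
  then show ?thesis using inj by (metis finite_imageD inj_on_subset subset_UNIV)
qed

lemma coeff_product_sum_le:
  assumes e: "orthonormal e" and \<phi>: "\<phi> \<in> L2" and \<psi>: "\<psi> \<in> L2"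
  shows "(\<Sum>k. cmod (l2_inner \<phi> (e k)) * cmod (l2_inner \<psi> (e k))) \<le> l2_norm \<phi> * l2_norm \<psi>"
proof (rule suminf_le_const[OF coeff_product_summable[OF assms]])
  fix N
  have le: "L2_set (\<lambda>k. cmod (l2_inner \<phi> (e k))) {..<N} \<le> l2_norm \<phi>" if "\<phi> \<in> L2" for \<phi>
    unfolding L2_set_def using Bessel[OF e _ that, of "{..<N}"] by (intro real_le_lsqrt) (auto intro: sum_nonneg)
  have "(\<Sum>k<N. cmod (l2_inner \<phi> (e k)) * cmod (l2_inner \<psi> (e k)))
    \<le> L2_set (\<lambda>k. cmod (l2_inner \<phi> (e k))) {..<N} * L2_set (\<lambda>k. cmod (l2_inner \<psi> (e k))) {..<N}"
    using L2_set_mult_ineq[of "\<lambda>k. cmod (l2_inner \<phi> (e k))" "\<lambda>k. cmod (l2_inner \<psi> (e k))" "{..<N}"] by simp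
  also have "\<dots> \<le> l2_norm \<phi> * l2_norm \<psi>"
    by (intro mult_mono le \<phi> \<psi> l2_norm_nonneg L2_set_nonneg)
  finally show "(\<Sum>k<N. cmod (l2_inner \<phi> (e k)) * cmod (l2_inner \<psi> (e k))) \<le> l2_norm \<phi> * l2_norm \<psi>" .
qed

text \<open>The maximum over \<open>s\<close> is attained at \<open>J / q\<close>; its factor \<open>exp (- J)\<close> is dropped.\<close>

lemma power_times_exp_minus_le:
  assumes "s > 0" "q > 0" "J > 0"
  shows "s ^ J * exp (- (q * s)) \<le> (real J / q) ^ J"
proof -
  have "q * s / real J \<le> exp (q * s / real J)" using exp_ge_add_one_self[of "q * s / real J"] by linarith
  then have "(q * s / real J) ^ J \<le> exp (q * s / real J) ^ J" using assms by (intro power_mono) auto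
  also have "\<dots> = exp (q * s)" using assms by (simp add: exp_of_nat_mult[symmetric])
  finally have "(q * s / real J) ^ J * exp (- (q * s)) \<le> exp (q * s) * exp (- (q * s))" by (intro mult_right_mono) auto
  then have "(q * s / real J) ^ J * exp (- (q * s)) \<le> 1" by (simp add: exp_minus)
  then have "(real J / q) ^ J * ((q * s / real J) ^ J * exp (- (q * s))) \<le> (real J / q) ^ J * 1"
    using assms by (intro mult_left_mono) auto
  moreover have "(real J / q) ^ J * (q * s / real J) ^ J = s ^ J"
    using assms by (simp add: power_mult_distrib[symmetric])
  ultimately show ?thesis by (simp add: mult.assoc[symmetric])
qed

text \<open>The sequence \<open>z k * cnj (d k)\<close> of products of Hermite coefficients has vanishing even moments in the
  frequencies \<open>s k\<close>, because these are pairings of \<open>g\<close> with powers of the Hermite operator applied to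
  \<open>\<phi>\<close>, which live on disjoint sets. Its absolute moments of order \<open>J\<close> are at most of the order of
  \<open>(J / \<theta> (L * J ^ 4)) ^ J\<close>, up to geometric factors. For frequencies up to \<open>L * J ^ 4\<close> this is the decay of \<open>z\<close>; beyond that,
  \<open>s ^ J\<close> is dominated by \<open>s ^ (2 * J) / (L * J ^ 4) ^ J\<close>, whose sum is bounded uniformly in \<open>J\<close> by the
  Gevrey bounds for \<open>\<phi>\<close>. The cosine series therefore vanishes, and testing with a continuous function
  that isolates the eigenvalue \<open>\<mu>\<close> yields the claim.\<close>

lemma (in weights) eigenspace_pairing_vanishes:
  fixes g \<phi> :: "'n::finite fn" and \<theta> :: "real \<Rightarrow> real"
  assumes nn: "\<And>t. t \<ge> 0 \<Longrightarrow> 0 \<le> \<theta> t" and mono: "antimono_on {0..} \<theta>"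
    and inf: "\<not> (\<integral>\<^sup>+ t \<in> {1..}. ennreal (\<theta> t / t) \<partial>lborel) < \<infinity>"
    and lam: "lam \<noteq> 0" and g: "g \<in> L2"
    and decay: "\<And>N. (\<Sum>k<N. (cmod (l2_inner g (hbasis \<bar>lam\<bar> k)) *
        exp (\<theta> (sqrt (hbasis_eig TYPE('n) \<bar>lam\<bar> k)) * sqrt (hbasis_eig TYPE('n) \<bar>lam\<bar> k)))\<^sup>2) \<le> c0"
    and \<phi>: "Bd W R A 0 \<phi>" and R: "R \<ge> 0"
    and gevrey: "\<And>j. W (2 * Suc j) \<le> (D * real (Suc j) ^ 4) ^ Suc j" and D: "D > 0"
    and K: "closed K" "\<And>x. x \<notin> K \<Longrightarrow> \<phi> x = 0" "\<And>x. x \<in> K \<Longrightarrow> g x = 0"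
  shows "(\<Sum>k | hbasis_eig TYPE('n) \<bar>lam\<bar> k = \<mu>. l2_inner g (hbasis \<bar>lam\<bar> k) * cnj (l2_inner \<phi> (hbasis \<bar>lam\<bar> k))) = 0"
proof -
  define al where "al = \<bar>lam\<bar>"
  define h where "h = (hbasis al :: nat \<Rightarrow> 'n fn)"
  define \<nu> where "\<nu> k = hbasis_eig TYPE('n) al k" for k
  define s where "s k = sqrt (\<nu> k)" for k
  define z where "z k = l2_inner g (h k)" for k
  define d where "d k = l2_inner \<phi> (h k)" for k
  \<comment> \<open>Square summable by assumption.\<close>
  define zw where "zw k = cmod (z k) * exp (\<theta> (s k) * s k)" for k
  define p where "p k = cmod (z k) * cmod (d k)" for k
  define a where "a k = z k * cnj (d k)" for k
  define u where "u m = (hermite_op lam ^^ m) \<phi>" for m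
  define Q where "Q = real CARD('n) * (1 + lam\<^sup>2 * (R + c)\<^sup>2)"
  define V where "V = sqrt (measure lborel (cbox (- (R *\<^sub>R One)) (R *\<^sub>R One) :: (real ^ 'n) set))"
  have al: "al > 0" using lam by (simp add: al_def)
  have oh: "orthonormal h" "l2_total h" unfolding h_def using hbasis_orthonormal[OF al] hbasis_total[OF al] by auto
  have \<nu>: "\<nu> k > 0" for k unfolding \<nu>_def by (rule hbasis_eig_pos[OF al])
  have s: "s k > 0" for k using \<nu> by (simp add: s_def)
  have ssq: "s k ^ (2 * m) = \<nu> k ^ m" for k m using \<nu>[of k] by (simp add: s_def power_mult less_imp_le)
  have A: "A \<ge> 0" by (rule Bd_nonneg[OF \<phi>])
  have Q: "Q > 0" unfolding Q_def by (intro mult_pos_pos add_pos_nonneg) auto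
  have V: "V \<ge> 0" by (simp add: V_def)
  have uBd: "Bd W R (Q ^ m * A) (2 * m) (u m)" for m unfolding u_def Q_def by (rule Bd_hermite_op_power[OF \<phi> R])
  have uL2: "u m \<in> L2" for m by (rule Bd_L2(1)[OF uBd])
  have unorm: "l2_norm (u m) \<le> Q ^ m * A * W (2 * m) * V" for m unfolding V_def by (rule Bd_L2(2)[OF uBd])
  have ucoeff: "l2_inner (u m) (h k) = complex_of_real (s k ^ (2 * m)) * d k" for m k
    unfolding ssq unfolding u_def h_def d_def \<nu>_def al_def by (rule hermite_power_coeff[OF \<phi> R lam])
  have uout: "u m x = 0" if "x \<notin> K" for m x unfolding u_def by (rule hermite_power_outside[OF K(1,2) that])
  have gu: "l2_inner g (u m) = 0" for m
  proof -
    have "g x * cnj (u m x) = 0" for x using K(3)[of x] uout[of x m] by (cases "x \<in> K") auto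
    then show ?thesis by (simp only: l2_inner_def Bochner_Integration.integral_zero)
  qed
  have asums: "(\<lambda>k. complex_of_real (s k ^ (2 * m)) * a k) sums 0" for m
    using Parseval[OF oh g uL2[of m]] unfolding gu ucoeff z_def[symmetric]
    by (simp add: a_def mult_ac)
  have p0: "p k \<ge> 0" for k by (simp add: p_def)
  have peq: "s k ^ (2 * m) * p k = cmod (l2_inner g (h k)) * cmod (l2_inner (u m) (h k))" for k m
    using s[of k] by (simp add: ucoeff p_def z_def norm_mult norm_power)
  have psm2: "summable (\<lambda>k. s k ^ (2 * m) * p k)" for m
    unfolding peq by (rule coeff_product_summable[OF oh(1) g uL2])
  have psum2: "(\<Sum>k. s k ^ (2 * m) * p k) \<le> l2_norm g * l2_norm (u m)" for m
    unfolding peq by (rule coeff_product_sum_le[OF oh(1) g uL2])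
  have psm: "summable (\<lambda>k. s k ^ j * p k)" for j
  proof (rule summable_comparison_test')
    show "summable (\<lambda>k. s k ^ (2 * 0) * p k + s k ^ (2 * j) * p k)" by (intro summable_add psm2)
    fix k
    have "0 < s k ^ j" using s by simp
    then have "s k ^ j \<le> 1 + (s k ^ j)\<^sup>2" using sum_squares_bound[of "s k ^ j" 1] by simp
    then have "s k ^ j * p k \<le> (1 + s k ^ (2 * j)) * p k" using p0
      by (intro mult_right_mono) (simp_all add: power_mult[symmetric] mult.commute)
    then show "norm (s k ^ j * p k) \<le> s k ^ (2 * 0) * p k + s k ^ (2 * j) * p k"
      using s[of k] p0[of k] by (simp add: abs_mult distrib_right)
  qed
  have zdsm: "summable (\<lambda>k. zw k * cmod (d k))"
  proof (rule summable_comparison_test')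
    have "summable (\<lambda>k. (zw k)\<^sup>2)"
      using decay unfolding al_def[symmetric] h_def[symmetric] \<nu>_def[symmetric] s_def[symmetric] z_def[symmetric] zw_def[symmetric]
      by (intro summableI_nonneg_bounded) auto
    then show "summable (\<lambda>k. (zw k)\<^sup>2 + (cmod (d k))\<^sup>2)"
      unfolding d_def by (intro summable_add Bessel_summable[OF oh(1)] Bd_L2(1)[OF \<phi>])
    fix k
    have "0 \<le> zw k" by (simp add: zw_def)
    then have "0 \<le> zw k * cmod (d k)" by simp
    then show "norm (zw k * cmod (d k)) \<le> (zw k)\<^sup>2 + (cmod (d k))\<^sup>2"
      using sum_squares_bound[of "zw k" "cmod (d k)"] by (simp only: real_norm_def abs_of_nonneg mult.assoc)
  qed
  define C1 where "C1 = (\<Sum>k. zw k * cmod (d k))"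
  have C1: "C1 \<ge> 0" unfolding C1_def using zdsm by (intro suminf_nonneg) (auto simp: zw_def)
  define C2 where "C2 = l2_norm g * (A * V)"
  have C2: "C2 \<ge> 0" using A V by (simp add: C2_def)
  \<comment> \<open>Large enough that the norm of \<open>u J\<close> is at most a constant times \<open>(L * J ^ 4) ^ J\<close>.\<close>
  define L where "L = max 1 (Q * D)"
  have L: "L \<ge> 1" "Q * D \<le> L" by (auto simp: L_def)
  define q where "q j = \<theta> (L * real j ^ 4)" for j
  have div: "\<not> summable (\<lambda>j. q (Suc j) / real (Suc j))"
    unfolding q_def by (rule divergent_integral_imp_divergent_sum[OF nn mono L(1) inf])
  have arg0: "L * real j ^ 4 \<ge> 0" for j using L by simp
  have qdec: "q j \<le> q i" if "i \<le> j" for i j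
    unfolding q_def using L that by (intro antimono_onD[OF mono arg0] mult_left_mono power_mono) auto
  \<comment> \<open>If \<open>\<theta>\<close> vanished somewhere it would vanish from there on, and the sum would be finite.\<close>
  have qpos: "q j > 0" for j
  proof (rule ccontr)
    assume "\<not> q j > 0"
    then have "q i \<le> 0" if "i \<ge> j" for i using qdec[OF that] by linarith
    then have "q i = 0" if "i \<ge> j" for i using nn[OF arg0[of i]] that by (fastforce simp: q_def)
    then have "summable (\<lambda>j. q (Suc j) / real (Suc j))"
      by (intro summable_finite[of "{..<j}"]) auto
    then show False using div by simp
  qed
  define B where "B = 1 + \<theta> 0"
  have B: "B \<ge> 1" using nn[of 0] by (simp add: B_def)
  define C where "C = C1 + C2 + 1"
  have growth: "(\<Sum>k. s k ^ Suc j * p k) \<le> C * (B * real (Suc j) / q (Suc j)) ^ Suc j" for j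
  proof -
    define J where "J = Suc j"
    have J: "J > 0" by (simp add: J_def)
    let ?T = "L * real J ^ 4"
    have T: "?T > 0" using L J by simp
    have pt: "s k ^ J * p k \<le> (real J / q J) ^ J * (zw k * cmod (d k)) + s k ^ (2 * J) * p k / ?T ^ J" for k
    proof (cases "s k \<le> ?T")
      case True
      then have "q J \<le> \<theta> (s k)" unfolding q_def using s[of k] by (intro antimono_onD[OF mono]) auto
      then have "exp (- (\<theta> (s k) * s k)) \<le> exp (- (q J * s k))" using s[of k] by (simp add: mult_right_mono)
      then have "s k ^ J * exp (- (\<theta> (s k) * s k)) \<le> s k ^ J * exp (- (q J * s k))" using s[of k] by (intro mult_left_mono) auto
      also have "\<dots> \<le> (real J / q J) ^ J" by (rule power_times_exp_minus_le[OF s qpos J])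
      finally have "s k ^ J * exp (- (\<theta> (s k) * s k)) * (zw k * cmod (d k)) \<le> (real J / q J) ^ J * (zw k * cmod (d k))"
        by (intro mult_right_mono) (auto simp: zw_def)
      moreover have "s k ^ J * exp (- (\<theta> (s k) * s k)) * (zw k * cmod (d k)) = s k ^ J * p k"
        by (simp add: zw_def p_def exp_minus)
      moreover have "0 \<le> s k ^ (2 * J) * p k / ?T ^ J" using s[of k] p0[of k] T by simp
      ultimately show ?thesis by linarith
    next
      case False
      then have "s k ^ J * ?T ^ J \<le> s k ^ J * s k ^ J" using s[of k] T by (intro mult_left_mono power_mono) auto
      then have "s k ^ J * ?T ^ J * p k \<le> s k ^ (2 * J) * p k" using p0[of k] by (intro mult_right_mono) (simp_all add: power_add[symmetric] mult_2)
      then have "s k ^ J * p k \<le> s k ^ (2 * J) * p k / ?T ^ J"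
        using T by (simp add: pos_le_divide_eq mult_ac del: power_mult_distrib)
      moreover have "0 \<le> (real J / q J) ^ J * (zw k * cmod (d k))" using qpos[of J] by (simp add: zw_def)
      ultimately show ?thesis by linarith
    qed
    have "(\<Sum>k. s k ^ J * p k) \<le> (\<Sum>k. (real J / q J) ^ J * (zw k * cmod (d k)) + s k ^ (2 * J) * p k / ?T ^ J)"
      by (intro suminf_le pt psm summable_add summable_mult zdsm summable_divide psm2)
    also have "\<dots> = (real J / q J) ^ J * C1 + (\<Sum>k. s k ^ (2 * J) * p k) / ?T ^ J"
      unfolding C1_def
      by (simp only: suminf_add[symmetric] suminf_mult suminf_divide summable_mult summable_divide zdsm psm2)
    also have "(\<Sum>k. s k ^ (2 * J) * p k) / ?T ^ J \<le> C2"
    proof -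
      have "(\<Sum>k. s k ^ (2 * J) * p k) \<le> l2_norm g * (Q ^ J * A * W (2 * J) * V)"
        by (intro order_trans[OF psum2] mult_left_mono unorm l2_norm_nonneg)
      also have "\<dots> \<le> l2_norm g * (Q ^ J * A * (D * real J ^ 4) ^ J * V)"
        unfolding J_def using Q A V by (intro mult_left_mono mult_right_mono gevrey) auto
      also have "\<dots> = C2 * (Q * D * real J ^ 4) ^ J" by (simp add: C2_def power_mult_distrib mult_ac)
      also have "\<dots> \<le> C2 * ?T ^ J" using C2 Q D L by (intro mult_left_mono power_mono mult_right_mono) auto
      finally show ?thesis using T by (simp add: pos_divide_le_eq)
    qed
    also have "(real J / q J) ^ J * C1 + C2 \<le> (B * real J / q J) ^ J * C1 + (B * real J / q J) ^ J * C2"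
    proof (intro add_mono mult_right_mono C1)
      show "(real J / q J) ^ J \<le> (B * real J / q J) ^ J"
        using qpos[of J] mult_right_mono[OF B, of "real J"] by (intro power_mono divide_right_mono) auto
      have "q J \<le> B" using antimono_onD[OF mono _ arg0[of J]] by (simp add: q_def B_def)
      also have "B \<le> B * real J" using B J by simp
      finally have "1 \<le> (B * real J / q J) ^ J" using qpos[of J] by (intro one_le_power) simp
      then have "1 * C2 \<le> (B * real J / q J) ^ J * C2" using C2 by (intro mult_right_mono)
      then show "C2 \<le> (B * real J / q J) ^ J * C2" by simp
    qed
    also have "\<dots> \<le> C * (B * real J / q J) ^ J"
      using qpos[of J] B by (simp add: C_def algebra_simps)
    finally show ?thesis by (simp only: J_def) 
  qed
  have cosine: "(\<Sum>k. T (a k) * cos (t * s k)) = 0"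
    if T: "bounded_linear T" "\<And>w. \<bar>T w\<bar> \<le> cmod w" "\<And>r w. T (complex_of_real r * w) = r * T w" for T t
  proof (rule cosine_series_vanishes[where p = p and q = q and B = B and C = C])
    show "\<bar>T (a k)\<bar> \<le> p k" for k using T(2)[of "a k"] by (simp add: a_def p_def norm_mult)
    show "(\<Sum>k. T (a k) * s k ^ (2 * m)) = 0" for m
    proof -
      have "(\<lambda>k. s k ^ (2 * m) * T (a k)) sums 0"
        using bounded_linear.sums[OF T(1) asums[of m]] unfolding T(3) linear_0[OF bounded_linear.linear[OF T(1)]] .
      then show ?thesis by (simp add: sums_iff mult.commute)
    qed
    show "C \<ge> 1" using C1 C2 by (simp add: C_def)
  qed (use s psm qpos B growth div in auto)
  have asm: "summable (\<lambda>k. cmod (a k))" using psm[of 0] by (simp add: a_def p_def norm_mult)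
  have "(\<Sum>k. a k * complex_of_real (cos (t * s k))) = 0" for t
  proof -
    have sm: "summable (\<lambda>k. a k * complex_of_real (cos (t * s k)))"
    proof (rule summable_norm_cancel, rule summable_comparison_test'[OF asm])
      show "norm (norm (a k * complex_of_real (cos (t * s k)))) \<le> cmod (a k)" for k
        using mult_left_mono[OF abs_cos_le_one[of "t * s k"], of "cmod (a k)"] by (simp add: norm_mult)
    qed
    have "Re (\<Sum>k. a k * complex_of_real (cos (t * s k))) = (\<Sum>k. Re (a k) * cos (t * s k))"
      by (subst Re_suminf[OF sm]) simp
    also have "\<dots> = 0" by (rule cosine[OF bounded_linear_Re]) (simp_all add: abs_Re_le_cmod)
    finally have re: "Re (\<Sum>k. a k * complex_of_real (cos (t * s k))) = 0" .
    have "Im (\<Sum>k. a k * complex_of_real (cos (t * s k))) = (\<Sum>k. Im (a k) * cos (t * s k))"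
      by (subst Im_suminf[OF sm]) simp
    also have "\<dots> = 0" by (rule cosine[OF bounded_linear_Im]) (simp_all add: abs_Im_le_cmod)
    finally show ?thesis using re by (simp add: complex_eq_iff)
  qed
  note zero = this
  \<comment> \<open>A tent in \<open>y\<^sup>2\<close> that equals \<open>1\<close> at the eigenvalue \<open>\<mu>\<close> and vanishes at all others.\<close>
  define F where "F y = max 0 (1 - \<bar>y\<^sup>2 - \<mu>\<bar> / (2 * al))" for y
  have fin: "finite {k. \<nu> k = \<mu>}" unfolding \<nu>_def by (rule finite_eigenvalue_multiplicity[OF al])
  have "(\<Sum>k\<in>{k. \<nu> k = \<mu>}. a k) = 0"
  proof (cases "{k. \<nu> k = \<mu>} = {}")
    case False
    then obtain l where l: "\<nu> l = \<mu>" by blast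
    have F01: "F (s k) = (if \<nu> k = \<mu> then 1 else 0)" for k
    proof (cases "\<nu> k = \<mu>")
      case False
      then have "2 * al \<le> \<bar>\<nu> k - \<mu>\<bar>" using hbasis_eig_separated[OF al, where 'n = 'n, of k l] l by (simp add: \<nu>_def)
      then have "1 \<le> \<bar>\<nu> k - \<mu>\<bar> / (2 * al)" using al by (simp add: pos_le_divide_eq)
      then show ?thesis using False ssq[of k 1] by (simp add: F_def)
    qed (use ssq[of k 1] in \<open>simp add: F_def\<close>)
    have "(\<Sum>k. a k * complex_of_real (F (s k))) = 0"
    proof (rule cosine_series_unique[OF asm zero])
      show "continuous_on UNIV F" unfolding F_def using al by (intro continuous_intros) auto
      show "\<bar>F y\<bar> \<le> 1" for y using al by (simp add: F_def)
      show "F (- y) = F y" for y by (simp add: F_def)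
    qed
    moreover have "(\<Sum>k. a k * complex_of_real (F (s k))) = (\<Sum>k\<in>{k. \<nu> k = \<mu>}. a k * complex_of_real (F (s k)))"
      by (rule suminf_finite[OF fin]) (simp add: F01)
    ultimately show ?thesis by (simp add: F01)
  qed simp
  then show ?thesis unfolding a_def z_def d_def h_def \<nu>_def al_def .
qed

text \<open>Let \<open>P\<close> be the projection of \<open>g\<close> to an eigenspace. Small Gevrey bumps near a point outside the support
  of \<open>g\<close> are orthogonal to \<open>P\<close>, so that the continuous function \<open>P\<close> vanishes there; by
  \<open>hermite_combination_vanishes\<close> it vanishes everywhere.\<close>

lemma compact_support_spectral_decay_vanishes:
  fixes g :: "'n::finite fn" and \<theta> :: "real \<Rightarrow> real"
  assumes nn: "\<And>t. t \<ge> 0 \<Longrightarrow> 0 \<le> \<theta> t" and mono: "antimono_on {0..} \<theta>"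
    and inf: "\<not> (\<integral>\<^sup>+ t \<in> {1..}. ennreal (\<theta> t / t) \<partial>lborel) < \<infinity>"
    and lam: "lam \<noteq> 0" and g: "g \<in> L2"
    and decay: "\<And>N. (\<Sum>k<N. (cmod (l2_inner g (hbasis \<bar>lam\<bar> k)) *
        exp (\<theta> (sqrt (hbasis_eig TYPE('n) \<bar>lam\<bar> k)) * sqrt (hbasis_eig TYPE('n) \<bar>lam\<bar> k)))\<^sup>2) \<le> c0"
    and out: "\<And>x. norm x > r \<Longrightarrow> g x = 0"
  shows "AE x in lborel. g x = 0"
proof -
  define h where "h = (hbasis \<bar>lam\<bar> :: nat \<Rightarrow> 'n fn)"
  define \<nu> where "\<nu> k = hbasis_eig TYPE('n) \<bar>lam\<bar> k" for k
  define z where "z k = l2_inner g (h k)" for k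
  have al: "\<bar>lam\<bar> > 0" using lam by simp
  have oh: "orthonormal h" "l2_total h" unfolding h_def using hbasis_orthonormal[OF al] hbasis_total[OF al] by auto
  have hL: "h k \<in> L2" for k using oh(1) by (simp add: orthonormal_def)
  have hc: "continuous_on UNIV (h k)" for k
    unfolding h_def hbasis_def by (rule C1_continuous[OF C2_C1(1)[OF hfun_C2]])
  have "z l = 0" for l
  proof -
    define B where "B = {k. \<nu> k = \<nu> l}"
    define P where "P x = (\<Sum>k\<in>B. z k * h k x)" for x
    have fin: "finite B" unfolding B_def \<nu>_def by (rule finite_eigenvalue_multiplicity[OF al])
    have Pc: "continuous_on UNIV P" unfolding P_def by (intro continuous_intros hc)
    have PL: "P \<in> L2" unfolding P_def by (rule L2_lincomb[OF hL])
    have Pout: "P x0 = 0" if x0: "norm x0 > r" for x0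
    proof (rule ccontr)
      assume ne: "P x0 \<noteq> 0"
      \<comment> \<open>Positive near \<open>x0\<close>, which contradicts orthogonality to a nonnegative bump.\<close>
      define T where "T x = Re (cnj (P x0) * P x)" for x
      have Tc: "continuous_on UNIV T" unfolding T_def by (intro continuous_intros Pc)
      have "T x0 = (cmod (P x0))\<^sup>2" by (simp only: T_def mult.commute[of "cnj (P x0)"] complex_norm_square[symmetric] Re_complex_of_real)
      then have T0: "T x0 > 0" using ne by simp
      have "isCont T x0" using Tc by (simp add: continuous_on_eq_continuous_at)
      then obtain \<epsilon> where \<epsilon>: "\<epsilon> > 0" "\<forall>x. dist x x0 < \<epsilon> \<longrightarrow> dist (T x) (T x0) < T x0"
        using T0 unfolding continuous_at_eps_delta by blast
      have Tpos: "T x > 0" if "norm (x - x0) < \<epsilon>" for x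
      proof -
        have "dist (T x) (T x0) < T x0" using \<epsilon>(2) that by (simp add: dist_norm)
        then show ?thesis by (simp add: dist_real_def)
      qed
      define \<rho> where "\<rho> = min \<epsilon> ((norm x0 - r) / 2)"
      have \<rho>: "\<rho> > 0" "\<rho> \<le> \<epsilon>" using \<epsilon>(1) x0 by (auto simp: \<rho>_def)
      have \<rho>3: "\<rho> \<le> (norm x0 - r) / 2" unfolding \<rho>_def by (rule min.cobounded2)
      obtain W R D \<phi> where W: "weights W 1" and R: "R \<ge> 0" and D: "D > 0" and Bd: "Bd W R 1 0 \<phi>"
        and supp: "\<forall>x. norm (x - x0) \<ge> \<rho> \<longrightarrow> \<phi> x = 0"
        and real: "\<forall>x. \<phi> x = complex_of_real (Re (\<phi> x)) \<and> Re (\<phi> x) \<ge> 0" and pos: "Re (\<phi> x0) > 0"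
        and gevrey: "\<forall>j. W (2 * Suc j) \<le> (D * real (Suc j) ^ 4) ^ Suc j"
        using gevrey_bump_exists[OF \<rho>(1), of x0] by (elim exE conjE)
      interpret weights W 1 by (rule W)
      have \<phi>L: "\<phi> \<in> L2" by (rule Bd_L2(1)[OF Bd])
      have \<phi>c: "continuous_on UNIV \<phi>" by (rule Bd_continuous[OF Bd])
      have "(\<Sum>k\<in>B. z k * cnj (l2_inner \<phi> (h k))) = 0"
        unfolding B_def z_def h_def \<nu>_def
      proof (rule eigenspace_pairing_vanishes[OF nn mono inf lam g decay Bd R _ D, where K = "cball x0 \<rho>"])
        show "W (2 * Suc j) \<le> (D * real (Suc j) ^ 4) ^ Suc j" for j using gevrey by blast
        show "\<phi> x = 0" if "x \<notin> cball x0 \<rho>" for x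
          using supp that by (auto simp: dist_norm norm_minus_commute)
        show "g x = 0" if "x \<in> cball x0 \<rho>" for x
        proof (rule out)
          have "norm x0 - norm (x0 - x) \<le> norm x" using norm_triangle_ineq2[of x0 x] norm_triangle_sub[of x0 x] by linarith
          then show "r < norm x" using that \<rho>3 x0 by (simp add: dist_norm)
        qed
      qed auto
      then have P\<phi>: "l2_inner P \<phi> = 0"
        unfolding P_def l2_inner_sum_left[OF hL \<phi>L] l2_inner_cnj .
      have int: "integrable lborel (\<lambda>x. cnj (P x0) * (P x * cnj (\<phi> x)))"
        by (intro integrable_mult_right l2_inner_integrable PL \<phi>L)
      have Re: "Re (cnj (P x0) * (P x * cnj (\<phi> x))) = T x * Re (\<phi> x)" for x
      proof -
        obtain y where "\<phi> x = complex_of_real y" using real by blast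
        then show ?thesis by (simp add: T_def algebra_simps)
      qed
      have "(LINT x|lborel. T x * Re (\<phi> x)) = Re (LINT x|lborel. cnj (P x0) * (P x * cnj (\<phi> x)))"
        unfolding integral_Re[OF int, symmetric] Re ..
      also have "(LINT x|lborel. cnj (P x0) * (P x * cnj (\<phi> x))) = cnj (P x0) * l2_inner P \<phi>"
        unfolding l2_inner_def by simp
      finally have I0: "(LINT x|lborel. T x * Re (\<phi> x)) = 0" using P\<phi> by simp
      have iT: "integrable lborel (\<lambda>x. T x * Re (\<phi> x))" using integrable_Re[OF int] unfolding Re .
      have nonneg: "0 \<le> T x * Re (\<phi> x)" for x
      proof (cases "norm (x - x0) < \<rho>")
        case True
        then show ?thesis using Tpos[of x] \<rho>(2) real by (simp add: less_imp_le)
      next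
        case False
        then show ?thesis using supp by simp
      qed
      have "AE x in lborel. T x * Re (\<phi> x) = 0"
        using integral_nonneg_eq_0_iff_AE[OF iT] nonneg I0 by simp
      then have "AE x in lborel. complex_of_real (T x * Re (\<phi> x)) = 0" by simp
      then have "complex_of_real (T x0 * Re (\<phi> x0)) = 0"
        by (rule continuous_AE_zero[rotated]) (intro continuous_intros Tc \<phi>c)
      then show False using T0 pos by simp
    qed
    have "P x = 0" for x
      by (rule hermite_combination_vanishes[OF _ Pout, where z = z and B = B and a = "\<bar>lam\<bar>"]) (simp_all add: P_def[abs_def] h_def)
    then have "l2_inner P (h l) = 0" by (simp add: l2_inner_def)
    then show "z l = 0" unfolding P_def orthonormal_coeff[OF oh(1) fin] by (simp add: B_def)
  qed
  then show ?thesis using oh(2) g by (simp add: l2_total_def z_def)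
qed

lemma norm_im_vec_le: "norm (im_vec z) \<le> norm z"
  unfolding norm_vec_def im_vec_def by (intro L2_set_mono) (auto simp: abs_Im_le_cmod)

lemma group_fourier_bounded_support:
  fixes f :: "'n::finite heis \<Rightarrow> complex"
  assumes f: "compact_supp f K" and \<zeta>: "\<And>x. norm x > r \<Longrightarrow> \<zeta> x = 0"
  shows "\<exists>R. \<forall>\<xi>. norm \<xi> > R \<longrightarrow> group_fourier f lam \<zeta> \<xi> = 0"
proof -
  interpret compact_supp f K by (rule f)
  obtain b where b: "\<forall>g\<in>K. norm g \<le> b" using compact_imp_bounded[OF K] by (auto simp: bounded_iff)
  have "f g * schroedinger lam g \<zeta> \<xi> = 0" if \<xi>: "norm \<xi> > r + b" for g \<xi>
  proof (cases "g \<in> K")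
    case True
    have "norm (im_vec (fst g)) \<le> norm g" 
      using norm_im_vec_le[of "fst g"] norm_fst_le[of "fst g" "snd g"] by simp
    also have "\<dots> \<le> b" using b True by blast
    finally have "norm (\<xi> + im_vec (fst g)) > r" using \<xi> norm_diff_ineq[of \<xi> "im_vec (fst g)"] by linarith
    then show ?thesis using \<zeta> by (simp add: schroedinger_hphase)
  qed (simp add: out)
  then have "\<forall>\<xi>. norm \<xi> > r + b \<longrightarrow> group_fourier f lam \<zeta> \<xi> = 0"
    unfolding group_fourier_def by (intro allI impI) (simp only: Bochner_Integration.integral_zero)
  then show ?thesis by blast
qed

text \<open>The inequality controls the transform of \<open>f\<close>, whereas the support argument needs a fixed function of
  compact support with decaying coefficients. Duality provides it: for \<open>\<zeta>\<close> of bounded support, the adjoint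
  transform \<open>g\<close> of \<open>\<zeta>\<close> has bounded support, and the inequality bounds its coefficients.\<close>

theorem ingham_necessity:
  fixes f :: "'n::finite heis \<Rightarrow> complex" and \<theta> :: "real \<Rightarrow> real"
  assumes nn: "\<And>t. t \<ge> 0 \<Longrightarrow> 0 \<le> \<theta> t" and mono: "antimono_on {0..} \<theta>"
    and inf: "\<not> (\<integral>\<^sup>+ t \<in> {1..}. ennreal (\<theta> t / t) \<partial>lborel) < \<infinity>"
    and f: "compact_supp f K" and C: "C > 0"
    and le: "\<And>lam. lam \<noteq> 0 \<Longrightarrow> l2_op_le (l2_adjoint (group_fourier f lam) \<circ> group_fourier f lam)
       (\<lambda>\<phi> \<xi>. complex_of_real C * functional_calculus (hermite_op lam) (\<lambda>s. exp (- 2 * \<theta> (sqrt s) * sqrt s)) \<phi> \<xi>)"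
  shows "f p = 0"
proof (rule group_fourier_injective[OF f])
  fix lam :: real and \<phi> :: "'n fn" assume lam: "lam \<noteq> 0" and \<phi>: "\<phi> \<in> L2"
  define h where "h = (hbasis \<bar>lam\<bar> :: nat \<Rightarrow> 'n fn)"
  define \<nu> where "\<nu> k = hbasis_eig TYPE('n) \<bar>lam\<bar> k" for k
  define M where "M s = exp (- 2 * \<theta> (sqrt s) * sqrt s)" for s
  have al: "\<bar>lam\<bar> > 0" using lam by simp
  have oh: "orthonormal h" unfolding h_def by (rule hbasis_orthonormal[OF al])
  have hL: "h k \<in> L2" for k using oh by (simp add: orthonormal_def)
  have Mpos: "M s > 0" for s by (simp add: M_def)
  have M1: "\<bar>M s\<bar> \<le> 1" if "s > 0" for s using nn[of "sqrt s"] that by (simp add: M_def)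
  have bound: "(l2_norm (group_fourier f lam \<psi>))\<^sup>2 \<le> C * S"
    if \<psi>: "\<psi> \<in> L2" and S: "(\<lambda>k. M (\<nu> k) * (cmod (l2_inner \<psi> (h k)))\<^sup>2) sums S" for \<psi> S
  proof -
    have "(\<lambda>k. M (\<nu> k) * (cmod (l2_inner \<psi> (h k)))\<^sup>2) sums Re (l2_inner (functional_calculus (hermite_op lam) M \<psi>) \<psi>)"
      unfolding h_def \<nu>_def by (rule functional_calculus_coeffs(3)[OF lam M1 \<psi>])
    then have "S = Re (l2_inner (functional_calculus (hermite_op lam) M \<psi>) \<psi>)" using S by (metis sums_unique2)
    moreover have "Re (l2_inner ((l2_adjoint (group_fourier f lam) \<circ> group_fourier f lam) \<psi>) \<psi>)
      \<le> Re (l2_inner (\<lambda>\<xi>. complex_of_real C * functional_calculus (hermite_op lam) M \<psi> \<xi>) \<psi>)"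
      using le[OF lam, unfolded l2_op_le_def, rule_format, OF \<psi>] unfolding M_def .
    ultimately show ?thesis
      unfolding adjoint_composition_inner[OF f \<psi>] l2_inner_scale_left by simp
  qed
  let ?F = "group_fourier f lam \<phi>"
  have FL: "?F \<in> L2" by (rule compact_supp.group_fourier_L2(1)[OF f \<phi>])
  have orth: "l2_inner ?F \<zeta> = 0" if \<zeta>: "\<zeta> \<in> L2" and out: "\<And>x. norm x > r \<Longrightarrow> \<zeta> x = 0" for \<zeta> :: "'n fn" and r
  proof -
    define g where "g = group_fourier (conj_refl f) lam \<zeta>"
    have f': "compact_supp (conj_refl f) (uminus ` K)" by (rule compact_supp_conj_refl[OF f])
    have g: "g \<in> L2" unfolding g_def by (rule compact_supp.group_fourier_L2(1)[OF f' \<zeta>])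
    obtain R where R: "\<forall>\<xi>. norm \<xi> > R \<longrightarrow> g \<xi> = 0"
      using group_fourier_bounded_support[where \<zeta> = \<zeta> and r = r and lam = lam, OF f' out] unfolding g_def by blast
    define z where "z k = l2_inner g (h k)" for k
    have w: "(cmod (z k) * exp (\<theta> (sqrt (\<nu> k)) * sqrt (\<nu> k)))\<^sup>2 = (cmod (z k))\<^sup>2 / M (\<nu> k)" for k
      by (simp add: M_def power_mult_distrib exp_minus divide_inverse exp_double[symmetric])
    have dec: "(\<Sum>k<N. (cmod (z k) * exp (\<theta> (sqrt (\<nu> k)) * sqrt (\<nu> k)))\<^sup>2) \<le> C * (l2_norm \<zeta>)\<^sup>2" for N
    proof -
      \<comment> \<open>The test function for which the inequality returns the weighted sum \<open>Y\<close> on both sides.\<close>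
      define \<psi> where "\<psi> = (\<lambda>x. \<Sum>k<N. z k / complex_of_real (M (\<nu> k)) * h k x)"
      define Y where "Y = (\<Sum>k<N. (cmod (z k))\<^sup>2 / M (\<nu> k))"
      have Y: "Y \<ge> 0" unfolding Y_def using Mpos by (intro sum_nonneg) (simp add: less_imp_le)
      have \<psi>: "\<psi> \<in> L2" unfolding \<psi>_def by (rule L2_lincomb[OF hL])
      have coeff: "l2_inner \<psi> (h k) = (if k < N then z k / complex_of_real (M (\<nu> k)) else 0)" for k
        unfolding \<psi>_def orthonormal_coeff[OF oh finite_lessThan] by simp
      have "(\<lambda>k. M (\<nu> k) * (cmod (l2_inner \<psi> (h k)))\<^sup>2) sums (\<Sum>k<N. M (\<nu> k) * (cmod (l2_inner \<psi> (h k)))\<^sup>2)"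
        by (rule sums_finite) (auto simp: coeff)
      also have "(\<Sum>k<N. M (\<nu> k) * (cmod (l2_inner \<psi> (h k)))\<^sup>2) = Y"
        unfolding Y_def
      proof (rule sum.cong[OF refl])
        fix k assume "k \<in> {..<N}"
        then show "M (\<nu> k) * (cmod (l2_inner \<psi> (h k)))\<^sup>2 = (cmod (z k))\<^sup>2 / M (\<nu> k)"
          using Mpos[of "\<nu> k"] by (simp add: coeff norm_divide power_divide power2_eq_square)
      qed
      finally have fY: "(l2_norm (group_fourier f lam \<psi>))\<^sup>2 \<le> C * Y" by (rule bound[OF \<psi>])
      have "l2_inner (group_fourier f lam \<psi>) \<zeta> = l2_inner \<psi> g"
        unfolding g_def by (rule group_fourier_adjoint[OF f \<psi> \<zeta>])
      also have "\<dots> = (\<Sum>k<N. z k / complex_of_real (M (\<nu> k)) * l2_inner (h k) g)"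
        unfolding \<psi>_def by (rule l2_inner_sum_left[OF hL g])
      also have "\<dots> = complex_of_real Y"
        unfolding Y_def of_real_sum
      proof (rule sum.cong[OF refl])
        fix k
        have "l2_inner (h k) g = cnj (z k)" by (simp add: z_def l2_inner_cnj)
        then have "z k / complex_of_real (M (\<nu> k)) * l2_inner (h k) g = (z k * cnj (z k)) / complex_of_real (M (\<nu> k))" by simp
        also have "z k * cnj (z k) = complex_of_real ((cmod (z k))\<^sup>2)" by (rule complex_norm_square[symmetric])
        finally show "z k / complex_of_real (M (\<nu> k)) * l2_inner (h k) g = complex_of_real ((cmod (z k))\<^sup>2 / M (\<nu> k))" by simp
      qed
      finally have "Y = cmod (l2_inner (group_fourier f lam \<psi>) \<zeta>)" using Y by simp
      also have "\<dots> \<le> l2_norm (group_fourier f lam \<psi>) * l2_norm \<zeta>"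
        by (rule l2_Cauchy_Schwarz[OF compact_supp.group_fourier_L2(1)[OF f \<psi>] \<zeta>])
      finally have "Y\<^sup>2 \<le> (l2_norm (group_fourier f lam \<psi>) * l2_norm \<zeta>)\<^sup>2" using Y by (intro power_mono)
      also have "\<dots> \<le> (C * Y) * (l2_norm \<zeta>)\<^sup>2" unfolding power_mult_distrib using fY by (intro mult_right_mono) auto
      finally have "Y * Y \<le> (C * (l2_norm \<zeta>)\<^sup>2) * Y" by (simp add: power2_eq_square mult_ac)
      moreover have "0 \<le> C * (l2_norm \<zeta>)\<^sup>2" using C by simp
      ultimately have "Y \<le> C * (l2_norm \<zeta>)\<^sup>2" using Y by (cases "Y = 0") (auto simp: mult_le_cancel_right)
      then show ?thesis unfolding w Y_def .
    qed
    have AE: "AE x in lborel. g x = 0"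
    proof (rule compact_support_spectral_decay_vanishes[OF nn mono inf lam g])
      show "(\<Sum>k<N. (cmod (l2_inner g (hbasis \<bar>lam\<bar> k)) *
        exp (\<theta> (sqrt (hbasis_eig TYPE('n) \<bar>lam\<bar> k)) * sqrt (hbasis_eig TYPE('n) \<bar>lam\<bar> k)))\<^sup>2) \<le> C * (l2_norm \<zeta>)\<^sup>2" for N
        by (rule dec[unfolded z_def h_def \<nu>_def])
      show "g x = 0" if "norm x > R" for x using R that by blast
    qed
    have "l2_inner ?F \<zeta> = l2_inner \<phi> g" unfolding g_def by (rule group_fourier_adjoint[OF f \<phi> \<zeta>])
    also have "\<dots> = cnj (l2_inner g \<phi>)" by (simp only: l2_inner_cnj)
    also have "l2_inner g \<phi> = l2_inner (\<lambda>x. 0) \<phi>" by (rule l2_inner_cong_AE[OF g L2_zero \<phi> AE])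
    finally show ?thesis by simp
  qed
  have "AE x in lborel. x \<in> cball 0 (real n) \<longrightarrow> ?F x = 0" for n
  proof -
    define \<zeta> where "\<zeta> x = (if x \<in> cball 0 (real n) then ?F x else 0)" for x
    have [measurable]: "?F \<in> borel_measurable borel" by (rule L2_measurable[OF FL])
    have \<zeta>: "\<zeta> \<in> L2"
      by (rule L2_dominated[OF FL]) (simp_all add: \<zeta>_def[abs_def])
    have "l2_inner ?F \<zeta> = l2_inner \<zeta> \<zeta>"
      unfolding l2_inner_def by (rule Bochner_Integration.integral_cong) (simp_all add: \<zeta>_def)
    moreover have "l2_inner ?F \<zeta> = 0" by (rule orth[OF \<zeta>, of "real n"]) (simp add: \<zeta>_def)
    ultimately have "l2_norm \<zeta> = 0" unfolding l2_inner_self by simp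
    then have "AE x in lborel. \<zeta> x = 0" using l2_norm_eq_0_iff[OF \<zeta>] by simp
    then show ?thesis by eventually_elim (simp add: \<zeta>_def split: if_splits)
  qed
  then have "AE x in lborel. \<forall>n. x \<in> cball 0 (real n) \<longrightarrow> ?F x = 0"
    unfolding AE_all_countable by blast
  then show "AE x in lborel. ?F x = 0"
  proof eventually_elim
    case (elim x)
    obtain n where "norm x \<le> real n" using real_arch_simple by blast
    then show ?case using elim by auto
  qed
qed

section \<open>Ingham's theorem on the Heisenberg group\<close>

theorem theorem1p3:
  fixes \<theta> :: "real \<Rightarrow> real"
  assumes "\<forall>t\<ge>0. 0 \<le> \<theta> t"
    and "antimono_on {0..} \<theta>"
    and "(\<theta> \<longlongrightarrow> 0) at_top"
  shows "(\<exists>(f :: 'n::finite heis \<Rightarrow> complex) C :: real.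
            continuous_on UNIV f \<and> compact (closure {g. f g \<noteq> 0}) \<and> (\<exists>g. f g \<noteq> 0) \<and> C > 0 \<and>
            (\<forall>lam. lam \<noteq> 0 \<longrightarrow>
               l2_op_le (l2_adjoint (group_fourier f lam) \<circ> group_fourier f lam)
                 (\<lambda>\<phi> \<xi>. complex_of_real C *
                    functional_calculus (hermite_op lam)
                      (\<lambda>s. exp (- 2 * \<theta> (sqrt s) * sqrt s)) \<phi> \<xi>)))
         \<longleftrightarrow> (\<integral>\<^sup>+ t \<in> {1..}. ennreal (\<theta> t / t) \<partial>lborel) < \<infinity>"
    (is "?L \<longleftrightarrow> ?R")
proof
  have nn: "\<And>t. t \<ge> 0 \<Longrightarrow> 0 \<le> \<theta> t" using assms(1) by blast
  show ?R if ?L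
  proof (rule ccontr)
    assume inf: "\<not> ?R"
    from \<open>?L\<close> obtain f :: "'n heis \<Rightarrow> complex" and C g where f: "continuous_on UNIV f" "compact (closure {g. f g \<noteq> 0})"
      and ne: "f g \<noteq> 0" and C: "C > 0" and le: "\<forall>lam. lam \<noteq> 0 \<longrightarrow>
               l2_op_le (l2_adjoint (group_fourier f lam) \<circ> group_fourier f lam)
                 (\<lambda>\<phi> \<xi>. complex_of_real C *
                    functional_calculus (hermite_op lam)
                      (\<lambda>s. exp (- 2 * \<theta> (sqrt s) * sqrt s)) \<phi> \<xi>)"
      by (elim exE conjE)
    have cs: "compact_supp f (closure {g. f g \<noteq> 0})"
    proof
      show "f g = 0" if "g \<notin> closure {g. f g \<noteq> 0}" for g using that closure_subset[of "{g. f g \<noteq> 0}"] by blast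
    qed (rule f)+
    have "f g = 0"
      by (rule ingham_necessity[where \<theta> = \<theta> and C = C, OF nn assms(2) inf cs C]) (use le in blast)+
    then show False using ne by simp
  qed
  show ?L if ?R
  proof (rule ingham_sufficiency[OF nn assms(2,3) \<open>?R\<close>])
    fix f :: "'n heis \<Rightarrow> complex" and C :: real
    assume "continuous_on UNIV f" "compact (closure {g. f g \<noteq> 0})" "\<exists>g. f g \<noteq> 0" "C > 0"
      "\<And>lam. lam \<noteq> 0 \<Longrightarrow> l2_op_le (l2_adjoint (group_fourier f lam) \<circ> group_fourier f lam)
       (\<lambda>\<phi> \<xi>. complex_of_real C * functional_calculus (hermite_op lam) (\<lambda>s. exp (- 2 * \<theta> (sqrt s) * sqrt s)) \<phi> \<xi>)"
    then show ?L by (intro exI[of _ f] exI[of _ C]) simp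
  qed
qed

end
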